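(* Let $n\in\mathbb{N}$, $n\ge5$, let $q\in C^n(\mathbb{R}^3)$ and $g\in C^{n+2}(\mathbb{R}^3)$ with the norm bounds $\|q\|_{C^n}\le\mathcal{M}$ and $\|g\|_{C^{n+2}}\le\mathcal{N}$. Then there is a unique $C^1$ solution $u$ to the problem $$(\partial_t^2-\Delta-q)u=0,\quad x\in\mathbb{R}^3,\ t>|x|,\qquad u(x,t)=g(x),\quad x\in\mathbb{R}^3,\ t=|x|.$$ It is also in $C^s(\mathbb{R}^3\times\mathbb{R})$, where $s=\lfloor\frac{n-2}{3}\rfloor$, and satisfies $$(\partial_t+\partial_r)u=\partial_r g,\qquad x\in\mathbb{R}^3,\ t=|x|,$$ where $\partial_r=\frac{x}{|x|}\cdot\nabla_x$. For any $T<\infty$ the solution has the norm estimate $$\|u\|_{C^s(\mathbb{R}^3\times[0,T])}\le C_{T,n,\mathcal{M}}\,\mathcal{N}.$$ Finally, if $q_1,q_2\in C^n(\mathbb{R}^3)$ and $g_1,g_2\in C^{n+2}(\mathbb{R}^3)$ (with the same norm bounds $\|q_j\|_{C^n}\le\mathcal{M}$ and $\|g_j\|_{C^{n+2}}\le\mathcal{N}$, $j=1,2$), then their corresponding solutions $u_1,u_2$ satisfy $$\|u_1-u_2\|_{C^s(\mathbb{R}^3\times[0,T])}\le C_{T,n,\mathcal{M},\mathcal{N}}\big(\|q_1-q_2\|_{C^n(\mathbb{R}^3)}+\|g_1-g_2\|_{C^{n+2}(\mathbb{R}^3)}\big).$$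
   Context: For $s\in\mathbb{N}$ and $X\subset\mathbb{R}^d$, $C^s(X)$ is the set of all $f\colon X\to\mathbb{C}$ that are $s$ times continuously differentiable, and $\|f\|_{C^s(X)}=\sum_{|\alpha|\le s}\sup_{p\in X}|\partial^\alpha f(p)|$, where $\alpha$ is a multi-index. Here $x\in\mathbb{R}^3$ is the space variable, $t\in\mathbb{R}$ is time, and $\Delta$ is the Laplacian in $x$. The constants $C_{T,n,\mathcal{M}}$ and $C_{T,n,\mathcal{M},\mathcal{N}}$ are finite and depend only on the parameters in their indices. The problem is called the Goursat problem (characteristic initial value problem). *)

theory Defs
  imports "HOL-Analysis.Analysis"
begin

text \<open>
  The class \<open>C\<^sup>s(X)\<close>. Derivatives are taken within \<open>X\<close>, so that on a closed set with
  nonempty interior, such as the solid light cone, this means differentiability up to the boundary.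
  No boundedness is included.
\<close>

primrec Ck :: "nat \<Rightarrow> 'a::euclidean_space set \<Rightarrow> ('a \<Rightarrow> complex) \<Rightarrow> bool" where
  "Ck 0 X f \<longleftrightarrow> continuous_on X f"
| "Ck (Suc s) X f \<longleftrightarrow>
     (\<exists>D. (\<forall>p\<in>X. (f has_derivative D p) (at p within X)) \<and>
          (\<forall>b\<in>Basis. Ck s X (\<lambda>p. D p b)))"

definition pd :: "'a::euclidean_space \<Rightarrow> ('a \<Rightarrow> complex) \<Rightarrow> 'a \<Rightarrow> complex" where
  "pd b f p = frechet_derivative f (at p) b"

definition basis_list :: "'a::euclidean_space list" where
  "basis_list = (SOME bs. distinct bs \<and> set bs = Basis)"

lemma basis_list: "distinct (basis_list :: 'a::euclidean_space list)"
    "set (basis_list :: 'a list) = Basis"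
proof -
  have "\<exists>bs :: 'a list. distinct bs \<and> set bs = Basis"
    using finite_distinct_list[OF finite_Basis] by blast
  from someI_ex[OF this] show "distinct (basis_list :: 'a list)" "set (basis_list :: 'a list) = Basis"
    by (auto simp: basis_list_def)
qed

text \<open>
  A multi-index is a function on the standard basis, extended by zero. The order in which the partial
  derivatives are applied is immaterial for the functions and orders in question, since
  derivatives of order at most \<open>s\<close> of a \<open>C\<^sup>s\<close> function commute.
\<close>

definition multi_indices :: "nat \<Rightarrow> ('a::euclidean_space \<Rightarrow> nat) set" where
  "multi_indices s = {\<alpha>. (\<forall>b. b \<notin> Basis \<longrightarrow> \<alpha> b = 0) \<and> (\<Sum>b\<in>Basis. \<alpha> b) \<le> s}"

definition pd_multi :: "('a::euclidean_space \<Rightarrow> nat) \<Rightarrow> ('a \<Rightarrow> complex) \<Rightarrow> 'a \<Rightarrow> complex" where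
  "pd_multi \<alpha> f = foldr (\<lambda>b. pd b ^^ \<alpha> b) basis_list f"

text \<open>
  The \<open>C\<^sup>s(X)\<close> norm of a function that is \<open>C\<^sup>s\<close> on the whole space, with value \<open>\<infinity>\<close> if a
  derivative is unbounded on \<open>X\<close>.
\<close>

definition Ck_norm :: "nat \<Rightarrow> 'a::euclidean_space set \<Rightarrow> ('a \<Rightarrow> complex) \<Rightarrow> ennreal" where
  "Ck_norm s X f = (\<Sum>\<alpha>\<in>multi_indices s. SUP p\<in>X. ennreal (cmod (pd_multi \<alpha> f p)))"

type_synonym spacetime = "(real^3) \<times> real"

definition open_cone :: "spacetime set" where
  "open_cone = {(x, t). t > norm x}"

definition closed_cone :: "spacetime set" where
  "closed_cone = {(x, t). t \<ge> norm x}"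

definition pd_t :: "(spacetime \<Rightarrow> complex) \<Rightarrow> spacetime \<Rightarrow> complex" where
  "pd_t u = pd (0, 1) u"

definition laplace_x :: "(spacetime \<Rightarrow> complex) \<Rightarrow> spacetime \<Rightarrow> complex" where
  "laplace_x u p = (\<Sum>e\<in>Basis. pd (e, 0) (pd (e, 0) u) p)"

text \<open>The radial derivative \<open>x/|x| \<cdot> \<nabla>\<^sub>x\<close> (meaningful for \<open>x \<noteq> 0\<close>) on space-time and on space.\<close>

definition pd_r :: "(spacetime \<Rightarrow> complex) \<Rightarrow> spacetime \<Rightarrow> complex" where
  "pd_r u p = (\<Sum>e\<in>Basis. of_real ((fst p \<bullet> e) / norm (fst p)) * pd (e, 0) u p)"

definition pd_r_space :: "(real^3 \<Rightarrow> complex) \<Rightarrow> real^3 \<Rightarrow> complex" where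
  "pd_r_space g x = (\<Sum>e\<in>Basis. of_real ((x \<bullet> e) / norm x) * pd e g x)"

definition test_function :: "spacetime set \<Rightarrow> (spacetime \<Rightarrow> complex) \<Rightarrow> bool" where
  "test_function U \<phi> \<longleftrightarrow>
     (\<forall>k. Ck k UNIV \<phi>) \<and> compact (closure {p. \<phi> p \<noteq> 0}) \<and> closure {p. \<phi> p \<noteq> 0} \<subseteq> U"

text \<open>
  A \<open>C\<^sup>1\<close> function need not have second derivatives, so the equation
  \<open>(\<partial>\<^sub>t\<^sup>2 - \<Delta> - q) u = 0\<close> in \<open>U\<close> is understood in the sense of distributions.
\<close>

definition weak_wave_solution ::
    "spacetime set \<Rightarrow> (real^3 \<Rightarrow> complex) \<Rightarrow> (spacetime \<Rightarrow> complex) \<Rightarrow> bool" where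
  "weak_wave_solution U q u \<longleftrightarrow>
     (\<forall>\<phi>. test_function U \<phi> \<longrightarrow>
        (\<integral>p. u p * (pd_t (pd_t \<phi>) p - laplace_x \<phi> p - q (fst p) * \<phi> p) \<partial>lborel) = 0)"

text \<open>The problem constrains \<open>u\<close> on the closed solid cone only; values elsewhere are irrelevant.\<close>

definition goursat_solution ::
    "(real^3 \<Rightarrow> complex) \<Rightarrow> (real^3 \<Rightarrow> complex) \<Rightarrow> (spacetime \<Rightarrow> complex) \<Rightarrow> bool" where
  "goursat_solution q g u \<longleftrightarrow>
     Ck 1 closed_cone u \<and> weak_wave_solution open_cone q u \<and> (\<forall>x. u (x, norm x) = g x)"

text \<open>
  The signs of \<open>M\<close> and \<open>N\<close> are implied by the norm bounds, but not after the truncation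
  performed by \<^const>\<open>ennreal\<close>.
\<close>

definition admissible ::
    "nat \<Rightarrow> real \<Rightarrow> real \<Rightarrow> (real^3 \<Rightarrow> complex) \<Rightarrow> (real^3 \<Rightarrow> complex) \<Rightarrow> bool" where
  "admissible n M N q g \<longleftrightarrow> 0 \<le> M \<and> 0 \<le> N \<and>
     Ck n UNIV q \<and> Ck_norm n UNIV q \<le> ennreal M \<and>
     Ck (n + 2) UNIV g \<and> Ck_norm (n + 2) UNIV g \<le> ennreal N"

end

theory Submission
  imports Defs "HOL-Analysis.Analysis"
begin

text \<open>
  Put \<open>\<rho> = t\<^sup>2 - |x|\<^sup>2\<close> and \<open>m = s + 1\<close>. The solution is sought as
  \<open>u = (\<Sum>k\<le>m. b\<^sub>k(x) \<rho>\<^sup>k) + v\<close> inside the cone. With \<open>b\<^sub>0 = g\<close> and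
  \<open>b\<^sub>k\<^sub>+\<^sub>1(x) = 1 / (4 (k+1)) \<integral>\<^sub>0\<^sup>1 \<sigma>\<^sup>k\<^sup>+\<^sup>1 ((\<Delta> + q) b\<^sub>k)(\<sigma> x) d\<sigma>\<close> the sum solves the equation up to
  \<open>- G\<close>, \<open>G = \<rho>\<^sup>m (\<Delta> + q) b\<^sub>m\<close>, whose extension by zero outside the cone is still \<open>C\<^sup>s\<close>. The
  remainder solves \<open>(\<box> - q) v = G\<close> with \<open>v = 0\<close> outside the cone, that is \<open>v = ret (q v + G)\<close> with
  the retarded potential; this is a contraction for a weight \<open>exp (l t)\<close>, and all bounds are linear
  in the data. That the potential inverts \<open>\<box>\<close> is obtained by integrating over the hyperboloids
  \<open>t = sqrt (|y|\<^sup>2 + \<epsilon>\<^sup>2)\<close>, \<open>\<epsilon> \<rightarrow> 0\<close>.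

  For uniqueness, the difference of two solutions vanishes on \<open>t = |x|\<close>, and its extension \<open>W\<close> by zero
  is a weak solution across the cone: cutting off a test function near the cone with a function of
  \<open>\<rho>\<close> costs only \<open>1 / \<rho>\<close>, which the vanishing of the \<open>C\<^sup>1\<close> function \<open>W\<close> compensates. Testing against
  advanced potentials then gives \<open>W = ret (q W)\<close>, hence \<open>W = 0\<close>.
\<close>

section \<open>Calculus of iterated partial derivatives\<close>

text \<open>The value of \<open>s\<close> balances two losses. Each transport step costs two
  derivatives, so the residual coefficient (Delta + q) b_m is only of class n - 2m; the power rho^m,
  cut off at the cone, is only of class m - 1. With m = s + 1 both are at least s exactly when 3s <=
  n - 2, and n >= 5 makes s at least 1, so that the constructed solution is C^1. The potential
  itself loses nothing: it commutes with all partial derivatives, and the weight exp (l t) depends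
  on time alone. The contraction estimate therefore carries over from the sup norm to every order,
  at the price of a factor from Leibniz' rule for q v. Two obstacles shape the details. The powers
  rho^k are unbounded on a slab 0 <= t <= T, so outside the cone they are continued with a cutoff
  that is 0 for rho <= -1; nothing changes inside the cone. And the constants must not depend on the
  particular q and g, so l is fixed from M and the orders alone, and the remainder is selected by
  its equation, without reference to M and N.\<close>

lemma pd_eq:
  assumes "(f has_derivative D) (at p)"
  shows "pd b f p = D b"
  using frechet_derivative_at[OF assms] by (simp add: pd_def)

text \<open>On the whole space derivatives are unique, so the \<open>D\<close> hidden in
  \<open>Ck\<close> must be \<open>frechet_derivative\<close>. This turns \<open>Ck\<close> into a
  recursion on \<open>pd b f\<close>, the form used by the inductions on the order.\<close>

lemma Ck_Suc_UNIV:
  "Ck (Suc k) UNIV f \<longleftrightarrow> (\<forall>p. f differentiable (at p)) \<and> (\<forall>b\<in>Basis. Ck k UNIV (pd b f))"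
proof
  assume "Ck (Suc k) UNIV f"
  then obtain D where D: "\<And>p. (f has_derivative D p) (at p)" "\<And>b. b \<in> Basis \<Longrightarrow> Ck k UNIV (\<lambda>p. D p b)"
    by auto
  have "pd b f = (\<lambda>p. D p b)" for b
    using pd_eq[OF D(1)] by auto
  with D show "(\<forall>p. f differentiable (at p)) \<and> (\<forall>b\<in>Basis. Ck k UNIV (pd b f))"
    by (auto simp: differentiable_def)
next
  assume *: "(\<forall>p. f differentiable (at p)) \<and> (\<forall>b\<in>Basis. Ck k UNIV (pd b f))"
  show "Ck (Suc k) UNIV f"
    unfolding Ck.simps
    by (rule exI[of _ "\<lambda>p. frechet_derivative f (at p)"])
      (use * in \<open>auto simp: frechet_derivative_works[symmetric] pd_def[abs_def]\<close>)
qed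

lemma Ck_Suc_UNIV_I:
  assumes "\<And>p. (f has_derivative D p) (at p)" "\<And>b. b \<in> Basis \<Longrightarrow> Ck k UNIV (\<lambda>p. D p b)"
  shows "Ck (Suc k) UNIV f"
  using assms by auto

lemma Ck_continuous: "Ck k X f \<Longrightarrow> continuous_on X f"
proof (cases k)
  case (Suc j)
  moreover assume "Ck k X f"
  ultimately obtain D where "\<And>p. p \<in> X \<Longrightarrow> (f has_derivative D p) (at p within X)"
    by auto
  then show ?thesis by (rule has_derivative_continuous_on)
qed simp

lemma Ck_Suc_imp_Ck: "Ck (Suc k) X f \<Longrightarrow> Ck k X f"
proof (induction k arbitrary: f)
  case 0
  then show ?case using Ck_continuous by fastforce
next
  case (Suc k)
  then show ?case by (metis Ck.simps(2))
qed

lemma Ck_mono: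
  assumes "Ck k X f" "j \<le> k"
  shows "Ck j X f"
proof -
  have "Ck (j + i) X f \<Longrightarrow> Ck j X f" for i
    by (induction i) (auto dest: Ck_Suc_imp_Ck simp del: Ck.simps)
  with assms show ?thesis using le_Suc_ex by blast
qed

lemma Ck_subset: "Ck k X f \<Longrightarrow> Y \<subseteq> X \<Longrightarrow> Ck k Y f"
proof (induction k arbitrary: f)
  case 0
  then show ?case by (auto intro: continuous_on_subset)
next
  case (Suc k)
  then obtain D where "\<And>p. p \<in> X \<Longrightarrow> (f has_derivative D p) (at p within X)"
      "\<And>b. b \<in> Basis \<Longrightarrow> Ck k Y (\<lambda>p. D p b)"
    by (metis Ck.simps(2))
  with Suc.prems show ?case
    by (auto intro!: exI[of _ D] intro: has_derivative_subset)
qed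

lemma Ck_differentiable: "Ck (Suc k) UNIV f \<Longrightarrow> f differentiable (at p)"
  by (simp add: Ck_Suc_UNIV del: Ck.simps)

lemma Ck_has_derivative: "Ck (Suc k) UNIV f \<Longrightarrow> (f has_derivative (\<lambda>h. pd h f p)) (at p)"
  using Ck_differentiable[of k f p] unfolding frechet_derivative_works pd_def by simp

lemma Ck_pd: "Ck (Suc k) UNIV f \<Longrightarrow> b \<in> Basis \<Longrightarrow> Ck k UNIV (pd b f)"
  by (simp add: Ck_Suc_UNIV del: Ck.simps)

lemma Ck_isCont: "Ck k UNIV f \<Longrightarrow> isCont f p"
  using Ck_continuous[of k UNIV f] by (simp add: continuous_on_eq_continuous_at)

lemma pd_linear_sum:
  assumes "f differentiable (at p)"
  shows "pd h f p = (\<Sum>b\<in>Basis. (h \<bullet> b) *\<^sub>R pd b f p)"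
proof -
  have "linear (frechet_derivative f (at p))"
    using assms by (simp add: frechet_derivative_works has_derivative_linear)
  then have "frechet_derivative f (at p) (\<Sum>b\<in>Basis. (h \<bullet> b) *\<^sub>R b) = (\<Sum>b\<in>Basis. (h \<bullet> b) *\<^sub>R pd b f p)"
    by (simp add: linear_sum linear_scale pd_def)
  then show ?thesis
    by (simp add: euclidean_representation pd_def)
qed

lemma pd_add: "f differentiable (at p) \<Longrightarrow> g differentiable (at p) \<Longrightarrow>
    pd b (\<lambda>x. f x + g x) p = pd b f p + pd b g p"
  unfolding differentiable_def by (auto simp: pd_eq[OF has_derivative_add] pd_eq)

lemma pd_diff: "f differentiable (at p) \<Longrightarrow> g differentiable (at p) \<Longrightarrow>
    pd b (\<lambda>x. f x - g x) p = pd b f p - pd b g p"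
  unfolding differentiable_def by (auto simp: pd_eq[OF has_derivative_diff] pd_eq)

lemma pd_mult: "f differentiable (at p) \<Longrightarrow> g differentiable (at p) \<Longrightarrow>
    pd b (\<lambda>x. f x * g x) p = f p * pd b g p + pd b f p * g p"
  unfolding differentiable_def
  by (auto simp: pd_eq[OF has_derivative_mult] pd_eq)

lemma pd_const [simp]: "pd b (\<lambda>x. c) p = 0"
  by (rule pd_eq[THEN trans, OF has_derivative_const]) simp

lemma pd_cmult: "f differentiable (at p) \<Longrightarrow> pd b (\<lambda>x. c * f x) p = c * pd b f p"
  by (subst pd_mult) auto

lemma Ck_const [simp]: "Ck k UNIV (\<lambda>x. c)"
  by (induction k arbitrary: c) (auto intro!: exI[of _ "\<lambda>p h. 0"])

lemma Ck_add: "Ck k UNIV f \<Longrightarrow> Ck k UNIV g \<Longrightarrow> Ck k UNIV (\<lambda>x. f x + g x)"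
proof (induction k arbitrary: f g)
  case 0
  then show ?case by (simp add: continuous_on_add continuous_on_mult continuous_on_inverse)
next
  case (Suc k)
  then have "pd b (\<lambda>x. f x + g x) = (\<lambda>x. pd b f x + pd b g x)" for b
    by (auto simp: pd_add Ck_differentiable simp del: Ck.simps)
  with Suc show ?case by (simp add: Ck_Suc_UNIV del: Ck.simps)
qed

lemma Ck_mult: "Ck k UNIV f \<Longrightarrow> Ck k UNIV g \<Longrightarrow> Ck k UNIV (\<lambda>x. f x * g x)"
proof (induction k arbitrary: f g)
  case 0
  then show ?case by (simp add: continuous_on_add continuous_on_mult continuous_on_inverse)
next
  case (Suc k)
  then have "pd b (\<lambda>x. f x * g x) = (\<lambda>x. f x * pd b g x + pd b f x * g x)" for b
    by (auto simp: pd_mult Ck_differentiable simp del: Ck.simps)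
  moreover have "Ck k UNIV (\<lambda>x. f x * pd b g x + pd b f x * g x)" if "b \<in> Basis" for b
    using Suc.prems that by (intro Ck_add Suc.IH Ck_pd) (auto dest: Ck_Suc_imp_Ck simp del: Ck.simps)
  ultimately show ?case 
    using Suc.prems by (simp add: Ck_Suc_UNIV del: Ck.simps)
qed

lemma Ck_cmult: "Ck k UNIV f \<Longrightarrow> Ck k UNIV (\<lambda>x. c * f x)"
  by (intro Ck_mult Ck_const)

lemma Ck_uminus: "Ck k UNIV f \<Longrightarrow> Ck k UNIV (\<lambda>x. - f x)"
  using Ck_cmult[of k f "-1"] by simp

lemma Ck_diff: "Ck k UNIV f \<Longrightarrow> Ck k UNIV g \<Longrightarrow> Ck k UNIV (\<lambda>x. f x - g x)"
  using Ck_add[OF _ Ck_uminus, of k f g] by simp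

lemma Ck_sum: "(\<And>i. i \<in> I \<Longrightarrow> Ck k UNIV (f i)) \<Longrightarrow> Ck k UNIV (\<lambda>x. \<Sum>i\<in>I. f i x)"
  by (induction I rule: infinite_finite_induct) (auto intro: Ck_add)

lemma Ck_power: "Ck k UNIV f \<Longrightarrow> Ck k UNIV (\<lambda>x. f x ^ n)"
  by (induction n) (auto intro: Ck_mult)

lemma Ck_bounded_linear: "bounded_linear L \<Longrightarrow> Ck k UNIV L"
  by (cases k) (auto intro!: exI[of _ "\<lambda>p. L"] 
      simp: bounded_linear_imp_has_derivative linear_continuous_on)

lemma Ck_inverse: "Ck k UNIV f \<Longrightarrow> (\<And>x. f x \<noteq> 0) \<Longrightarrow> Ck k UNIV (\<lambda>x. inverse (f x))"
proof (induction k arbitrary: f)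
  case 0
  then show ?case by (simp add: continuous_on_add continuous_on_mult continuous_on_inverse)
next
  case (Suc k)
  have d: "((\<lambda>x. inverse (f x)) has_derivative (\<lambda>h. - (inverse (f p) * pd h f p * inverse (f p)))) (at p)" for p
    by (rule Deriv.has_derivative_inverse[OF _ Ck_has_derivative]) (use Suc.prems in \<open>auto simp del: Ck.simps\<close>)
  have "Ck k UNIV (\<lambda>x. inverse (f x))"
    using Suc Ck_Suc_imp_Ck by blast
  with Suc.prems(1) show ?case
    by (intro Ck_Suc_UNIV_I[OF d] Ck_uminus Ck_mult Ck_pd)
qed

text \<open>The components of the inner map are embedded in the complex numbers because
  \<open>Ck\<close> speaks of complex-valued functions only. The chain rule writes a first
  derivative as a sum of products of derivatives of components with \<open>pd b f\<close> at
  \<open>\<phi> p\<close>; the latter has one order less, so the induction hypothesis applies to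
  it.\<close>

lemma Ck_compose:
  fixes f :: "'b::euclidean_space \<Rightarrow> complex" and \<phi> :: "'a::euclidean_space \<Rightarrow> 'b"
  assumes "Ck k UNIV f" "\<And>b. b \<in> Basis \<Longrightarrow> Ck k UNIV (\<lambda>p. of_real (\<phi> p \<bullet> b))"
  shows "Ck k UNIV (\<lambda>p. f (\<phi> p))"
  using assms
proof (induction k arbitrary: f)
  case 0
  have "continuous_on UNIV (\<lambda>p. Re (of_real (\<phi> p \<bullet> b)))" if "b \<in> Basis" for b
    by (rule continuous_on_Re) (use 0(2)[OF that] in simp)
  then have "continuous_on UNIV \<phi>"
    by (subst continuous_on_componentwise) auto
  with 0 show ?case
    by (auto intro: continuous_on_compose2)
next
  case (Suc k)
  let ?\<psi> = "\<lambda>b p. complex_of_real (\<phi> p \<bullet> b)"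
  have 1: "((\<lambda>p. \<phi> p \<bullet> b) has_derivative (\<lambda>h. Re (pd h (?\<psi> b) p))) (at p)" if "b \<in> Basis" for b p
    using bounded_linear.has_derivative[OF bounded_linear_Re Ck_has_derivative[OF Suc.prems(2)[OF that], of p]]
    unfolding Re_complex_of_real .
  \<comment> \<open>The derivative of a real-valued function is real, so passing to
    \<open>Re\<close> and back loses nothing.\<close>
  have re: "of_real (Re (pd h (?\<psi> b) p)) = pd h (?\<psi> b) p" if "b \<in> Basis" for b p h
    using pd_eq[OF bounded_linear.has_derivative[OF bounded_linear_of_real 1[OF that]]] by simp
  define D where "D p h = (\<Sum>b\<in>Basis. Re (pd h (?\<psi> b) p) *\<^sub>R b)" for p h
  have D_inner: "D p h \<bullet> b = Re (pd h (?\<psi> b) p)" if "b \<in> Basis" for p h b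
    unfolding D_def using that by (simp add: inner_sum_left inner_Basis if_distrib sum.delta cong: if_cong)
  have 2: "(\<phi> has_derivative D p) (at p)" for p
    by (subst has_derivative_componentwise_within) (simp add: D_inner 1)
  have 3: "((\<lambda>p. f (\<phi> p)) has_derivative (\<lambda>h. pd (D p h) f (\<phi> p))) (at p)" for p
    using diff_chain_at[OF 2 Ck_has_derivative[OF Suc.prems(1)]] unfolding o_def .
  have 4: "pd (D p h) f (\<phi> p) = (\<Sum>b\<in>Basis. pd h (?\<psi> b) p * pd b f (\<phi> p))" for p h
  proof -
    have "pd (D p h) f (\<phi> p) = (\<Sum>b\<in>Basis. (D p h \<bullet> b) *\<^sub>R pd b f (\<phi> p))"
      by (rule pd_linear_sum[OF Ck_differentiable[OF Suc.prems(1)]])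
    also have "\<dots> = (\<Sum>b\<in>Basis. pd h (?\<psi> b) p * pd b f (\<phi> p))"
      by (rule sum.cong[OF refl]) (simp only: D_inner scaleR_conv_of_real re)
    finally show ?thesis .
  qed
  have IH: "Ck k UNIV (\<lambda>p. pd b f (\<phi> p))" if "b \<in> Basis" for b
    by (rule Suc.IH[OF Ck_pd[OF Suc.prems(1) that] Ck_Suc_imp_Ck[OF Suc.prems(2)]])
  show ?case
    by (rule Ck_Suc_UNIV_I[OF 3], unfold 4) (intro Ck_sum Ck_mult IH Ck_pd[OF Suc.prems(2)])
qed

lemma Ck_compose_real:
  fixes f :: "real \<Rightarrow> complex"
  assumes "Ck k UNIV f" "Ck k UNIV (\<lambda>p. of_real (\<phi> p))"
  shows "Ck k UNIV (\<lambda>p. f (\<phi> p))"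
  by (rule Ck_compose[OF assms(1)]) (use assms(2) in simp)

lemma bounded_linear_of_real_inner:
  assumes "bounded_linear L"
  shows "bounded_linear (\<lambda>p. complex_of_real (L p \<bullet> b))"
  by (rule bounded_linear_compose[OF bounded_linear_of_real bounded_linear_compose[OF bounded_linear_inner_left assms]])

lemma Ck_affine:
  fixes L :: "'a::euclidean_space \<Rightarrow> 'b::euclidean_space"
  assumes "Ck k UNIV f" "bounded_linear L"
  shows "Ck k UNIV (\<lambda>p. f (L p + c))"
proof (rule Ck_compose[OF assms(1)])
  fix b :: 'b assume "b \<in> Basis"
  have "Ck k UNIV (\<lambda>p. complex_of_real (L p \<bullet> b) + of_real (c \<bullet> b))"
    by (rule Ck_add[OF Ck_bounded_linear[OF bounded_linear_of_real_inner[OF assms(2)]] Ck_const])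
  then show "Ck k UNIV (\<lambda>p. complex_of_real ((L p + c) \<bullet> b))"
    by (simp add: inner_add_left)
qed

lemma pd_affine:
  assumes "f differentiable at (L p + c)" "bounded_linear L"
  shows "pd h (\<lambda>p. f (L p + c)) p = pd (L h) f (L p + c)"
proof -
  have "((\<lambda>p. L p + c) has_derivative L) (at p)"
    using bounded_linear_imp_has_derivative[OF assms(2)] by (auto intro!: derivative_eq_intros)
  moreover have "(f has_derivative (\<lambda>h. pd h f (L p + c))) (at (L p + c))"
    using assms(1) by (simp add: frechet_derivative_works pd_def[abs_def])
  ultimately show ?thesis
    by (intro pd_eq) (auto dest: diff_chain_at simp: o_def)
qed

lemma pd_cong_open:
  assumes "open S" "p \<in> S" "\<And>x. x \<in> S \<Longrightarrow> f x = g x"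
  shows "pd b f p = pd b g p"
proof -
  have "(f has_derivative D) (at p) \<longleftrightarrow> (g has_derivative D) (at p)" for D
    by (rule iffI; erule has_derivative_transform_within_open[where s=S]) (use assms in auto)
  then show ?thesis by (simp add: pd_def frechet_derivative_def)
qed

text \<open>Needed because the retarded potential agrees with an integral over a bounded set only
  locally in time.\<close>

lemma Ck_local:
  assumes "\<And>p. \<exists>S g. open S \<and> p \<in> S \<and> Ck k UNIV g \<and> (\<forall>x\<in>S. f x = g x)"
  shows "Ck k UNIV f"
  using assms
proof (induction k arbitrary: f)
  case 0
  have "isCont f p" for p
  proof -
    obtain S g where "open S" "p \<in> S" "continuous_on UNIV g" "\<And>x. x \<in> S \<Longrightarrow> f x = g x"
      using 0[of p] by auto
    moreover from this have "\<forall>\<^sub>F x in nhds p. f x = g x"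
      by (auto simp: eventually_nhds)
    ultimately show ?thesis
      by (simp add: isCont_cong continuous_on_eq_continuous_at)
  qed
  then show ?case by (simp add: continuous_at_imp_continuous_on)
next
  case (Suc k)
  have d: "f differentiable at p" for p
  proof -
    obtain S g where "open S" "p \<in> S" "Ck (Suc k) UNIV g" "\<And>x. x \<in> S \<Longrightarrow> f x = g x"
      using Suc.prems[of p] by auto
    then have "(f has_derivative (\<lambda>h. pd h g p)) (at p)"
      by (intro has_derivative_transform_within_open[OF Ck_has_derivative]) auto
    then show ?thesis
      unfolding differentiable_def by blast
  qed
  have "Ck k UNIV (pd b f)" if b: "b \<in> Basis" for b
  proof (rule Suc.IH)
    fix p
    obtain S g where "open S" "p \<in> S" "Ck (Suc k) UNIV g" "\<And>x. x \<in> S \<Longrightarrow> f x = g x"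
      using Suc.prems[of p] by auto
    then show "\<exists>S g. open S \<and> p \<in> S \<and> Ck k UNIV g \<and> (\<forall>x\<in>S. pd b f x = g x)"
      by (intro exI[of _ S] exI[of _ "pd b g"]) (auto simp del: Ck.simps intro!: Ck_pd b pd_cong_open[of S])
  qed
  with d show ?case by (simp add: Ck_Suc_UNIV del: Ck.simps)
qed

section \<open>Symmetry of mixed partial derivatives\<close>

text \<open>The mean value inequality is used twice: for \<open>pd b f\<close> along
  \<open>a\<close>, then along \<open>b\<close> for the increment of \<open>f\<close> in direction
  \<open>a\<close>. The linear terms that are subtracted accumulate to \<open>h * h\<close> times
  \<open>c\<close>.\<close>

lemma second_difference_estimate:
  fixes f :: "'a::euclidean_space \<Rightarrow> complex"
  assumes f: "Ck 2 UNIV f" and b: "b \<in> Basis" and h: "h > 0"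
    and e: "\<And>x y. x \<in> {0..h} \<Longrightarrow> y \<in> {0..h} \<Longrightarrow> norm (pd a (pd b f) (p + x *\<^sub>R a + y *\<^sub>R b) - c) \<le> e"
  shows "norm (f (p + h *\<^sub>R a + h *\<^sub>R b) - f (p + h *\<^sub>R a) - f (p + h *\<^sub>R b) + f p - (h*h) *\<^sub>R c) \<le> e * (h * h)"
proof -
  have f1: "Ck (Suc 0) UNIV (pd b f)" and f2: "Ck (Suc 1) UNIV f"
    using f b Ck_pd[of 1 f b] by (auto simp: numeral_2_eq_2 simp del: Ck.simps)
  note d1 = Ck_has_derivative[OF f1] and d2 = Ck_has_derivative[OF f2]
  have lin: "pd (t *\<^sub>R v) u x = t *\<^sub>R pd v u x" if "u differentiable (at x)" for t v x and u :: "'a \<Rightarrow> complex"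
    using that by (simp add: pd_def frechet_derivative_works has_derivative_linear linear_scale)
  have inner: "norm (pd b f (p + h *\<^sub>R a + y *\<^sub>R b) - pd b f (p + y *\<^sub>R b) - h *\<^sub>R c) \<le> e * h" if y: "y \<in> {0..h}" for y
  proof -
    let ?\<psi> = "\<lambda>x. pd b f (p + x *\<^sub>R a + y *\<^sub>R b) - x *\<^sub>R c"
    have "(?\<psi> has_derivative (\<lambda>t. pd (t *\<^sub>R a) (pd b f) (p + x *\<^sub>R a + y *\<^sub>R b) - t *\<^sub>R c)) (at x within {0..h})" for x
      by (auto intro!: derivative_eq_intros has_derivative_compose[OF _ d1])
    then have "(?\<psi> has_derivative (\<lambda>t. t *\<^sub>R (pd a (pd b f) (p + x *\<^sub>R a + y *\<^sub>R b) - c))) (at x within {0..h})" for x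
      by (simp add: lin[OF Ck_differentiable[OF f1]] scaleR_diff_right)
    note d = this
    have "norm (?\<psi> h - ?\<psi> 0) \<le> e * norm (h - 0)"
      by (rule differentiable_bound[OF convex_real_interval(5) d])
        (use h e y in \<open>auto simp: onorm_scaleR_left[of "\<lambda>x. x"] onorm_id[unfolded id_def]\<close>)
    then show ?thesis using h by (simp add: algebra_simps)
  qed
  let ?\<psi> = "\<lambda>y. f (p + h *\<^sub>R a + y *\<^sub>R b) - f (p + y *\<^sub>R b) - (y * h) *\<^sub>R c"
  have "(?\<psi> has_derivative (\<lambda>t. pd (t *\<^sub>R b) f (p + h *\<^sub>R a + y *\<^sub>R b) - pd (t *\<^sub>R b) f (p + y *\<^sub>R b) - (t * h) *\<^sub>R c)) (at y within {0..h})" for y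
    by (auto intro!: derivative_eq_intros has_derivative_compose[OF _ d2])
  then have "(?\<psi> has_derivative (\<lambda>t. t *\<^sub>R (pd b f (p + h *\<^sub>R a + y *\<^sub>R b) - pd b f (p + y *\<^sub>R b) - h *\<^sub>R c))) (at y within {0..h})" for y
    by (simp add: lin[OF Ck_differentiable[OF f2]] scaleR_diff_right)
  note d = this
  have "norm (?\<psi> h - ?\<psi> 0) \<le> (e * h) * norm (h - 0)"
    by (rule differentiable_bound[OF convex_real_interval(5) d])
      (use h inner in \<open>auto simp: onorm_scaleR_left[of "\<lambda>x. x"] onorm_id[unfolded id_def]\<close>)
  then show ?thesis using h by (simp add: algebra_simps)
qed

text \<open>The second difference is symmetric in \<open>a\<close> and \<open>b\<close>, hence close
  to \<open>h * h\<close> times either mixed derivative.\<close>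

lemma pd_commute:
  fixes f :: "'a::euclidean_space \<Rightarrow> complex"
  assumes f: "Ck 2 UNIV f" and a: "a \<in> Basis" and b: "b \<in> Basis"
  shows "pd a (pd b f) p = pd b (pd a f) p"
proof (rule ccontr)
  let ?A = "pd a (pd b f)" and ?B = "pd b (pd a f)"
  assume ne: "?A p \<noteq> ?B p"
  \<comment> \<open>A quarter of the gap: the two errors \<open>e\<close> add up to only half of
    it.\<close>
  define e where "e = norm (?A p - ?B p) / 4"
  have e: "e > 0" using ne by (simp add: e_def)
  have cont: "isCont ?A p" "isCont ?B p"
    using f a b by (auto simp: numeral_2_eq_2 simp del: Ck.simps intro!: Ck_isCont[of 0] Ck_pd)
  from cont(1) e obtain d1 where d1: "d1 > 0" "\<And>x. dist x p < d1 \<Longrightarrow> norm (?A x - ?A p) < e"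
    unfolding continuous_at_eps_delta dist_norm by metis
  from cont(2) e obtain d2 where d2: "d2 > 0" "\<And>x. dist x p < d2 \<Longrightarrow> norm (?B x - ?B p) < e"
    unfolding continuous_at_eps_delta dist_norm by metis
  \<comment> \<open>The points of the square lie within \<open>2 * h\<close> of \<open>p\<close>; a
    third of the smaller radius keeps \<open>2 * h\<close> below both radii.\<close>
  define h where "h = min d1 d2 / 3"
  have h: "h > 0" "2 * h < d1" "2 * h < d2" using d1(1) d2(1) by (auto simp: h_def min_def)
  have dist: "dist (p + x *\<^sub>R u + y *\<^sub>R v) p \<le> 2 * h"
    if "x \<in> {0..h}" "y \<in> {0..h}" "u \<in> Basis" "v \<in> Basis" for x y :: real and u v :: 'a
    using that norm_triangle_ineq[of "x *\<^sub>R u" "y *\<^sub>R v"] by (simp add: dist_norm add.assoc)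
  let ?S = "f (p + h *\<^sub>R a + h *\<^sub>R b) - f (p + h *\<^sub>R a) - f (p + h *\<^sub>R b) + f p"
  have "norm (?A (p + x *\<^sub>R a + y *\<^sub>R b) - ?A p) \<le> e" if "x \<in> {0..h}" "y \<in> {0..h}" for x y
    using dist[OF that a b] d1(2)[of "p + x *\<^sub>R a + y *\<^sub>R b"] h by auto
  then have 1: "norm (?S - (h*h) *\<^sub>R ?A p) \<le> e * (h * h)"
    by (intro second_difference_estimate f b h)
  have "norm (?B (p + x *\<^sub>R b + y *\<^sub>R a) - ?B p) \<le> e" if "x \<in> {0..h}" "y \<in> {0..h}" for x y
    using dist[OF that b a] d2(2)[of "p + x *\<^sub>R b + y *\<^sub>R a"] h by auto
  then have "norm (f (p + h *\<^sub>R b + h *\<^sub>R a) - f (p + h *\<^sub>R b) - f (p + h *\<^sub>R a) + f p - (h*h) *\<^sub>R ?B p) \<le> e * (h * h)"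
    by (intro second_difference_estimate f a h)
  then have 2: "norm (?S - (h*h) *\<^sub>R ?B p) \<le> e * (h * h)"
    by (simp add: algebra_simps)
  have eq: "(h*h) *\<^sub>R (?A p - ?B p) = (?S - (h*h) *\<^sub>R ?B p) - (?S - (h*h) *\<^sub>R ?A p)"
    by (simp add: scaleR_diff_right)
  have "norm ((h*h) *\<^sub>R (?A p - ?B p)) \<le> e * (h*h) + e * (h*h)"
    unfolding eq by (rule order.trans[OF norm_triangle_ineq4 add_mono[OF 2 1]])
  then have "(h*h) * (4 * e) \<le> (h * h) * (2 * e)"
    unfolding norm_scaleR using h by (simp add: e_def)
  then show False using h e by (simp add: mult_le_cancel_left)
qed

section \<open>Words of directions, multi-indices and bounds on all derivatives\<close>

definition pdl :: "'a::euclidean_space list \<Rightarrow> ('a \<Rightarrow> complex) \<Rightarrow> 'a \<Rightarrow> complex" where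
  "pdl l f = foldr pd l f"

lemma pdl_simps [simp]: "pdl [] f = f" "pdl (b # l) f = pd b (pdl l f)" "pdl (l @ l') f = pdl l (pdl l' f)"
  by (simp_all add: pdl_def)

lemma Ck_pdl: "Ck (k + length l) UNIV f \<Longrightarrow> set l \<subseteq> Basis \<Longrightarrow> Ck k UNIV (pdl l f)"
  by (induction l arbitrary: k) (auto simp del: Ck.simps intro!: Ck_pd)

lemma pdl_swap:
  assumes "Ck (Suc (length xs + length ys)) UNIV f" "a \<in> Basis" "set xs \<subseteq> Basis" "set ys \<subseteq> Basis"
  shows "pd a (pdl (xs @ ys) f) = pdl (xs @ a # ys) f"
  using assms
proof (induction xs)
  case (Cons x xs)
  have "Ck 2 UNIV (pdl (xs @ ys) f)"
    by (rule Ck_pdl) (use Cons.prems in \<open>auto simp del: Ck.simps simp: numeral_2_eq_2\<close>)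
  then have "pd a (pd x (pdl (xs @ ys) f)) = pd x (pd a (pdl (xs @ ys) f))"
    using Cons.prems by (intro ext pd_commute) auto
  also have "pd a (pdl (xs @ ys) f) = pdl (xs @ a # ys) f"
    using Cons.prems by (intro Cons.IH) (auto dest: Ck_Suc_imp_Ck simp del: Ck.simps)
  finally show ?case by simp
qed simp

text \<open>By \<open>pd_commute\<close> a derivative can be moved through the others, so only the
  multiset of directions matters. This links words of directions, which suit induction, with the
  multi-indices of \<open>Ck_norm\<close>.\<close>

lemma pdl_mset_cong:
  assumes "Ck (length l) UNIV f" "set l \<subseteq> Basis" "mset l = mset l'"
  shows "pdl l f = pdl l' f"
  using assms
proof (induction l arbitrary: l')
  case (Cons a l)
  then have "a \<in> set l'" by (metis list.set_intros(1) mset_eq_setD)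
  then obtain xs ys where l': "l' = xs @ a # ys" by (meson split_list)
  have eq: "mset l = mset (xs @ ys)" using Cons.prems(3) l' by simp
  then have len: "length l = length xs + length ys" "set l = set xs \<union> set ys"
    using mset_eq_length[OF eq] mset_eq_setD[OF eq] by auto
  have "pdl l f = pdl (xs @ ys) f"
    using Cons.prems eq by (intro Cons.IH) (auto dest: Ck_Suc_imp_Ck simp del: Ck.simps)
  then have "pdl (a # l) f = pd a (pdl (xs @ ys) f)" by simp
  also have "\<dots> = pdl l' f"
    unfolding l' using Cons.prems len by (intro pdl_swap) (auto simp del: Ck.simps)
  finally show ?case .
qed simp

lemma pd_multi_pdl: "pd_multi \<alpha> f = pdl (concat (map (\<lambda>b. replicate (\<alpha> b) b) basis_list)) f"
proof -
  have r: "(pd b ^^ n) g = pdl (replicate n b) g" for b n and g :: "'a \<Rightarrow> complex"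
    by (induction n) auto
  have "foldr (\<lambda>b. pd b ^^ \<alpha> b) l f = pdl (concat (map (\<lambda>b. replicate (\<alpha> b) b) l)) f" for l
    by (induction l) (auto simp: r)
  then show ?thesis by (simp add: pd_multi_def)
qed

lemma length_multi_index:
  "length (concat (map (\<lambda>b. replicate (\<alpha> b) b) (basis_list :: 'a::euclidean_space list))) = (\<Sum>b\<in>Basis. \<alpha> b)"
  using sum_list_distinct_conv_sum_set[of "basis_list :: 'a list" \<alpha>]
  by (simp add: length_concat o_def basis_list)

text \<open>Bounds on all iterated partial derivatives, in any order.\<close>

definition bnd :: "nat \<Rightarrow> 'a::euclidean_space set \<Rightarrow> ('a \<Rightarrow> real) \<Rightarrow> ('a \<Rightarrow> complex) \<Rightarrow> bool" where
  "bnd k X \<beta> f \<longleftrightarrow> (\<forall>l. set l \<subseteq> Basis \<and> length l \<le> k \<longrightarrow> (\<forall>p\<in>X. norm (pdl l f p) \<le> \<beta> p))"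

lemma bnd_0 [simp]: "bnd 0 X \<beta> f \<longleftrightarrow> (\<forall>p\<in>X. norm (f p) \<le> \<beta> p)"
  by (auto simp: bnd_def)

lemma bnd_Suc: "bnd (Suc k) X \<beta> f \<longleftrightarrow> (\<forall>p\<in>X. norm (f p) \<le> \<beta> p) \<and> (\<forall>b\<in>Basis. bnd k X \<beta> (pd b f))"
proof safe
  assume *: "bnd (Suc k) X \<beta> f"
  show "norm (f p) \<le> \<beta> p" if "p \<in> X" for p
    using *[unfolded bnd_def, rule_format, of "[]"] that by simp
  show "bnd k X \<beta> (pd b f)" if "b \<in> Basis" for b
    unfolding bnd_def using *[unfolded bnd_def, rule_format, of "_ @ [b]"] that by auto
next
  assume *: "\<forall>p\<in>X. norm (f p) \<le> \<beta> p" "\<forall>b\<in>Basis. bnd k X \<beta> (pd b f)"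
  show "bnd (Suc k) X \<beta> f"
    unfolding bnd_def
  proof safe
    fix l p assume l: "set l \<subseteq> (Basis :: 'a set)" "length l \<le> Suc k" "p \<in> X"
    show "norm (pdl l f p) \<le> \<beta> p"
    \<comment> \<open>The last entry of a word is the derivative that is applied first.\<close>
    proof (cases l rule: rev_cases)
      case (snoc l' b)
      then show ?thesis using * l by (auto simp: bnd_def)
    qed (use * l in auto)
  qed
qed

lemma bnd_norm: "bnd k X \<beta> f \<Longrightarrow> p \<in> X \<Longrightarrow> norm (f p) \<le> \<beta> p"
  by (cases k) (auto simp: bnd_Suc)

lemma bnd_pd: "bnd (Suc k) X \<beta> f \<Longrightarrow> b \<in> Basis \<Longrightarrow> bnd k X \<beta> (pd b f)"
  by (simp add: bnd_Suc)

lemma bnd_weaken: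
  assumes "bnd k X \<beta> f" "j \<le> k" "Y \<subseteq> X" "\<And>p. p \<in> Y \<Longrightarrow> \<beta> p \<le> \<gamma> p"
  shows "bnd j Y \<gamma> f"
  unfolding bnd_def
proof safe
  fix l p assume "set l \<subseteq> (Basis::'a set)" "length l \<le> j" "p \<in> Y"
  with assms show "norm (pdl l f p) \<le> \<gamma> p"
    unfolding bnd_def by (meson le_trans order.trans subsetD)
qed

lemma bnd_add:
  assumes "Ck k UNIV f" "Ck k UNIV g" "bnd k X \<beta> f" "bnd k X \<gamma> g"
  shows "bnd k X (\<lambda>p. \<beta> p + \<gamma> p) (\<lambda>p. f p + g p)"
  using assms
proof (induction k arbitrary: f g)
  case 0
  then show ?case by (auto intro: norm_triangle_mono)
next
  case (Suc k)
  then have "pd b (\<lambda>x. f x + g x) = (\<lambda>x. pd b f x + pd b g x)" for b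
    by (auto simp: pd_add Ck_differentiable simp del: Ck.simps)
  with Suc show ?case
    by (auto simp: bnd_Suc Ck_Suc_UNIV simp del: Ck.simps intro: norm_triangle_mono)
qed

text \<open>Leibniz' rule produces two products per derivative, so the constant doubles with each
  order.\<close>

lemma bnd_mult:
  assumes "Ck k UNIV f" "Ck k UNIV g" "bnd k X \<beta> f" "bnd k X \<gamma> g"
  shows "bnd k X (\<lambda>p. 2^k * (\<beta> p * \<gamma> p)) (\<lambda>p. f p * g p)"
  using assms
proof (induction k arbitrary: f g)
  case 0
  have "norm (f p) * norm (g p) \<le> \<beta> p * \<gamma> p" if "p \<in> X" for p
  proof (rule mult_mono)
    show "norm (f p) \<le> \<beta> p" using 0 that by simp
    then show "0 \<le> \<beta> p" using norm_ge_zero order.trans by blast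
  qed (use 0 that in auto)
  then show ?case by (simp add: norm_mult)
next
  case (Suc k)
  have pd: "pd b (\<lambda>x. f x * g x) = (\<lambda>x. f x * pd b g x + pd b f x * g x)" for b
    using Suc.prems by (auto simp: pd_mult Ck_differentiable simp del: Ck.simps)
  have *: "bnd k X (\<lambda>p. 2^k * (\<beta> p * \<gamma> p) + 2^k * (\<beta> p * \<gamma> p)) (\<lambda>x. f x * pd b g x + pd b f x * g x)" if "b \<in> Basis" for b
    using Suc.prems that
    by (intro bnd_add Suc.IH Ck_mult Ck_pd bnd_pd) (auto dest: Ck_Suc_imp_Ck intro: bnd_weaken[of "Suc k"] simp del: Ck.simps)
  have "bnd k X (\<lambda>p. 2 * 2^k * (\<beta> p * \<gamma> p)) (\<lambda>x. f x * pd b g x + pd b f x * g x)" if "b \<in> Basis" for b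
    by (rule bnd_weaken[OF *[OF that]]) auto
  moreover have "norm (f p * g p) \<le> 2 * 2 ^ k * (\<beta> p * \<gamma> p)" if p: "p \<in> X" for p
  proof -
    have "norm (f p) \<le> \<beta> p" "norm (g p) \<le> \<gamma> p" using Suc.prems p by (auto simp: bnd_Suc)
    then have "norm (f p) * norm (g p) \<le> \<beta> p * \<gamma> p"
      by (meson mult_mono norm_ge_zero order.trans)
    moreover have "1 * (\<beta> p * \<gamma> p) \<le> 2^(Suc k) * (\<beta> p * \<gamma> p)"
      by (rule mult_right_mono)
        (use order.trans[OF mult_nonneg_nonneg[OF norm_ge_zero norm_ge_zero] calculation] 
           one_le_power[of "2::real" "Suc k"] in auto)
    ultimately show ?thesis by (simp add: norm_mult)
  qed
  ultimately show ?case
    by (simp add: bnd_Suc pd)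
qed

lemma bnd_const: "norm c \<le> B \<Longrightarrow> bnd k X (\<lambda>p. B) (\<lambda>p. c)"
proof (induction k arbitrary: c)
  case (Suc k)
  have "pd b (\<lambda>p. c) = (\<lambda>p::'a. 0)" for b by (simp add: fun_eq_iff)
  moreover have "0 \<le> B" using Suc.prems norm_ge_zero order.trans by blast
  ultimately show ?case using Suc by (simp add: bnd_Suc)
qed simp

lemma bnd_cmult:
  assumes "Ck k UNIV f" "bnd k X \<beta> f"
  shows "bnd k X (\<lambda>p. norm c * \<beta> p) (\<lambda>p. c * f p)"
  using assms
proof (induction k arbitrary: f)
  case 0
  then show ?case by (auto simp: norm_mult intro: mult_left_mono)
next
  case (Suc k)
  then have "pd b (\<lambda>x. c * f x) = (\<lambda>x. c * pd b f x)" for b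
    by (auto simp: pd_cmult Ck_differentiable simp del: Ck.simps)
  with Suc show ?case
    by (auto simp: bnd_Suc Ck_Suc_UNIV norm_mult simp del: Ck.simps intro: mult_left_mono)
qed

lemma bnd_sum:
  assumes "finite I" "\<And>i. i \<in> I \<Longrightarrow> Ck k UNIV (f i)" "\<And>i. i \<in> I \<Longrightarrow> bnd k X (\<beta> i) (f i)"
  shows "bnd k X (\<lambda>p. \<Sum>i\<in>I. \<beta> i p) (\<lambda>p. \<Sum>i\<in>I. f i p)"
  using assms
  by (induction I rule: finite_induct) (auto intro!: bnd_add bnd_const Ck_sum)

lemma finite_multi_indices [simp]: "finite (multi_indices s :: ('a::euclidean_space \<Rightarrow> nat) set)"
proof (rule finite_subset)
  show "multi_indices s \<subseteq> {\<alpha>. \<forall>b::'a. (b \<in> Basis \<longrightarrow> \<alpha> b \<in> {..s}) \<and> (b \<notin> Basis \<longrightarrow> \<alpha> b = 0)}"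
  proof (intro subsetI CollectI allI conjI impI)
    fix \<alpha> :: "'a \<Rightarrow> nat" and b :: 'a assume \<alpha>: "\<alpha> \<in> multi_indices s"
    show "\<alpha> b \<in> {..s}" if "b \<in> Basis"
      using \<alpha> member_le_sum[OF that, of \<alpha>] by (auto simp: multi_indices_def)
    show "\<alpha> b = 0" if "b \<notin> Basis"
      using \<alpha> that by (auto simp: multi_indices_def)
  qed
  show "finite {\<alpha>. \<forall>b::'a. (b \<in> Basis \<longrightarrow> \<alpha> b \<in> {..s}) \<and> (b \<notin> Basis \<longrightarrow> \<alpha> b = 0)}"
    by (rule finite_set_of_finite_funs) auto
qed

lemma Ck_norm_le:
  fixes f :: "'a::euclidean_space \<Rightarrow> complex"
  assumes "bnd s X (\<lambda>p. B) f" "0 \<le> B"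
  shows "Ck_norm s X f \<le> ennreal (real (card (multi_indices s :: ('a \<Rightarrow> nat) set)) * B)"
    (is "_ \<le> ennreal (real (card ?M) * B)")
proof -
  have "Ck_norm s X f \<le> (\<Sum>\<alpha>\<in>?M. ennreal B)"
    unfolding Ck_norm_def
  proof (intro sum_mono SUP_least ennreal_leI)
    fix \<alpha> and p :: 'a assume \<alpha>: "\<alpha> \<in> ?M" and p: "p \<in> X"
    have "set (concat (map (\<lambda>b. replicate (\<alpha> b) b) (basis_list :: 'a list))) \<subseteq> Basis"
      by (auto simp: basis_list)
    then show "norm (pd_multi \<alpha> f p) \<le> B"
      using assms(1) \<alpha> p by (auto simp: bnd_def pd_multi_pdl length_multi_index multi_indices_def)
  qed
  then show ?thesis using assms(2) by (simp add: ennreal_mult ennreal_of_nat_eq_real_of_nat)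
qed

text \<open>The word \<open>l\<close> is a rearrangement of the multi-index that counts its letters,
  so its derivative occurs as one summand of the norm. Passing from the norm to \<open>bnd\<close>
  thus keeps the constant, whereas the converse \<open>Ck_norm_le\<close> multiplies it by the
  number of multi-indices.\<close>

lemma Ck_norm_bnd:
  fixes f :: "'a::euclidean_space \<Rightarrow> complex"
  assumes "Ck s UNIV f" "Ck_norm s X f \<le> ennreal B" "0 \<le> B"
  shows "bnd s X (\<lambda>p. B) f"
  unfolding bnd_def
proof safe
  fix l p assume l: "set l \<subseteq> (Basis :: 'a set)" "length l \<le> s" and p: "p \<in> X"
  let ?\<alpha> = "count (mset l)"
  let ?l = "concat (map (\<lambda>b. replicate (?\<alpha> b) b) (basis_list :: 'a list))"
  \<comment> \<open>Listing each direction as often as it occurs recovers the letters of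
    \<open>l\<close>; the induction runs over an arbitrary distinct list in place of
    \<open>basis_list\<close>.\<close>
  have "mset (concat (map (\<lambda>b. replicate (?\<alpha> b) b) L)) = filter_mset (\<lambda>b. b \<in> set L) (mset l)" if "distinct L" for L
    using that
  proof (induction L)
    case (Cons a L)
    then show ?case
      by (intro multiset_eqI) (auto simp: not_in_iff)
  qed simp
  from this[OF basis_list(1)] have "mset ?l = filter_mset (\<lambda>b. b \<in> Basis) (mset l)"
    by (simp add: basis_list)
  also have "\<dots> = mset l"
    by (intro multiset_eqI) (use l(1) in \<open>auto simp: count_eq_zero_iff\<close>)
  finally have ms: "mset l = mset ?l" ..
  have "length l = length ?l" using mset_eq_length[OF ms] .
  then have sum: "(\<Sum>b\<in>Basis. ?\<alpha> b) \<le> s" unfolding length_multi_index using l by simp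
  have "?\<alpha> b = 0" if "b \<notin> Basis" for b using that l(1) by (auto simp: not_in_iff[symmetric])
  then have \<alpha>: "?\<alpha> \<in> multi_indices s" using sum by (auto simp: multi_indices_def)
  have "pdl l f = pd_multi ?\<alpha> f"
    unfolding pd_multi_pdl using assms(1) l by (intro pdl_mset_cong ms) (auto intro: Ck_mono)
  then have "ennreal (norm (pdl l f p)) \<le> (SUP p\<in>X. ennreal (norm (pd_multi ?\<alpha> f p)))"
    using p by (auto intro: SUP_upper2)
  also have "\<dots> \<le> Ck_norm s X f"
    unfolding Ck_norm_def using \<alpha> by (intro member_le_sum) auto
  also have "\<dots> \<le> ennreal B" by fact
  finally show "norm (pdl l f p) \<le> B" using assms(3) by simp
qed

lemma pd_vanish: "open S \<Longrightarrow> (\<And>x. x \<in> S \<Longrightarrow> f x = 0) \<Longrightarrow> p \<in> S \<Longrightarrow> pd b f p = 0"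
  using pd_cong_open[of S p f "\<lambda>x. 0" b] by simp

lemma pdl_vanish: "open S \<Longrightarrow> (\<And>x. x \<in> S \<Longrightarrow> f x = 0) \<Longrightarrow> p \<in> S \<Longrightarrow> pdl l f p = 0"
  by (induction l arbitrary: p) (auto intro: pd_vanish)

text \<open>All derivatives vanish on an open set where the function does. The bounds of functions
  supported in the cone, or in a bounded part of a slab, are extended in this way.\<close>

lemma bnd_extend_zero:
  assumes "bnd k X \<beta> f" "open S" "\<And>x. x \<in> S \<Longrightarrow> f x = 0" "Y \<subseteq> X \<union> S" "\<And>p. p \<in> Y \<Longrightarrow> 0 \<le> \<beta> p"
  shows "bnd k Y \<beta> f"
  unfolding bnd_def
proof safe
  fix l p assume "set l \<subseteq> (Basis::'a set)" "length l \<le> k" "p \<in> Y"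
  then show "norm (pdl l f p) \<le> \<beta> p"
    using assms pdl_vanish[of S f p l] by (cases "p \<in> S") (auto simp: bnd_def)
qed

lemma bnd_compact:
  assumes "Ck k UNIV f" "compact X"
  shows "\<exists>B\<ge>0. bnd k X (\<lambda>p. B) f"
  using assms(1)
proof (induction k arbitrary: f)
  case 0
  then have "bounded (f ` X)"
    using assms(2) compact_continuous_image compact_imp_bounded continuous_on_subset by (metis Ck.simps(1) subset_UNIV)
  then obtain B where "\<And>p. p \<in> X \<Longrightarrow> norm (f p) \<le> B" by (auto simp: bounded_iff)
  then show ?case by (intro exI[of _ "max B 0"]) (simp add: le_max_iff_disj)
next
  case (Suc k)
  have "\<exists>B\<ge>0. bnd k X (\<lambda>p. B) (pd b f)" if "b \<in> Basis" for b
    using Suc that by (intro Suc.IH Ck_pd)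
  then obtain B where B: "\<And>b. b \<in> Basis \<Longrightarrow> 0 \<le> B b \<and> bnd k X (\<lambda>p. B b) (pd b f)" by metis
  obtain C where C: "C \<ge> 0" "bnd k X (\<lambda>p. C) f"
    using Suc.IH[of f] Suc.prems Ck_Suc_imp_Ck by blast
  let ?B = "C + (\<Sum>b\<in>Basis. B b)"
  have "B b \<le> ?B" if "b \<in> Basis" for b
    using member_le_sum[OF that, of B] B C by auto
  then have "bnd k X (\<lambda>p. ?B) (pd b f)" if "b \<in> Basis" for b
    using B that by (auto intro: bnd_weaken)
  moreover have "norm (f p) \<le> ?B" if "p \<in> X" for p
    using bnd_norm[OF C(2) that] sum_nonneg[of Basis B] B by auto
  moreover have "0 \<le> ?B" using C B by (auto intro!: add_nonneg_nonneg sum_nonneg)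
  ultimately show ?case by (auto simp: bnd_Suc intro!: exI[of _ ?B])
qed

section \<open>A smooth step function\<close>

text \<open>The denominators \<open>z ^ k\<close> make the family closed under differentiation up to
  linear combinations, so that smoothness becomes one induction on the order, for all
  \<open>k\<close> at once.\<close>

definition flat :: "nat \<Rightarrow> real \<Rightarrow> real" where
  "flat k z = (if z \<le> 0 then 0 else exp (- 1 / z) / z ^ k)"

lemma flat_nonneg: "0 \<le> flat k z"
  by (simp add: flat_def)

text \<open>From exp x >= x at x = 1 / (n z) follows exp (-1 / (n z)) <= n z. The n-th power with n
  = k + 2 beats \<open>z ^ k\<close> by a square, and the square is what makes the difference
  quotient at 0 tend to 0.\<close>

lemma flat_le: "z > 0 \<Longrightarrow> flat k z \<le> real (k + 2) ^ (k + 2) * z\<^sup>2"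
proof -
  assume z: "z > 0"
  define n where "n = k + 2"
  have n: "real n > 0" by (simp add: n_def)
  have "1 / (n * z) \<le> exp (1 / (n * z))"
    using exp_ge_add_one_self[of "1 / (n * z)"] by linarith
  then have "inverse (exp (1 / (n * z))) \<le> inverse (1 / (n * z))"
    by (rule le_imp_inverse_le) (use z n in simp)
  then have "exp (- 1 / (n * z)) \<le> n * z"
    by (simp add: exp_minus)
  then have "exp (- 1 / (n * z)) ^ n \<le> (n * z) ^ n"
    by (intro power_mono) auto
  moreover have "exp (- 1 / (n * z)) ^ n = exp (- 1 / z)"
    using n by (subst exp_of_nat_mult[symmetric]) (simp add: field_simps)
  ultimately have "exp (- 1 / z) / z ^ k \<le> (n * z) ^ n / z ^ k"
    using z by (intro divide_right_mono) auto
  also have "\<dots> = real n ^ n * z\<^sup>2"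
    using z by (simp add: n_def power_mult_distrib power_add power2_eq_square)
  finally show ?thesis using z by (simp add: flat_def n_def)
qed

lemma has_derivative_flat:
  "(flat k has_field_derivative (flat (k + 2) z - k * flat (k + 1) z)) (at z)"
proof (cases z "0::real" rule: linorder_cases)
  case less
  have "((\<lambda>_. 0) has_field_derivative 0) (at z)" by simp
  then have "(flat k has_field_derivative 0) (at z)"
    by (rule has_field_derivative_transform_within_open[where S="{..<0}"]) (use less in \<open>auto simp: flat_def\<close>)
  with less show ?thesis by (simp add: flat_def)
next
  case equal
  let ?C = "real (k + 2) ^ (k + 2)"
  have "((\<lambda>h. (flat k (0 + h) - flat k 0) / h) \<longlongrightarrow> 0) (at 0)"
  proof (rule tendsto_0_le[where K=1])
    show "((\<lambda>h. ?C * h) \<longlongrightarrow> 0) (at 0)" by (auto intro!: tendsto_eq_intros)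
    have "\<bar>flat k h\<bar> / \<bar>h\<bar> \<le> ?C * \<bar>h\<bar>" if "h \<noteq> 0" for h :: real
    proof (cases "h > 0")
      case True
      then show ?thesis 
        using divide_right_mono[OF flat_le[OF True, of k], of h] flat_nonneg[of k h] by (simp add: power2_eq_square)
    next
      case False
      have "0 \<le> ?C * \<bar>h\<bar>" by (intro mult_nonneg_nonneg) auto
      with False show ?thesis by (simp add: flat_def)
    qed
    then show "\<forall>\<^sub>F h in at 0. norm ((flat k (0 + h) - flat k 0) / h) \<le> norm (?C * h) * 1"
      by (auto simp: eventually_at_filter flat_def[of k 0] abs_mult abs_divide)
  qed
  then show ?thesis using equal by (simp add: DERIV_def flat_def)
next
  case greater
  have 1: "((\<lambda>z. z ^ k) has_field_derivative (real k * z ^ k / z)) (at z)"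
    using DERIV_pow[of k z] greater by (cases k) auto
  have 2: "((\<lambda>z. exp (- 1 / z)) has_field_derivative (exp (- 1 / z) / z\<^sup>2)) (at z)"
    using greater by (auto intro!: derivative_eq_intros simp: field_simps power2_eq_square)
  have "((\<lambda>z. exp (- 1 / z) / z ^ k) has_field_derivative (flat (k + 2) z - k * flat (k + 1) z)) (at z)"
    by (rule DERIV_cong[OF DERIV_divide[OF 2 1]]) 
      (use greater in \<open>simp_all add: flat_def field_simps power2_eq_square\<close>)
  then show ?thesis
    by (rule has_field_derivative_transform_within_open[where S="{0<..}"]) (use greater in \<open>auto simp: flat_def\<close>)
qed

lemma Ck_flat: "Ck j UNIV (\<lambda>z. complex_of_real (flat k z))"
proof (induction j arbitrary: k)
  case 0
  have "isCont (flat k) z" for z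
    by (rule DERIV_isCont[OF has_derivative_flat])
  then show ?case by (auto intro!: continuous_intros continuous_at_imp_continuous_on)
next
  case (Suc j)
  have "((\<lambda>z. complex_of_real (flat k z)) has_derivative
     (\<lambda>h. of_real (h * (flat (k + 2) z - k * flat (k + 1) z)))) (at z)" for z
    using bounded_linear.has_derivative[OF bounded_linear_of_real has_derivative_flat[unfolded has_field_derivative_def]]
    by (simp add: mult.commute)
  then show ?case
  proof (rule Ck_Suc_UNIV_I)
    fix b :: real assume "b \<in> Basis"
    then have "(\<lambda>p. complex_of_real (b * (flat (k + 2) p - k * flat (k + 1) p))) =
        (\<lambda>p. of_real (flat (k + 2) p) - of_nat k * of_real (flat (k + 1) p))" by simp
    then show "Ck j UNIV (\<lambda>p. complex_of_real (b * (flat (k + 2) p - k * flat (k + 1) p)))"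
      by (simp only:) (intro Ck_diff Ck_cmult Suc.IH)
  qed
qed

definition step :: "real \<Rightarrow> complex" where
  "step z = of_real (flat 0 z) * inverse (of_real (flat 0 z) + of_real (flat 0 (1 - z)))"

lemma Ck_real_affine: "Ck k UNIV f \<Longrightarrow> Ck k UNIV (\<lambda>z::real. f (a * z + b))"
  using Ck_affine[of k f "\<lambda>z. a * z" b] bounded_linear_mult_right[of a] by blast

lemma Ck_step: "Ck k UNIV step"
  unfolding step_def[abs_def]
proof (intro Ck_mult Ck_inverse Ck_add Ck_flat)
  show "Ck k UNIV (\<lambda>z. complex_of_real (flat 0 (1 - z)))"
    using Ck_real_affine[OF Ck_flat, of k 0 "-1" 1] by simp
  \<comment> \<open>\<open>z\<close> and \<open>1 - z\<close> are never both nonpositive, so one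
    summand is positive.\<close>
  show "complex_of_real (flat 0 z) + complex_of_real (flat 0 (1 - z)) \<noteq> 0" for z
  proof -
    have "flat 0 z + flat 0 (1 - z) > 0"
      by (cases "z > 0") (auto simp: flat_def intro: add_pos_nonneg)
    then have "complex_of_real (flat 0 z + flat 0 (1 - z)) \<noteq> 0"
      unfolding of_real_eq_0_iff by simp
    then show ?thesis by simp
  qed
qed

lemma step_0: "z \<le> 0 \<Longrightarrow> step z = 0" and step_1: "z \<ge> 1 \<Longrightarrow> step z = 1"
  by (auto simp: step_def flat_def)

section \<open>Differentiation under the integral sign\<close>

text \<open>Dominated convergence for the remainder quotients: the mean value inequality gives
  \<open>G\<close> the Lipschitz constant \<open>L\<close> wherever \<open>w\<close> is nonzero, so
  2 L |w| is a majorant. The integrable weight \<open>w\<close> carries the singularity of the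
  kernel, and \<open>G\<close> is the regular factor.\<close>

lemma has_derivative_lebesgue_integral:
  fixes G :: "'a::euclidean_space \<Rightarrow> 'y \<Rightarrow> complex"
  assumes w: "integrable M w"
    and meas: "\<And>x. x \<in> ball p 1 \<Longrightarrow> (\<lambda>y. w y *\<^sub>R G x y) \<in> borel_measurable M"
    and measD: "\<And>h. (\<lambda>y. w y *\<^sub>R G' p y h) \<in> borel_measurable M"
    and der: "\<And>x y. x \<in> ball p 1 \<Longrightarrow> w y \<noteq> 0 \<Longrightarrow> ((\<lambda>x. G x y) has_derivative G' x y) (at x)"
    and bd: "\<And>x y h. x \<in> ball p 1 \<Longrightarrow> w y \<noteq> 0 \<Longrightarrow> norm (G' x y h) \<le> L * norm h"
    and int: "integrable M (\<lambda>y. w y *\<^sub>R G p y)"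
  shows "((\<lambda>x. \<integral>y. w y *\<^sub>R G x y \<partial>M) has_derivative (\<lambda>h. \<integral>y. w y *\<^sub>R G' p y h \<partial>M)) (at p)"
proof (cases "\<exists>y. w y \<noteq> 0")
  case False
  then show ?thesis by simp
next
  case True
  obtain b :: 'a where b: "b \<in> Basis" using nonempty_Basis by blast
  obtain y0 where y0: "w y0 \<noteq> 0" using True by blast
  \<comment> \<open>The sign of \<open>L\<close> is read off at a point where \<open>w\<close> does
    not vanish; this is why the case of vanishing \<open>w\<close> is split off.\<close>
  have "0 \<le> norm (G' p y0 b)" by simp
  also have "\<dots> \<le> L * norm b" by (rule bd) (use y0 in auto)
  finally have L: "L \<ge> 0" using b by simp
  have wr: "norm ((w y *\<^sub>R u - w y *\<^sub>R v - w y *\<^sub>R z) /\<^sub>R t) = \<bar>w y\<bar> * (norm (u - v - z) / \<bar>t\<bar>)" for y t and u v z :: complex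
    by (simp only: scaleR_diff_right[symmetric] norm_scaleR abs_inverse divide_inverse mult_ac)
  have lip: "norm (G x y - G p y) \<le> L * norm (x - p)" if "x \<in> ball p 1" "w y \<noteq> 0" for x y
  proof (rule differentiable_bound[OF convex_ball[of p 1]])
    show "((\<lambda>x. G x y) has_derivative G' x y) (at x within ball p 1)" if "x \<in> ball p 1" for x
      using der that \<open>w y \<noteq> 0\<close> by (blast intro: has_derivative_at_withinI)
    show "onorm (G' x y) \<le> L" if "x \<in> ball p 1" for x
      using bd that \<open>w y \<noteq> 0\<close> L by (intro onorm_bound) auto
  qed (use that in auto)
  have intD: "integrable M (\<lambda>y. w y *\<^sub>R G' p y h)" for h
  proof (rule Bochner_Integration.integrable_bound)
    show "integrable M (\<lambda>y. (L * norm h) * w y)" using w by simp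
    show "AE y in M. norm (w y *\<^sub>R G' p y h) \<le> norm ((L * norm h) * w y)"
    proof (intro AE_I2)
      fix y show "norm (w y *\<^sub>R G' p y h) \<le> norm ((L * norm h) * w y)"
        using bd[of p y h] L by (cases "w y = 0") (auto simp: abs_mult mult.commute mult_right_mono)
    qed
  qed (rule measD)
  have intG: "integrable M (\<lambda>y. w y *\<^sub>R G x y)" if x: "x \<in> ball p 1" for x
  proof -
    have "integrable M (\<lambda>y. w y *\<^sub>R G x y - w y *\<^sub>R G p y)"
    proof (rule Bochner_Integration.integrable_bound)
      show "integrable M (\<lambda>y. (L * norm (x - p)) * w y)" using w by simp
      show "AE y in M. norm (w y *\<^sub>R G x y - w y *\<^sub>R G p y) \<le> norm ((L * norm (x - p)) * w y)"
      proof (intro AE_I2)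
        fix y show "norm (w y *\<^sub>R G x y - w y *\<^sub>R G p y) \<le> norm ((L * norm (x - p)) * w y)"
          unfolding scaleR_diff_right[symmetric]
          using lip[OF x, of y] L by (cases "w y = 0") (auto simp: abs_mult mult.commute mult_right_mono)
      qed
    qed (use meas[OF x] meas[of p] in auto)
    from Bochner_Integration.integrable_add[OF this int] show ?thesis by simp
  qed
  have linD: "linear (G' p y)" if "w y \<noteq> 0" for y
    using der[of p y] that has_derivative_linear by force
  let ?D = "\<lambda>h. \<integral>y. w y *\<^sub>R G' p y h \<partial>M"
  have "bounded_linear ?D"
  proof (rule bounded_linear_intro[where K="L * (\<integral>y. \<bar>w y\<bar> \<partial>M)"])
    fix h k :: 'a and r :: real
    have "?D (h + k) = (\<integral>y. w y *\<^sub>R G' p y h + w y *\<^sub>R G' p y k \<partial>M)"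
    proof (intro Bochner_Integration.integral_cong refl)
      show "w y *\<^sub>R G' p y (h + k) = w y *\<^sub>R G' p y h + w y *\<^sub>R G' p y k" for y
        by (cases "w y = 0") (auto simp: linear_add[OF linD] scaleR_add_right)
    qed
    then show "?D (h + k) = ?D h + ?D k" using intD by simp
    have "?D (r *\<^sub>R h) = (\<integral>y. r *\<^sub>R (w y *\<^sub>R G' p y h) \<partial>M)"
    proof (intro Bochner_Integration.integral_cong refl)
      show "w y *\<^sub>R G' p y (r *\<^sub>R h) = r *\<^sub>R (w y *\<^sub>R G' p y h)" for y
        by (cases "w y = 0") (auto simp: linear_scale[OF linD])
    qed
    then show "?D (r *\<^sub>R h) = r *\<^sub>R ?D h" unfolding integral_scaleR_right .
    have "norm (?D h) \<le> (\<integral>y. norm (w y *\<^sub>R G' p y h) \<partial>M)" by (rule integral_norm_bound)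
    also have "\<dots> \<le> (\<integral>y. (L * norm h) * \<bar>w y\<bar> \<partial>M)"
    proof (rule integral_mono)
      fix y show "norm (w y *\<^sub>R G' p y h) \<le> (L * norm h) * \<bar>w y\<bar>"
        using bd[of p y h] L by (cases "w y = 0") (auto simp: mult.commute mult_right_mono)
    qed (use w integrable_norm[OF intD[of h]] in auto)
    finally show "norm (?D h) \<le> norm h * (L * (\<integral>y. \<bar>w y\<bar> \<partial>M))" by (simp add: mult_ac)
  qed
  moreover have "(\<lambda>h. norm ((\<integral>y. w y *\<^sub>R G (p + h) y \<partial>M) - (\<integral>y. w y *\<^sub>R G p y \<partial>M) - ?D h) / norm h) \<midarrow>0\<rightarrow> 0"
    unfolding tendsto_at_iff_sequentially o_def
  proof safe
    fix X :: "nat \<Rightarrow> 'a" assume X0: "\<forall>i. X i \<in> UNIV - {0}" and X: "X \<longlonglongrightarrow> 0"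
    \<comment> \<open>Set to 0 for long increments, where the hypotheses on the unit ball say
      nothing; as \<open>X\<close> tends to 0, this concerns only finitely many
      \<open>i\<close>.\<close>
    define r where "r i y = (if norm (X i) < 1 then (w y *\<^sub>R G (p + X i) y - w y *\<^sub>R G p y - w y *\<^sub>R G' p y (X i)) /\<^sub>R norm (X i) else 0)" for i y
    have inb: "p + X i \<in> ball p 1" if "norm (X i) < 1" for i using that by (simp add: dist_norm)
    have rn: "norm (r i y) = \<bar>w y\<bar> * (norm (G (p + X i) y - G p y - G' p y (X i)) / norm (X i))"
      if "norm (X i) < 1" for i y
      using that by (simp only: r_def if_True wr abs_norm_cancel)
    have r0: "r i y = 0" if "\<not> norm (X i) < 1 \<or> w y = 0" for i y
      using that by (auto simp: r_def)
    have rbd: "norm (r i y) \<le> 2 * L * \<bar>w y\<bar>" for i y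
    proof (cases "norm (X i) < 1 \<and> w y \<noteq> 0")
      case True
      have "norm (G (p + X i) y - G p y - G' p y (X i)) \<le> L * norm (X i) + L * norm (X i)"
        using True by (intro order.trans[OF norm_triangle_ineq4 add_mono] bd order.trans[OF lip[OF inb]]) auto
      then have "\<bar>w y\<bar> * norm (G (p + X i) y - G p y - G' p y (X i)) \<le> \<bar>w y\<bar> * (2 * L * norm (X i))"
        by (intro mult_left_mono) auto
      then show ?thesis
        using True X0 by (simp add: rn pos_divide_le_eq mult_ac)
    next
      case False
      then have "r i y = 0" using r0 by blast
      then show ?thesis using L by simp
    qed
    have "(\<lambda>i. \<integral>y. r i y \<partial>M) \<longlonglongrightarrow> (\<integral>y. 0 \<partial>M)"
    proof (rule integral_dominated_convergence)
      show "integrable M (\<lambda>y. 2 * L * \<bar>w y\<bar>)" using w by simp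
      show "r i \<in> borel_measurable M" for i
        unfolding r_def using intG[OF inb, of i] int intD
        by (cases "norm (X i) < 1") auto
      show "AE y in M. norm (r i y) \<le> 2 * L * \<bar>w y\<bar>" for i using rbd by simp
      show "AE y in M. (\<lambda>i. r i y) \<longlonglongrightarrow> 0"
      proof (intro AE_I2)
        fix y show "(\<lambda>i. r i y) \<longlonglongrightarrow> 0"
        proof (cases "w y = 0")
          case False
          have "(\<lambda>h. norm (G (p + h) y - G p y - G' p y h) / norm h) \<midarrow>0\<rightarrow> 0"
            using der[of p y] False by (simp add: has_derivative_at)
          then have "(\<lambda>i. norm (G (p + X i) y - G p y - G' p y (X i)) / norm (X i)) \<longlonglongrightarrow> 0"
            using X0 X unfolding tendsto_at_iff_sequentially o_def by simp
          from tendsto_mult_left[OF this, of "\<bar>w y\<bar>"]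
          have *: "(\<lambda>i. \<bar>w y\<bar> * (norm (G (p + X i) y - G p y - G' p y (X i)) / norm (X i))) \<longlonglongrightarrow> 0" by simp
          show ?thesis
            by (rule Lim_null_comparison[OF _ *]) 
              (use tendstoD[OF X, of 1] in \<open>auto simp: rn elim!: eventually_mono\<close>)
        qed (simp add: r0)
      qed
    qed simp
    then have "(\<lambda>i. norm (\<integral>y. r i y \<partial>M)) \<longlonglongrightarrow> 0" by (simp add: tendsto_norm_zero)
    moreover have "\<forall>\<^sub>F i in sequentially. norm (\<integral>y. r i y \<partial>M) =
        norm ((\<integral>y. w y *\<^sub>R G (p + X i) y \<partial>M) - (\<integral>y. w y *\<^sub>R G p y \<partial>M) - ?D (X i)) / norm (X i)"
    proof -
      have "\<forall>\<^sub>F i in sequentially. norm (X i) < 1"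
        using tendstoD[OF X, of 1] by simp
      then show ?thesis
        by eventually_elim (simp add: r_def intG[OF inb] int intD divide_inverse mult.commute)
    qed
    ultimately show "(\<lambda>i. norm ((\<integral>y. w y *\<^sub>R G (p + X i) y \<partial>M) - (\<integral>y. w y *\<^sub>R G p y \<partial>M) - ?D (X i)) / norm (X i)) \<longlonglongrightarrow> 0"
      by (rule Lim_transform_eventually)
  qed
  ultimately show ?thesis unfolding has_derivative_at by simp
qed

text \<open>Common form of two integral operators: the retarded potential has \<open>a = 1\<close>
  and \<open>c y = (y, norm y)\<close>, the average along the ray to the origin has
  \<open>a \<sigma> = \<sigma>\<close> and \<open>c = 0\<close>. Differentiation multiplies the
  weight by \<open>a\<close> and so preserves the form.\<close>

definition pint :: "('y::euclidean_space \<Rightarrow> real) \<Rightarrow> ('y \<Rightarrow> real) \<Rightarrow> ('y \<Rightarrow> 'a) \<Rightarrow> ('a::euclidean_space \<Rightarrow> complex) \<Rightarrow> 'a \<Rightarrow> complex" where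
  "pint w a c F p = (\<integral>y. w y *\<^sub>R F (a y *\<^sub>R p - c y) \<partial>lborel)"

locale param_integral =
  fixes a :: "'y::euclidean_space \<Rightarrow> real" and c :: "'y \<Rightarrow> 'a::euclidean_space" and Y :: "'y set"
  assumes a: "continuous_on UNIV a" and c: "continuous_on UNIV c" and Y: "compact Y"
begin

lemma bounded_on_range:
  fixes F :: "'a \<Rightarrow> complex"
  assumes "continuous_on UNIV F"
  obtains B where "B \<ge> 0" "\<And>x y. y \<in> Y \<Longrightarrow> x \<in> cball p 1 \<Longrightarrow> norm (F (a y *\<^sub>R x - c y)) \<le> B"
proof -
  have "continuous_on (Y \<times> cball p 1) (\<lambda>z. F (a (fst z) *\<^sub>R snd z - c (fst z)))"
    by (intro continuous_on_compose2[OF assms] continuous_intros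
        continuous_on_compose2[OF a] continuous_on_compose2[OF c]) auto
  then have "compact ((\<lambda>z. F (a (fst z) *\<^sub>R snd z - c (fst z))) ` (Y \<times> cball p 1))"
    by (intro compact_continuous_image compact_Times Y compact_cball)
  from compact_imp_bounded[OF this]
  obtain B where B: "\<And>z. z \<in> Y \<times> cball p 1 \<Longrightarrow> norm (F (a (fst z) *\<^sub>R snd z - c (fst z))) \<le> B"
    unfolding bounded_iff by blast
  show thesis
  proof (rule that[of "max B 0"])
    show "norm (F (a y *\<^sub>R x - c y)) \<le> max B 0" if "y \<in> Y" "x \<in> cball p 1" for x y
      using B[of "(y, x)"] that by (simp add: le_max_iff_disj)
  qed simp
qed

lemma measurable_param:
  fixes F :: "'a \<Rightarrow> complex"
  assumes "continuous_on UNIV F"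
  shows "(\<lambda>y. F (a y *\<^sub>R p - c y)) \<in> borel_measurable borel"
  by (rule borel_measurable_continuous_onI)
    (intro continuous_on_compose2[OF assms] continuous_intros a c, auto)

lemma pint_integrable:
  fixes F :: "'a \<Rightarrow> complex"
  assumes w: "integrable lborel w" "\<And>y. y \<notin> Y \<Longrightarrow> w y = 0" and F: "continuous_on UNIV F"
  shows "integrable lborel (\<lambda>y. w y *\<^sub>R F (a y *\<^sub>R p - c y))"
proof -
  obtain B where B: "B \<ge> 0" "\<And>x y. y \<in> Y \<Longrightarrow> x \<in> cball p 1 \<Longrightarrow> norm (F (a y *\<^sub>R x - c y)) \<le> B"
    using bounded_on_range[OF F] by metis
  show ?thesis
  proof (rule Bochner_Integration.integrable_bound)
    show "integrable lborel (\<lambda>y. B * w y)" using w by simp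
    have "norm (w y *\<^sub>R F (a y *\<^sub>R p - c y)) \<le> norm (B * w y)" for y
      using B(2)[of y p] B(1) w(2)[of y]
      by (cases "y \<in> Y") (auto simp: abs_mult mult.commute[of B] intro: mult_left_mono)
    then show "AE y in lborel. norm (w y *\<^sub>R F (a y *\<^sub>R p - c y)) \<le> norm (B * w y)" by simp
  qed (use measurable_param[OF F] w in auto)
qed

lemma pint_isCont:
  assumes w: "integrable lborel w" "\<And>y. y \<notin> Y \<Longrightarrow> w y = 0" and F: "continuous_on UNIV F"
  shows "isCont (pint w a c F) p"
  unfolding isCont_def tendsto_at_iff_sequentially o_def
proof safe
  fix X :: "nat \<Rightarrow> 'a" assume X: "X \<longlonglongrightarrow> p"
  obtain B where B: "B \<ge> 0" "\<And>x y. y \<in> Y \<Longrightarrow> x \<in> cball p 1 \<Longrightarrow> norm (F (a y *\<^sub>R x - c y)) \<le> B"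
    using bounded_on_range[OF F] by metis
  \<comment> \<open>Entries at distance 1 or more are replaced by \<open>p\<close>, so that the
    bound on the unit ball applies to the whole sequence.\<close>
  define Z where "Z i = (if dist (X i) p < 1 then X i else p)" for i
  have ev: "\<forall>\<^sub>F i in sequentially. X i = Z i"
    using tendstoD[OF X, of 1] by (auto simp: Z_def elim: eventually_mono)
  have Z: "Z \<longlonglongrightarrow> p" by (rule Lim_transform_eventually[OF X ev])
  have "(\<lambda>i. pint w a c F (Z i)) \<longlonglongrightarrow> pint w a c F p"
    unfolding pint_def
  proof (rule integral_dominated_convergence)
    show "integrable lborel (\<lambda>y. B * \<bar>w y\<bar>)" using w by simp
    have Zb: "Z i \<in> cball p 1" for i by (auto simp: Z_def dist_commute)
    have "norm (w y *\<^sub>R F (a y *\<^sub>R Z i - c y)) \<le> B * \<bar>w y\<bar>" for i y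
      using mult_left_mono[OF B(2)[of y "Z i"], of "\<bar>w y\<bar>"] Zb[of i] w(2)[of y] 
      by (cases "y \<in> Y") (auto simp: mult.commute[of B])
    then show "AE y in lborel. norm (w y *\<^sub>R F (a y *\<^sub>R Z i - c y)) \<le> B * \<bar>w y\<bar>" for i by simp
    have "(\<lambda>i. w y *\<^sub>R F (a y *\<^sub>R Z i - c y)) \<longlonglongrightarrow> w y *\<^sub>R F (a y *\<^sub>R p - c y)" for y
      by (intro tendsto_intros continuous_on_tendsto_compose[OF F] Z) auto
    then show "AE y in lborel. (\<lambda>i. w y *\<^sub>R F (a y *\<^sub>R Z i - c y)) \<longlonglongrightarrow> w y *\<^sub>R F (a y *\<^sub>R p - c y)" by simp
  qed (use measurable_param[OF F] w in auto)
  then show "(\<lambda>i. pint w a c F (X i)) \<longlonglongrightarrow> pint w a c F p"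
    by (rule Lim_transform_eventually) (use ev in \<open>auto elim: eventually_mono\<close>)
qed

lemma integrable_mult_continuous:
  assumes w: "integrable lborel w" "\<And>y. y \<notin> Y \<Longrightarrow> w y = (0::real)"
  shows "integrable lborel (\<lambda>y. w y * a y)"
proof -
  have "compact (a ` Y)" using a Y by (intro compact_continuous_image) (auto intro: continuous_on_subset)
  then obtain B where B: "\<And>y. y \<in> Y \<Longrightarrow> \<bar>a y\<bar> \<le> B"
    using compact_imp_bounded[of "a ` Y"] unfolding bounded_iff by auto
  show ?thesis
  proof (rule Bochner_Integration.integrable_bound)
    show "integrable lborel (\<lambda>y. B * w y)" using w by simp
    have "norm (w y * a y) \<le> norm (B * w y)" for y
      using mult_left_mono[OF B[of y], of "\<bar>w y\<bar>"] w(2)[of y]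
      by (cases "y \<in> Y") (auto simp: abs_mult mult.commute[of B] intro: order.trans[OF _ mult_left_mono[OF abs_ge_self]])
    then show "AE y in lborel. norm (w y * a y) \<le> norm (B * w y)" by simp
  qed (use w borel_measurable_continuous_onI[OF a] in auto)
qed

lemma pint_has_derivative:
  assumes w: "integrable lborel w" "\<And>y. y \<notin> Y \<Longrightarrow> w y = 0" and F: "Ck (Suc k) UNIV F"
  shows "(pint w a c F has_derivative (\<lambda>h. pint (\<lambda>y. w y * a y) a c (pd h F) p)) (at p)"
proof -
  have contF: "continuous_on UNIV F" using F Ck_continuous by blast
  have pdF: "continuous_on UNIV (pd b F)" if "b \<in> Basis" for b
    using Ck_pd[OF F that] Ck_continuous by blast
  have pdsum: "pd h F x = (\<Sum>b\<in>Basis. (h \<bullet> b) *\<^sub>R pd b F x)" for h x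
    by (rule pd_linear_sum[OF Ck_differentiable[OF F]])
  have pdh: "continuous_on UNIV (pd h F)" for h
    unfolding pdsum[of h, abs_def] by (intro continuous_intros pdF)
  have "\<exists>B\<ge>0. \<forall>x y. y \<in> Y \<longrightarrow> x \<in> cball p 1 \<longrightarrow> norm (pd b F (a y *\<^sub>R x - c y)) \<le> B" if b: "b \<in> Basis" for b
    by (rule bounded_on_range[OF pdF[OF b], of p]) blast
  then have "\<forall>b. \<exists>B. b \<in> Basis \<longrightarrow> B \<ge> 0 \<and> (\<forall>x y. y \<in> Y \<longrightarrow> x \<in> cball p 1 \<longrightarrow> norm (pd b F (a y *\<^sub>R x - c y)) \<le> B)"
    by blast
  from choice[OF this] obtain B where B: "\<And>b. b \<in> Basis \<Longrightarrow> B b \<ge> 0"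
     "\<And>b x y. b \<in> Basis \<Longrightarrow> y \<in> Y \<Longrightarrow> x \<in> cball p 1 \<Longrightarrow> norm (pd b F (a y *\<^sub>R x - c y)) \<le> B b" by blast
  have "compact (a ` Y)" using a Y by (intro compact_continuous_image) (auto intro: continuous_on_subset)
  then obtain A where A: "\<And>y. y \<in> Y \<Longrightarrow> \<bar>a y\<bar> \<le> A"
    using compact_imp_bounded[of "a ` Y"] unfolding bounded_iff by auto
  let ?L = "A * (\<Sum>b\<in>Basis. B b)"
  have "((\<lambda>x. \<integral>y. w y *\<^sub>R F (a y *\<^sub>R x - c y) \<partial>lborel) has_derivative
      (\<lambda>h. \<integral>y. w y *\<^sub>R (a y *\<^sub>R pd h F (a y *\<^sub>R p - c y)) \<partial>lborel)) (at p)"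
  proof (rule has_derivative_lebesgue_integral[OF w(1), where G'="\<lambda>x y h. a y *\<^sub>R pd h F (a y *\<^sub>R x - c y)" and L = ?L])
    show "(\<lambda>y. w y *\<^sub>R F (a y *\<^sub>R x - c y)) \<in> borel_measurable lborel" for x
      using measurable_param[OF contF] w by simp
    show "(\<lambda>y. w y *\<^sub>R a y *\<^sub>R pd h F (a y *\<^sub>R p - c y)) \<in> borel_measurable lborel" for h
      by (intro borel_measurable_scaleR) 
        (use measurable_param[OF pdh] w borel_measurable_continuous_onI[OF a] in auto)
    show "integrable lborel (\<lambda>y. w y *\<^sub>R F (a y *\<^sub>R p - c y))"
      by (rule pint_integrable[OF w contF])
    fix x y assume x: "x \<in> ball p 1" and "w y \<noteq> 0"
    then have y: "y \<in> Y" using w by blast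
    have sc: "pd (a y *\<^sub>R h) F z = a y *\<^sub>R pd h F z" for h z
      unfolding pdsum[of "a y *\<^sub>R h"] pdsum[of h] scaleR_sum_right inner_scaleR_left scaleR_scaleR ..
    have "((\<lambda>x. F (a y *\<^sub>R x - c y)) has_derivative (\<lambda>h. pd (a y *\<^sub>R h) F (a y *\<^sub>R x - c y))) (at x)"
      by (rule has_derivative_compose[OF _ Ck_has_derivative[OF F], where f="\<lambda>x. a y *\<^sub>R x - c y"])
        (rule derivative_eq_intros refl | simp)+
    then show "((\<lambda>x. F (a y *\<^sub>R x - c y)) has_derivative (\<lambda>h. a y *\<^sub>R pd h F (a y *\<^sub>R x - c y))) (at x)"
      unfolding sc .
    fix h
    have "norm (pd h F (a y *\<^sub>R x - c y)) \<le> (\<Sum>b\<in>Basis. norm h * B b)"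
      unfolding pdsum[of h]
    proof (rule order.trans[OF norm_sum sum_mono])
      fix b :: 'a assume b: "b \<in> Basis"
      have "norm (pd b F (a y *\<^sub>R x - c y)) \<le> B b" using B(2)[OF b y] x by simp
      then show "norm ((h \<bullet> b) *\<^sub>R pd b F (a y *\<^sub>R x - c y)) \<le> norm h * B b"
        unfolding norm_scaleR by (intro mult_mono Basis_le_norm b) auto
    qed
    then have "\<bar>a y\<bar> * norm (pd h F (a y *\<^sub>R x - c y)) \<le> A * (\<Sum>b\<in>Basis. norm h * B b)"
      using A[OF y] by (intro mult_mono) auto
    then show "norm (a y *\<^sub>R pd h F (a y *\<^sub>R x - c y)) \<le> ?L * norm h"
      unfolding sum_distrib_left[symmetric] by (simp add: mult_ac)
  qed
  then show ?thesis by (simp add: pint_def[abs_def])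
qed

lemma Ck_pint:
  assumes "integrable lborel w" "\<And>y. y \<notin> Y \<Longrightarrow> w y = 0" "Ck k UNIV F"
  shows "Ck k UNIV (pint w a c F)"
  using assms
proof (induction k arbitrary: w F)
  case 0
  then show ?case using pint_isCont[of w F] by (simp add: continuous_at_imp_continuous_on)
next
  case (Suc k)
  show ?case
    by (rule Ck_Suc_UNIV_I[OF pint_has_derivative[OF Suc.prems]])
      (use Suc in \<open>auto intro!: Suc.IH integrable_mult_continuous Ck_pd simp del: Ck.simps\<close>)
qed

lemma pd_pint:
  assumes "integrable lborel w" "\<And>y. y \<notin> Y \<Longrightarrow> w y = 0" "Ck (Suc k) UNIV F"
  shows "pd b (pint w a c F) = pint (\<lambda>y. w y * a y) a c (pd b F)"
  using pd_eq[OF pint_has_derivative[OF assms]] by auto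

end

section \<open>The retarded potential\<close>

text \<open>Majorant for all integrability claims about radial kernels: of order |y|^-1 at the
  origin and |y|^-4 at infinity, both integrable in dimension 3.\<close>

definition K0 :: "real^3 \<Rightarrow> real" where
  "K0 y = 1 / (norm y * (1 + norm y) ^ 3)"

text \<open>The one-dimensional factor in the product that dominates \<open>K0\<close>: of order
  |z|^(-1/3) at 0 and |z|^(-4/3) at infinity.\<close>

lemma nn_integral_powr_profile:
  "(\<integral>\<^sup>+z. ennreal (\<bar>z :: real\<bar> powr (-1/3) / (1 + \<bar>z\<bar>)) \<partial>lborel) < \<infinity>"
proof -
  define f where "f z = ennreal (\<bar>z\<bar> powr (-1/3) / (1 + \<bar>z\<bar>))" for z :: real
  define u where "u z = ennreal (z powr (-1/3)) * indicator {0..1} z" for z :: real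
  define v where "v z = ennreal (z powr (-4/3)) * indicator {1..} z" for z :: real
  define h where "h z = u z + v z" for z
  have [measurable]: "u \<in> borel_measurable borel" "v \<in> borel_measurable borel"
    unfolding u_def[abs_def] v_def[abs_def] by simp_all
  have hm [measurable]: "h \<in> borel_measurable borel"
    unfolding h_def[abs_def] by measurable
  have hm' [measurable]: "(\<lambda>z. h (- z)) \<in> borel_measurable borel"
    by (rule measurable_compose[OF _ hm]) simp
  have "(\<integral>\<^sup>+z. u z \<partial>lborel) = ennreal (1 powr (-1/3+1) / (-1/3+1))"
    unfolding u_def by (rule nn_integral_has_integral_lebesgue'[OF _ has_integral_powr_from_0]) auto
  moreover have "(\<integral>\<^sup>+z. v z \<partial>lborel) = ennreal (- (1 powr (-4/3+1)) / (-4/3+1))"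
    unfolding v_def by (rule nn_integral_has_integral_lebesgue'[OF _ has_integral_powr_to_inf]) auto
  moreover have "(\<integral>\<^sup>+z. h z \<partial>lborel) = (\<integral>\<^sup>+z. u z \<partial>lborel) + (\<integral>\<^sup>+z. v z \<partial>lborel)"
    unfolding h_def by (rule nn_integral_add) simp_all
  ultimately have h: "(\<integral>\<^sup>+z. h z \<partial>lborel) < top" by simp
  have fh: "f z \<le> h z" if "z \<ge> 0" for z
  proof (cases "z \<le> 1")
    case True
    have "z powr (-1/3) / (1 + z) \<le> z powr (-1/3)"
      using that by (simp add: divide_le_eq mult_le_cancel_left1)
    then have "f z \<le> u z" using True that by (simp add: f_def u_def ennreal_leI)
    then show ?thesis unfolding h_def by (rule add_increasing2[OF zero_le])
  next
    case False
    have "z powr (-1/3) / (1 + z) \<le> z powr (-1/3) / z" using False by (intro divide_left_mono) auto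
    also have "\<dots> = z powr (-4/3)" using False powr_diff[of z "-1/3" 1] by simp
    finally have "f z \<le> v z" using False that by (simp add: f_def v_def ennreal_leI)
    then show ?thesis unfolding h_def by (rule add_increasing[OF zero_le])
  qed
  have "(\<integral>\<^sup>+z. f z \<partial>lborel) \<le> (\<integral>\<^sup>+z. h z + h (-z) \<partial>lborel)"
  proof (rule nn_integral_mono)
    fix z :: real
    show "f z \<le> h z + h (-z)"
    proof (cases "z \<ge> 0")
      case True
      show ?thesis by (rule add_increasing2[OF zero_le fh[OF True]])
    next
      case False
      then have "0 \<le> -z" by simp
      from fh[OF this] have "f z \<le> h (-z)" by (simp add: f_def)
      then show ?thesis by (rule add_increasing[OF zero_le])
    qed
  qed
  also have "\<dots> = (\<integral>\<^sup>+z. h z \<partial>lborel) + (\<integral>\<^sup>+z. h (-z) \<partial>lborel)"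
    by (rule nn_integral_add) simp_all
  also have "(\<integral>\<^sup>+z. h (-z) \<partial>lborel) = (\<integral>\<^sup>+z. h z \<partial>lborel)"
    using nn_integral_real_affine[OF hm, of "-1" 0] by simp
  finally have "(\<integral>\<^sup>+z. f z \<partial>lborel) \<le> (\<integral>\<^sup>+z. h z \<partial>lborel) + (\<integral>\<^sup>+z. h z \<partial>lborel)" .
  also have "\<dots> < top" using h by simp
  finally show ?thesis by (simp add: f_def)
qed

text \<open>\<open>K0\<close> is the cube of a decreasing profile of |y|, and |y| dominates every
  coordinate. Hence \<open>K0\<close> is at most the product of the profiles of the three
  coordinates, whose integral splits.\<close>

lemma integrable_K0: "integrable lborel K0"
proof (rule integrableI_nonneg)
  let ?f = "\<lambda>z::real. \<bar>z\<bar> powr (-1/3) / (1 + \<bar>z\<bar>)"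
  show "K0 \<in> borel_measurable lborel" unfolding K0_def[abs_def] by measurable
  show "AE y in lborel. 0 \<le> K0 y" by (simp add: K0_def)
  have "(\<integral>\<^sup>+y. ennreal (K0 y) \<partial>lborel) \<le> (\<integral>\<^sup>+y. (\<Prod>b\<in>Basis. ennreal (?f (y \<bullet> b))) \<partial>(lborel :: (real^3) measure))"
  proof (rule nn_integral_mono_AE)
    \<comment> \<open>Points with a vanishing coordinate must be discarded:
      \<open>0 powr (-1/3)\<close> is 0 by convention, so the product would be 0 there.\<close>
    have "AE y in lborel. \<forall>b\<in>Basis. (y :: real^3) \<bullet> b \<noteq> 0"
      by (intro AE_finite_allI AE_lborel_inner_neq) auto
    then show "AE y in lborel. ennreal (K0 y) \<le> (\<Prod>b\<in>Basis. ennreal (?f (y \<bullet> b)))"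
    proof eventually_elim
      fix y :: "real^3" assume y: "\<forall>b\<in>Basis. y \<bullet> b \<noteq> 0"
      obtain b0 :: "real^3" where "b0 \<in> Basis" using nonempty_Basis by blast
      with y have "y \<noteq> 0" by auto
      then have ny: "norm y > 0" by simp
      have "K0 y = ?f (norm y) ^ card (Basis :: (real^3) set)"
      proof -
        have p3: "(norm y powr (-1/3)) ^ 3 = inverse (norm y)"
          using ny powr_power[of "norm y" "-1/3" 3] powr_minus[of "norm y" 1] by simp
        have "?f (norm y) ^ card (Basis :: (real^3) set) = (norm y powr (-1/3)) ^ 3 / (1 + norm y) ^ 3"
          by (simp only: power_divide abs_norm_cancel) simp
        also have "\<dots> = K0 y"
          unfolding p3 K0_def by (simp only: inverse_eq_divide divide_divide_eq_left)
        finally show ?thesis ..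
      qed
      also have "\<dots> = (\<Prod>b\<in>(Basis :: (real^3) set). ?f (norm y))" by simp
      also have "\<dots> \<le> (\<Prod>b\<in>Basis. ?f (y \<bullet> b))"
      proof (rule prod_mono, safe)
        fix b :: "real^3" assume b: "b \<in> Basis"
        have "\<bar>norm y\<bar> powr (-1/3) \<le> \<bar>y \<bullet> b\<bar> powr (-1/3)"
          using y b Basis_le_norm[OF b, of y] by (intro powr_mono2') auto
        then show "?f (norm y) \<le> ?f (y \<bullet> b)"
          using Basis_le_norm[OF b, of y] by (intro frac_le) auto
      qed auto
      finally show "ennreal (K0 y) \<le> (\<Prod>b\<in>Basis. ennreal (?f (y \<bullet> b)))"
        by (subst prod_ennreal) (auto intro: ennreal_leI)
    qed
  qed
  also have "\<dots> = (\<Prod>b\<in>(Basis :: (real^3) set). \<integral>\<^sup>+z. ennreal (?f z) \<partial>lborel)"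
    by (rule nn_integral_lborel_prod) auto
  also have "\<dots> < \<infinity>"
    using nn_integral_powr_profile by (simp add: power_less_top_ennreal)
  finally show "(\<integral>\<^sup>+y. ennreal (K0 y) \<partial>lborel) < \<infinity>" .
qed

lemma integrable_K0_bound:
  fixes f :: "real^3 \<Rightarrow> real"
  assumes "f \<in> borel_measurable borel" "\<And>y. y \<noteq> 0 \<Longrightarrow> \<bar>f y\<bar> \<le> C * K0 y"
  shows "integrable lborel f"
proof (rule Bochner_Integration.integrable_bound[of _ "\<lambda>y. C * K0 y"])
  show "integrable lborel (\<lambda>y. C * K0 y)" using integrable_K0 by simp
  have "AE y in lborel. (y::real^3) \<noteq> 0" by (rule AE_lborel_singleton)
  then show "AE y in lborel. norm (f y) \<le> norm (C * K0 y)"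
  proof eventually_elim
    fix y :: "real^3" assume "y \<noteq> 0"
    from assms(2)[OF this] have "\<bar>f y\<bar> \<le> \<bar>C * K0 y\<bar>" by linarith
    then show "norm (f y) \<le> norm (C * K0 y)" by simp
  qed
qed (use assms in simp)

text \<open>From (1 + r)^2 <= 2 (1 + r^2) one gets (1 + r)^4 <= 4 (1 + r^2)^2, which is the origin
  of the factor 4.\<close>

lemma integrable_tau:
  assumes "n \<ge> 4"
  shows "integrable lborel (\<lambda>z::real^3. 1 / sqrt (1 + (norm z)\<^sup>2) ^ n)"
proof (rule integrable_K0_bound[where C=4])
  fix y :: "real^3" assume "y \<noteq> 0"
  then have y: "norm y > 0" by simp
  let ?r = "norm y" and ?\<tau> = "sqrt (1 + (norm y)\<^sup>2)"
  have \<tau>: "?\<tau> \<ge> 1" by simp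
  then have t5: "4 * ?\<tau> ^ n > 0" using zero_less_power[of ?\<tau> n] by linarith
  have "(1 + ?r)\<^sup>2 \<le> 2 * ?\<tau>\<^sup>2"
    using zero_le_power2[of "?r - 1"] by (simp add: power2_eq_square algebra_simps)
  then have "((1 + ?r)\<^sup>2)\<^sup>2 \<le> (2 * ?\<tau>\<^sup>2)\<^sup>2" by (rule power_mono) simp
  then have "(1 + ?r) ^ 4 \<le> 4 * ?\<tau> ^ 4" unfolding power_mult_distrib power_mult[symmetric] by simp
  moreover have "?\<tau> ^ 4 \<le> ?\<tau> ^ n" using \<tau> assms by (intro power_increasing) auto
  moreover have "?r * (1 + ?r) ^ 3 \<le> (1 + ?r) * (1 + ?r) ^ 3" by (intro mult_right_mono) auto
  moreover have "(1 + ?r) * (1 + ?r) ^ 3 = (1 + ?r) ^ 4" by (simp add: power_numeral_reduce)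
  ultimately have "?r * (1 + ?r) ^ 3 \<le> 4 * ?\<tau> ^ n" by linarith
  moreover have pos: "?r * (1 + ?r) ^ 3 > 0" using y add_pos_pos[OF zero_less_one y] by (intro mult_pos_pos zero_less_power) simp_all
  ultimately have "4 / (4 * ?\<tau> ^ n) \<le> 4 / (?r * (1 + ?r) ^ 3)"
    using mult_pos_pos[OF t5 pos] by (intro divide_left_mono) simp_all
  then show "\<bar>1 / ?\<tau> ^ n\<bar> \<le> 4 * K0 y" using \<tau> by (simp add: K0_def)
qed measurable

text \<open>The value is \<open>4\<pi>\<close>; only positivity matters.\<close>

definition kc :: real where
  "kc = 3 * (\<integral>z. 1 / sqrt (1 + (norm (z::real^3))\<^sup>2) ^ 5 \<partial>lborel)"

lemma kc_pos: "kc > 0"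
proof -
  let ?f = "\<lambda>z::real^3. 1 / sqrt (1 + (norm z)\<^sup>2) ^ 5"
  have pos: "?f z > 0" for z by (simp add: add_pos_nonneg)
  have "\<not> (AE z in lborel. ?f z = 0)"
  proof
    assume "AE z in lborel. ?f z = 0"
    then have "AE z in (lborel :: (real^3) measure). False"
      by eventually_elim (use pos in \<open>auto simp: less_le\<close>)
    then show False by (simp add: AE_iff_null null_sets_def)
  qed
  moreover have "AE z in lborel. 0 \<le> ?f z" using pos by (simp add: less_imp_le)
  ultimately have "integral\<^sup>L lborel ?f \<noteq> 0" 
    using integral_nonneg_eq_0_iff_AE[OF integrable_tau[of 5]] by simp
  moreover have "integral\<^sup>L lborel ?f \<ge> 0" by (intro integral_nonneg_AE) (use pos in \<open>simp add: less_imp_le\<close>)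
  ultimately show ?thesis unfolding kc_def by linarith
qed

definition kern :: "real^3 \<Rightarrow> real" where "kern y = 1 / (kc * norm y)"

lemma kern_nonneg: "0 \<le> kern y"
  using kc_pos by (simp add: kern_def)

lemma kern_measurable [measurable]: "kern \<in> borel_measurable borel"
  unfolding kern_def[abs_def] by measurable

lemma integrable_kern_cball: "integrable lborel (\<lambda>y. indicator (cball 0 T) y * kern y)"
proof (rule integrable_K0_bound[where C="(1 + \<bar>T\<bar>) ^ 3 / kc"])
  fix y :: "real^3" assume "y \<noteq> 0"
  then have y: "norm y > 0" by simp
  show "\<bar>indicator (cball 0 T) y * kern y\<bar> \<le> (1 + \<bar>T\<bar>) ^ 3 / kc * K0 y"
  proof (cases "y \<in> cball 0 T")
    case True
    have "(1 + norm y) ^ 3 \<le> (1 + \<bar>T\<bar>) ^ 3" using True by (intro power_mono) auto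
    then have "1 \<le> (1 + \<bar>T\<bar>) ^ 3 / (1 + norm y) ^ 3" by (simp add: add_pos_nonneg le_divide_eq)
    then have "kern y * 1 \<le> kern y * ((1 + \<bar>T\<bar>) ^ 3 / (1 + norm y) ^ 3)"
      by (rule mult_left_mono) (rule kern_nonneg)
    then show ?thesis using True kern_nonneg[of y] by (simp add: K0_def kern_def mult_ac)
  next
    case False
    then show ?thesis using kc_pos by (simp add: K0_def)
  qed
qed (intro borel_measurable_times borel_measurable_indicator kern_measurable, simp)

lemma integrable_kern_exp:
  assumes "l \<ge> 1" shows "integrable lborel (\<lambda>y. kern y * exp (- (l * norm y)))"
\<comment> \<open>27 is 3^3: exp r = exp (r / 3)^3 >= (1 + r / 3)^3 >= ((1 + r) / 3)^3.\<close>
proof (rule integrable_K0_bound[where C="27 / kc"])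
  fix y :: "real^3" assume "y \<noteq> 0"
  then have y: "norm y > 0" by simp
  have "(1 + norm y / 3) ^ 3 \<le> exp (norm y / 3) ^ 3"
    by (intro power_mono exp_ge_add_one_self) (use y in auto)
  also have "\<dots> = exp (norm y)" by (subst exp_of_nat_mult[symmetric]) simp
  also have "\<dots> \<le> exp (l * norm y)" using assms y by simp
  finally have "(1 + norm y / 3) ^ 3 \<le> exp (l * norm y)" .
  moreover have "((1 + norm y) / 3) ^ 3 \<le> (1 + norm y / 3) ^ 3" by (intro power_mono) auto
  ultimately have "(1 + norm y) ^ 3 / 27 \<le> exp (l * norm y)" by (simp add: power_divide)
  then have "exp (- (l * norm y)) \<le> 27 / (1 + norm y) ^ 3"
    by (simp add: exp_minus field_simps add_pos_nonneg)
  then have "kern y * exp (- (l * norm y)) \<le> kern y * (27 / (1 + norm y) ^ 3)"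
    by (rule mult_left_mono) (rule kern_nonneg)
  then show "\<bar>kern y * exp (- (l * norm y))\<bar> \<le> 27 / kc * K0 y"
    using kern_nonneg[of y] by (simp add: K0_def kern_def mult_ac)
qed measurable

text \<open>Bounds the operator norm of the retarded potential for the weight exp (l t): going back
  in time by |y| gains exp (- l |y|).\<close>

definition kap :: "real \<Rightarrow> real" where
  "kap l = (\<integral>y. kern y * exp (- (l * norm y)) \<partial>lborel)"

lemma kap_nonneg: "0 \<le> kap l"
  unfolding kap_def by (rule integral_nonneg_AE) (simp add: kern_nonneg)

text \<open>Off the origin the integrand tends to 0, and it is dominated by its value at
  \<open>l = 1\<close>. This is what makes the Volterra iteration a contraction for a potential of
  any size.\<close>

lemma kap_small:
  assumes "d > 0" shows "\<exists>l\<ge>L. l \<ge> 1 \<and> kap l \<le> d"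
proof -
  have "(\<lambda>i. kap (real (Suc i))) \<longlonglongrightarrow> (\<integral>y. 0 \<partial>(lborel :: (real^3) measure))"
    unfolding kap_def
  proof (rule integral_dominated_convergence)
    show "integrable lborel (\<lambda>y. kern y * exp (- (1 * norm y)))" by (rule integrable_kern_exp) simp
    show "AE y in lborel. norm (kern y * exp (- (real (Suc i) * norm y))) \<le> kern y * exp (- (1 * norm y))" for i
      by (intro AE_I2) (auto simp: abs_mult kern_nonneg intro!: mult_left_mono, simp add: algebra_simps)
    show "AE y in lborel. (\<lambda>i. kern y * exp (- (real (Suc i) * norm y))) \<longlonglongrightarrow> 0"
    proof (intro AE_I2)
      fix y :: "real^3"
      show "(\<lambda>i. kern y * exp (- (real (Suc i) * norm y))) \<longlonglongrightarrow> 0"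
      proof (cases "y = 0")
        case False
        have "exp (- (real (Suc i) * norm y)) = exp (- norm y) ^ Suc i" for i
          by (subst exp_of_nat_mult[symmetric]) simp
        moreover have "(\<lambda>i. exp (- norm y) ^ Suc i) \<longlonglongrightarrow> 0"
          by (rule LIMSEQ_Suc[OF LIMSEQ_power_zero]) (use False in simp)
        ultimately show ?thesis by (simp add: tendsto_mult_right_zero)
      \<comment> \<open>At the origin \<open>kern\<close> is 0, by the value of division by
        zero.\<close>
      qed (simp add: kern_def)
    qed
  qed simp_all
  then have "\<forall>\<^sub>F i in sequentially. kap (real (Suc i)) < d"
    using assms by (intro order_tendstoD) auto
  moreover have "\<forall>\<^sub>F i in sequentially. real (Suc i) \<ge> L"
    using eventually_ge_at_top[of "nat \<lceil>L\<rceil>"] by eventually_elim linarith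
  ultimately have "\<forall>\<^sub>F i in sequentially. kap (real (Suc i)) < d \<and> real (Suc i) \<ge> L" by (rule eventually_conj)
  then obtain i where "kap (real (Suc i)) < d" "real (Suc i) \<ge> L"
    using eventually_happens' sequentially_bot by (metis (no_types, lifting))
  then show ?thesis by (intro exI[of _ "real (Suc i)"]) auto
qed

text \<open>The retarded potential.\<close>

definition ret :: "(spacetime \<Rightarrow> complex) \<Rightarrow> spacetime \<Rightarrow> complex" where
  "ret F p = (\<integral>y. kern y *\<^sub>R F (p - (y, norm y)) \<partial>lborel)"

definition vanishes_before :: "real \<Rightarrow> (spacetime \<Rightarrow> complex) \<Rightarrow> bool" where
  "vanishes_before t0 F \<longleftrightarrow> (\<forall>p. snd p < t0 \<longrightarrow> F p = 0)"

definition csupp :: "(spacetime \<Rightarrow> complex) \<Rightarrow> bool" where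
  "csupp F \<longleftrightarrow> (\<forall>p. p \<notin> closed_cone \<longrightarrow> F p = 0)"

lemma csupp_D: "csupp F \<Longrightarrow> snd p < norm (fst p) \<Longrightarrow> F p = 0"
  by (cases p) (auto simp: csupp_def closed_cone_def)

lemma csupp_vanishes: "csupp F \<Longrightarrow> vanishes_before 0 F"
  unfolding vanishes_before_def
proof (intro allI impI)
  fix p :: spacetime assume "csupp F" "snd p < 0"
  then show "F p = 0" using norm_ge_zero[of "fst p"] by (intro csupp_D) linarith+
qed

abbreviation null_ray :: "real^3 \<Rightarrow> spacetime" where "null_ray y \<equiv> (y, norm y)"

definition kernT :: "real \<Rightarrow> real^3 \<Rightarrow> real" where
  "kernT T y = indicator (cball 0 T) y * kern y"

interpretation ret: param_integral "\<lambda>y::real^3. 1" null_ray "cball 0 T" for T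
  by standard (auto intro!: continuous_intros)

text \<open>Causality: at a time up to \<open>t0 + T\<close>, a source that vanishes before
  \<open>t0\<close> is seen only from distances up to \<open>T\<close>, so the kernel may be
  truncated to a ball.\<close>

lemma ret_local_integrand:
  assumes "vanishes_before t0 F" "snd p \<le> t0 + T"
  shows "kern y *\<^sub>R F (p - null_ray y) = kernT T y *\<^sub>R F (1 *\<^sub>R p - null_ray y)"
proof (cases "norm y \<le> T")
  case False
  then have "snd (p - null_ray y) < t0" using assms(2) by simp
  then have "F (p - null_ray y) = 0" using assms(1) vanishes_before_def by blast
  then show ?thesis by simp
qed (simp add: kernT_def)

lemma ret_local:
  assumes "vanishes_before t0 F" "snd p \<le> t0 + T"
  shows "ret F p = pint (kernT T) (\<lambda>y. 1) null_ray F p"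
  unfolding ret_def pint_def ret_local_integrand[OF assms] ..

lemma kernT_integrable: "integrable lborel (kernT T)" and kernT_0: "y \<notin> cball 0 T \<Longrightarrow> kernT T y = 0"
  using integrable_kern_cball by (auto simp: kernT_def[abs_def])

lemma ret_integrable:
  assumes "vanishes_before t0 F" "continuous_on UNIV F"
  shows "integrable lborel (\<lambda>y. kern y *\<^sub>R F (p - null_ray y))"
proof -
  have "snd p \<le> t0 + (snd p - t0)" by simp
  show ?thesis
    unfolding ret_local_integrand[OF assms(1) \<open>snd p \<le> t0 + (snd p - t0)\<close>]
    by (rule ret.pint_integrable[OF kernT_integrable kernT_0 assms(2)])
qed

lemma vanishes_before_pd: "vanishes_before t0 F \<Longrightarrow> vanishes_before t0 (pd b F)"
  unfolding vanishes_before_def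
proof safe
  fix x :: "real^3" and t assume *: "\<forall>p. snd p < t0 \<longrightarrow> F p = 0" "snd (x, t) < t0"
  have "open {p::spacetime. snd p < t0}" by (intro open_Collect_less continuous_intros)
  from pd_vanish[OF this, of F "(x,t)" b] show "pd b F (x, t) = 0" using * by auto
qed

lemma closed_closed_cone: "closed closed_cone"
proof -
  have eq: "closed_cone = {p. norm (fst p) \<le> snd p}" by (auto simp: closed_cone_def)
  show ?thesis unfolding eq by (intro closed_Collect_le continuous_intros)
qed

lemma csupp_pd: "csupp F \<Longrightarrow> csupp (pd b F)"
  unfolding csupp_def using closed_closed_cone
  by (intro allI impI, intro pd_vanish[of "- closed_cone" F]) (simp_all only: open_Compl Compl_iff not_False_eq_True)

lemma Ck_ret:
  assumes "vanishes_before t0 F" "Ck k UNIV F"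
  shows "Ck k UNIV (ret F)"
proof (rule Ck_local)
  fix p :: spacetime
  show "\<exists>S g. open S \<and> p \<in> S \<and> Ck k UNIV g \<and> (\<forall>x\<in>S. ret F x = g x)"
  proof (intro exI conjI ballI)
    let ?T = "snd p - t0 + 1"
    show "open {q::spacetime. snd q < t0 + ?T}" by (intro open_Collect_less continuous_intros)
    show "Ck k UNIV (pint (kernT ?T) (\<lambda>y. 1) null_ray F)"
      by (rule ret.Ck_pint[OF kernT_integrable kernT_0 assms(2)])
    show "ret F x = pint (kernT ?T) (\<lambda>y. 1) null_ray F x" if "x \<in> {q. snd q < t0 + ?T}" for x
      using that by (intro ret_local[OF assms(1)]) auto
  qed auto
qed

lemma pd_ret:
  assumes "vanishes_before t0 F" "Ck (Suc k) UNIV F"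
  shows "pd b (ret F) = ret (pd b F)"
proof
  fix p :: spacetime
  let ?T = "snd p - t0 + 1" and ?S = "{q::spacetime. snd q < t0 + (snd p - t0 + 1)}"
  have "open ?S" by (intro open_Collect_less continuous_intros)
  then have "pd b (ret F) p = pd b (pint (kernT ?T) (\<lambda>y. 1) null_ray F) p"
    by (rule pd_cong_open) (auto intro!: ret_local[OF assms(1)])
  also have "\<dots> = pint (kernT ?T) (\<lambda>y. 1) null_ray (pd b F) p"
    by (subst ret.pd_pint[OF kernT_integrable kernT_0 assms(2)]) simp_all
  also have "\<dots> = ret (pd b F) p"
    by (rule ret_local[symmetric, OF vanishes_before_pd[OF assms(1)]]) simp
  finally show "pd b (ret F) p = ret (pd b F) p" .
qed

text \<open>By the triangle inequality, a backward null ray that starts outside the forward cone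
  never enters it.\<close>

lemma ret_csupp:
  assumes "csupp F" shows "csupp (ret F)"
  unfolding csupp_def
proof safe
  fix x t assume "(x, t) \<notin> closed_cone"
  then have t: "t < norm x" by (simp add: closed_cone_def)
  have "F ((x, t) - null_ray y) = 0" for y
    using t norm_triangle_sub[of x y] by (intro csupp_D[OF assms]) auto
  then show "ret F (x, t) = 0" unfolding ret_def by simp
qed

lemma ret_add:
  assumes "vanishes_before t0 F" "continuous_on UNIV F" "vanishes_before t1 G" "continuous_on UNIV G"
  shows "ret (\<lambda>p. F p + G p) p = ret F p + ret G p"
  unfolding ret_def scaleR_add_right
  by (rule Bochner_Integration.integral_add[OF ret_integrable[OF assms(1,2)] ret_integrable[OF assms(3,4)]])

lemma ret_diff:
  assumes "vanishes_before t0 F" "continuous_on UNIV F" "vanishes_before t1 G" "continuous_on UNIV G"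
  shows "ret (\<lambda>p. F p - G p) p = ret F p - ret G p"
  unfolding ret_def scaleR_diff_right
  by (rule Bochner_Integration.integral_diff[OF ret_integrable[OF assms(1,2)] ret_integrable[OF assms(3,4)]])

text \<open>At the retarded time the source is at most B exp (l t) exp (- l |y|). Only earlier times
  are visited, so a bound up to \<open>T\<close> is enough; this spares the uniqueness argument a
  growth condition for large times.\<close>

lemma ret_norm_le:
  assumes "vanishes_before t0 F" "continuous_on UNIV F" "l \<ge> 1"
    and bd: "\<And>p. snd p \<le> T \<Longrightarrow> norm (F p) \<le> B * exp (l * snd p)" and p: "snd p \<le> T"
  shows "norm (ret F p) \<le> kap l * B * exp (l * snd p)"
proof -
  have "norm (ret F p) \<le> (\<integral>y. norm (kern y *\<^sub>R F (p - null_ray y)) \<partial>lborel)"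
    unfolding ret_def by (rule integral_norm_bound)
  also have "\<dots> \<le> (\<integral>y. (B * exp (l * snd p)) * (kern y * exp (- (l * norm y))) \<partial>lborel)"
  proof (rule integral_mono)
    show "integrable lborel (\<lambda>y. norm (kern y *\<^sub>R F (p - null_ray y)))"
      using ret_integrable[OF assms(1,2)] by (rule integrable_norm)
    show "integrable lborel (\<lambda>y. (B * exp (l * snd p)) * (kern y * exp (- (l * norm y))))"
      by (intro integrable_mult_right integrable_kern_exp assms)
    fix y
    have sn: "snd (p - null_ray y) \<le> T" using p norm_ge_zero[of y] by (simp del: norm_ge_zero)
    have "norm (F (p - null_ray y)) \<le> B * exp (l * snd (p - null_ray y))"
      by (rule bd[OF sn])
    also have "\<dots> = B * exp (l * snd p) * exp (- (l * norm y))"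
      by (simp add: algebra_simps exp_add[symmetric] exp_diff exp_minus divide_inverse)
    finally have "kern y * norm (F (p - null_ray y)) \<le> kern y * (B * exp (l * snd p) * exp (- (l * norm y)))"
      by (rule mult_left_mono) (rule kern_nonneg)
    then show "norm (kern y *\<^sub>R F (p - null_ray y)) \<le> (B * exp (l * snd p)) * (kern y * exp (- (l * norm y)))"
      using kern_nonneg[of y] by (simp add: mult_ac)
  qed
  also have "\<dots> = kap l * B * exp (l * snd p)" by (simp add: kap_def)
  finally show ?thesis .
qed

abbreviation wt :: "real \<Rightarrow> real \<Rightarrow> spacetime \<Rightarrow> real" where
  "wt B l p \<equiv> B * exp (l * snd p)"

text \<open>\<open>ret\<close> commutes with \<open>pd b\<close>, so the constant is the same at
  every order.\<close>

lemma bnd_ret: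
  assumes "vanishes_before t0 F" "Ck k UNIV F" "l \<ge> 1" "bnd k UNIV (wt B l) F"
  shows "bnd k UNIV (wt (kap l * B) l) (ret F)"
  using assms
proof (induction k arbitrary: F)
  case 0
  have "norm (ret F p) \<le> wt (kap l * B) l p" for p
    by (rule ret_norm_le[OF 0(1) Ck_continuous[OF 0(2)] 0(3) bnd_norm[OF 0(4)] order.refl]) simp
  then show ?case by simp
next
  case (Suc k)
  have "norm (ret F p) \<le> wt (kap l * B) l p" for p
    by (rule ret_norm_le[OF Suc.prems(1) Ck_continuous[OF Suc.prems(2)] Suc.prems(3) bnd_norm[OF Suc.prems(4)] order.refl]) simp
  moreover have "bnd k UNIV (wt (kap l * B) l) (pd b (ret F))" if "b \<in> Basis" for b
    unfolding pd_ret[OF Suc.prems(1,2)]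
    using Suc.prems that by (intro Suc.IH vanishes_before_pd Ck_pd bnd_pd)
  ultimately show ?case unfolding bnd_Suc by blast
qed

section \<open>Compact support and integration by parts\<close>

definition bsupp :: "('a::euclidean_space \<Rightarrow> complex) \<Rightarrow> bool" where
  "bsupp f \<longleftrightarrow> (\<exists>R. \<forall>p. norm p > R \<longrightarrow> f p = 0)"

lemma bsupp_pos: "bsupp f \<Longrightarrow> \<exists>R>0. \<forall>p. norm p > R \<longrightarrow> f p = 0"
  unfolding bsupp_def by (meson less_le_trans linorder_not_le max.cobounded1 max.cobounded2 gt_ex order.strict_trans)

lemma bsupp_pd: "bsupp f \<Longrightarrow> bsupp (pd b f)"
  unfolding bsupp_def
proof (elim exE)
  fix R assume R: "\<forall>p. norm p > R \<longrightarrow> f p = 0"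
  have "open {p::'a. norm p > R}" by (intro open_Collect_less continuous_intros)
  from pd_vanish[OF this, of f] R show "\<exists>R. \<forall>p. norm p > R \<longrightarrow> pd b f p = 0" by auto
qed

lemma bsupp_mult1: "bsupp f \<Longrightarrow> bsupp (\<lambda>p. f p * g p)"
  and bsupp_mult2: "bsupp g \<Longrightarrow> bsupp (\<lambda>p. f p * g p)"
  unfolding bsupp_def by auto

lemma bsupp_diff: "bsupp f \<Longrightarrow> bsupp g \<Longrightarrow> bsupp (\<lambda>p. f p - g p)"
  unfolding bsupp_def
proof (elim exE)
  fix R S assume "\<forall>p. norm p > R \<longrightarrow> f p = 0" "\<forall>p. norm p > S \<longrightarrow> g p = 0"
  then show "\<exists>R. \<forall>p. norm p > R \<longrightarrow> f p - g p = 0" by (intro exI[of _ "max R S"]) auto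
qed

lemma bsupp_sum: "(\<And>i. i \<in> I \<Longrightarrow> bsupp (f i)) \<Longrightarrow> bsupp (\<lambda>p. \<Sum>i\<in>I. f i p)"
proof (induction I rule: infinite_finite_induct)
  case (insert i I)
  then have "bsupp (f i)" "bsupp (\<lambda>p. \<Sum>i\<in>I. f i p)" by auto
  then obtain R S where "\<forall>p. norm p > R \<longrightarrow> f i p = 0" "\<forall>p. norm p > S \<longrightarrow> (\<Sum>i\<in>I. f i p) = 0"
    unfolding bsupp_def by blast
  with insert.hyps show ?case unfolding bsupp_def by (intro exI[of _ "max R S"]) auto
qed (auto simp: bsupp_def)

lemma bsupp_integrable:
  fixes f :: "'a::euclidean_space \<Rightarrow> complex"
  assumes "continuous_on UNIV f" "bsupp f"
  shows "integrable lborel f"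
proof -
  obtain R where R: "\<forall>p. norm p > R \<longrightarrow> f p = 0" using assms(2) bsupp_def by blast
  have "integrable lborel (\<lambda>x. indicator (cball 0 R) x *\<^sub>R f x)"
    by (rule borel_integrable_compact) (use assms(1) in \<open>auto intro: continuous_on_subset\<close>)
  moreover have "(\<lambda>x. indicator (cball 0 R) x *\<^sub>R f x) = f"
    using R by (auto simp: indicator_def fun_eq_iff not_le)
  ultimately show ?thesis by simp
qed

lemma bsupp_bounded:
  fixes f :: "'a::euclidean_space \<Rightarrow> complex"
  assumes "continuous_on UNIV f" "bsupp f"
  shows "\<exists>B\<ge>0. \<forall>p. norm (f p) \<le> B"
proof -
  obtain R where R: "\<forall>p. norm p > R \<longrightarrow> f p = 0" using assms(2) bsupp_def by blast
  obtain B where B: "B \<ge> 0" "bnd 0 (cball 0 R) (\<lambda>p. B) f"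
    using bnd_compact[of 0 f "cball 0 R"] assms(1) by auto
  have "norm (f p) \<le> B" for p
    using B R by (cases "norm p \<le> R") auto
  with B(1) show ?thesis by blast
qed

lemma lborel_integral_translate:
  fixes f :: "'a::euclidean_space \<Rightarrow> complex"
  assumes "f \<in> borel_measurable borel"
  shows "(\<integral>p. f (p + c) \<partial>lborel) = (\<integral>p. f p \<partial>lborel)"
proof -
  have "(\<integral>p. f p \<partial>lborel) = (\<integral>p. f p \<partial>distr lborel borel ((+) c))" by (simp add: lborel_distr_plus)
  also have "\<dots> = (\<integral>p. f (c + p) \<partial>lborel)" by (rule integral_distr) (use assms in auto)
  finally show ?thesis by (simp add: add.commute)
qed

lemma lborel_integral_scale:
  fixes f :: "'a::euclidean_space \<Rightarrow> complex"
  assumes "f \<in> borel_measurable borel" "c > 0"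
  shows "(\<integral>p. f p \<partial>lborel) = c ^ DIM('a) *\<^sub>R (\<integral>p. f (c *\<^sub>R p) \<partial>lborel)"
proof -
  have "(\<integral>p. f p \<partial>lborel) = (\<integral>p. f p \<partial>density (distr lborel borel (\<lambda>x. 0 + c *\<^sub>R x)) (\<lambda>_. ennreal (\<bar>c\<bar> ^ DIM('a))))"
    using lborel_affine[of c "0::'a"] assms by simp
  also have "\<dots> = (\<integral>p. (c ^ DIM('a)) *\<^sub>R f p \<partial>distr lborel borel (\<lambda>x. 0 + c *\<^sub>R x))"
    by (subst integral_density) (use assms in auto)
  also have "\<dots> = (\<integral>p. (c ^ DIM('a)) *\<^sub>R f (c *\<^sub>R p) \<partial>lborel)"
    by (subst integral_distr) (use assms in auto)
  finally show ?thesis by simp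
qed

text \<open>The integral of the translate y -> f (y + t b) does not depend on t; differentiate it
  under the integral sign at t = 0. The ball of radius R + 1 contains the supports of all translates
  with |t| < 1, and its indicator is the integrable weight.\<close>

lemma integral_pd_zero:
  fixes f :: "'a::euclidean_space \<Rightarrow> complex"
  assumes f: "Ck (Suc 0) UNIV f" "bsupp f" and b: "b \<in> Basis"
  shows "(\<integral>p. pd b f p \<partial>lborel) = 0"
proof -
  obtain R where R: "R > 0" "\<forall>p. norm p > R \<longrightarrow> f p = 0" using bsupp_pos[OF f(2)] by blast
  have cf: "continuous_on UNIV f" and cpd: "continuous_on UNIV (pd b f)"
    using Ck_continuous[OF f(1)] Ck_continuous[OF Ck_pd[OF f(1) b]] by auto
  obtain L where L: "L \<ge> 0" "\<forall>p. norm (pd b f p) \<le> L"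
    using bsupp_bounded[OF cpd bsupp_pd[OF f(2)]] by blast
  let ?w = "indicator (cball 0 (R + 1)) :: 'a \<Rightarrow> real"
  have meas: "(\<lambda>y. f (y + t *\<^sub>R b)) \<in> borel_measurable borel" for t
    by (rule borel_measurable_continuous_onI) (intro continuous_on_compose2[OF cf] continuous_intros, auto)
  have wf: "?w y *\<^sub>R f (y + t *\<^sub>R b) = f (y + t *\<^sub>R b)" if "\<bar>t\<bar> < 1" for y t
  proof (cases "norm y \<le> R + 1")
    case False
    have "norm y \<le> norm (y + t *\<^sub>R b) + norm (t *\<^sub>R b)" by (metis add_diff_cancel_right' norm_triangle_ineq4)
    then have "norm (y + t *\<^sub>R b) > R" using False that b by simp
    then show ?thesis using R by simp
  qed simp
  have lin: "pd (h *\<^sub>R b) f p = h *\<^sub>R pd b f p" for h p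
    using linear_scale[OF has_derivative_linear[OF Ck_has_derivative[OF f(1), of p]], of h b] .
  have "((\<lambda>t. \<integral>y. ?w y *\<^sub>R f (y + t *\<^sub>R b) \<partial>lborel) has_derivative
     (\<lambda>h. \<integral>y. ?w y *\<^sub>R (h *\<^sub>R pd b f (y + 0 *\<^sub>R b)) \<partial>lborel)) (at (0::real))"
  proof (rule has_derivative_lebesgue_integral[where L=L and G'="\<lambda>t y h. h *\<^sub>R pd b f (y + t *\<^sub>R b)"])
    show "integrable lborel ?w"
      by (intro integrable_real_indicator emeasure_lborel_cball_finite) simp
    show "(\<lambda>y. ?w y *\<^sub>R f (y + t *\<^sub>R b)) \<in> borel_measurable lborel" for t
      by (intro borel_measurable_scaleR borel_measurable_indicator) (simp_all add: meas)
    show "(\<lambda>y. ?w y *\<^sub>R h *\<^sub>R pd b f (y + 0 *\<^sub>R b)) \<in> borel_measurable lborel" for h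
      by (intro borel_measurable_scaleR borel_measurable_indicator) (simp_all add: borel_measurable_continuous_onI[OF cpd])
    show "((\<lambda>t. f (y + t *\<^sub>R b)) has_derivative (\<lambda>h. h *\<^sub>R pd b f (y + t *\<^sub>R b))) (at t)" for t y
      unfolding lin[symmetric]
      by (rule has_derivative_compose[OF _ Ck_has_derivative[OF f(1)]]) (auto intro!: derivative_eq_intros)
    show "norm (h *\<^sub>R pd b f (y + t *\<^sub>R b)) \<le> L * norm h" for t y h
      using L by (simp add: mult.commute[of L] mult_left_mono)
    show "integrable lborel (\<lambda>y. ?w y *\<^sub>R f (y + 0 *\<^sub>R b))"
      using wf[of 0] bsupp_integrable[OF cf f(2)] by simp
  qed
  moreover have "((\<lambda>t. \<integral>y. ?w y *\<^sub>R f (y + t *\<^sub>R b) \<partial>lborel) has_derivative (\<lambda>h. 0)) (at (0::real))"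
  proof (rule has_derivative_transform_within_open[where s="ball 0 1"])
    show "((\<lambda>t. \<integral>y. f y \<partial>lborel) has_derivative (\<lambda>h. 0)) (at (0::real))" by simp
    show "(\<integral>y. f y \<partial>lborel) = (\<integral>y. ?w y *\<^sub>R f (y + t *\<^sub>R b) \<partial>lborel)" if "t \<in> ball 0 1" for t
      using that wf[of t] lborel_integral_translate[OF borel_measurable_continuous_onI[OF cf]] by simp
  qed auto
  ultimately have "(\<lambda>h. \<integral>y. ?w y *\<^sub>R (h *\<^sub>R pd b f (y + 0 *\<^sub>R b)) \<partial>lborel) = (\<lambda>h::real. 0)"
    by (rule has_derivative_unique)
  from fun_cong[OF this, of 1] have "(\<integral>y. ?w y *\<^sub>R pd b f y \<partial>lborel) = 0" by simp
  moreover have "?w y *\<^sub>R pd b f y = pd b f y" for y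
  proof (cases "norm y \<le> R + 1")
    case False
    have "open {p::'a. norm p > R}" by (intro open_Collect_less continuous_intros)
    from pd_vanish[OF this, of f y b] R False show ?thesis by simp
  qed simp
  ultimately show ?thesis by simp
qed

definition wave_op :: "(spacetime \<Rightarrow> complex) \<Rightarrow> spacetime \<Rightarrow> complex" where
  "wave_op f p = pd_t (pd_t f) p - laplace_x f p"

lemma Basis_t [simp]: "(0, 1) \<in> (Basis :: spacetime set)"
  and Basis_x [simp]: "e \<in> Basis \<Longrightarrow> (e, 0) \<in> (Basis :: spacetime set)"
  by (auto simp: Basis_prod_def)

text \<open>In direction b, the derivative of f g_b - f_b g is f g_bb - f_bb g, and it integrates to
  zero.\<close>

lemma integral_second_derivative_by_parts:
  assumes f: "Ck 2 UNIV f" and g: "Ck 2 UNIV g" "bsupp g" and b: "b \<in> Basis"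
  shows "(\<integral>p. f p * pd b (pd b g) p \<partial>lborel) = (\<integral>p. pd b (pd b f) p * g p \<partial>lborel)"
proof -
  have f1: "Ck (Suc (Suc 0)) UNIV f" and g1: "Ck (Suc (Suc 0)) UNIV g"
    using f g by (simp_all only: numeral_2_eq_2)
  note f2 = Ck_pd[OF f1 b] and g2 = Ck_pd[OF g1 b]
  note f0 = Ck_Suc_imp_Ck[OF f1] and g0 = Ck_Suc_imp_Ck[OF g1]
  let ?h = "\<lambda>p. f p * pd b g p - pd b f p * g p"
  have pd: "pd b ?h p = f p * pd b (pd b g) p - pd b (pd b f) p * g p" for p
  proof -
    have "(?h has_derivative (\<lambda>h. (f p * pd h (pd b g) p + pd h f p * pd b g p) - (pd b f p * pd h g p + pd h (pd b f) p * g p))) (at p)"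
      by (intro has_derivative_diff has_derivative_mult Ck_has_derivative[OF f0] Ck_has_derivative[OF g0]
          Ck_has_derivative[OF f2] Ck_has_derivative[OF g2])
    from pd_eq[OF this] show ?thesis by simp
  qed
  have int: "integrable lborel (\<lambda>p. f p * pd b (pd b g) p)" "integrable lborel (\<lambda>p. pd b (pd b f) p * g p)"
    using Ck_continuous[OF Ck_pd[OF f2 b]] Ck_continuous[OF Ck_pd[OF g2 b]] Ck_continuous[OF f] Ck_continuous[OF g(1)]
    by (auto intro!: bsupp_integrable continuous_on_mult bsupp_mult2 bsupp_pd g(2))
  have "(\<integral>p. pd b ?h p \<partial>lborel) = 0"
    by (intro integral_pd_zero b Ck_diff Ck_mult f0 g0 f2 g2 bsupp_diff bsupp_mult2 bsupp_pd g(2))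
  then show ?thesis unfolding pd using int by simp
qed

lemma box_by_parts:
  assumes f: "Ck 2 UNIV f" and g: "Ck 2 UNIV g" "bsupp g"
  shows "(\<integral>p. f p * wave_op g p \<partial>lborel) = (\<integral>p. wave_op f p * g p \<partial>lborel)"
proof -
  have c2: "continuous_on UNIV (pd b (pd b u))" if "Ck 2 UNIV u" "b \<in> Basis" for u :: "spacetime \<Rightarrow> complex" and b
    using that by (intro Ck_continuous[of 0] Ck_pd) (simp_all only: numeral_2_eq_2)
  have int: "integrable lborel (\<lambda>p. f p * pd b (pd b g) p)" "integrable lborel (\<lambda>p. pd b (pd b f) p * g p)" if "b \<in> Basis" for b
    using c2[OF f that] c2[OF g(1) that] Ck_continuous[OF f] Ck_continuous[OF g(1)]
    by (auto intro!: bsupp_integrable continuous_on_mult bsupp_mult2 bsupp_pd g(2))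
  note eq = integral_second_derivative_by_parts[OF f g]
  show ?thesis
    unfolding wave_op_def pd_t_def laplace_x_def right_diff_distrib left_diff_distrib sum_distrib_left sum_distrib_right
    by (simp add: int Bochner_Integration.integral_diff Bochner_Integration.integral_sum Bochner_Integration.integrable_sum eq)
qed

section \<open>Kirchhoff's formula\<close>

text \<open>The light cone \<open>t = |y|\<close> is approximated by the hyperboloids \<open>t = tau \<epsilon> y\<close>, along which
  everything is smooth.\<close>

definition tau :: "real \<Rightarrow> real^3 \<Rightarrow> real" where
  "tau \<epsilon> y = sqrt ((norm y)\<^sup>2 + \<epsilon>\<^sup>2)"

abbreviation hyp :: "real \<Rightarrow> real^3 \<Rightarrow> spacetime" where "hyp \<epsilon> y \<equiv> (y, tau \<epsilon> y)"

abbreviation itau :: "real \<Rightarrow> real^3 \<Rightarrow> complex" where "itau \<epsilon> y \<equiv> inverse (complex_of_real (tau \<epsilon> y))"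

lemma tau_pos: "\<epsilon> > 0 \<Longrightarrow> tau \<epsilon> y > 0"
  by (simp add: tau_def add_nonneg_pos)

lemma tau_squared: "(tau \<epsilon> y)\<^sup>2 = y \<bullet> y + \<epsilon>\<^sup>2"
  by (simp add: tau_def power2_norm_eq_inner)

lemma norm_le_tau: "norm y \<le> tau \<epsilon> y" and eps_le_tau: "\<bar>\<epsilon>\<bar> \<le> tau \<epsilon> y"
  by (auto simp: tau_def real_le_rsqrt)

lemma tau_scale: "c > 0 \<Longrightarrow> tau (c * \<epsilon>) (c *\<^sub>R y) = c * tau \<epsilon> y"
proof -
  assume c: "c > 0"
  have "(norm (c *\<^sub>R y))\<^sup>2 + (c * \<epsilon>)\<^sup>2 = c\<^sup>2 * ((norm y)\<^sup>2 + \<epsilon>\<^sup>2)"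
    by (simp add: power_mult_distrib distrib_left)
  then show ?thesis using c by (simp add: tau_def real_sqrt_mult)
qed

lemma tau_has_derivative:
  assumes "\<epsilon> > 0"
  shows "(tau \<epsilon> has_derivative (\<lambda>h. (y \<bullet> h) / tau \<epsilon> y)) (at y)"
proof -
  have pos: "y \<bullet> y + \<epsilon>\<^sup>2 > 0" using assms by (simp add: add_nonneg_pos)
  have "((\<lambda>y. sqrt (y \<bullet> y + \<epsilon>\<^sup>2)) has_derivative (\<lambda>h. (y \<bullet> h) / sqrt (y \<bullet> y + \<epsilon>\<^sup>2))) (at y)"
    using pos by (auto intro!: derivative_eq_intros simp: inner_commute field_simps fun_eq_iff)
  then show ?thesis by (simp add: tau_def[abs_def] power2_norm_eq_inner)
qed

lemma Ck_tau: "\<epsilon> > 0 \<Longrightarrow> Ck k UNIV (\<lambda>y. complex_of_real (tau \<epsilon> y))"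
proof (induction k)
  case 0
  have "isCont (tau \<epsilon>) y" for y using has_derivative_continuous[OF tau_has_derivative[OF 0]] .
  then have "continuous_on UNIV (tau \<epsilon>)" by (simp add: continuous_at_imp_continuous_on)
  then show ?case by (simp add: continuous_on_of_real)
next
  case (Suc k)
  show ?case
  proof (rule Ck_Suc_UNIV_I)
    show "((\<lambda>y. complex_of_real (tau \<epsilon> y)) has_derivative (\<lambda>h. of_real ((y \<bullet> h) / tau \<epsilon> y))) (at y)" for y
      by (rule bounded_linear.has_derivative[OF bounded_linear_of_real tau_has_derivative[OF Suc.prems]])
    fix b :: "real^3"
    have "Ck k UNIV (\<lambda>y. complex_of_real (y \<bullet> b) * itau \<epsilon> y)"
    proof (intro Ck_mult Ck_inverse Suc.IH Suc.prems)
      show "Ck k UNIV (\<lambda>y. complex_of_real (y \<bullet> b))"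
        using Ck_bounded_linear[OF bounded_linear_of_real_inner[OF bounded_linear_ident]] .
    qed (use tau_pos[OF Suc.prems] in \<open>simp add: less_imp_neq[THEN not_sym]\<close>)
    then show "Ck k UNIV (\<lambda>y. complex_of_real ((y \<bullet> b) / tau \<epsilon> y))"
      by (simp add: divide_inverse)
  qed
qed

lemma Ck_itau: "\<epsilon> > 0 \<Longrightarrow> Ck k UNIV (itau \<epsilon>)"
  by (rule Ck_inverse[OF Ck_tau]) (use tau_pos in \<open>auto simp: less_imp_neq[THEN not_sym]\<close>)

lemma Ck_hyp:
  assumes e: "\<epsilon> > 0" and F: "Ck k UNIV F"
  shows "Ck k UNIV (\<lambda>y. F (hyp \<epsilon> y))"
proof (rule Ck_compose[OF F])
  fix b :: spacetime assume "b \<in> Basis"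
  then consider e where "b = (e, 0)" | "b = (0, 1)" by (auto simp: Basis_prod_def)
  then show "Ck k UNIV (\<lambda>y. complex_of_real (hyp \<epsilon> y \<bullet> b))"
  proof cases
    case 1
    then show ?thesis
      using Ck_bounded_linear[OF bounded_linear_of_real_inner[OF bounded_linear_ident]] by simp
  next
    case 2
    then show ?thesis using Ck_tau[OF e] by simp
  qed
qed

lemma pd_pair:
  assumes "Ck (Suc k) UNIV (F :: spacetime \<Rightarrow> complex)"
  shows "pd (h, s) F p = pd (h, 0) F p + of_real s * pd (0, 1) F p"
proof -
  have lin: "linear (\<lambda>h. pd h F p)" by (rule has_derivative_linear[OF Ck_has_derivative[OF assms]])
  have "(h, s) = (h, 0) + s *\<^sub>R (0, 1)" by simp
  then have "pd (h, s) F p = pd ((h, 0) + s *\<^sub>R (0, 1)) F p" by simp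
  also have "\<dots> = pd (h, 0) F p + s *\<^sub>R pd (0, 1) F p"
    unfolding linear_add[OF lin, of "(h, 0)" "s *\<^sub>R (0, 1)"] linear_scale[OF lin, of s] ..
  finally show ?thesis by (simp add: scaleR_conv_of_real)
qed

lemma has_derivative_hyp:
  assumes "\<epsilon> > 0" "Ck (Suc k) UNIV F"
  shows "((\<lambda>y. F (hyp \<epsilon> y)) has_derivative
    (\<lambda>h. pd (h, 0) F (hyp \<epsilon> y) + of_real (y \<bullet> h) * itau \<epsilon> y * pd (0, 1) F (hyp \<epsilon> y))) (at y)"
proof -
  have "((\<lambda>y. hyp \<epsilon> y) has_derivative (\<lambda>h. (h, (y \<bullet> h) / tau \<epsilon> y))) (at y)"
    by (intro has_derivative_Pair has_derivative_ident tau_has_derivative assms)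
  from has_derivative_compose[OF this Ck_has_derivative[OF assms(2)]]
  show ?thesis by (subst (asm) pd_pair[OF assms(2)]) (simp add: divide_inverse)
qed

text \<open>One component of a vector field whose divergence is the wave operator divided by tau, up
  to a multiple of \<epsilon>^2. The first two terms are balanced so that the mixed space-time
  derivatives cancel; the third cancels the first-order term that comes from differentiating 1 / tau
  in the second.\<close>

lemma pd_hyperboloid_flux:
  assumes \<epsilon>: "\<epsilon> > 0" and \<phi>: "Ck 2 UNIV \<phi>" and e: "e \<in> Basis"
  defines "Y \<equiv> \<lambda>y::real^3. complex_of_real (y \<bullet> e)"
  shows "pd e (\<lambda>y. pd (0,1) \<phi> (hyp \<epsilon> y) * Y y * itau \<epsilon> y ^ 2 - pd (e,0) \<phi> (hyp \<epsilon> y) * itau \<epsilon> y - \<phi> (hyp \<epsilon> y) * Y y * itau \<epsilon> y ^ 3) y =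
    (pd (0,1) (pd (0,1) \<phi>) (hyp \<epsilon> y) * itau \<epsilon> y ^ 3 - 3 * pd (0,1) \<phi> (hyp \<epsilon> y) * itau \<epsilon> y ^ 4 + 3 * \<phi> (hyp \<epsilon> y) * itau \<epsilon> y ^ 5) * (Y y)\<^sup>2
    + (pd (0,1) \<phi> (hyp \<epsilon> y) * itau \<epsilon> y ^ 2 - \<phi> (hyp \<epsilon> y) * itau \<epsilon> y ^ 3) - pd (e,0) (pd (e,0) \<phi>) (hyp \<epsilon> y) * itau \<epsilon> y"
proof -
  have \<phi>2: "Ck (Suc (Suc 0)) UNIV \<phi>" using \<phi> by (simp only: numeral_2_eq_2)
  note A = has_derivative_hyp[OF \<epsilon> Ck_pd[OF \<phi>2 Basis_t], of y]
  note B = has_derivative_hyp[OF \<epsilon> Ck_pd[OF \<phi>2 Basis_x[OF e]], of y]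
  note C = has_derivative_hyp[OF \<epsilon> \<phi>2, of y]
  have Y: "(Y has_derivative Y) (at y)"
    unfolding Y_def by (rule bounded_linear_imp_has_derivative[OF bounded_linear_of_real_inner[OF bounded_linear_ident]])
  have T: "((\<lambda>y. complex_of_real (tau \<epsilon> y)) has_derivative (\<lambda>h. of_real ((y \<bullet> h) / tau \<epsilon> y))) (at y)"
    by (rule bounded_linear.has_derivative[OF bounded_linear_of_real tau_has_derivative[OF \<epsilon>]])
  have nz: "complex_of_real (tau \<epsilon> y) \<noteq> 0" using tau_pos[OF \<epsilon>, of y] by simp
  note I = Deriv.has_derivative_inverse[OF nz T]
  have comm: "pd (e,0) (pd (0,1) \<phi>) p = pd (0,1) (pd (e,0) \<phi>) p" for p
    by (rule pd_commute[OF \<phi> Basis_x[OF e] Basis_t])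
  have "e \<bullet> e = 1" using e by simp
  then have Ye: "Y e = 1" by (simp add: Y_def)
  have Yy: "complex_of_real ((y \<bullet> e) / tau \<epsilon> y) = Y y * itau \<epsilon> y" "complex_of_real (y \<bullet> e) = Y y"
    by (simp_all add: Y_def divide_inverse)
  show ?thesis
    apply (rule trans[OF pd_eq[OF has_derivative_diff[OF has_derivative_diff[OF has_derivative_mult[OF has_derivative_mult[OF A Y] has_derivative_power[OF I]]
      has_derivative_mult[OF B I]] has_derivative_mult[OF has_derivative_mult[OF C Y] has_derivative_power[OF I]]]]])
    unfolding comm Yy Ye
    by (simp add: algebra_simps eval_nat_numeral)
qed

text \<open>The divergence of the flux integrates to zero; insert |y|^2 = tau^2 - \<epsilon>^2. The
  terms with tau^2 that contain \<phi> or its time derivative cancel against the three equal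
  contributions of the components, because the space has dimension 3.\<close>

lemma hyperboloid_identity:
  assumes \<epsilon>: "\<epsilon> > 0" and \<phi>: "Ck 2 UNIV \<phi>" "bsupp \<phi>"
  shows "(\<integral>y. wave_op \<phi> (hyp \<epsilon> y) * itau \<epsilon> y \<partial>lborel) = 
    (\<integral>y. of_real (\<epsilon>\<^sup>2) * (pd (0,1) (pd (0,1) \<phi>) (hyp \<epsilon> y) * itau \<epsilon> y ^ 3 - 3 * pd (0,1) \<phi> (hyp \<epsilon> y) * itau \<epsilon> y ^ 4 + 3 * \<phi> (hyp \<epsilon> y) * itau \<epsilon> y ^ 5) \<partial>lborel)"
    (is "_ = (\<integral>y. of_real (\<epsilon>\<^sup>2) * ?K y \<partial>lborel)")
proof -
  note \<phi>2 = \<phi>(1)[unfolded numeral_2_eq_2]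
  let ?Y = "\<lambda>(e::real^3) y. complex_of_real (y \<bullet> e)"
  let ?V = "\<lambda>e y. pd (0,1) \<phi> (hyp \<epsilon> y) * ?Y e y * itau \<epsilon> y ^ 2 - pd (e,0) \<phi> (hyp \<epsilon> y) * itau \<epsilon> y - \<phi> (hyp \<epsilon> y) * ?Y e y * itau \<epsilon> y ^ 3"
  have bs: "bsupp (\<lambda>y. F (hyp \<epsilon> y))" if F: "bsupp F" for F :: "spacetime \<Rightarrow> complex"
  proof -
    obtain R where R: "\<forall>p. norm p > R \<longrightarrow> F p = 0" using F unfolding bsupp_def by blast
    have "F (hyp \<epsilon> y) = 0" if "norm y > R" for y
      by (rule R[rule_format, OF order.strict_trans2[OF that norm_fst_le]])
    then show ?thesis unfolding bsupp_def by (intro exI[of _ R] allI impI)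
  qed
  have CV: "Ck (Suc 0) UNIV (?V e)" if "e \<in> Basis" for e
    by (intro Ck_diff Ck_mult Ck_power Ck_hyp Ck_itau \<epsilon> Ck_pd[OF \<phi>2] Basis_t Basis_x that Ck_Suc_imp_Ck[OF \<phi>2]
      Ck_bounded_linear bounded_linear_of_real_inner bounded_linear_ident)
  have bV: "bsupp (?V e)" for e
    by (intro bsupp_diff bsupp_mult1 bs bsupp_pd \<phi>(2))
  have int0: "(\<integral>y. pd e (?V e) y \<partial>lborel) = 0" if "e \<in> Basis" for e
    by (rule integral_pd_zero[OF CV[OF that] bV that])
  have intV: "integrable lborel (pd e (?V e))" if "e \<in> Basis" for e
    by (intro bsupp_integrable Ck_continuous[OF Ck_pd[OF CV[OF that] that]] bsupp_pd bV)
  have sum: "(\<Sum>e\<in>Basis. pd e (?V e) y) = wave_op \<phi> (hyp \<epsilon> y) * itau \<epsilon> y - of_real (\<epsilon>\<^sup>2) * ?K y" for y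
  proof -
    let ?i = "itau \<epsilon> y" and ?T = "complex_of_real (tau \<epsilon> y)"
    let ?L = "pd (0,1) \<phi> (hyp \<epsilon> y) * ?i ^ 2 - \<phi> (hyp \<epsilon> y) * ?i ^ 3"
    have "?T \<noteq> 0" using tau_pos[OF \<epsilon>, of y] by simp
    then have Ti: "?T * ?i = 1" by simp
    have "(\<Sum>e\<in>Basis. (?Y e y)\<^sup>2) = of_real (\<Sum>e\<in>Basis. (y \<bullet> e) * (y \<bullet> e))"
      by (simp add: power2_eq_square)
    also have "\<dots> = of_real (y \<bullet> y)" by (simp only: euclidean_inner[symmetric])
    also have "\<dots> = ?T\<^sup>2 - of_real (\<epsilon>\<^sup>2)" 
      unfolding of_real_power[symmetric] of_real_diff[symmetric] tau_squared by simp
    finally have Y2: "(\<Sum>e\<in>Basis. (?Y e y)\<^sup>2) = ?T\<^sup>2 - of_real (\<epsilon>\<^sup>2)" .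
    have "(\<Sum>e\<in>Basis. pd e (?V e) y) = (\<Sum>e\<in>Basis. ?K y * (?Y e y)\<^sup>2 + ?L - pd (e,0) (pd (e,0) \<phi>) (hyp \<epsilon> y) * ?i)"
      by (rule sum.cong[OF refl pd_hyperboloid_flux[OF \<epsilon> \<phi>(1)]])
    also have "\<dots> = ?K y * (\<Sum>e\<in>Basis. (?Y e y)\<^sup>2) + of_nat (card (Basis :: (real^3) set)) * ?L - laplace_x \<phi> (hyp \<epsilon> y) * ?i"
      unfolding laplace_x_def sum_subtractf sum.distrib sum_distrib_left sum_distrib_right by simp
    also have "\<dots> = ?K y * (?T\<^sup>2 - of_real (\<epsilon>\<^sup>2)) + 3 * ?L - laplace_x \<phi> (hyp \<epsilon> y) * ?i"
      unfolding Y2 by simp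
    also have "?K y * (?T\<^sup>2 - of_real (\<epsilon>\<^sup>2)) = (pd (0,1) (pd (0,1) \<phi>) (hyp \<epsilon> y) * ?i * (?T * ?i)\<^sup>2 - 3 * pd (0,1) \<phi> (hyp \<epsilon> y) * ?i ^ 2 * (?T * ?i)\<^sup>2 + 3 * \<phi> (hyp \<epsilon> y) * ?i ^ 3 * (?T * ?i)\<^sup>2) - of_real (\<epsilon>\<^sup>2) * ?K y"
      by (simp add: algebra_simps eval_nat_numeral)
    finally show ?thesis
      unfolding Ti by (simp add: wave_op_def pd_t_def algebra_simps)
  qed
  have bi: "integrable lborel (\<lambda>y. wave_op \<phi> (hyp \<epsilon> y) * itau \<epsilon> y)"
  proof (intro bsupp_integrable bsupp_mult1 bs)
    show "bsupp (wave_op \<phi>)" unfolding wave_op_def[abs_def] pd_t_def laplace_x_def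
      by (intro bsupp_diff bsupp_sum bsupp_pd \<phi>(2))
    have "Ck 0 UNIV (wave_op \<phi>)" unfolding wave_op_def[abs_def] pd_t_def laplace_x_def
      by (intro Ck_diff Ck_sum Ck_pd \<phi>2 Basis_t Basis_x)
    then show "continuous_on UNIV (\<lambda>y. wave_op \<phi> (hyp \<epsilon> y) * itau \<epsilon> y)"
      by (intro Ck_continuous[of 0] Ck_mult Ck_hyp Ck_itau \<epsilon>)
  qed
  have "0 = (\<integral>y. (\<Sum>e\<in>Basis. pd e (?V e) y) \<partial>lborel)"
    by (subst Bochner_Integration.integral_sum) (simp_all add: intV int0)
  moreover have isum: "integrable lborel (\<lambda>y. \<Sum>e\<in>Basis. pd e (?V e) y)"
    by (rule Bochner_Integration.integrable_sum) (rule intV)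
  ultimately have "(\<integral>y. wave_op \<phi> (hyp \<epsilon> y) * itau \<epsilon> y - (\<Sum>e\<in>Basis. pd e (?V e) y) \<partial>lborel) = (\<integral>y. wave_op \<phi> (hyp \<epsilon> y) * itau \<epsilon> y \<partial>lborel)"
    using Bochner_Integration.integral_diff[OF bi isum] by simp
  then show ?thesis unfolding sum by simp
qed

section \<open>The limit from the hyperboloids to the light cone\<close>

definition smooth :: "('a::euclidean_space \<Rightarrow> complex) \<Rightarrow> bool" where
  "smooth f \<longleftrightarrow> (\<forall>k. Ck k UNIV f)"

lemma smooth_Ck: "smooth f \<Longrightarrow> Ck k UNIV f"
  by (simp add: smooth_def)

lemma smooth_continuous: "smooth f \<Longrightarrow> continuous_on UNIV f"
  by (rule Ck_continuous[of 0]) (rule smooth_Ck)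

lemma smooth_pd: "smooth f \<Longrightarrow> b \<in> Basis \<Longrightarrow> smooth (pd b f)"
  unfolding smooth_def by (intro allI Ck_pd) blast+

lemma smooth_box: "smooth f \<Longrightarrow> smooth (wave_op f)"
  unfolding wave_op_def[abs_def] pd_t_def laplace_x_def
  by (subst smooth_def, intro allI Ck_diff Ck_sum smooth_Ck smooth_pd Basis_t Basis_x)

lemma bsupp_box: "bsupp f \<Longrightarrow> bsupp (wave_op f)"
  unfolding wave_op_def[abs_def] pd_t_def laplace_x_def
  by (intro bsupp_diff bsupp_sum bsupp_pd)

lemma continuous_null_ray:
  "continuous_on UNIV F \<Longrightarrow> continuous_on UNIV (\<lambda>y. (F :: spacetime \<Rightarrow> complex) (p + null_ray y))"
  by (rule continuous_on_compose2[of UNIV F]) (auto intro!: continuous_intros)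

abbreviation eps :: "nat \<Rightarrow> real" where "eps j \<equiv> 1 / real (Suc j)"

lemma eps_pos: "eps j > 0" and eps_le_1: "eps j \<le> 1" and eps_tendsto: "eps \<longlonglongrightarrow> 0"
  using LIMSEQ_inverse_real_of_nat by (auto simp: inverse_eq_divide)

lemma tau_tendsto: "(\<lambda>j. tau (eps j) y) \<longlonglongrightarrow> norm y"
proof -
  have "(\<lambda>j. sqrt ((norm y)\<^sup>2 + (eps j)\<^sup>2)) \<longlonglongrightarrow> sqrt ((norm y)\<^sup>2 + 0\<^sup>2)"
    by (intro tendsto_intros eps_tendsto)
  then show ?thesis by (simp add: tau_def)
qed

lemma norm_itau_le: "y \<noteq> 0 \<Longrightarrow> norm (itau \<epsilon> y) \<le> 1 / norm y"
proof -
  assume y: "y \<noteq> 0"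
  have "norm (itau \<epsilon> y) = 1 / tau \<epsilon> y"
    unfolding norm_inverse norm_of_real
    using order.trans[OF norm_ge_zero norm_le_tau[of y \<epsilon>]] by (simp add: inverse_eq_divide)
  also have "\<dots> \<le> 1 / norm y"
  proof (rule divide_left_mono)
    have "norm y > 0" using y by simp
    then show "0 < tau \<epsilon> y * norm y" using norm_le_tau[of y \<epsilon>] by (intro mult_pos_pos) linarith
  qed (simp_all add: norm_le_tau)
  finally show ?thesis .
qed

lemma norm_itau: "\<epsilon> > 0 \<Longrightarrow> norm (itau \<epsilon> y) = 1 / tau \<epsilon> y"
  unfolding norm_inverse norm_of_real using tau_pos[of \<epsilon> y] by (simp add: inverse_eq_divide)

text \<open>A majorant independent of \<epsilon>: a point of the hyperboloid is at least as far from
  the origin as its space component, so the support of \<open>F\<close> bounds |y|.\<close>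

lemma hyperboloid_dominated:
  fixes F :: "spacetime \<Rightarrow> complex"
  assumes R: "\<forall>p. norm p > R \<longrightarrow> F p = 0" and B: "\<forall>p. norm (F p) \<le> B" and y: "y \<noteq> 0" and z: "norm z \<le> 1 / norm y"
  shows "norm (F (hyp \<epsilon> y) * z) \<le> B * kc * kernT R y"
proof (cases "norm y \<le> R")
  case True
  have "norm (F (hyp \<epsilon> y)) * norm z \<le> B * (1 / norm y)"
    using B z by (intro mult_mono) (auto intro: order.trans[OF norm_ge_zero])
  then show ?thesis using True kc_pos by (simp add: norm_mult kernT_def kern_def)
next
  case False
  have "norm (hyp \<epsilon> y) > R" using order.strict_trans2[OF _ norm_fst_le[of y "tau \<epsilon> y"], of R] False by simp
  then show ?thesis using False R by (simp add: kernT_def)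
qed

lemma cone_limit:
  assumes \<phi>: "smooth F" "bsupp F"
  shows "(\<lambda>j. \<integral>y. F (hyp (eps j) y) * itau (eps j) y \<partial>lborel) \<longlonglongrightarrow> (\<integral>y. F (null_ray y) * of_real (1 / norm y) \<partial>lborel)"
proof -
  obtain R where R: "R > 0" "\<forall>p. norm p > R \<longrightarrow> F p = 0" using bsupp_pos[OF \<phi>(2)] by blast
  note cF = smooth_continuous[OF \<phi>(1)]
  obtain B where B: "B \<ge> 0" "\<forall>p. norm (F p) \<le> B" using bsupp_bounded[OF cF \<phi>(2)] by blast
  have nz: "AE y in lborel. (y::real^3) \<noteq> 0" by (rule AE_lborel_singleton)
  show ?thesis
  proof (rule integral_dominated_convergence)
    show "integrable lborel (\<lambda>y. B * kc * kernT R y)" using kernT_integrable by simp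
    show "AE y in lborel. norm (F (hyp (eps j) y) * itau (eps j) y) \<le> B * kc * kernT R y" for j
      using nz by eventually_elim (rule hyperboloid_dominated[OF R(2) B(2) _ norm_itau_le])
    show "(\<lambda>y. F (hyp (eps j) y) * itau (eps j) y) \<in> borel_measurable lborel" for j
    proof -
      have "continuous_on UNIV (\<lambda>y. F (hyp (eps j) y) * itau (eps j) y)"
        by (intro Ck_continuous[of 0] Ck_mult Ck_hyp Ck_itau eps_pos smooth_Ck \<phi>)
      from borel_measurable_continuous_onI[OF this] show ?thesis by simp
    qed
    have "(\<lambda>y. F (null_ray y)) \<in> borel_measurable borel"
      using borel_measurable_continuous_onI[OF continuous_null_ray[OF cF, of 0]] by simp
    moreover have "(\<lambda>y. complex_of_real (1 / norm (y::real^3))) \<in> borel_measurable borel" by measurable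
    ultimately show "(\<lambda>y. F (null_ray y) * of_real (1 / norm y)) \<in> borel_measurable lborel" by simp
    show "AE y in lborel. (\<lambda>j. F (hyp (eps j) y) * itau (eps j) y) \<longlonglongrightarrow> F (null_ray y) * of_real (1 / norm y)"
      using nz
    proof eventually_elim
      fix y :: "real^3" assume y: "y \<noteq> 0"
      have "(\<lambda>j. F (hyp (eps j) y)) \<longlonglongrightarrow> F (null_ray y)"
        by (rule continuous_on_tendsto_compose[OF cF tendsto_Pair[OF tendsto_const tau_tendsto]]) auto
      moreover have "(\<lambda>j. itau (eps j) y) \<longlonglongrightarrow> inverse (of_real (norm y))"
        by (rule tendsto_inverse[OF tendsto_of_real[OF tau_tendsto]]) (use y in simp)
      ultimately have "(\<lambda>j. F (hyp (eps j) y) * itau (eps j) y) \<longlonglongrightarrow> F (null_ray y) * inverse (of_real (norm y))"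
        by (rule tendsto_mult)
      then show "(\<lambda>j. F (hyp (eps j) y) * itau (eps j) y) \<longlonglongrightarrow> F (null_ray y) * of_real (1 / norm y)"
        by (simp add: inverse_eq_divide)
    qed
  qed
qed

text \<open>Since \<epsilon> <= tau, the factor \<epsilon>^2 / tau^3 is at most 1 / tau. The
  majorant of the main term therefore serves again, while the integrand tends to 0 off the
  origin.\<close>

lemma cone_error_limit:
  assumes \<phi>: "smooth F" "bsupp F"
  shows "(\<lambda>j. \<integral>y. of_real ((eps j)\<^sup>2) * (F (hyp (eps j) y) * itau (eps j) y ^ 3) \<partial>lborel) \<longlonglongrightarrow> 0"
proof -
  obtain R where R: "R > 0" "\<forall>p. norm p > R \<longrightarrow> F p = 0" using bsupp_pos[OF \<phi>(2)] by blast
  note cF = smooth_continuous[OF \<phi>(1)]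
  obtain B where B: "B \<ge> 0" "\<forall>p. norm (F p) \<le> B" using bsupp_bounded[OF cF \<phi>(2)] by blast
  have nz: "AE y in lborel. (y::real^3) \<noteq> 0" by (rule AE_lborel_singleton)
  have small: "norm (of_real (\<epsilon>\<^sup>2) * itau \<epsilon> y ^ 3) \<le> norm (itau \<epsilon> y)" if "\<epsilon> > 0" for \<epsilon> y
  proof -
    have "norm (of_real (\<epsilon>\<^sup>2) * itau \<epsilon> y ^ 3) = (\<epsilon> * (1 / tau \<epsilon> y))\<^sup>2 * norm (itau \<epsilon> y)"
      using that by (simp add: norm_mult norm_power norm_itau power_mult_distrib power2_eq_square power3_eq_cube)
    also have "\<dots> \<le> 1\<^sup>2 * norm (itau \<epsilon> y)"
      using eps_le_tau[of \<epsilon> y] tau_pos[OF that, of y] that by (intro mult_right_mono power_mono) auto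
    finally show ?thesis by simp
  qed
  have "(\<lambda>j. \<integral>y. of_real ((eps j)\<^sup>2) * (F (hyp (eps j) y) * itau (eps j) y ^ 3) \<partial>lborel) \<longlonglongrightarrow> (\<integral>y. 0 \<partial>(lborel :: (real^3) measure))"
  proof (rule integral_dominated_convergence)
    show "integrable lborel (\<lambda>y. B * kc * kernT R y)" using kernT_integrable by simp
    show "AE y in lborel. norm (of_real ((eps j)\<^sup>2) * (F (hyp (eps j) y) * itau (eps j) y ^ 3)) \<le> B * kc * kernT R y" for j
      using nz
    proof eventually_elim
      fix y :: "real^3" assume y: "y \<noteq> 0"
      have "norm (F (hyp (eps j) y) * (of_real ((eps j)\<^sup>2) * itau (eps j) y ^ 3)) \<le> B * kc * kernT R y"
        by (rule hyperboloid_dominated[OF R(2) B(2) y order.trans[OF small[OF eps_pos] norm_itau_le[OF y]]])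
      then show "norm (of_real ((eps j)\<^sup>2) * (F (hyp (eps j) y) * itau (eps j) y ^ 3)) \<le> B * kc * kernT R y"
        by (simp only: mult.left_commute)
    qed
    show "(\<lambda>y. of_real ((eps j)\<^sup>2) * (F (hyp (eps j) y) * itau (eps j) y ^ 3)) \<in> borel_measurable lborel" for j
    proof -
      have "continuous_on UNIV (\<lambda>y. of_real ((eps j)\<^sup>2) * (F (hyp (eps j) y) * itau (eps j) y ^ 3))"
        by (intro Ck_continuous[of 0] Ck_mult Ck_const Ck_power Ck_hyp Ck_itau eps_pos smooth_Ck \<phi>)
      from borel_measurable_continuous_onI[OF this] show ?thesis by simp
    qed
    show "AE y in lborel. (\<lambda>j. of_real ((eps j)\<^sup>2) * (F (hyp (eps j) y) * itau (eps j) y ^ 3)) \<longlonglongrightarrow> 0"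
      using nz
    proof eventually_elim
      fix y :: "real^3" assume y: "y \<noteq> 0"
      have "(\<lambda>j. of_real ((eps j)\<^sup>2) * (F (hyp (eps j) y) * itau (eps j) y ^ 3)) \<longlonglongrightarrow> of_real (0\<^sup>2) * (F (null_ray y) * inverse (of_real (norm y)) ^ 3)"
        by (intro tendsto_intros eps_tendsto tau_tendsto continuous_on_tendsto_compose[OF cF]) (use y in auto)
      then show "(\<lambda>j. of_real ((eps j)\<^sup>2) * (F (hyp (eps j) y) * itau (eps j) y ^ 3)) \<longlonglongrightarrow> 0" by simp
    qed
  qed simp
  then show ?thesis by simp
qed

lemma integrable_itau: "n \<ge> 4 \<Longrightarrow> integrable lborel (\<lambda>z. itau 1 z ^ n)"
proof -
  assume "n \<ge> 4"
  then have "integrable lborel (\<lambda>z::real^3. complex_of_real (1 / sqrt (1 + (norm z)\<^sup>2) ^ n))"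
    by (intro integrable_of_real integrable_tau)
  then show ?thesis by (simp add: tau_def add.commute power_inverse inverse_eq_divide power_one_over)
qed

text \<open>The exponent 5 is critical: after y = \<epsilon> z the volume factor \<epsilon>^3, the
  prefactor \<epsilon>^2 and tau^-5 balance exactly, and the mass concentrates at the vertex. The
  term with tau^-4 keeps a factor \<epsilon> and disappears. The limit, 3 times the integral of (1 +
  |z|^2)^(-5/2), is the origin of \<open>kc\<close>.\<close>

lemma cone_vertex_limit:
  assumes F: "smooth F" "bsupp F" and G: "smooth G" "bsupp G"
  shows "(\<lambda>j. \<integral>y. of_real ((eps j)\<^sup>2) * (3 * F (hyp (eps j) y) * itau (eps j) y ^ 5 - 3 * G (hyp (eps j) y) * itau (eps j) y ^ 4) \<partial>lborel) \<longlonglongrightarrow> of_real kc * F 0"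
proof -
  note cF = smooth_continuous[OF F(1)] and cG = smooth_continuous[OF G(1)]
  obtain B where B: "B \<ge> 0" "\<forall>p. norm (F p) \<le> B" using bsupp_bounded[OF cF F(2)] by blast
  obtain C where C: "C \<ge> 0" "\<forall>p. norm (G p) \<le> C" using bsupp_bounded[OF cG G(2)] by blast
  let ?f = "\<lambda>j y. of_real ((eps j)\<^sup>2) * (3 * F (hyp (eps j) y) * itau (eps j) y ^ 5 - 3 * G (hyp (eps j) y) * itau (eps j) y ^ 4)"
  let ?g = "\<lambda>j y. 3 * F (eps j *\<^sub>R hyp 1 y) * itau 1 y ^ 5 - of_real (eps j) * (3 * G (eps j *\<^sub>R hyp 1 y) * itau 1 y ^ 4)"
  have cf: "continuous_on UNIV (?f j)" for j
    by (intro Ck_continuous[of 0] Ck_mult Ck_diff Ck_const Ck_power Ck_hyp Ck_itau eps_pos smooth_Ck F G)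
  have sc: "hyp (eps j) (eps j *\<^sub>R y) = eps j *\<^sub>R hyp 1 y" "itau (eps j) (eps j *\<^sub>R y) = inverse (of_real (eps j)) * itau 1 y" for j y
  proof -
    have t: "tau (eps j) (eps j *\<^sub>R y) = eps j * tau 1 y" for j y
      using tau_scale[OF eps_pos, of j 1 y] by (simp only: mult_1_right)
    show "hyp (eps j) (eps j *\<^sub>R y) = eps j *\<^sub>R hyp 1 y" "itau (eps j) (eps j *\<^sub>R y) = inverse (of_real (eps j)) * itau 1 y" for j y
      by (simp_all only: t scaleR_Pair real_scaleR_def of_real_mult inverse_mult_distrib)
  qed
  have eq: "(\<integral>y. ?f j y \<partial>lborel) = (\<integral>y. ?g j y \<partial>lborel)" for j
  proof -
    have e: "complex_of_real (eps j) \<noteq> 0" using eps_pos[of j] by (simp only: of_real_eq_0_iff)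
    have alg: "(e::complex) ^ 3 * (e\<^sup>2 * (a * (inverse e * i) ^ 5 - b * (inverse e * i) ^ 4)) = a * i ^ 5 - e * (b * i ^ 4)" if "e \<noteq> 0" for e a b i
      using that by (simp add: field_simps eval_nat_numeral)
    have "(\<integral>y. ?f j y \<partial>lborel) = eps j ^ 3 *\<^sub>R (\<integral>y. ?f j (eps j *\<^sub>R y) \<partial>lborel)"
      using lborel_integral_scale[OF borel_measurable_continuous_onI[OF cf] eps_pos, of j j] by simp
    also have "\<dots> = (\<integral>y. eps j ^ 3 *\<^sub>R ?f j (eps j *\<^sub>R y) \<partial>lborel)" by simp
    also have "\<dots> = (\<integral>y. ?g j y \<partial>lborel)"
      unfolding sc
      by (rule Bochner_Integration.integral_cong[OF refl])
        (simp only: scaleR_conv_of_real of_real_power alg[OF e])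
    finally show ?thesis .
  qed
  have cg: "continuous_on UNIV (?g j)" for j
  proof -
    have hc: "Ck 0 UNIV (\<lambda>y. H (eps j *\<^sub>R hyp 1 y))" if H: "continuous_on UNIV H" for H :: "spacetime \<Rightarrow> complex"
    proof (rule Ck_hyp)
      show "Ck 0 UNIV (\<lambda>p. H (eps j *\<^sub>R p))"
        unfolding Ck.simps by (rule continuous_on_compose2[OF H]) (auto intro!: continuous_intros)
    qed simp
    show ?thesis
      by (intro Ck_continuous[of 0] Ck_mult Ck_diff Ck_const Ck_power Ck_itau hc cF cG zero_less_one)
  qed
  have "(\<lambda>j. \<integral>y. ?g j y \<partial>lborel) \<longlonglongrightarrow> (\<integral>y. 3 * F 0 * itau 1 y ^ 5 \<partial>lborel)"
  proof (rule integral_dominated_convergence)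
    show "integrable lborel (\<lambda>y. (3 * B) * norm (itau 1 y ^ 5) + (3 * C) * norm (itau 1 y ^ 4))"
      by (intro Bochner_Integration.integrable_add integrable_mult_right integrable_norm integrable_itau) auto
    show "AE y in lborel. norm (?g j y) \<le> (3 * B) * norm (itau 1 y ^ 5) + (3 * C) * norm (itau 1 y ^ 4)" for j
    proof (intro AE_I2 order.trans[OF norm_triangle_ineq4 add_mono])
      fix y
      show "norm (3 * F (eps j *\<^sub>R hyp 1 y) * itau 1 y ^ 5) \<le> (3 * B) * norm (itau 1 y ^ 5)"
        unfolding norm_mult using B by (intro mult_right_mono) auto
      have "norm (complex_of_real (eps j)) * norm (3 * G (eps j *\<^sub>R hyp 1 y) * itau 1 y ^ 4) \<le> 1 * ((3 * C) * norm (itau 1 y ^ 4))"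
      proof (rule mult_mono)
        show "norm (complex_of_real (eps j)) \<le> 1" using eps_pos[of j] eps_le_1[of j] by (simp only: norm_of_real)
        show "norm (3 * G (eps j *\<^sub>R hyp 1 y) * itau 1 y ^ 4) \<le> (3 * C) * norm (itau 1 y ^ 4)"
          unfolding norm_mult using C by (intro mult_right_mono) auto
      qed auto
      then show "norm (of_real (eps j) * (3 * G (eps j *\<^sub>R hyp 1 y) * itau 1 y ^ 4)) \<le> (3 * C) * norm (itau 1 y ^ 4)"
        by (simp only: norm_mult mult_1)
    qed
    show "?g j \<in> borel_measurable lborel" for j
      using borel_measurable_continuous_onI[OF cg[of j]] by (simp only: measurable_lborel1 measurable_lborel2)
    have "continuous_on UNIV (\<lambda>y. 3 * F 0 * itau 1 y ^ 5)"
      by (intro Ck_continuous[of 0] Ck_mult Ck_const Ck_power Ck_itau) simp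
    from borel_measurable_continuous_onI[OF this] 
    show "(\<lambda>y. 3 * F 0 * itau 1 y ^ 5) \<in> borel_measurable lborel" by (simp only: measurable_lborel1 measurable_lborel2)
    show "AE y in lborel. (\<lambda>j. ?g j y) \<longlonglongrightarrow> 3 * F 0 * itau 1 y ^ 5"
    proof (intro AE_I2)
      fix y
      have z: "(\<lambda>j. eps j *\<^sub>R hyp 1 y) \<longlonglongrightarrow> 0"
        using tendsto_scaleR[OF eps_tendsto tendsto_const, of "hyp 1 y"] unfolding scaleR_zero_left .
      have "(\<lambda>j. ?g j y) \<longlonglongrightarrow> 3 * F 0 * itau 1 y ^ 5 - of_real 0 * (3 * G 0 * itau 1 y ^ 4)"
        by (intro tendsto_diff tendsto_mult tendsto_const tendsto_of_real eps_tendsto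
           continuous_on_tendsto_compose[OF cF z] continuous_on_tendsto_compose[OF cG z]) auto
      then show "(\<lambda>j. ?g j y) \<longlonglongrightarrow> 3 * F 0 * itau 1 y ^ 5" by simp
    qed
  qed
  moreover have "(\<integral>y. 3 * F 0 * itau 1 y ^ 5 \<partial>lborel) = of_real kc * F 0"
  proof -
    have "itau 1 y ^ 5 = of_real (1 / sqrt (1 + (norm y)\<^sup>2) ^ 5)" for y
      by (simp add: tau_def add.commute inverse_eq_divide power_one_over)
    then have "(\<integral>y. itau 1 y ^ 5 \<partial>lborel) = complex_of_real (\<integral>z. 1 / sqrt (1 + (norm (z::real^3))\<^sup>2) ^ 5 \<partial>lborel)"
      by (simp only: integral_complex_of_real)
    then show ?thesis by (simp add: kc_def mult_ac)
  qed
  ultimately show ?thesis unfolding eq by (simp only:)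
qed

text \<open>Both sides of the hyperboloid identity converge, the left one to an integral over the
  cone, the right one to the contribution of the vertex alone. \<open>kern\<close> divides out the
  constant \<open>kc\<close>.\<close>

lemma kirchhoff_origin:
  assumes \<phi>: "smooth \<phi>" "bsupp \<phi>"
  shows "(\<integral>y. kern y *\<^sub>R wave_op \<phi> (null_ray y) \<partial>lborel) = \<phi> 0"
proof -
  let ?A = "\<lambda>j. \<integral>y. of_real ((eps j)\<^sup>2) * (pd (0,1) (pd (0,1) \<phi>) (hyp (eps j) y) * itau (eps j) y ^ 3) \<partial>lborel"
  let ?B = "\<lambda>j. \<integral>y. of_real ((eps j)\<^sup>2) * (3 * \<phi> (hyp (eps j) y) * itau (eps j) y ^ 5 - 3 * pd (0,1) \<phi> (hyp (eps j) y) * itau (eps j) y ^ 4) \<partial>lborel"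
  note st = smooth_pd[OF \<phi>(1) Basis_t] and stt = smooth_pd[OF smooth_pd[OF \<phi>(1) Basis_t] Basis_t]
  note bt = bsupp_pd[OF \<phi>(2)] and btt = bsupp_pd[OF bsupp_pd[OF \<phi>(2)]]
  have bs: "bsupp (\<lambda>y. F (hyp \<epsilon> y))" if F: "bsupp F" for F :: "spacetime \<Rightarrow> complex" and \<epsilon>
  proof -
    obtain R where R: "\<forall>p. norm p > R \<longrightarrow> F p = 0" using F unfolding bsupp_def by blast
    have "F (hyp \<epsilon> y) = 0" if "norm y > R" for y
      by (rule R[rule_format, OF order.strict_trans2[OF that norm_fst_le]])
    then show ?thesis unfolding bsupp_def by (intro exI[of _ R] allI impI)
  qed
  have eq: "(\<integral>y. wave_op \<phi> (hyp (eps j) y) * itau (eps j) y \<partial>lborel) = ?A j + ?B j" for j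
  proof -
    have iA: "integrable lborel (\<lambda>y. of_real ((eps j)\<^sup>2) * (pd (0,1) (pd (0,1) \<phi>) (hyp (eps j) y) * itau (eps j) y ^ 3))"
      by (intro bsupp_integrable Ck_continuous[of 0] Ck_mult Ck_const Ck_power Ck_hyp Ck_itau eps_pos smooth_Ck stt
        bsupp_mult2 bsupp_mult1 bs btt)
    have iB: "integrable lborel (\<lambda>y. of_real ((eps j)\<^sup>2) * (3 * \<phi> (hyp (eps j) y) * itau (eps j) y ^ 5 - 3 * pd (0,1) \<phi> (hyp (eps j) y) * itau (eps j) y ^ 4))"
      by (intro bsupp_integrable Ck_continuous[of 0] Ck_mult Ck_diff Ck_const Ck_power Ck_hyp Ck_itau eps_pos smooth_Ck st \<phi>
        bsupp_mult2[where f="\<lambda>_. of_real ((eps j)\<^sup>2)"] bsupp_diff bsupp_mult1[where f="\<lambda>y. 3 * F (hyp (eps j) y)" for F]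
        bsupp_mult2[where f="\<lambda>_. 3"] bs bt)
    show ?thesis
      unfolding hyperboloid_identity[OF eps_pos smooth_Ck[OF \<phi>(1)] \<phi>(2)] Bochner_Integration.integral_add[OF iA iB, symmetric]
      by (rule Bochner_Integration.integral_cong[OF refl]) (simp only: distrib_left[symmetric], simp add: algebra_simps)
  qed
  have "(\<lambda>j. ?A j + ?B j) \<longlonglongrightarrow> 0 + of_real kc * \<phi> 0"
    by (intro tendsto_add cone_error_limit cone_vertex_limit \<phi> st stt bt btt)
  moreover have "(\<lambda>j. ?A j + ?B j) \<longlonglongrightarrow> (\<integral>y. wave_op \<phi> (null_ray y) * of_real (1 / norm y) \<partial>lborel)"
    using cone_limit[OF smooth_box[OF \<phi>(1)] bsupp_box[OF \<phi>(2)]] unfolding eq .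
  ultimately have "(\<integral>y. wave_op \<phi> (null_ray y) * of_real (1 / norm y) \<partial>lborel) = 0 + of_real kc * \<phi> 0"
    by (rule LIMSEQ_unique[THEN sym])
  then have *: "of_real (1 / kc) * (\<integral>y. wave_op \<phi> (null_ray y) * of_real (1 / norm y) \<partial>lborel) = \<phi> 0"
    using kc_pos by simp
  have "(\<integral>y. kern y *\<^sub>R wave_op \<phi> (null_ray y) \<partial>lborel) = (\<integral>y. of_real (1 / kc) * (wave_op \<phi> (null_ray y) * of_real (1 / norm y)) \<partial>lborel)"
    by (rule Bochner_Integration.integral_cong[OF refl]) (simp add: kern_def scaleR_conv_of_real)
  also have "\<dots> = of_real (1 / kc) * (\<integral>y. wave_op \<phi> (null_ray y) * of_real (1 / norm y) \<partial>lborel)"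
    by (rule integral_mult_right_zero)
  finally show ?thesis using * by simp
qed

section \<open>The advanced potential and its duality with the retarded one\<close>

lemma Ck_translate: "Ck k UNIV f \<Longrightarrow> Ck k UNIV (\<lambda>q. f (q + p))"
  by (rule Ck_affine[OF _ bounded_linear_ident])

lemma pd_translate: "Ck (Suc k) UNIV f \<Longrightarrow> pd b (\<lambda>q. f (q + p)) = (\<lambda>q. pd b f (q + p))"
  by (rule ext, rule pd_affine[OF Ck_differentiable bounded_linear_ident])

lemma smooth_translate: "smooth f \<Longrightarrow> smooth (\<lambda>q. f (q + p))"
  by (simp add: smooth_def Ck_translate del: Ck.simps)

lemma bsupp_translate: "bsupp f \<Longrightarrow> bsupp (\<lambda>q. f (q + p))"
proof -
  assume "bsupp f"
  then obtain R where R: "\<forall>p. norm p > R \<longrightarrow> f p = 0" unfolding bsupp_def by blast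
  have "f (q + p) = 0" if "norm q > R + norm p" for q
    using that norm_triangle_ineq4[of "q + p" p] R by simp
  then show ?thesis unfolding bsupp_def by (intro exI[of _ "R + norm p"] allI impI)
qed

text \<open>The advanced potential.\<close>

definition adv :: "(spacetime \<Rightarrow> complex) \<Rightarrow> spacetime \<Rightarrow> complex" where
  "adv F p = (\<integral>y. kern y *\<^sub>R F (p + null_ray y) \<partial>lborel)"

lemma adv_box:
  assumes \<phi>: "smooth \<phi>" "bsupp \<phi>"
  shows "adv (wave_op \<phi>) p = \<phi> p"
proof -
  have pp: "pd b (pd c (\<lambda>q. \<phi> (q + p))) = (\<lambda>q. pd b (pd c \<phi>) (q + p))" if "c \<in> Basis" for b c
    by (simp only: pd_translate[OF smooth_Ck[OF \<phi>(1), of "Suc 0"]] pd_translate[OF smooth_Ck[OF smooth_pd[OF \<phi>(1) that], of "Suc 0"]])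
  have "wave_op (\<lambda>q. \<phi> (q + p)) q = wave_op \<phi> (q + p)" for q
    by (simp add: wave_op_def pd_t_def laplace_x_def pp)
  with kirchhoff_origin[OF smooth_translate[OF \<phi>(1)] bsupp_translate[OF \<phi>(2)], of p]
  show ?thesis by (simp add: adv_def add.commute)
qed

lemma vanishes_before_D: "vanishes_before t0 H \<Longrightarrow> snd p < t0 \<Longrightarrow> H p = 0"
  unfolding vanishes_before_def by blast

lemma kernT_nonneg: "0 \<le> kernT T y"
  by (simp add: kernT_def kern_nonneg)

lemma kernT_measurable [measurable]: "kernT T \<in> borel_measurable borel"
  using borel_measurable_integrable[OF kernT_integrable[of T]] by simp

text \<open>In the range of the truncated kernel \<open>g\<close> is bounded and supported in a ball
  in \<open>p\<close>, so the product of an indicator with the kernel is an integrable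
  majorant.\<close>

lemma kernT_Fubini:
  fixes g :: "spacetime \<times> (real^3) \<Rightarrow> complex"
  assumes g: "continuous_on UNIV g" and supp: "\<And>p y. norm y \<le> T \<Longrightarrow> norm p > R \<Longrightarrow> g (p, y) = 0"
  shows "(\<integral>p. (\<integral>y. kernT T y *\<^sub>R g (p, y) \<partial>lborel) \<partial>lborel) = (\<integral>y. (\<integral>p. kernT T y *\<^sub>R g (p, y) \<partial>lborel) \<partial>lborel)"
proof -
  have "compact (g ` (cball 0 R \<times> cball 0 T))"
    by (intro compact_continuous_image compact_Times compact_cball) (rule continuous_on_subset[OF g], simp)
  from compact_imp_bounded[OF this]
  obtain B where B: "norm (g z) \<le> B" if "z \<in> cball 0 R \<times> cball 0 T" for z
    unfolding bounded_iff by blast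
  define h where "h = (\<lambda>z :: spacetime \<times> (real^3). indicator (cball 0 R) (fst z) * (\<bar>B\<bar> * kernT T (snd z)))"
  have hm: "h \<in> borel_measurable (lborel \<Otimes>\<^sub>M lborel)"
  proof -
    have fs: "(fst :: spacetime \<times> (real^3) \<Rightarrow> _) \<in> borel_measurable borel" "(snd :: spacetime \<times> (real^3) \<Rightarrow> _) \<in> borel_measurable borel"
      by (intro borel_measurable_continuous_onI continuous_intros)+
    have "h \<in> borel_measurable borel"
      unfolding h_def
      by (intro borel_measurable_times borel_measurable_const measurable_compose[OF fs(1)] measurable_compose[OF fs(2)]
          kernT_measurable borel_measurable_indicator) simp
    then show ?thesis unfolding lborel_prod by simp
  qed
  have "integrable (lborel \<Otimes>\<^sub>M lborel) h"
  proof (rule lborel_pair.Fubini_integrable[OF hm])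
    have "(\<lambda>x. \<integral>y. norm (h (x, y)) \<partial>lborel) = (\<lambda>x. indicator (cball 0 R) x * (\<bar>B\<bar> * (\<integral>y. kernT T y \<partial>lborel)))"
      by (simp add: h_def abs_mult abs_of_nonneg[OF kernT_nonneg])
    moreover have "integrable lborel (indicator (cball 0 R) :: spacetime \<Rightarrow> real)"
      by (intro integrable_real_indicator emeasure_lborel_cball_finite) simp
    ultimately show "integrable lborel (\<lambda>x. \<integral>y. norm (h (x, y)) \<partial>lborel)" by simp
    show "AE x in lborel. integrable lborel (\<lambda>y. h (x, y))"
      using kernT_integrable by (simp add: h_def)
  qed
  then have "integrable (lborel \<Otimes>\<^sub>M lborel) (\<lambda>z. kernT T (snd z) *\<^sub>R g z)"
  proof (rule Bochner_Integration.integrable_bound)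
    have "g \<in> borel_measurable borel" by (rule borel_measurable_continuous_onI[OF g])
    then have [measurable]: "g \<in> borel_measurable (lborel \<Otimes>\<^sub>M lborel)" unfolding lborel_prod by simp
    have "(\<lambda>z :: spacetime \<times> (real^3). kernT T (snd z)) \<in> borel_measurable (lborel \<Otimes>\<^sub>M lborel)"
      by (rule measurable_compose[OF measurable_snd]) simp
    then show "(\<lambda>z. kernT T (snd z) *\<^sub>R g z) \<in> borel_measurable (lborel \<Otimes>\<^sub>M lborel)" by simp
    have nb: "norm (kernT T y *\<^sub>R g (p, y)) \<le> norm (h (p, y))" for p y
    proof (cases "norm y \<le> T")
      case True
      show ?thesis
      proof (cases "norm p \<le> R")
        case True
        then have "norm (g (p, y)) \<le> \<bar>B\<bar>" using B[of "(p, y)"] \<open>norm y \<le> T\<close> by simp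
        from mult_left_mono[OF this kernT_nonneg] True show ?thesis
          by (simp add: h_def abs_mult abs_of_nonneg[OF kernT_nonneg] mult.commute)
      next
        case False
        then show ?thesis using supp[OF True, of p] by simp
      qed
    next
      case False
      then show ?thesis by (simp add: kernT_def)
    qed
    show "AE z in lborel \<Otimes>\<^sub>M lborel. norm (kernT T (snd z) *\<^sub>R g z) \<le> norm (h z)"
    proof (rule AE_I2)
      fix z show "norm (kernT T (snd z) *\<^sub>R g z) \<le> norm (h z)"
        using nb[of "snd z" "fst z"] by simp
    qed
  qed
  then have "integrable (lborel \<Otimes>\<^sub>M lborel) (\<lambda>(p, y). kernT T y *\<^sub>R g (p, y))"
    by (simp add: case_prod_beta')
  from lborel_pair.Fubini_integral[OF this] show ?thesis by simp
qed

text \<open>Fubini's theorem, and for each fixed \<open>y\<close> the translation of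
  \<open>p\<close> by the null vector of \<open>y\<close>.\<close>

lemma ret_adv_duality:
  assumes H: "continuous_on UNIV H" "vanishes_before t0 H" and \<Psi>: "continuous_on UNIV \<Psi>" "bsupp \<Psi>"
  shows "(\<integral>p. ret H p * \<Psi> p \<partial>lborel) = (\<integral>p. H p * adv \<Psi> p \<partial>lborel)"
proof -
  obtain R where R: "R > 0" "\<forall>p. norm p > R \<longrightarrow> \<Psi> p = 0" using bsupp_pos[OF \<Psi>(2)] by blast
  \<comment> \<open>Large enough for both truncations: on the support of \<Psi> the time is at most
    R <= t0 + T, and from a time >= t0 a null vector with |y| > T leads beyond time R.\<close>
  define T where "T = R + \<bar>t0\<bar>"
  have snd_norm: "snd p \<le> norm p" for p :: spacetime
    using norm_snd_le[of "snd p" "fst p"] by (simp add: abs_le_iff)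
  let ?g1 = "\<lambda>z :: spacetime \<times> (real^3). H (fst z - null_ray (snd z)) * \<Psi> (fst z)"
  let ?g2 = "\<lambda>z :: spacetime \<times> (real^3). H (fst z) * \<Psi> (fst z + null_ray (snd z))"
  have c1: "continuous_on UNIV ?g1"
    by (intro continuous_on_mult continuous_on_compose2[OF H(1)] continuous_on_compose2[OF \<Psi>(1)] continuous_intros) auto
  have c2: "continuous_on UNIV ?g2"
    by (intro continuous_on_mult continuous_on_compose2[OF H(1)] continuous_on_compose2[OF \<Psi>(1)] continuous_intros) auto
  have "ret H p * \<Psi> p = (\<integral>y. kernT T y *\<^sub>R ?g1 (p, y) \<partial>lborel)" for p
  proof (cases "norm p \<le> R")
    case True
    have "snd p \<le> t0 + T" using snd_norm[of p] True by (simp add: T_def)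
    from ret_local[OF H(2) this]
    have "ret H p * \<Psi> p = (\<integral>y. kernT T y *\<^sub>R H (p - null_ray y) \<partial>lborel) * \<Psi> p" by (simp add: pint_def)
    also have "\<dots> = (\<integral>y. kernT T y *\<^sub>R H (p - null_ray y) * \<Psi> p \<partial>lborel)"
      by (rule integral_mult_left_zero[symmetric])
    finally show ?thesis by simp
  next
    case False
    then have "\<Psi> p = 0" using R(2)[rule_format, of p] by linarith
    then show ?thesis by simp
  qed
  then have "(\<integral>p. ret H p * \<Psi> p \<partial>lborel) = (\<integral>p. (\<integral>y. kernT T y *\<^sub>R ?g1 (p, y) \<partial>lborel) \<partial>lborel)"
    by (simp only:)
  also have "\<dots> = (\<integral>y. (\<integral>p. kernT T y *\<^sub>R ?g1 (p, y) \<partial>lborel) \<partial>lborel)"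
    by (rule kernT_Fubini[OF c1, where R=R]) (simp add: R(2)[rule_format])
  also have "\<dots> = (\<integral>y. (\<integral>p. kernT T y *\<^sub>R ?g2 (p, y) \<partial>lborel) \<partial>lborel)"
  proof (rule Bochner_Integration.integral_cong[OF refl])
    fix y
    have "continuous_on UNIV (\<lambda>p. kernT T y *\<^sub>R (H (p - null_ray y) * \<Psi> p))"
      by (intro continuous_intros continuous_on_mult continuous_on_compose2[OF H(1)] \<Psi>(1)) auto
    from lborel_integral_translate[OF borel_measurable_continuous_onI[OF this], of "null_ray y"]
    show "(\<integral>p. kernT T y *\<^sub>R ?g1 (p, y) \<partial>lborel) = (\<integral>p. kernT T y *\<^sub>R ?g2 (p, y) \<partial>lborel)"
      by (simp only: add_diff_cancel fst_conv snd_conv)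
  qed
  also have "\<dots> = (\<integral>p. (\<integral>y. kernT T y *\<^sub>R ?g2 (p, y) \<partial>lborel) \<partial>lborel)"
  proof (rule kernT_Fubini[OF c2, where R="R + 2 * T", symmetric])
    fix p :: spacetime and y :: "real^3" assume y: "norm y \<le> T" and p: "norm p > R + 2 * T"
    have "norm p \<le> norm (p + null_ray y) + norm (null_ray y)"
      using norm_triangle_ineq4[of "p + null_ray y" "null_ray y"] by simp
    moreover have "norm (null_ray y) \<le> norm y + norm (norm y)" by (rule norm_Pair_le)
    ultimately have "norm (p + null_ray y) > R" using y p by simp
    then show "?g2 (p, y) = 0" by (simp add: R(2)[rule_format])
  qed
  also have "\<dots> = (\<integral>p. H p * adv \<Psi> p \<partial>lborel)"
  proof (rule Bochner_Integration.integral_cong[OF refl])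
    fix p :: spacetime
    show "(\<integral>y. kernT T y *\<^sub>R ?g2 (p, y) \<partial>lborel) = H p * adv \<Psi> p"
    proof (cases "snd p < t0")
      case True
      then have "H p = 0" by (rule vanishes_before_D[OF H(2)])
      then show ?thesis by simp
    next
      case False
      have eq: "kernT T y *\<^sub>R \<Psi> (p + null_ray y) = kern y *\<^sub>R \<Psi> (p + null_ray y)" for y
      proof (cases "norm y \<le> T")
        case True
        then show ?thesis by (simp add: kernT_def)
      next
        case ny: False
        then have "snd (p + null_ray y) > R" using False by (simp add: T_def)
        then have "\<Psi> (p + null_ray y) = 0" using R(2) order.strict_trans2[OF _ snd_norm] by blast
        then show ?thesis by simp
      qed
      have "(\<integral>y. kernT T y *\<^sub>R ?g2 (p, y) \<partial>lborel) = (\<integral>y. H p * (kern y *\<^sub>R \<Psi> (p + null_ray y)) \<partial>lborel)"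
        by (rule Bochner_Integration.integral_cong[OF refl]) (simp add: eq[symmetric])
      also have "\<dots> = H p * adv \<Psi> p" unfolding adv_def by (rule integral_mult_right_zero)
      finally show ?thesis .
    qed
  qed
  finally show ?thesis .
qed

text \<open>Reflection of space-time exchanges past and future, and a bounded support becomes a zero
  past. In this way \<open>adv\<close> inherits integrability and smoothness from
  \<open>ret\<close>.\<close>

lemma adv_eq_ret: "adv F p = ret (\<lambda>q. F (- q)) (- p)"
  unfolding adv_def ret_def by (simp add: add.commute)

lemma bsupp_reflect_vanishes: "bsupp F \<Longrightarrow> \<exists>t0. vanishes_before t0 (\<lambda>q. F (- q))"
proof -
  assume "bsupp F"
  then obtain R where R: "\<forall>p. norm p > R \<longrightarrow> F p = 0" unfolding bsupp_def by blast
  have "F (- q) = 0" if "snd q < - R" for q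
  proof (rule R[rule_format])
    have "R < \<bar>snd q\<bar>" using that by simp
    also have "\<dots> \<le> norm (- q)" using norm_snd_le[of "snd q" "fst q"] by simp
    finally show "R < norm (- q)" .
  qed
  then show ?thesis unfolding vanishes_before_def by blast
qed

lemma Ck_reflect: "Ck k UNIV F \<Longrightarrow> Ck k UNIV (\<lambda>q. F (- q))"
  using Ck_affine[of k F uminus 0] bounded_linear_minus[OF bounded_linear_ident] by simp

lemma pd_reflect: "Ck (Suc k) UNIV F \<Longrightarrow> pd b (\<lambda>q. F (- q)) = (\<lambda>q. - pd b F (- q))"
proof
  fix q assume F: "Ck (Suc k) UNIV F"
  have "pd b (\<lambda>q. F (- q)) q = pd (- b) F (- q)"
    using pd_affine[OF Ck_differentiable[OF F], where L=uminus and p=q and c=0 and h=b]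
      bounded_linear_minus[OF bounded_linear_ident] by simp
  also have "\<dots> = - pd b F (- q)"
    using linear_neg[OF has_derivative_linear[OF Ck_has_derivative[OF F, of "- q"]], of b] .
  finally show "pd b (\<lambda>q. F (- q)) q = - pd b F (- q)" .
qed

lemma adv_integrable:
  assumes "continuous_on UNIV F" "bsupp F"
  shows "integrable lborel (\<lambda>y. kern y *\<^sub>R F (p + null_ray y))"
proof -
  obtain t0 where t0: "vanishes_before t0 (\<lambda>q. F (- q))" using bsupp_reflect_vanishes[OF assms(2)] by blast
  have "Ck 0 UNIV (\<lambda>q. F (- q))" by (rule Ck_reflect) (simp add: assms)
  then have "continuous_on UNIV (\<lambda>q. F (- q))" by simp
  from ret_integrable[OF t0 this, of "- p"] show ?thesis by (simp add: add.commute)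
qed

lemma Ck_adv: "Ck k UNIV F \<Longrightarrow> bsupp F \<Longrightarrow> Ck k UNIV (adv F)"
proof -
  assume F: "Ck k UNIV F" "bsupp F"
  obtain t0 where t0: "vanishes_before t0 (\<lambda>q. F (- q))" using bsupp_reflect_vanishes[OF F(2)] by blast
  from Ck_reflect[OF Ck_ret[OF t0 Ck_reflect[OF F(1)]]] show ?thesis by (simp add: adv_eq_ret[abs_def])
qed

lemma pd_adv: "Ck (Suc k) UNIV F \<Longrightarrow> bsupp F \<Longrightarrow> pd b (adv F) = adv (pd b F)"
proof
  fix p assume F: "Ck (Suc k) UNIV F" "bsupp F"
  obtain t0 where t0: "vanishes_before t0 (\<lambda>q. F (- q))" using bsupp_reflect_vanishes[OF F(2)] by blast
  have "pd b (adv F) p = pd b (\<lambda>p. ret (\<lambda>q. F (- q)) (- p)) p" by (simp add: adv_eq_ret[abs_def])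
  also have "\<dots> = - pd b (ret (\<lambda>q. F (- q))) (- p)"
    by (simp only: pd_reflect[OF Ck_ret[OF t0 Ck_reflect[OF F(1)]]])
  also have "\<dots> = - ret (\<lambda>q. - pd b F (- q)) (- p)"
    by (simp only: pd_ret[OF t0 Ck_reflect[OF F(1)]] pd_reflect[OF F(1)])
  also have "\<dots> = adv (pd b F) p" by (simp add: adv_eq_ret ret_def)
  finally show "pd b (adv F) p = adv (pd b F) p" .
qed

lemma smooth_adv: "smooth F \<Longrightarrow> bsupp F \<Longrightarrow> smooth (adv F)"
  by (simp add: smooth_def Ck_adv del: Ck.simps)

text \<open>\<open>adv\<close> commutes with partial derivatives, hence with the wave operator, so
  the claim reduces to \<open>adv_box\<close>.\<close>

lemma box_adv:
  assumes F: "smooth F" "bsupp F"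
  shows "wave_op (adv F) p = F p"
proof -
  have pp: "pd b (pd b (adv F)) = adv (pd b (pd b F))" if "b \<in> Basis" for b
    by (simp only: pd_adv[OF smooth_Ck[OF F(1), of "Suc 0"] F(2)]
        pd_adv[OF smooth_Ck[OF smooth_pd[OF F(1) that], of "Suc 0"] bsupp_pd[OF F(2)]])
  have int: "integrable lborel (\<lambda>y. kern y *\<^sub>R pd b (pd b F) (p + null_ray y))" if "b \<in> Basis" for b
    by (intro adv_integrable smooth_continuous smooth_pd bsupp_pd F that)
  have "wave_op (adv F) p = adv (pd (0,1) (pd (0,1) F)) p - (\<Sum>e\<in>Basis. adv (pd (e,0) (pd (e,0) F)) p)"
    by (simp add: wave_op_def pd_t_def laplace_x_def pp)
  also have "\<dots> = adv (wave_op F) p"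
    unfolding adv_def wave_op_def[abs_def] pd_t_def laplace_x_def scaleR_diff_right scaleR_sum_right
    by (simp add: Bochner_Integration.integral_diff Bochner_Integration.integral_sum Bochner_Integration.integrable_sum int)
  finally show ?thesis using adv_box[OF F] by simp
qed

text \<open>The advanced potential of a test function need not have compact support, as it extends
  along null rays into the past. A last time is still enough to confine it to a compact set within
  the forward cone, where it is paired with \<open>W\<close> below.\<close>

lemma adv_vanishes_after: "bsupp F \<Longrightarrow> \<exists>T. \<forall>p. snd p > T \<longrightarrow> adv F p = 0"
proof -
  assume "bsupp F"
  then obtain R where R: "\<forall>p. norm p > R \<longrightarrow> F p = 0" unfolding bsupp_def by blast
  have "adv F p = 0" if "snd p > R" for p
  proof -
    have "F (p + null_ray y) = 0" for y
    proof (rule R[rule_format])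
      have "R < \<bar>snd (p + null_ray y)\<bar>" using that norm_ge_zero[of y] by (simp del: norm_ge_zero)
      also have "\<dots> \<le> norm (p + null_ray y)"
        using norm_snd_le[of "snd (p + null_ray y)" "fst (p + null_ray y)"] by (simp only: real_norm_def prod.collapse)
      finally show "R < norm (p + null_ray y)" .
    qed
    then show ?thesis by (simp add: adv_def)
  qed
  then show ?thesis by blast
qed

section \<open>Bump functions and the fundamental lemma of the calculus of variations\<close>

lemma Ck_inner_self: "Ck k UNIV (\<lambda>p::'a::euclidean_space. complex_of_real (p \<bullet> p))"
proof -
  have "(\<lambda>p::'a. complex_of_real (p \<bullet> p)) = (\<lambda>p. \<Sum>b\<in>Basis. of_real (p \<bullet> b) * of_real (p \<bullet> b))"
    by (rule ext, subst euclidean_inner) (simp only: of_real_sum of_real_mult)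
  then show ?thesis
    by (simp only:) (intro Ck_sum Ck_mult Ck_bounded_linear bounded_linear_of_real_inner bounded_linear_ident)
qed

lemma smooth_bump:
  fixes p0 :: "'a::euclidean_space"
  shows "smooth (\<lambda>p. complex_of_real (flat 0 (d - (p - p0) \<bullet> (p - p0))))"
  unfolding smooth_def
proof
  fix k
  have "Ck k UNIV (\<lambda>p. complex_of_real d - of_real ((p + (- p0)) \<bullet> (p + (- p0))))"
    by (rule Ck_diff[OF Ck_const Ck_translate[OF Ck_inner_self]])
  then show "Ck k UNIV (\<lambda>p. complex_of_real (flat 0 (d - (p - p0) \<bullet> (p - p0))))"
    by (intro Ck_compose_real[OF Ck_flat]) simp
qed

text \<open>Test with a bump on a ball where Z differs from its value at p0 by less than half of |Z
  p0|. Then |Z p0| times the integral of the bump is at most half of itself, so this integral is 0,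
  although the bump is positive on a nonempty open set.\<close>

lemma fundamental_lemma:
  fixes Z :: "'a::euclidean_space \<Rightarrow> complex"
  assumes Z: "continuous_on UNIV Z" and zero: "\<And>\<phi>. smooth \<phi> \<Longrightarrow> bsupp \<phi> \<Longrightarrow> (\<integral>p. Z p * \<phi> p \<partial>lborel) = 0"
  shows "Z p0 = 0"
proof (rule ccontr)
  assume ne: "Z p0 \<noteq> 0"
  define m where "m = norm (Z p0)"
  have m: "m > 0" using ne by (simp add: m_def)
  have "isCont Z p0" using Z by (simp add: continuous_on_eq_continuous_at)
  then obtain d where d: "d > 0" "\<And>p. dist p p0 < d \<Longrightarrow> norm (Z p - Z p0) < m / 2"
    using m unfolding continuous_at_eps_delta dist_norm by (metis half_gt_zero)
  define b where "b p = flat 0 (d\<^sup>2 - (p - p0) \<bullet> (p - p0))" for p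
  let ?\<phi> = "\<lambda>p. complex_of_real (b p)"
  have sm: "smooth ?\<phi>" unfolding b_def by (rule smooth_bump)
  have b0: "b p = 0" if "\<not> dist p p0 < d" for p
  proof -
    have "d\<^sup>2 \<le> (norm (p - p0))\<^sup>2" using that d(1) by (intro power_mono) (auto simp: dist_norm)
    then show ?thesis by (simp add: b_def flat_def power2_norm_eq_inner)
  qed
  have bs: "bsupp ?\<phi>"
  proof -
    have "?\<phi> p = 0" if "norm p > norm p0 + d" for p
    proof -
      have "\<not> dist p p0 < d" using that norm_triangle_sub[of p p0] by (simp add: dist_norm)
      then show ?thesis by (simp add: b0)
    qed
    then show ?thesis unfolding bsupp_def by blast
  qed
  have bnn: "0 \<le> b p" for p by (simp add: b_def flat_nonneg)
  note c\<phi> = smooth_continuous[OF sm]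
  have int\<phi>: "integrable lborel ?\<phi>" by (rule bsupp_integrable[OF c\<phi> bs])
  then have intb: "integrable lborel b" using integrable_Re[OF int\<phi>] by simp
  have contb: "continuous_on UNIV b"
    using continuous_on_Re[OF c\<phi>] by simp
  let ?I = "\<integral>p. b p \<partial>lborel"
  have "0 = (\<integral>p. Z p * ?\<phi> p \<partial>lborel)" by (rule zero[OF sm bs, symmetric])
  also have "\<dots> = (\<integral>p. Z p0 * ?\<phi> p + (Z p - Z p0) * ?\<phi> p \<partial>lborel)"
    by (simp add: algebra_simps)
  also have "\<dots> = (\<integral>p. Z p0 * ?\<phi> p \<partial>lborel) + (\<integral>p. (Z p - Z p0) * ?\<phi> p \<partial>lborel)"
    by (intro Bochner_Integration.integral_add bsupp_integrable continuous_intros Z c\<phi> bsupp_mult2 bs)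
  also have "(\<integral>p. Z p0 * ?\<phi> p \<partial>lborel) = Z p0 * of_real ?I" by simp
  finally have "Z p0 * of_real ?I = - (\<integral>p. (Z p - Z p0) * ?\<phi> p \<partial>lborel)"
    by (simp add: eq_neg_iff_add_eq_0)
  then have "m * \<bar>?I\<bar> = norm (\<integral>p. (Z p - Z p0) * ?\<phi> p \<partial>lborel)"
    by (metis m_def norm_minus_cancel norm_mult norm_of_real)
  also have "\<dots> \<le> (\<integral>p. norm ((Z p - Z p0) * ?\<phi> p) \<partial>lborel)" by (rule integral_norm_bound)
  also have "\<dots> \<le> (\<integral>p. m / 2 * b p \<partial>lborel)"
  proof (rule integral_mono)
    show "integrable lborel (\<lambda>p. norm ((Z p - Z p0) * ?\<phi> p))"
      by (intro integrable_norm bsupp_integrable continuous_intros Z c\<phi> bsupp_mult2 bs)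
    show "integrable lborel (\<lambda>p. m / 2 * b p)" using intb by simp
    show "norm ((Z p - Z p0) * ?\<phi> p) \<le> m / 2 * b p" for p
    proof (cases "dist p p0 < d")
      case True
      from mult_right_mono[OF less_imp_le[OF d(2)[OF True]] bnn[of p]] show ?thesis
        using bnn[of p] by (simp add: norm_mult)
    qed (simp add: b0)
  qed
  also have "\<dots> = m / 2 * ?I" by simp
  finally have "m * \<bar>?I\<bar> \<le> m / 2 * ?I" .
  moreover have "0 \<le> ?I" by (intro integral_nonneg_AE) (simp add: bnn)
  ultimately have I0: "?I = 0" using m by (auto simp: mult_le_cancel_left)
  have "AE p in lborel. b p = 0"
    using integral_nonneg_eq_0_iff_AE[OF intb] I0 bnn by simp
  have "{p. b p > 0} \<noteq> {}" "open {p. b p > 0}"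
  proof -
    show "{p. b p > 0} \<noteq> {}"
    proof -
      have "b p0 > 0" using d(1) by (simp add: b_def flat_def)
      then show ?thesis by blast
    qed
    show "open {p. b p > 0}" by (intro open_Collect_less continuous_intros contb)
  qed
  moreover have "{p. b p > 0} \<in> null_sets lborel"
  proof -
    have "AE p in lborel. p \<notin> {p. b p > 0}"
      using \<open>AE p in lborel. b p = 0\<close> by eventually_elim simp
    moreover have "{p. b p > 0} \<in> sets lborel" using \<open>open {p. b p > 0}\<close> by simp
    ultimately show ?thesis by (simp add: AE_iff_null_sets)
  qed
  then have "negligible {p. b p > 0}"
    using negligible_iff_null_sets null_sets_completionI by blast
  with open_not_negligible[OF \<open>open {p. b p > 0}\<close> \<open>{p. b p > 0} \<noteq> {}\<close>] show False by blast
qed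

section \<open>The Volterra equation\<close>

lemma continuous_compact_bound:
  fixes f :: "'a::topological_space \<Rightarrow> 'b::real_normed_vector"
  assumes "continuous_on UNIV f" "compact X"
  obtains B where "B \<ge> 0" "\<And>x. x \<in> X \<Longrightarrow> norm (f x) \<le> B"
proof -
  have "bounded (f ` X)"
    using assms by (intro compact_imp_bounded compact_continuous_image) (auto intro: continuous_on_subset)
  then obtain B where B: "\<forall>y\<in>f ` X. norm y \<le> B" unfolding bounded_iff by blast
  show thesis
  proof (rule that[of "max B 0"])
    show "norm (f x) \<le> max B 0" if "x \<in> X" for x
      using B[rule_format, of "f x"] that by (simp add: le_max_iff_disj)
  qed simp
qed

lemma geometric_tail:
  fixes a :: "nat \<Rightarrow> complex"
  assumes "\<And>i. norm (a i) \<le> C * (1/2) ^ i"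
  shows "summable a" "norm ((\<Sum>i<n. a i) - suminf a) \<le> 2 * C * (1/2) ^ n"
proof -
  have sg: "summable (\<lambda>i. C * (1/2::real) ^ i)" by (intro summable_mult summable_geometric) simp
  show sa: "summable a" by (rule summable_comparison_test'[OF sg, of 0]) (rule assms)
  have sn: "summable (\<lambda>i. C * (1/2::real) ^ (i + n))"
    using sg by (rule summable_ignore_initial_segment)
  have "(\<Sum>i. C * (1/2::real) ^ (i + n)) = (\<Sum>i. (C * (1/2)^n) * (1/2) ^ i)"
    by (simp add: power_add mult_ac)
  also have "\<dots> = (C * (1/2)^n) * (\<Sum>i. (1/2) ^ i)"
    by (rule suminf_mult) (simp add: summable_geometric)
  also have "\<dots> = 2 * C * (1/2) ^ n" by (subst suminf_geometric) auto
  finally have eq: "(\<Sum>i. C * (1/2::real) ^ (i + n)) = 2 * C * (1/2) ^ n" .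
  have "(\<Sum>i<n. a i) - suminf a = - (\<Sum>i. a (i + n))"
    using suminf_split_initial_segment[OF sa, of n] by simp
  also have "norm \<dots> \<le> (\<Sum>i. C * (1/2::real) ^ (i + n))"
    unfolding norm_minus_cancel by (rule norm_suminf_le[OF assms sn])
  finally show "norm ((\<Sum>i<n. a i) - suminf a) \<le> 2 * C * (1/2) ^ n" unfolding eq .
qed

lemma norm_pd_le:
  assumes "f differentiable (at p)" "\<And>b. b \<in> Basis \<Longrightarrow> norm (pd b f p) \<le> C"
  shows "norm (pd h f (p::'a::euclidean_space)) \<le> real DIM('a) * C * norm h"
proof -
  have "norm (pd h f p) \<le> (\<Sum>b\<in>(Basis::'a set). norm h * C)"
    unfolding pd_linear_sum[OF assms(1), of h]
  proof (rule order.trans[OF norm_sum sum_mono])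
    fix b :: 'a assume b: "b \<in> Basis"
    show "norm ((h \<bullet> b) *\<^sub>R pd b f p) \<le> norm h * C"
      unfolding norm_scaleR real_norm_def[symmetric]
      by (intro mult_mono) (use Basis_le_norm[OF b, of h] assms(2)[OF b] in auto)
  qed
  then show ?thesis by (simp add: mult_ac)
qed

text \<open>Termwise differentiation: the continuous weight \<beta> is bounded on the unit ball
  about \<open>p\<close>, so a single geometric series dominates the derivatives there and they
  converge uniformly.\<close>

lemma geometric_series_has_derivative:
  fixes f :: "nat \<Rightarrow> 'a::euclidean_space \<Rightarrow> complex"
  assumes f: "\<And>j. Ck (Suc 0) UNIV (f j)" and bd: "\<And>j. bnd (Suc 0) UNIV (\<lambda>p. \<beta> p * (1/2) ^ j) (f j)"
    and \<beta>: "continuous_on UNIV \<beta>"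
  shows "((\<lambda>p. \<Sum>j. f j p) has_derivative (\<lambda>h. \<Sum>j. pd h (f j) p)) (at p)"
proof -
  obtain B where B0: "B \<ge> 0" and "\<And>x. x \<in> cball p 1 \<Longrightarrow> norm (\<beta> x) \<le> B"
    using continuous_compact_bound[OF \<beta> compact_cball[of p 1]] by blast
  then have B: "\<And>x. x \<in> cball p 1 \<Longrightarrow> \<bar>\<beta> x\<bar> \<le> B" unfolding real_norm_def by blast
  let ?C = "real DIM('a) * B"
  have pdb: "norm (pd h (f j) x) \<le> (?C * norm h) * (1/2) ^ j" if x: "x \<in> cball p 1" for h j x
  proof -
    have "norm (pd b (f j) x) \<le> B * (1/2) ^ j" if "b \<in> Basis" for b
    proof -
      have "norm (pd b (f j) x) \<le> \<beta> x * (1/2) ^ j"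
        using bnd_norm[OF bnd_pd[OF bd that], of x] by simp
      also have "\<dots> \<le> B * (1/2) ^ j" using B[OF x] by (intro mult_right_mono) auto
      finally show ?thesis .
    qed
    from norm_pd_le[OF Ck_differentiable[OF f] this, of h] show ?thesis by (simp add: mult_ac)
  qed
  have sums: "(\<lambda>j. f j x) sums (\<Sum>j. f j x)" if "x \<in> cball p 1" for x
  proof (rule summable_sums[OF geometric_tail(1)])
    show "norm (f j x) \<le> \<beta> x * (1/2) ^ j" for j using bnd_norm[OF bd, of x j] by simp
  qed
  have "\<exists>g. \<forall>x\<in>ball p 1. (\<lambda>n. f n x) sums (g x) \<and> (g has_derivative (\<lambda>h. \<Sum>j. pd h (f j) x)) (at x within ball p 1)"
  proof (rule has_derivative_series[of _ _ "\<lambda>n x h. pd h (f n) x"])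
    show "(f n has_derivative (\<lambda>h. pd h (f n) x)) (at x within ball p 1)" for n x
      by (rule has_derivative_at_withinI[OF Ck_has_derivative[OF f]])
    show "p \<in> ball p 1" by simp
    show "(\<lambda>n. f n p) sums (\<Sum>j. f j p)" by (rule sums) simp
    fix e :: real assume e: "e > 0"
    have "(\<lambda>n. 2 * ?C * (1/2) ^ n) \<longlonglongrightarrow> 2 * ?C * 0"
      by (intro tendsto_intros LIMSEQ_power_zero) simp
    then have "\<forall>\<^sub>F n in sequentially. 2 * ?C * (1/2) ^ n < e"
      using e by (intro order_tendstoD(2)) auto
    then show "\<forall>\<^sub>F n in sequentially. \<forall>x\<in>ball p 1. \<forall>h. norm ((\<Sum>i<n. pd h (f i) x) - (\<Sum>j. pd h (f j) x)) \<le> e * norm h"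
    proof eventually_elim
      fix n assume n: "2 * ?C * (1/2) ^ n < e"
      show "\<forall>x\<in>ball p 1. \<forall>h. norm ((\<Sum>i<n. pd h (f i) x) - (\<Sum>j. pd h (f j) x)) \<le> e * norm h"
      proof (intro ballI allI)
        fix x h assume "x \<in> ball p 1"
        then have "x \<in> cball p 1" by simp
        from geometric_tail(2)[of "\<lambda>j. pd h (f j) x" "?C * norm h" n, OF pdb[OF this]]
        have "norm ((\<Sum>i<n. pd h (f i) x) - (\<Sum>j. pd h (f j) x)) \<le> (2 * ?C * (1/2) ^ n) * norm h"
          by (simp add: mult_ac)
        also have "\<dots> \<le> e * norm h" using n by (intro mult_right_mono) auto
        finally show "norm ((\<Sum>i<n. pd h (f i) x) - (\<Sum>j. pd h (f j) x)) \<le> e * norm h" .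
      qed
    qed
  qed simp
  then obtain g where g: "\<forall>x\<in>ball p 1. (\<lambda>n. f n x) sums (g x) \<and> (g has_derivative (\<lambda>h. \<Sum>j. pd h (f j) x)) (at x within ball p 1)" ..
  have p: "p \<in> ball p 1" by simp
  have "(g has_derivative (\<lambda>h. \<Sum>j. pd h (f j) p)) (at p)"
    using bspec[OF g p, THEN conjunct2] unfolding at_within_open[OF p open_ball] .
  then show ?thesis
  proof (rule has_derivative_transform_within_open[where s="ball p 1"])
    show "g x = (\<Sum>j. f j x)" if "x \<in> ball p 1" for x
      by (rule sums_unique[OF bspec[OF g that, THEN conjunct1]])
  qed (simp_all add: p)
qed

lemma
  fixes f :: "nat \<Rightarrow> 'a::euclidean_space \<Rightarrow> complex"
  assumes "\<And>j. Ck k UNIV (f j)" "\<And>j. bnd k UNIV (\<lambda>p. \<beta> p * (1/2) ^ j) (f j)" "continuous_on UNIV \<beta>"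
  shows Ck_geometric_series: "Ck k UNIV (\<lambda>p. \<Sum>j. f j p)"
    and bnd_geometric_series: "bnd k UNIV (\<lambda>p. 2 * \<beta> p) (\<lambda>p. \<Sum>j. f j p)"
proof -
  have norm: "norm (\<Sum>j. f j p) \<le> 2 * \<beta> p" if "\<And>j. norm (f j p) \<le> \<beta> p * (1/2) ^ j" for f :: "nat \<Rightarrow> 'a \<Rightarrow> complex" and p
    using geometric_tail(2)[of "\<lambda>j. f j p" "\<beta> p" 0] that by simp
  have "Ck k UNIV (\<lambda>p. \<Sum>j. f j p) \<and> bnd k UNIV (\<lambda>p. 2 * \<beta> p) (\<lambda>p. \<Sum>j. f j p)"
    using assms(1,2)
  proof (induction k arbitrary: f)
    case 0
    have "isCont (\<lambda>p. \<Sum>j. f j p) p" for p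
    proof -
      obtain B where "\<And>x. x \<in> cball p 1 \<Longrightarrow> norm (\<beta> x) \<le> B"
        using continuous_compact_bound[OF assms(3) compact_cball[of p 1]] by blast
      then have B: "\<And>x. x \<in> cball p 1 \<Longrightarrow> \<bar>\<beta> x\<bar> \<le> B" unfolding real_norm_def by blast
      have "uniform_limit (cball p 1) (\<lambda>n p. \<Sum>j<n. f j p) (\<lambda>p. \<Sum>j. f j p) sequentially"
      proof (rule Weierstrass_m_test)
        show "norm (f n x) \<le> B * (1/2) ^ n" if "x \<in> cball p 1" for n x
        proof -
          have "norm (f n x) \<le> \<beta> x * (1/2) ^ n" using bnd_norm[OF 0(2), of x] by simp
          also have "\<dots> \<le> B * (1/2) ^ n" using B[OF that] by (intro mult_right_mono) auto
          finally show ?thesis .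
        qed
        show "summable (\<lambda>n. B * (1/2::real) ^ n)" by (intro summable_mult summable_geometric) simp
      qed
      moreover have "continuous_on (cball p 1) (\<lambda>p. \<Sum>j<n. f j p)" for n
        using Ck_continuous[OF Ck_sum[of "{..<n}", OF 0(1)]] by (rule continuous_on_subset) auto
      ultimately have "continuous_on (cball p 1) (\<lambda>p. \<Sum>j. f j p)"
        by (intro uniform_limit_theorem[of _ "\<lambda>n p. \<Sum>j<n. f j p"] always_eventually) auto
      then have "continuous_on (ball p 1) (\<lambda>p. \<Sum>j. f j p)" by (rule continuous_on_subset) auto
      then show ?thesis by (simp add: continuous_on_eq_continuous_at)
    qed
    then show ?case using 0(2) norm by (auto simp: continuous_at_imp_continuous_on)
  next
    case (Suc k)
    have d: "((\<lambda>p. \<Sum>j. f j p) has_derivative (\<lambda>h. \<Sum>j. pd h (f j) p)) (at p)" for p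
      by (rule geometric_series_has_derivative[OF Ck_mono[OF Suc.prems(1)] bnd_weaken[OF Suc.prems(2)] assms(3)]) auto
    have IH: "Ck k UNIV (\<lambda>p. \<Sum>j. pd b (f j) p)" "bnd k UNIV (\<lambda>p. 2 * \<beta> p) (\<lambda>p. \<Sum>j. pd b (f j) p)" if "b \<in> Basis" for b
      using Suc.IH[of "\<lambda>j. pd b (f j)", OF Ck_pd[OF Suc.prems(1) that] bnd_pd[OF Suc.prems(2) that]] by auto
    have "pd b (\<lambda>p. \<Sum>j. f j p) = (\<lambda>p. \<Sum>j. pd b (f j) p)" for b
      by (rule ext, rule pd_eq[OF d])
    moreover have "norm (\<Sum>j. f j p) \<le> 2 * \<beta> p" for p
      by (rule norm) (rule bnd_norm[OF Suc.prems(2) UNIV_I])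
    ultimately show ?case
      using Ck_Suc_UNIV_I[OF d IH(1)] IH(2) unfolding bnd_Suc by simp
  qed
  then show "Ck k UNIV (\<lambda>p. \<Sum>j. f j p)" "bnd k UNIV (\<lambda>p. 2 * \<beta> p) (\<lambda>p. \<Sum>j. f j p)" by blast+
qed

lemma Ck_fst: "Ck k UNIV q \<Longrightarrow> Ck k UNIV (\<lambda>p::spacetime. q (fst p))"
  using Ck_affine[of k q fst 0] bounded_linear_fst by simp

lemma pd_fst: "Ck (Suc k) UNIV q \<Longrightarrow> pd b (\<lambda>p::spacetime. q (fst p)) = (\<lambda>p. pd (fst b) q (fst p))"
proof
  fix p assume q: "Ck (Suc k) UNIV q"
  show "pd b (\<lambda>p::spacetime. q (fst p)) p = pd (fst b) q (fst p)"
    using pd_affine[OF Ck_differentiable[OF q], where L=fst and c=0 and p=p and h=b] bounded_linear_fst by simp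
qed

lemma pd_zero_direction: "Ck (Suc k) UNIV q \<Longrightarrow> pd 0 q x = 0"
  using linear_0[OF has_derivative_linear[OF Ck_has_derivative, of k q x]] by blast

lemma bnd_fst:
  assumes "Ck k UNIV q" "bnd k UNIV (\<lambda>_. M) q"
  shows "bnd k UNIV (\<lambda>_. M) (\<lambda>p::spacetime. q (fst p))"
  using assms
proof (induction k arbitrary: q)
  case (Suc k)
  have "M \<ge> 0" using order.trans[OF norm_ge_zero bnd_norm[OF Suc.prems(2) UNIV_I]] .
  have "bnd k UNIV (\<lambda>_. M) (pd b (\<lambda>p::spacetime. q (fst p)))" if "b \<in> Basis" for b
  proof -
    from that consider e where "e \<in> Basis" "b = (e, 0)" | "b = (0, 1)" by (auto simp: Basis_prod_def)
    then show ?thesis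
    proof cases
      case 1
      then show ?thesis unfolding pd_fst[OF Suc.prems(1)]
        by (auto intro!: Suc.IH Ck_pd[OF Suc.prems(1)] bnd_pd[OF Suc.prems(2)])
    next
      case 2
      then have "pd b (\<lambda>p::spacetime. q (fst p)) = (\<lambda>p. 0)"
        unfolding pd_fst[OF Suc.prems(1)] by (simp add: pd_zero_direction[OF Suc.prems(1)])
      then show ?thesis using bnd_const[of 0 M k UNIV] \<open>M \<ge> 0\<close> by simp
    qed
  qed
  then show ?case using bnd_norm[OF Suc.prems(2)] unfolding bnd_Suc by auto
qed auto

lemma csupp_mult: "csupp F \<Longrightarrow> csupp (\<lambda>p. f p * F p)"
  by (simp add: csupp_def)

lemma csupp_add: "csupp F \<Longrightarrow> csupp G \<Longrightarrow> csupp (\<lambda>p. F p + G p)"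
  and csupp_diff: "csupp F \<Longrightarrow> csupp G \<Longrightarrow> csupp (\<lambda>p. F p - G p)"
  by (simp_all add: csupp_def)

lemma csupp_sum: "(\<And>i. i \<in> I \<Longrightarrow> csupp (F i)) \<Longrightarrow> csupp (\<lambda>p. \<Sum>i\<in>I. F i p)"
  by (simp add: csupp_def)

text \<open>A solution of \<open>(\<box> - q) v = G\<close> with zero past is a fixed point of \<open>v \<mapsto> ret (q v + G)\<close>,
  a contraction for the weight \<open>exp (l t)\<close> with \<open>l\<close> large.\<close>

definition volterra :: "(real^3 \<Rightarrow> complex) \<Rightarrow> (spacetime \<Rightarrow> complex) \<Rightarrow> (spacetime \<Rightarrow> complex) \<Rightarrow> bool" where
  "volterra q G v \<longleftrightarrow> continuous_on UNIV v \<and> csupp v \<and> (\<forall>p. v p = ret (\<lambda>p. q (fst p) * v p + G p) p)"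

text \<open>Each substitution into the equation halves the weighted bound on times up to that of
  \<open>p0\<close>. The initial bound comes from compactness, because the part of the cone up to a
  given time is bounded.\<close>

lemma volterra_homogeneous_unique:
  assumes q: "continuous_on UNIV q" "\<And>x. norm (q x) \<le> M" and W: "continuous_on UNIV W" "csupp W"
    and eq: "\<And>p. W p = ret (\<lambda>p. q (fst p) * W p) p"
  shows "W p0 = 0"
proof -
  have M0: "M \<ge> 0" using order.trans[OF norm_ge_zero q(2)] .
  obtain l where l: "l \<ge> 1" "kap l \<le> 1 / (2 * (M + 1))"
    using kap_small[of "1 / (2 * (M + 1))" 0] M0 by auto
  have kM: "kap l * M \<le> 1 / 2"
  proof -
    have "kap l * M \<le> 1 / (2 * (M + 1)) * M" using l M0 by (intro mult_right_mono) auto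
    also have "\<dots> \<le> 1 / 2" using M0 by (simp add: field_simps)
    finally show ?thesis .
  qed
  define T where "T = snd p0"
  \<comment> \<open>In the cone up to time T the norm of (x, t) is at most |x| + t <= 2 T.\<close>
  obtain B where B0: "B \<ge> 0" and B: "\<And>p. p \<in> cball 0 (\<bar>T\<bar> + \<bar>T\<bar>) \<Longrightarrow> norm (W p) \<le> B"
    using continuous_compact_bound[OF W(1) compact_cball[of 0 "\<bar>T\<bar> + \<bar>T\<bar>"]] by blast
  have bd: "norm (W p) \<le> (B * (1/2) ^ n) * exp (l * snd p)" if "snd p \<le> T" for n p
    using that
  proof (induction n arbitrary: p)
    case 0
    show ?case
    proof (cases "norm (fst p) \<le> snd p")
      case True
      have sp: "0 \<le> snd p" using True norm_ge_zero order.trans by blast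
      have "norm p \<le> norm (fst p) + norm (snd p)" using norm_Pair_le[of "fst p" "snd p"] by simp
      then have "norm (W p) \<le> B" using True 0 sp by (intro B) simp
      also have "\<dots> \<le> B * exp (l * snd p)" using B0 l sp by (simp add: mult_le_cancel_left1)
      finally show ?thesis by simp
    next
      case False
      then show ?thesis using csupp_D[OF W(2), of p] B0 by simp
    qed
  next
    case (Suc n)
    have "norm (ret (\<lambda>p. q (fst p) * W p) p) \<le> kap l * (M * (B * (1/2) ^ n)) * exp (l * snd p)"
    proof (rule ret_norm_le[OF csupp_vanishes[OF csupp_mult[OF W(2)]] _ l(1) _ Suc.prems])
      show "continuous_on UNIV (\<lambda>p. q (fst p) * W p)"
        by (rule continuous_on_mult[OF continuous_on_compose2[OF q(1) continuous_on_fst[OF continuous_on_id]] W(1)]) simp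
      fix p :: spacetime assume "snd p \<le> T"
      from mult_mono[OF q(2)[of "fst p"] Suc.IH[OF this]] M0
      show "norm (q (fst p) * W p) \<le> M * (B * (1/2) ^ n) * exp (l * snd p)"
        by (simp add: norm_mult mult_ac)
    qed
    also have "\<dots> = (kap l * M) * (B * (1/2) ^ n * exp (l * snd p))" by (simp only: mult_ac)
    also have "\<dots> \<le> (1/2) * (B * (1/2) ^ n * exp (l * snd p))"
      using kM B0 by (intro mult_right_mono) auto
    finally show ?case using eq[of p] by simp
  qed
  have "(\<lambda>n. (B * (1/2) ^ n) * exp (l * snd p0)) \<longlonglongrightarrow> (B * 0) * exp (l * snd p0)"
    by (intro tendsto_intros LIMSEQ_power_zero) simp
  then have "norm (W p0) \<le> (B * 0) * exp (l * snd p0)"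
    by (rule LIMSEQ_le_const) (use bd[of p0] in \<open>auto simp: T_def\<close>)
  then show ?thesis by simp
qed

lemma continuous_fst_mult:
  assumes q: "continuous_on UNIV q" and v: "continuous_on UNIV v"
  shows "continuous_on UNIV (\<lambda>p::spacetime. (q (fst p) :: complex) * v p)"
  by (rule continuous_on_mult[OF continuous_on_compose2[OF q continuous_on_fst[OF continuous_on_id]] v]) simp

text \<open>Keeping \<open>q1\<close> as the potential turns (q1 - q2) v2 into an additional source.
  With equal data this yields uniqueness, with different data the stability estimate.\<close>

lemma volterra_diff:
  assumes "continuous_on UNIV q1" "continuous_on UNIV q2" "continuous_on UNIV G1" "continuous_on UNIV G2" "csupp G1" "csupp G2"
    "volterra q1 G1 v1" "volterra q2 G2 v2"
  shows "volterra q1 (\<lambda>p. (q1 (fst p) - q2 (fst p)) * v2 p + (G1 p - G2 p)) (\<lambda>p. v1 p - v2 p)"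
proof -
  have v1: "continuous_on UNIV v1" "csupp v1" "\<And>p. v1 p = ret (\<lambda>p. q1 (fst p) * v1 p + G1 p) p"
    using assms(7) unfolding volterra_def by blast+
  have v2: "continuous_on UNIV v2" "csupp v2" "\<And>p. v2 p = ret (\<lambda>p. q2 (fst p) * v2 p + G2 p) p"
    using assms(8) unfolding volterra_def by blast+
  have "v1 p - v2 p = ret (\<lambda>p. q1 (fst p) * (v1 p - v2 p) + ((q1 (fst p) - q2 (fst p)) * v2 p + (G1 p - G2 p))) p" for p
  proof -
    have "v1 p - v2 p = ret (\<lambda>p. q1 (fst p) * v1 p + G1 p) p - ret (\<lambda>p. q2 (fst p) * v2 p + G2 p) p"
      using v1(3)[of p] v2(3)[of p] by (simp only:)
    also have "\<dots> = ret (\<lambda>p. (q1 (fst p) * v1 p + G1 p) - (q2 (fst p) * v2 p + G2 p)) p"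
      by (rule ret_diff[OF csupp_vanishes _ csupp_vanishes, symmetric])
        (intro csupp_vanishes csupp_add csupp_mult continuous_on_add continuous_fst_mult assms v1(1,2) v2(1,2))+
    finally show ?thesis by (simp add: algebra_simps)
  qed
  with csupp_diff[OF v1(2) v2(2)] continuous_on_diff[OF v1(1) v2(1)] show ?thesis
    unfolding volterra_def by blast
qed

lemma volterra_unique:
  assumes q: "continuous_on UNIV q" "\<And>x. norm (q x) \<le> M" and G: "continuous_on UNIV G" "csupp G"
    and v: "volterra q G v1" "volterra q G v2"
  shows "v1 = v2"
proof
  fix p
  have "volterra q (\<lambda>p. (q (fst p) - q (fst p)) * v2 p + (G p - G p)) (\<lambda>p. v1 p - v2 p)"
    by (rule volterra_diff) (use assms in auto)
  then have *: "continuous_on UNIV (\<lambda>p. v1 p - v2 p)" "csupp (\<lambda>p. v1 p - v2 p)"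
    "\<And>p. v1 p - v2 p = ret (\<lambda>p. q (fst p) * (v1 p - v2 p)) p"
    unfolding volterra_def diff_self mult_zero_left add_0_right by blast+
  from volterra_homogeneous_unique[OF q *, of p] show "v1 p = v2 p" by simp
qed

lemma bnd_potential_mult:
  assumes "Ck k UNIV q" "bnd k UNIV (\<lambda>_. M) q" "Ck k UNIV v" "bnd k UNIV (wt B l) v"
  shows "bnd k UNIV (wt (2 ^ k * M * B) l) (\<lambda>p. q (fst p) * v p)"
  using bnd_mult[OF Ck_fst[OF assms(1)] assms(3) bnd_fst[OF assms(1,2)] assms(4)]
  by (simp add: mult_ac)

text \<open>Neumann series for v = ret (q v + G). By Leibniz' rule, multiplication by
  \<open>q\<close> costs \<open>2 ^ k * M\<close> at order \<open>k\<close>, and the choice of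
  \<open>l\<close> makes the bound of each term half of the one before. The factor 2 in the final
  bound is the sum of the geometric series.\<close>

lemma volterra_exists:
  assumes q: "Ck k UNIV q" "bnd k UNIV (\<lambda>_. M) q" and G: "Ck k UNIV G" "csupp G" "bnd k UNIV (wt \<Gamma> l) G"
    and l: "l \<ge> 1" "kap l * (2 ^ k * M) \<le> 1 / 2"
  shows "\<exists>v. volterra q G v \<and> Ck k UNIV v \<and> bnd k UNIV (wt (2 * kap l * \<Gamma>) l) v"
proof -
  have M0: "M \<ge> 0" using order.trans[OF norm_ge_zero bnd_norm[OF q(2) UNIV_I]] .
  have \<Gamma>0: "\<Gamma> \<ge> 0" using order.trans[OF norm_ge_zero bnd_norm[OF G(3), of "(0, 0)"]] by simp
  \<comment> \<open>The terms of the series: \<open>V j\<close> is the j-th iterate of u -> ret (q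
    u), applied to \<open>ret G\<close>.\<close>
  define V where "V = rec_nat (ret G) (\<lambda>j u. ret (\<lambda>p. q (fst p) * u p))"
  have V0: "V 0 = ret G" and VS: "V (Suc j) = ret (\<lambda>p. q (fst p) * V j p)" for j
    by (simp_all add: V_def)
  let ?B = "kap l * \<Gamma>"
  have V: "csupp (V j) \<and> Ck k UNIV (V j) \<and> bnd k UNIV (wt (?B * (1/2) ^ j) l) (V j)" for j
  proof (induction j)
    case 0
    show ?case unfolding V0
      using ret_csupp[OF G(2)] Ck_ret[OF csupp_vanishes[OF G(2)] G(1)] bnd_ret[OF csupp_vanishes[OF G(2)] G(1) l(1) G(3)]
      by simp
  next
    case (Suc j)
    then have c: "csupp (\<lambda>p. q (fst p) * V j p)" and C: "Ck k UNIV (\<lambda>p. q (fst p) * V j p)"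
      by (auto intro!: csupp_mult Ck_mult Ck_fst q)
    have "bnd k UNIV (wt (2 ^ k * M * (?B * (1/2) ^ j)) l) (\<lambda>p. q (fst p) * V j p)"
      using Suc by (intro bnd_potential_mult q) auto
    from bnd_ret[OF csupp_vanishes[OF c] C l(1) this]
    have "bnd k UNIV (wt (kap l * (2 ^ k * M * (?B * (1/2) ^ j))) l) (V (Suc j))" unfolding VS .
    then have "bnd k UNIV (wt (?B * (1/2) ^ Suc j) l) (V (Suc j))"
    proof (rule bnd_weaken)
      fix p :: spacetime
      have "kap l * (2 ^ k * M * (?B * (1/2) ^ j)) = (kap l * (2 ^ k * M)) * (?B * (1/2) ^ j)" by (simp only: mult_ac)
      also have "\<dots> \<le> 1/2 * (?B * (1/2) ^ j)"
        using l(2) \<Gamma>0 kap_nonneg[of l] by (intro mult_right_mono) auto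
      finally show "wt (kap l * (2 ^ k * M * (?B * (1/2) ^ j))) l p \<le> wt (?B * (1/2) ^ Suc j) l p"
        by (intro mult_right_mono) auto
    qed auto
    with ret_csupp[OF c] Ck_ret[OF csupp_vanishes[OF c] C] show ?case unfolding VS by blast
  qed
  define v where "v p = (\<Sum>j. V j p)" for p
  have Vb: "bnd k UNIV (\<lambda>p. wt ?B l p * (1/2) ^ j) (V j)" for j
    by (rule bnd_weaken[OF V[of j, THEN conjunct2, THEN conjunct2]]) auto
  have cw: "continuous_on UNIV (wt ?B l)" by (intro continuous_intros)
  have Cv: "Ck k UNIV v" and bv: "bnd k UNIV (wt (2 * kap l * \<Gamma>) l) v"
  proof -
    have VC: "\<And>j. Ck k UNIV (V j)" using V by blast
    show "Ck k UNIV v" unfolding v_def by (rule Ck_geometric_series[OF VC Vb cw])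
    show "bnd k UNIV (wt (2 * kap l * \<Gamma>) l) v" unfolding v_def
      by (rule bnd_weaken[OF bnd_geometric_series[OF VC Vb cw]]) auto
  qed
  have csv: "csupp v"
    using V unfolding v_def csupp_def by simp
  have nV: "norm (V j p) \<le> wt ?B l p * (1/2) ^ j" for j p by (rule bnd_norm[OF Vb UNIV_I])
  have contv: "continuous_on UNIV v" by (rule Ck_continuous[OF Cv])
  have contq: "continuous_on UNIV q" by (rule Ck_continuous[OF q(1)])
  have nq: "norm (q x) \<le> M" for x by (rule bnd_norm[OF q(2) UNIV_I])
  have contV: "continuous_on UNIV (V j)" and csV: "csupp (V j)" for j using V Ck_continuous by blast+
  have partial: "(\<Sum>j<J. V (Suc j) p) = ret (\<lambda>p. q (fst p) * (\<Sum>j<J. V j p)) p" for J p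
  proof (induction J)
    case 0
    show ?case by (simp add: ret_def)
  next
    case (Suc J)
    have "ret (\<lambda>p. q (fst p) * (\<Sum>j<Suc J. V j p)) p = ret (\<lambda>p. q (fst p) * (\<Sum>j<J. V j p) + q (fst p) * V J p) p"
      by (simp add: distrib_left)
    also have "\<dots> = ret (\<lambda>p. q (fst p) * (\<Sum>j<J. V j p)) p + ret (\<lambda>p. q (fst p) * V J p) p"
      by (rule ret_add[OF csupp_vanishes _ csupp_vanishes]) (intro csupp_vanishes csupp_mult csupp_sum csV continuous_fst_mult contq contV continuous_on_sum)+
    finally show ?case using Suc by (simp add: VS)
  qed
  \<comment> \<open>The potential is not exchanged with the infinite sum; \<open>ret_norm_le\<close>
    is applied to the tail instead, whose bound tends to 0.\<close>
  have fix_eq: "v p = ret (\<lambda>p. q (fst p) * v p) p + ret G p" for p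
  proof -
    have "(\<lambda>J. ret (\<lambda>p. q (fst p) * v p) p - (\<Sum>j<J. V (Suc j) p)) \<longlonglongrightarrow> 0"
    proof (rule Lim_null_comparison)
      show "\<forall>\<^sub>F J in sequentially. norm (ret (\<lambda>p. q (fst p) * v p) p - (\<Sum>j<J. V (Suc j) p)) \<le> kap l * (M * (2 * ?B * (1/2) ^ J)) * exp (l * snd p)"
      proof (rule always_eventually, rule allI)
        fix J
        let ?r = "\<lambda>p. v p - (\<Sum>j<J. V j p)"
        have "ret (\<lambda>p. q (fst p) * v p) p - (\<Sum>j<J. V (Suc j) p) = ret (\<lambda>p. q (fst p) * v p - q (fst p) * (\<Sum>j<J. V j p)) p"
          unfolding partial
          by (rule ret_diff[OF csupp_vanishes _ csupp_vanishes, symmetric]) (intro csupp_vanishes csupp_mult csupp_sum csV csv continuous_fst_mult contq contV contv continuous_on_sum)+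
        also have "\<dots> = ret (\<lambda>p. q (fst p) * ?r p) p" by (simp add: right_diff_distrib)
        also have "norm \<dots> \<le> kap l * (M * (2 * ?B * (1/2) ^ J)) * exp (l * snd p)"
        proof (rule ret_norm_le[OF _ _ l(1) _ order.refl])
          show "vanishes_before 0 (\<lambda>p. q (fst p) * ?r p)"
            by (intro csupp_vanishes csupp_mult csupp_diff csupp_sum csV csv)
          show "continuous_on UNIV (\<lambda>p. q (fst p) * ?r p)"
            by (intro continuous_fst_mult continuous_on_diff continuous_on_sum contq contV contv)
          fix p
          have "norm (?r p) \<le> 2 * wt ?B l p * (1/2) ^ J"
            using geometric_tail(2)[of "\<lambda>j. V j p", OF nV, of J] by (simp add: v_def norm_minus_commute)
          from mult_mono[OF nq[of "fst p"] this] M0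
          show "norm (q (fst p) * ?r p) \<le> M * (2 * ?B * (1/2) ^ J) * exp (l * snd p)"
            by (simp add: norm_mult mult_ac)
        qed
        finally show "norm (ret (\<lambda>p. q (fst p) * v p) p - (\<Sum>j<J. V (Suc j) p)) \<le> kap l * (M * (2 * ?B * (1/2) ^ J)) * exp (l * snd p)" .
      qed
      have "(\<lambda>J. kap l * (M * (2 * ?B * (1/2) ^ J)) * exp (l * snd p)) \<longlonglongrightarrow> kap l * (M * (2 * ?B * 0)) * exp (l * snd p)"
        by (intro tendsto_intros LIMSEQ_power_zero) simp
      then show "(\<lambda>J. kap l * (M * (2 * ?B * (1/2) ^ J)) * exp (l * snd p)) \<longlonglongrightarrow> 0" by simp
    qed
    from tendsto_diff[OF tendsto_const[of "ret (\<lambda>p. q (fst p) * v p) p"] this]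
    have "(\<lambda>j. V (Suc j) p) sums ret (\<lambda>p. q (fst p) * v p) p" unfolding sums_def by simp
    moreover have "(\<lambda>j. V j p) sums v p"
      unfolding v_def by (rule summable_sums[OF geometric_tail(1)[OF nV]])
    then have "(\<lambda>j. V (Suc j) p) sums (v p - V 0 p)"
      using sums_Suc_iff[of "\<lambda>j. V j p" "v p - V 0 p"] by simp
    ultimately have "ret (\<lambda>p. q (fst p) * v p) p = v p - V 0 p" by (rule sums_unique2)
    then show ?thesis by (simp add: V0)
  qed
  have "v p = ret (\<lambda>p. q (fst p) * v p + G p) p" for p
    unfolding fix_eq[of p]
    by (rule ret_add[OF csupp_vanishes _ csupp_vanishes, symmetric]) (intro csupp_vanishes csupp_mult csv G continuous_fst_mult contq contv Ck_continuous[OF G(1)])+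
  then have "volterra q G v" unfolding volterra_def using contv csv by blast
  with Cv bv show ?thesis by blast
qed

section \<open>The transport equations\<close>

definition lapl :: "(real^3 \<Rightarrow> complex) \<Rightarrow> real^3 \<Rightarrow> complex" where
  "lapl f x = (\<Sum>e\<in>Basis. pd e (pd e f) x)"

definition schr :: "(real^3 \<Rightarrow> complex) \<Rightarrow> (real^3 \<Rightarrow> complex) \<Rightarrow> real^3 \<Rightarrow> complex" where
  "schr q f x = lapl f x + q x * f x"

definition avg :: "nat \<Rightarrow> (real^3 \<Rightarrow> complex) \<Rightarrow> real^3 \<Rightarrow> complex" where
  "avg k f = pint (\<lambda>\<sigma>. indicator {0..1} \<sigma> * \<sigma> ^ k) (\<lambda>\<sigma>. \<sigma>) (\<lambda>\<sigma>. 0) f"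

interpretation avg: param_integral "\<lambda>\<sigma>::real. \<sigma>" "\<lambda>\<sigma>. 0 :: real^3" "{0..1}"
  by standard (auto intro!: continuous_intros)

lemma avg_weight: "integrable lborel (\<lambda>\<sigma>::real. indicator {0..1} \<sigma> * \<sigma> ^ k)"
  "\<sigma> \<notin> {0..1} \<Longrightarrow> indicator {0..1} \<sigma> * \<sigma> ^ k = (0::real)"
proof -
  have "continuous_on {0..1} (\<lambda>\<sigma>::real. \<sigma> ^ k)" by (intro continuous_intros)
  from borel_integrable_compact[OF compact_Icc this]
  show "integrable lborel (\<lambda>\<sigma>::real. indicator {0..1} \<sigma> * \<sigma> ^ k)" by simp
qed simp

lemma Ck_avg: "Ck j UNIV f \<Longrightarrow> Ck j UNIV (avg k f)"
  unfolding avg_def by (rule avg.Ck_pint[OF avg_weight])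

lemma pd_avg: "Ck (Suc j) UNIV f \<Longrightarrow> pd b (avg k f) = avg (Suc k) (pd b f)"
  unfolding avg_def by (subst avg.pd_pint[OF avg_weight]) (simp_all add: mult_ac)

lemma avg_integrable:
  "continuous_on UNIV (f :: real^3 \<Rightarrow> complex) \<Longrightarrow> integrable lborel (\<lambda>\<sigma>. (indicator {0..1} \<sigma> * \<sigma> ^ k) *\<^sub>R f (\<sigma> *\<^sub>R x - 0))"
  by (rule avg.pint_integrable[OF avg_weight])

lemma norm_avg_le:
  assumes "continuous_on UNIV f" "\<And>x. norm (f x) \<le> B"
  shows "norm (avg k f x) \<le> B"
proof -
  have B: "B \<ge> 0" using order.trans[OF norm_ge_zero assms(2)] .
  have "norm (avg k f x) \<le> (\<integral>\<sigma>. norm ((indicator {0..1} \<sigma> * \<sigma> ^ k) *\<^sub>R f (\<sigma> *\<^sub>R x - 0)) \<partial>lborel)"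
    unfolding avg_def pint_def by (rule integral_norm_bound)
  also have "\<dots> \<le> (\<integral>\<sigma>. indicator {0..1::real} \<sigma> * B \<partial>lborel)"
  proof (rule integral_mono)
    show "integrable lborel (\<lambda>\<sigma>. norm ((indicator {0..1} \<sigma> * \<sigma> ^ k) *\<^sub>R f (\<sigma> *\<^sub>R x - 0)))"
      by (rule integrable_norm[OF avg_integrable[OF assms(1)]])
    show "integrable lborel (\<lambda>\<sigma>. indicator {0..1::real} \<sigma> * B)" by simp
    fix \<sigma> :: real
    show "norm ((indicator {0..1} \<sigma> * \<sigma> ^ k) *\<^sub>R f (\<sigma> *\<^sub>R x - 0)) \<le> indicator {0..1} \<sigma> * B"
    proof (cases "\<sigma> \<in> {0..1}")
      case True
      then have "\<bar>\<sigma> ^ k\<bar> * norm (f (\<sigma> *\<^sub>R x)) \<le> 1 * B"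
        by (intro mult_mono assms B) (auto simp: power_le_one power_abs)
      then show ?thesis using True by simp
    qed simp
  qed
  also have "\<dots> = B" by simp
  finally show ?thesis .
qed

lemma bnd_avg:
  assumes "Ck j UNIV f" "bnd j UNIV (\<lambda>_. B) f"
  shows "bnd j UNIV (\<lambda>_. B) (avg k f)"
  using assms
proof (induction j arbitrary: f k)
  case 0
  then show ?case using norm_avg_le[of f B k] by simp
next
  case (Suc j)
  have "norm (avg k f x) \<le> B" for x
    by (rule norm_avg_le[OF Ck_continuous[OF Suc.prems(1)] bnd_norm[OF Suc.prems(2) UNIV_I]])
  moreover have "bnd j UNIV (\<lambda>_. B) (pd b (avg k f))" if "b \<in> Basis" for b
    unfolding pd_avg[OF Suc.prems(1)] using Suc.prems that by (intro Suc.IH Ck_pd bnd_pd)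
  ultimately show ?case unfolding bnd_Suc by blast
qed

text \<open>\<open>pd x (avg k f) x\<close> is the derivative at \<open>x\<close> in the direction
  \<open>x\<close>, the Euler operator x . grad. Integrate the \<sigma>-derivative of \<sigma>^(k+1)
  f (\<sigma> x) from 0 to 1. The average is thus a solution of the Euler equation without a
  singularity at the origin.\<close>

lemma avg_euler:
  assumes f: "Ck (Suc 0) UNIV f"
  shows "pd x (avg k f) x + of_nat (Suc k) * avg k f x = f x"
proof -
  have cf: "continuous_on UNIV f" by (rule Ck_continuous[OF f])
  have pdsum: "pd x f y = (\<Sum>b\<in>Basis. (x \<bullet> b) *\<^sub>R pd b f y)" for y
    by (rule pd_linear_sum[OF Ck_differentiable[OF f]])
  have cpd: "continuous_on UNIV (pd x f)"
    unfolding pdsum[abs_def] by (intro continuous_intros Ck_continuous[OF Ck_pd[OF f]])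
  let ?F = "\<lambda>\<sigma>::real. \<sigma> ^ Suc k *\<^sub>R f (\<sigma> *\<^sub>R x)"
  let ?F' = "\<lambda>\<sigma>::real. \<sigma> ^ Suc k *\<^sub>R pd x f (\<sigma> *\<^sub>R x) + (real (Suc k) * \<sigma> ^ k) *\<^sub>R f (\<sigma> *\<^sub>R x)"
  have "(\<integral>\<sigma>. indicator {0..1} \<sigma> *\<^sub>R ?F' \<sigma> \<partial>lborel) = ?F 1 - ?F 0"
  proof (rule integral_FTC_atLeastAtMost)
    fix \<sigma> :: real
    have lin: "pd (h *\<^sub>R x) f y = h *\<^sub>R pd x f y" for h y
      using linear_scale[OF has_derivative_linear[OF Ck_has_derivative[OF f, of y]], of h x] .
    have d: "((\<lambda>\<sigma>. f (\<sigma> *\<^sub>R x)) has_derivative (\<lambda>h. h *\<^sub>R pd x f (\<sigma> *\<^sub>R x))) (at \<sigma>)"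
      unfolding lin[symmetric]
      by (rule has_derivative_compose[OF _ Ck_has_derivative[OF f]]) (auto intro!: derivative_eq_intros)
    have "((\<lambda>\<sigma>. f (\<sigma> *\<^sub>R x)) has_vector_derivative pd x f (\<sigma> *\<^sub>R x)) (at \<sigma>)"
      unfolding has_vector_derivative_def by (rule d)
    moreover have "((\<lambda>\<sigma>::real. \<sigma> ^ Suc k) has_real_derivative real (Suc k) * \<sigma> ^ k) (at \<sigma>)"
      using DERIV_pow[of "Suc k" \<sigma>] by simp
    ultimately have "(?F has_vector_derivative ?F' \<sigma>) (at \<sigma>)"
      by (intro has_vector_derivative_scaleR)
    then show "(?F has_vector_derivative ?F' \<sigma>) (at \<sigma> within {0..1})"
      by (rule has_vector_derivative_at_within)
  next
    have hc: "continuous_on {0..1} (\<lambda>\<sigma>::real. g (\<sigma> *\<^sub>R x))" if "continuous_on UNIV g" for g :: "real^3 \<Rightarrow> complex"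
      by (rule continuous_on_compose2[OF that]) (auto intro!: continuous_intros)
    show "continuous_on {0..1} ?F'" by (intro continuous_intros hc cf cpd)
  qed simp
  moreover have "(\<integral>\<sigma>. indicator {0..1} \<sigma> *\<^sub>R ?F' \<sigma> \<partial>lborel) = avg (Suc k) (pd x f) x + of_nat (Suc k) * avg k f x"
  proof -
    have eq: "indicator {0..1} \<sigma> *\<^sub>R ?F' \<sigma> = (indicator {0..1} \<sigma> * \<sigma> ^ Suc k) *\<^sub>R pd x f (\<sigma> *\<^sub>R x - 0)
       + of_nat (Suc k) * ((indicator {0..1} \<sigma> * \<sigma> ^ k) *\<^sub>R f (\<sigma> *\<^sub>R x - 0))" for \<sigma>
      by (simp add: scaleR_conv_of_real algebra_simps)
    show ?thesis unfolding eq avg_def pint_def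
      by (rule trans[OF Bochner_Integration.integral_add[OF avg_integrable[OF cpd] integrable_mult_right[OF avg_integrable[OF cf]]]])
        (simp only: integral_mult_right_zero)
  qed
  ultimately show ?thesis unfolding pd_avg[OF f] by simp
qed

text \<open>Solves the transport equation for the operator 4 (k + 1) (x . grad + k + 2), which
  arises when the wave operator is applied to b(x) rho^(k+1).\<close>

definition tstep :: "nat \<Rightarrow> (real^3 \<Rightarrow> complex) \<Rightarrow> real^3 \<Rightarrow> complex" where
  "tstep k f x = of_real (1 / (4 * real (Suc k))) * avg (Suc k) f x"

lemma Ck_tstep: "Ck j UNIV f \<Longrightarrow> Ck j UNIV (tstep k f)"
  unfolding tstep_def[abs_def] by (intro Ck_cmult Ck_avg)

lemma bnd_tstep:
  assumes "Ck j UNIV f" "bnd j UNIV (\<lambda>_. B) f"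
  shows "bnd j UNIV (\<lambda>_. B) (tstep k f)"
proof -
  have B: "B \<ge> 0" using order.trans[OF norm_ge_zero bnd_norm[OF assms(2) UNIV_I]] .
  have "norm (complex_of_real (1 / (4 * real (Suc k)))) * B \<le> 1 * B"
    unfolding norm_of_real by (intro mult_right_mono B) (simp add: divide_le_eq)
  then show ?thesis
    unfolding tstep_def[abs_def]
    by (intro bnd_weaken[OF bnd_cmult[OF Ck_avg[OF assms(1)] bnd_avg[OF assms]]]) auto
qed

lemma tstep_euler:
  assumes f: "Ck (Suc 0) UNIV f"
  shows "4 * of_nat (Suc k) * (pd x (tstep k f) x + of_nat (k + 2) * tstep k f x) = f x"
proof -
  have "pd x (tstep k f) x = of_real (1 / (4 * real (Suc k))) * pd x (avg (Suc k) f) x"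
    unfolding tstep_def[abs_def] by (rule pd_cmult[OF Ck_differentiable[OF Ck_avg[OF f]]])
  then have "pd x (tstep k f) x + of_nat (k + 2) * tstep k f x = of_real (1 / (4 * real (Suc k))) * (pd x (avg (Suc k) f) x + of_nat (Suc (Suc k)) * avg (Suc k) f x)"
    by (simp only: tstep_def distrib_left mult.left_commute add_2_eq_Suc')
  also have "\<dots> = of_real (1 / (4 * real (Suc k))) * f x" by (simp only: avg_euler[OF f])
  finally have "4 * of_nat (Suc k) * (pd x (tstep k f) x + of_nat (k + 2) * tstep k f x) = (4 * of_nat (Suc k) * of_real (1 / (4 * real (Suc k)))) * f x"
    by (simp only: mult.assoc)
  also have "4 * of_nat (Suc k) * complex_of_real (1 / (4 * real (Suc k))) = of_real (4 * real (Suc k) * (1 / (4 * real (Suc k))))"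
    by (simp only: of_real_mult of_real_of_nat_eq of_real_numeral)
  also have "4 * real (Suc k) * (1 / (4 * real (Suc k))) = 1" by (simp del: of_nat_Suc)
  finally show ?thesis by simp
qed

lemma tstep_diff:
  assumes "continuous_on UNIV f" "continuous_on UNIV h"
  shows "tstep k f x - tstep k h x = tstep k (\<lambda>x. f x - h x) x"
proof -
  have "avg (Suc k) (\<lambda>x. f x - h x) x = avg (Suc k) f x - avg (Suc k) h x"
    unfolding avg_def pint_def scaleR_diff_right
    by (rule Bochner_Integration.integral_diff[OF avg_integrable[OF assms(1)] avg_integrable[OF assms(2)]])
  then show ?thesis by (simp add: tstep_def right_diff_distrib)
qed

primrec bcoef :: "(real^3 \<Rightarrow> complex) \<Rightarrow> (real^3 \<Rightarrow> complex) \<Rightarrow> nat \<Rightarrow> real^3 \<Rightarrow> complex" where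
  "bcoef q g 0 = g"
| "bcoef q g (Suc k) = tstep k (schr q (bcoef q g k))"

lemma
  assumes b: "Ck (Suc (Suc j)) UNIV b"
  shows Ck_lapl: "Ck j UNIV (lapl b)"
    and bnd_lapl: "bnd (Suc (Suc j)) UNIV (\<lambda>_. B) b \<Longrightarrow> bnd j UNIV (\<lambda>_. 3 * B) (lapl b)"
proof -
  have C: "Ck j UNIV (pd e (pd e b))" if "e \<in> Basis" for e
    by (intro Ck_pd b that)
  show "Ck j UNIV (lapl b)" unfolding lapl_def[abs_def] by (intro Ck_sum C)
  assume bb: "bnd (Suc (Suc j)) UNIV (\<lambda>_. B) b"
  have "bnd j UNIV (\<lambda>_. \<Sum>e\<in>(Basis :: (real^3) set). B) (lapl b)"
    unfolding lapl_def[abs_def] by (intro bnd_sum C bnd_pd bb) auto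
  then show "bnd j UNIV (\<lambda>_. 3 * B) (lapl b)" by simp
qed

lemma Ck_schr: "Ck (Suc (Suc j)) UNIV b \<Longrightarrow> Ck j UNIV q \<Longrightarrow> Ck j UNIV (schr q b)"
  unfolding schr_def[abs_def] by (intro Ck_add Ck_lapl Ck_mult) (auto intro: Ck_mono simp del: Ck.simps)

lemma bnd_schr:
  assumes b: "Ck (Suc (Suc j)) UNIV b" "bnd (Suc (Suc j)) UNIV (\<lambda>_. B) b" and q: "Ck j UNIV q" "bnd j UNIV (\<lambda>_. M) q"
  shows "bnd j UNIV (\<lambda>_. (3 + 2 ^ j * M) * B) (schr q b)"
proof -
  have bj: "Ck j UNIV b" "bnd j UNIV (\<lambda>_. B) b"
    using Ck_mono[OF b(1), of j] bnd_weaken[OF b(2), of j UNIV] by auto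
  have "bnd j UNIV (\<lambda>_. 3 * B + 2 ^ j * (M * B)) (schr q b)"
    unfolding schr_def[abs_def] by (intro bnd_add Ck_lapl Ck_mult bnd_lapl bnd_mult b bj q)
  then show ?thesis by (simp add: algebra_simps)
qed

text \<open>One step costs two derivatives and multiplies the constant by 3 + 2^n M: 3 for the
  second derivatives in the Laplacian, and 2^n M for the product with \<open>q\<close> by Leibniz'
  rule.\<close>

lemma
  assumes q: "Ck n UNIV q" "bnd n UNIV (\<lambda>_. M) q" and g: "Ck (n + 2) UNIV g" "bnd (n + 2) UNIV (\<lambda>_. N) g"
  shows Ck_bcoef: "2 * k \<le> n + 2 \<Longrightarrow> Ck (n + 2 - 2 * k) UNIV (bcoef q g k)"
    and bnd_bcoef: "2 * k \<le> n + 2 \<Longrightarrow> bnd (n + 2 - 2 * k) UNIV (\<lambda>_. (3 + 2 ^ n * M) ^ k * N) (bcoef q g k)"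
proof -
  have M0: "M \<ge> 0" using order.trans[OF norm_ge_zero bnd_norm[OF q(2) UNIV_I]] .
  have N0: "N \<ge> 0" using order.trans[OF norm_ge_zero bnd_norm[OF g(2) UNIV_I]] .
  have "2 * k \<le> n + 2 \<Longrightarrow> Ck (n + 2 - 2 * k) UNIV (bcoef q g k) \<and> bnd (n + 2 - 2 * k) UNIV (\<lambda>_. (3 + 2 ^ n * M) ^ k * N) (bcoef q g k)"
  proof (induction k)
    case 0
    then show ?case using g by simp
  next
    case (Suc k)
    define j where "j = n - 2 * k"
    have j: "n + 2 - 2 * k = Suc (Suc j)" "n + 2 - 2 * Suc k = j" "j \<le> n" using Suc.prems by (auto simp: j_def)
    have IH: "Ck (Suc (Suc j)) UNIV (bcoef q g k)" "bnd (Suc (Suc j)) UNIV (\<lambda>_. (3 + 2 ^ n * M) ^ k * N) (bcoef q g k)"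
      using Suc unfolding j(1)[symmetric] by auto
    have qj: "Ck j UNIV q" "bnd j UNIV (\<lambda>_. M) q"
      using Ck_mono[OF q(1) j(3)] bnd_weaken[OF q(2) j(3), of UNIV] by auto
    have "bnd j UNIV (\<lambda>_. (3 + 2 ^ j * M) * ((3 + 2 ^ n * M) ^ k * N)) (bcoef q g (Suc k))"
      unfolding bcoef.simps by (intro bnd_tstep Ck_schr bnd_schr IH qj)
    then have "bnd j UNIV (\<lambda>_. (3 + 2 ^ n * M) ^ Suc k * N) (bcoef q g (Suc k))"
    proof (rule bnd_weaken)
      have "(3 + 2 ^ j * M) * ((3 + 2 ^ n * M) ^ k * N) \<le> (3 + 2 ^ n * M) * ((3 + 2 ^ n * M) ^ k * N)"
        using M0 N0 j(3) by (intro mult_right_mono add_left_mono power_increasing mult_nonneg_nonneg zero_le_power add_nonneg_nonneg) auto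
      then show "(3 + 2 ^ j * M) * ((3 + 2 ^ n * M) ^ k * N) \<le> (3 + 2 ^ n * M) ^ Suc k * N" by (simp add: mult.assoc)
    qed auto
    moreover have "Ck j UNIV (bcoef q g (Suc k))"
      unfolding bcoef.simps by (intro Ck_tstep Ck_schr IH qj)
    ultimately show ?case unfolding j(2) by blast
  qed
  then show "2 * k \<le> n + 2 \<Longrightarrow> Ck (n + 2 - 2 * k) UNIV (bcoef q g k)"
    "2 * k \<le> n + 2 \<Longrightarrow> bnd (n + 2 - 2 * k) UNIV (\<lambda>_. (3 + 2 ^ n * M) ^ k * N) (bcoef q g k)" by blast+
qed

lemma lapl_diff:
  assumes "Ck (Suc (Suc 0)) UNIV f" "Ck (Suc (Suc 0)) UNIV h"
  shows "lapl (\<lambda>x. f x - h x) x = lapl f x - lapl h x"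
proof -
  have "pd e (pd e (\<lambda>x. f x - h x)) x = pd e (pd e f) x - pd e (pd e h) x" if e: "e \<in> Basis" for e
  proof -
    have "pd e (\<lambda>x. f x - h x) = (\<lambda>x. pd e f x - pd e h x)"
      by (rule ext, rule pd_diff) (rule Ck_differentiable, rule assms)+
    then show ?thesis
      by (simp only:) (rule pd_diff; rule Ck_differentiable; rule Ck_pd[OF _ e]; rule assms)
  qed
  then show ?thesis by (simp add: lapl_def sum_subtractf)
qed

lemma schr_diff:
  assumes "Ck (Suc (Suc 0)) UNIV b1" "Ck (Suc (Suc 0)) UNIV b2"
  shows "schr q1 b1 x - schr q2 b2 x = schr q1 (\<lambda>x. b1 x - b2 x) x + (q1 x - q2 x) * b2 x"
  by (simp add: schr_def lapl_diff[OF assms] algebra_simps)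

text \<open>Rests on (Delta + q1) b1 - (Delta + q2) b2 = (Delta + q1) (b1 - b2) + (q1 - q2) b2: the
  old difference is propagated, and the new error carries the bound of a single coefficient.\<close>

lemma bnd_schr_diff:
  assumes b1: "Ck (Suc (Suc j)) UNIV b1" and b2: "Ck (Suc (Suc j)) UNIV b2" "bnd (Suc (Suc j)) UNIV (\<lambda>_. B) b2"
    and d: "bnd (Suc (Suc j)) UNIV (\<lambda>_. D) (\<lambda>x. b1 x - b2 x)"
    and q1: "Ck j UNIV q1" "bnd j UNIV (\<lambda>_. M) q1" and q2: "Ck j UNIV q2" "bnd j UNIV (\<lambda>_. \<delta>) (\<lambda>x. q1 x - q2 x)"
  shows "bnd j UNIV (\<lambda>_. (3 + 2 ^ j * M) * D + 2 ^ j * (\<delta> * B)) (\<lambda>x. schr q1 b1 x - schr q2 b2 x)"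
proof -
  have eq: "(\<lambda>x. schr q1 b1 x - schr q2 b2 x) = (\<lambda>x. schr q1 (\<lambda>x. b1 x - b2 x) x + (q1 x - q2 x) * b2 x)"
    by (rule ext, rule schr_diff) (rule Ck_mono[OF b1] Ck_mono[OF b2(1)], simp)+
  have b2j: "Ck j UNIV b2" "bnd j UNIV (\<lambda>_. B) b2"
    using Ck_mono[OF b2(1), of j] bnd_weaken[OF b2(2), of j UNIV] by auto
  show ?thesis unfolding eq
    by (intro bnd_add bnd_schr bnd_mult Ck_schr Ck_mult Ck_diff b1 b2 b2j d q1 q2)
qed

text \<open>Growth factor of the coefficient differences, per unit of the difference of the data.\<close>

primrec dcoef :: "nat \<Rightarrow> real \<Rightarrow> real \<Rightarrow> nat \<Rightarrow> real" where
  "dcoef n M N 0 = 1"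
| "dcoef n M N (Suc k) = (3 + 2 ^ n * M) * dcoef n M N k + 2 ^ n * ((3 + 2 ^ n * M) ^ k * N)"

lemma dcoef_nonneg: "M \<ge> 0 \<Longrightarrow> N \<ge> 0 \<Longrightarrow> dcoef n M N k \<ge> 0"
  by (induction k) (auto intro!: add_nonneg_nonneg mult_nonneg_nonneg)

text \<open>A single \<delta> measures the differences of both data, so that each step stays linear
  in it and the recursion for \<open>dcoef\<close> can be read off.\<close>

lemma bnd_bcoef_diff:
  assumes q1: "Ck n UNIV q1" "bnd n UNIV (\<lambda>_. M) q1" and q2: "Ck n UNIV q2" "bnd n UNIV (\<lambda>_. M) q2"
    and g1: "Ck (n + 2) UNIV g1" "bnd (n + 2) UNIV (\<lambda>_. N) g1" and g2: "Ck (n + 2) UNIV g2" "bnd (n + 2) UNIV (\<lambda>_. N) g2"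
    and dq: "bnd n UNIV (\<lambda>_. \<delta>) (\<lambda>x. q1 x - q2 x)" and dg: "bnd (n + 2) UNIV (\<lambda>_. \<delta>) (\<lambda>x. g1 x - g2 x)"
    and k: "2 * k \<le> n + 2"
  shows "bnd (n + 2 - 2 * k) UNIV (\<lambda>_. dcoef n M N k * \<delta>) (\<lambda>x. bcoef q1 g1 k x - bcoef q2 g2 k x)"
  using k
proof (induction k)
  case 0
  then show ?case using dg by simp
next
  case (Suc k)
  have M0: "M \<ge> 0" using order.trans[OF norm_ge_zero bnd_norm[OF q1(2) UNIV_I]] .
  have N0: "N \<ge> 0" using order.trans[OF norm_ge_zero bnd_norm[OF g1(2) UNIV_I]] .
  have \<delta>0: "\<delta> \<ge> 0" using order.trans[OF norm_ge_zero bnd_norm[OF dq UNIV_I]] .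
  define j where "j = n - 2 * k"
  have j: "n + 2 - 2 * k = Suc (Suc j)" "n + 2 - 2 * Suc k = j" "j \<le> n" and k': "2 * k \<le> n + 2"
    using Suc.prems by (auto simp: j_def)
  let ?K = "3 + 2 ^ n * M"
  note b1 = Ck_bcoef[OF q1 g1 k', unfolded j(1)] and b2 = Ck_bcoef[OF q2 g2 k', unfolded j(1)]
    and bb2 = bnd_bcoef[OF q2 g2 k', unfolded j(1)]
  note q1j = Ck_mono[OF q1(1) j(3)] bnd_weaken[OF q1(2) j(3) subset_UNIV order.refl]
  note q2j = Ck_mono[OF q2(1) j(3)] bnd_weaken[OF dq j(3) subset_UNIV order.refl]
  have IH: "bnd (Suc (Suc j)) UNIV (\<lambda>_. dcoef n M N k * \<delta>) (\<lambda>x. bcoef q1 g1 k x - bcoef q2 g2 k x)"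
    using Suc.IH[OF k'] unfolding j(1) .
  note s1 = Ck_schr[OF b1 q1j(1)] and s2 = Ck_schr[OF b2 q2j(1)]
  have eq: "(\<lambda>x. bcoef q1 g1 (Suc k) x - bcoef q2 g2 (Suc k) x) =
      tstep k (\<lambda>x. schr q1 (bcoef q1 g1 k) x - schr q2 (bcoef q2 g2 k) x)"
    unfolding bcoef.simps by (rule ext, rule tstep_diff) (rule Ck_continuous[OF s1], rule Ck_continuous[OF s2])
  have "bnd j UNIV (\<lambda>_. (3 + 2 ^ j * M) * (dcoef n M N k * \<delta>) + 2 ^ j * (\<delta> * (?K ^ k * N))) (\<lambda>x. bcoef q1 g1 (Suc k) x - bcoef q2 g2 (Suc k) x)"
    unfolding eq by (intro bnd_tstep Ck_diff s1 s2 bnd_schr_diff b1 b2 bb2 IH q1j q2j)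
  then have "bnd j UNIV (\<lambda>_. dcoef n M N (Suc k) * \<delta>) (\<lambda>x. bcoef q1 g1 (Suc k) x - bcoef q2 g2 (Suc k) x)"
  proof (rule bnd_weaken)
    have p: "(2::real) ^ j \<le> 2 ^ n" using j(3) by (intro power_increasing) auto
    have "(3 + 2 ^ j * M) * (dcoef n M N k * \<delta>) \<le> ?K * (dcoef n M N k * \<delta>)"
      by (intro mult_right_mono add_left_mono p M0 mult_nonneg_nonneg dcoef_nonneg N0 \<delta>0)
    moreover have "2 ^ j * (\<delta> * (?K ^ k * N)) \<le> 2 ^ n * (\<delta> * (?K ^ k * N))"
      using M0 by (intro mult_right_mono p mult_nonneg_nonneg N0 \<delta>0 zero_le_power add_nonneg_nonneg) auto
    ultimately show "(3 + 2 ^ j * M) * (dcoef n M N k * \<delta>) + 2 ^ j * (\<delta> * (?K ^ k * N)) \<le> dcoef n M N (Suc k) * \<delta>"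
      by (simp add: algebra_simps)
  qed auto
  then show ?case unfolding j(2) .
qed

section \<open>The wave operator on products with functions of rho\<close>

definition rho :: "spacetime \<Rightarrow> real" where
  "rho p = (snd p)\<^sup>2 - fst p \<bullet> fst p"

text \<open>The differential of \<open>rho\<close> at \<open>p\<close> in direction
  \<open>v\<close>, twice the Lorentz product of the two. It is also linear in \<open>p\<close>, so
  the second derivative of \<open>rho\<close> in direction \<open>b\<close> is the constant
  \<open>drho b b\<close>.\<close>

definition drho :: "spacetime \<Rightarrow> spacetime \<Rightarrow> real" where
  "drho p v = 2 * snd p * snd v - 2 * (fst p \<bullet> fst v)"

lemma rho_has_derivative: "(rho has_derivative drho p) (at p)"
  unfolding rho_def[abs_def] drho_def[abs_def]
  by (auto intro!: derivative_eq_intros simp: inner_commute algebra_simps)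

lemma Ck_coord: "bounded_linear L \<Longrightarrow> Ck k UNIV (\<lambda>p. complex_of_real (L p))"
  by (rule Ck_bounded_linear[OF bounded_linear_compose[OF bounded_linear_of_real]])

lemma Ck_rho: "Ck k UNIV (\<lambda>p. complex_of_real (rho p))"
proof -
  have "Ck k UNIV (\<lambda>p::spacetime. complex_of_real (snd p) ^ 2 - of_real (fst p \<bullet> fst p))"
    by (intro Ck_diff Ck_power Ck_coord bounded_linear_snd Ck_fst[OF Ck_inner_self])
  then show ?thesis by (simp add: rho_def)
qed

lemma Ck_drho: "Ck k UNIV (\<lambda>p. complex_of_real (drho p v))"
proof (rule Ck_coord)
  show "bounded_linear (\<lambda>p. drho p v)"
    unfolding drho_def
    by (intro bounded_linear_sub bounded_linear_mult_const bounded_linear_const_mult bounded_linear_snd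
        bounded_linear_compose[OF bounded_linear_inner_left bounded_linear_fst])
qed

lemma pd_drho: "pd w (\<lambda>p. complex_of_real (drho p v)) p = of_real (drho w v)"
proof -
  have "bounded_linear (\<lambda>p. complex_of_real (drho p v))"
    unfolding drho_def
    by (intro bounded_linear_compose[OF bounded_linear_of_real] bounded_linear_sub bounded_linear_mult_const bounded_linear_const_mult bounded_linear_snd
        bounded_linear_compose[OF bounded_linear_inner_left bounded_linear_fst])
  from pd_eq[OF bounded_linear_imp_has_derivative[OF this]] show ?thesis .
qed

lemma compose_rho_has_derivative:
  fixes h :: "real \<Rightarrow> complex"
  assumes h: "Ck (Suc k) UNIV h"
  shows "((\<lambda>p. h (rho p)) has_derivative (\<lambda>v. of_real (drho p v) * pd 1 h (rho p))) (at p)"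
proof -
  have lin: "pd r h z = of_real r * pd 1 h z" for r z
  proof -
    have "pd (r *\<^sub>R 1) h z = r *\<^sub>R pd 1 h z"
      by (rule linear_scale[OF has_derivative_linear[OF Ck_has_derivative[OF h]]])
    then show ?thesis unfolding real_scaleR_def mult_1_right scaleR_conv_of_real .
  qed
  have eq: "(\<lambda>v. pd (drho p v) h (rho p)) = (\<lambda>v. of_real (drho p v) * pd 1 h (rho p))"
    by (rule ext) (rule lin)
  show ?thesis
    using has_derivative_compose[OF rho_has_derivative Ck_has_derivative[OF h], of p] unfolding eq .
qed

lemma Ck_compose_rho: "Ck k UNIV h \<Longrightarrow> Ck k UNIV (\<lambda>p. h (rho p))"
  by (rule Ck_compose_real[OF _ Ck_rho])

lemma pd_pd_mult_rho:
  fixes h :: "real \<Rightarrow> complex"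
  assumes \<Phi>: "Ck 2 UNIV \<Phi>" and h: "Ck 2 UNIV h" and b: "b \<in> Basis"
  shows "pd b (pd b (\<lambda>p. \<Phi> p * h (rho p))) p = pd b (pd b \<Phi>) p * h (rho p)
    + 2 * (of_real (drho p b) * pd b \<Phi> p) * pd 1 h (rho p)
    + \<Phi> p * ((of_real (drho p b))\<^sup>2 * pd 1 (pd 1 h) (rho p) + of_real (drho b b) * pd 1 h (rho p))"
proof -
  note \<Phi>2 = \<Phi>[unfolded numeral_2_eq_2] and h2 = h[unfolded numeral_2_eq_2]
  have h1: "Ck (Suc 0) UNIV (pd 1 h)" by (rule Ck_pd[OF h2]) simp
  note \<Phi>1 = Ck_pd[OF \<Phi>2 b]
  have 1: "pd b (\<lambda>p. \<Phi> p * h (rho p)) = (\<lambda>p. \<Phi> p * (of_real (drho p b) * pd 1 h (rho p)) + pd b \<Phi> p * h (rho p))"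
    by (rule ext, rule pd_eq[OF has_derivative_mult[OF Ck_has_derivative[OF \<Phi>2] compose_rho_has_derivative[OF h2]]])
  have D: "((\<lambda>p. complex_of_real (drho p b)) has_derivative (\<lambda>v. of_real (drho v b))) (at p)"
    using Ck_has_derivative[OF Ck_drho, of b p] unfolding pd_drho .
  show ?thesis unfolding 1
    by (rule trans[OF pd_eq[OF has_derivative_add[OF has_derivative_mult[OF Ck_has_derivative[OF \<Phi>2] has_derivative_mult[OF D compose_rho_has_derivative[OF h1]]]
        has_derivative_mult[OF Ck_has_derivative[OF \<Phi>1] compose_rho_has_derivative[OF h2]]]]])
      (simp add: algebra_simps power2_eq_square)
qed

lemma sum_Basis_spacetime:
  fixes f :: "spacetime \<Rightarrow> complex"
  shows "(\<Sum>b\<in>Basis. f b) = (\<Sum>e\<in>Basis. f (e, 0)) + f (0, 1)"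
proof -
  have inj: "inj_on (\<lambda>u. (u, 0) :: spacetime) Basis" by (auto intro!: inj_onI)
  have eq: "(Basis :: spacetime set) = insert (0, 1) ((\<lambda>u. (u, 0)) ` Basis)"
    by (auto simp: Basis_prod_def)
  have "(0, 1) \<notin> (\<lambda>u. (u, 0) :: spacetime) ` Basis" by auto
  from sum.insert[OF _ this, of f]
  have "(\<Sum>b\<in>Basis. f b) = f (0, 1) + (\<Sum>b\<in>(\<lambda>u. (u, 0)) ` Basis. f b)"
    unfolding eq by simp
  then show ?thesis by (simp add: sum.reindex[OF inj] add.commute)
qed

lemma pd_radial_sum:
  assumes "Ck (Suc k) UNIV (\<Phi> :: spacetime \<Rightarrow> complex)"
  shows "pd p \<Phi> z = (\<Sum>e\<in>Basis. of_real (fst p \<bullet> e) * pd (e, 0) \<Phi> z) + of_real (snd p) * pd (0, 1) \<Phi> z"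
  unfolding pd_linear_sum[OF Ck_differentiable[OF assms], of p]
  by (subst sum_Basis_spacetime) (simp add: inner_prod_def scaleR_conv_of_real)

lemma laplace_sum_algebra:
  fixes A X D :: "real^3 \<Rightarrow> complex"
  shows "(\<Sum>e\<in>Basis. A e * h - 4 * (X e * D e) * h' + f * (4 * (X e)\<^sup>2 * h'' - 2 * h')) =
    (\<Sum>e\<in>Basis. A e) * h - 4 * (\<Sum>e\<in>Basis. X e * D e) * h' + f * (4 * (\<Sum>e\<in>Basis. (X e)\<^sup>2) * h'' - 6 * h')"
proof -
  have "(\<Sum>e\<in>Basis. A e * h - 4 * (X e * D e) * h' + f * (4 * (X e)\<^sup>2 * h'' - 2 * h')) =
     (\<Sum>e\<in>Basis. A e * h - (X e * D e) * (4 * h') + ((X e)\<^sup>2 * (4 * f * h'') - 2 * f * h'))"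
    by (rule sum.cong) (simp_all add: algebra_simps)
  also have "\<dots> = (\<Sum>e\<in>Basis. A e) * h - (\<Sum>e\<in>Basis. X e * D e) * (4 * h') +
     ((\<Sum>e\<in>Basis. (X e)\<^sup>2) * (4 * f * h'') - (\<Sum>e\<in>(Basis :: (real^3) set). 2 * f * h'))"
    by (simp only: sum.distrib sum_subtractf sum_distrib_right)
  finally show ?thesis by (simp add: algebra_simps)
qed

text \<open>The constants are those of \<open>rho\<close>: (d_t rho)^2 - |grad rho|^2 = 4 rho, and
  the wave operator sends \<open>rho\<close> to 2 + 6 = 8. The cross term is four times the Euler
  field t d_t + x . grad applied to \<Phi>, written \<open>pd p \<Phi> p\<close>.\<close>

lemma box_mult_rho:
  fixes h :: "real \<Rightarrow> complex"
  assumes \<Phi>: "Ck 2 UNIV \<Phi>" and h: "Ck 2 UNIV h"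
  shows "wave_op (\<lambda>p. \<Phi> p * h (rho p)) p = wave_op \<Phi> p * h (rho p)
    + \<Phi> p * (4 * of_real (rho p) * pd 1 (pd 1 h) (rho p) + 8 * pd 1 h (rho p)) + 4 * pd p \<Phi> p * pd 1 h (rho p)"
proof -
  let ?h = "h (rho p)" and ?h' = "pd 1 h (rho p)" and ?h'' = "pd 1 (pd 1 h) (rho p)"
  have xx: "(\<Sum>e\<in>Basis. (of_real (fst p \<bullet> e))\<^sup>2) = complex_of_real (fst p \<bullet> fst p)"
    by (subst euclidean_inner) (simp add: power2_eq_square)
  have t: "pd_t (pd_t (\<lambda>p. \<Phi> p * h (rho p))) p = pd_t (pd_t \<Phi>) p * ?h + 4 * (of_real (snd p) * pd (0,1) \<Phi> p) * ?h'
      + \<Phi> p * (4 * of_real ((snd p)\<^sup>2) * ?h'' + 2 * ?h')"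
    unfolding pd_t_def pd_pd_mult_rho[OF \<Phi> h Basis_t] by (simp add: drho_def power_mult_distrib)
  have "laplace_x (\<lambda>p. \<Phi> p * h (rho p)) p = (\<Sum>e\<in>Basis. pd (e,0) (pd (e,0) \<Phi>) p * ?h
      - 4 * (of_real (fst p \<bullet> e) * pd (e,0) \<Phi> p) * ?h' + \<Phi> p * (4 * (of_real (fst p \<bullet> e))\<^sup>2 * ?h'' - 2 * ?h'))"
    unfolding laplace_x_def
  proof (rule sum.cong[OF refl])
    fix e :: "real^3" assume e: "e \<in> Basis"
    have "e \<bullet> e = 1" using e by simp
    then show "pd (e,0) (pd (e,0) (\<lambda>p. \<Phi> p * h (rho p))) p = pd (e,0) (pd (e,0) \<Phi>) p * ?h
      - 4 * (of_real (fst p \<bullet> e) * pd (e,0) \<Phi> p) * ?h' + \<Phi> p * (4 * (of_real (fst p \<bullet> e))\<^sup>2 * ?h'' - 2 * ?h')"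
      unfolding pd_pd_mult_rho[OF \<Phi> h Basis_x[OF e]] by (simp add: drho_def power_mult_distrib)
  qed
  also have "\<dots> = laplace_x \<Phi> p * ?h - 4 * (\<Sum>e\<in>Basis. of_real (fst p \<bullet> e) * pd (e,0) \<Phi> p) * ?h'
      + \<Phi> p * (4 * of_real (fst p \<bullet> fst p) * ?h'' - 6 * ?h')"
    unfolding laplace_x_def xx[symmetric] by (rule laplace_sum_algebra)
  finally have x: "laplace_x (\<lambda>p. \<Phi> p * h (rho p)) p = \<dots>" .
  show ?thesis
    unfolding wave_op_def t x pd_radial_sum[OF \<Phi>[unfolded numeral_2_eq_2], where p=p and z=p]
    by (simp add: rho_def algebra_simps)
qed

lemma pd_box_fst:
  assumes b: "Ck (Suc (Suc 0)) UNIV b"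
  shows "wave_op (\<lambda>p. b (fst p)) p = - lapl b (fst p)" "pd p (\<lambda>p. b (fst p)) p = pd (fst p) b (fst p)"
proof -
  have "pd_t (\<lambda>p. b (fst p)) = (\<lambda>p. 0)"
    unfolding pd_t_def pd_fst[OF b] by (simp add: pd_zero_direction[OF b])
  then have t: "pd_t (pd_t (\<lambda>p. b (fst p))) p = 0" by (simp add: pd_t_def)
  have "pd (e,0) (pd (e,0) (\<lambda>p::spacetime. b (fst p))) p = pd e (pd e b) (fst p)" if "e \<in> Basis" for e
    unfolding pd_fst[OF b] fst_conv pd_fst[OF Ck_pd[OF b that]] ..
  then show "wave_op (\<lambda>p. b (fst p)) p = - lapl b (fst p)"
    by (simp add: wave_op_def t laplace_x_def lapl_def)
  show "pd p (\<lambda>p. b (fst p)) p = pd (fst p) b (fst p)" unfolding pd_fst[OF b] ..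
qed

lemma box_add:
  assumes "Ck 2 UNIV f" "Ck 2 UNIV g"
  shows "wave_op (\<lambda>p. f p + g p) p = wave_op f p + wave_op g p"
proof -
  note f = assms(1)[unfolded numeral_2_eq_2] and g = assms(2)[unfolded numeral_2_eq_2]
  have pp: "pd b (pd b (\<lambda>p. f p + g p)) p = pd b (pd b f) p + pd b (pd b g) p" if b: "b \<in> Basis" for b
  proof -
    have "pd b (\<lambda>p. f p + g p) = (\<lambda>p. pd b f p + pd b g p)"
      by (rule ext, rule pd_add) (rule Ck_differentiable, rule f g)+
    then show ?thesis
      by (simp only:) (rule pd_add; rule Ck_differentiable; rule Ck_pd[OF _ b]; rule f g)
  qed
  show ?thesis unfolding wave_op_def pd_t_def laplace_x_def
    by (simp add: pp sum.distrib algebra_simps)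
qed

lemma Ck_of_real_power: "Ck k UNIV (\<lambda>z::real. complex_of_real z ^ n)"
  by (intro Ck_power Ck_coord bounded_linear_ident)

lemma pd_of_real_power: "pd 1 (\<lambda>z::real. complex_of_real z ^ n) = (\<lambda>z. of_nat n * complex_of_real z ^ (n - 1))"
proof (rule ext, rule pd_eq[THEN trans])
  fix z :: real
  have d: "((\<lambda>z. complex_of_real z) has_derivative (\<lambda>h. of_real h)) (at z)"
    by (rule bounded_linear_imp_has_derivative[OF bounded_linear_of_real])
  show "((\<lambda>z. complex_of_real z ^ n) has_derivative (\<lambda>y. of_nat n * of_real y * complex_of_real z ^ (n - 1))) (at z)"
    by (rule has_derivative_power[OF d])
qed simp

text \<open>For h = z^(j+1) the expression 4 z h'' + 8 h' equals 4 (j + 1) (j + 2) z^j, and on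
  functions of x alone the Euler field is x . grad. This is the transport operator that
  \<open>tstep\<close> inverts.\<close>

lemma box_coefficient_term:
  assumes b: "Ck 2 UNIV b"
  shows "wave_op (\<lambda>p. b (fst p) * of_real (rho p) ^ Suc j) p = - lapl b (fst p) * of_real (rho p) ^ Suc j
    + 4 * of_nat (Suc j) * (pd (fst p) b (fst p) + of_nat (j + 2) * b (fst p)) * of_real (rho p) ^ j"
proof -
  let ?r = "complex_of_real (rho p)"
  have 2: "pd 1 (pd 1 (\<lambda>z::real. complex_of_real z ^ Suc j)) z = of_nat (Suc j) * (of_nat j * of_real z ^ (j - 1))" for z
    unfolding pd_of_real_power diff_Suc_1
    by (subst pd_cmult[OF Ck_differentiable[OF Ck_of_real_power]]) (simp add: pd_of_real_power)
  have d1: "pd 1 (\<lambda>z::real. complex_of_real z ^ Suc j) z = of_nat (Suc j) * of_real z ^ j" for z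
    unfolding pd_of_real_power diff_Suc_1 ..

  show ?thesis
    unfolding box_mult_rho[OF Ck_fst[OF b] Ck_of_real_power] pd_box_fst[OF b[unfolded numeral_2_eq_2]] 2 d1
    by (cases j) (simp_all add: algebra_simps)
qed

definition approx :: "(real^3 \<Rightarrow> complex) \<Rightarrow> (real^3 \<Rightarrow> complex) \<Rightarrow> nat \<Rightarrow> spacetime \<Rightarrow> complex" where
  "approx q g m p = (\<Sum>k\<le>m. bcoef q g k (fst p) * of_real (rho p) ^ k)"

lemma Ck_approx:
  "(\<And>k. k \<le> m \<Longrightarrow> Ck j UNIV (bcoef q g k)) \<Longrightarrow> Ck j UNIV (approx q g m)"
  unfolding approx_def[abs_def] by (intro Ck_sum Ck_mult Ck_fst Ck_power Ck_rho) auto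

text \<open>The transport equations make the residual telescope.\<close>

lemma box_approx:
  assumes "\<And>k. k \<le> m \<Longrightarrow> Ck 2 UNIV (bcoef q g k)" "\<And>k. k < m \<Longrightarrow> Ck (Suc 0) UNIV (schr q (bcoef q g k))"
  shows "wave_op (approx q g m) p - q (fst p) * approx q g m p = - schr q (bcoef q g m) (fst p) * of_real (rho p) ^ m"
  using assms
proof (induction m)
  case 0
  have "approx q g 0 = (\<lambda>p. g (fst p))" by (simp add: approx_def[abs_def])
  with 0 show ?case by (simp add: pd_box_fst(1) schr_def numeral_2_eq_2 del: Ck.simps)
next
  case (Suc m)
  let ?b = "bcoef q g (Suc m)" and ?r = "complex_of_real (rho p)"
  have eq: "approx q g (Suc m) = (\<lambda>p. approx q g m p + ?b (fst p) * of_real (rho p) ^ Suc m)"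
    by (simp add: approx_def[abs_def])
  have b: "Ck 2 UNIV ?b" using Suc.prems(1) by blast
  have "Ck 2 UNIV (approx q g m)" by (rule Ck_approx) (use Suc.prems(1) in auto)
  moreover have "Ck 2 UNIV (\<lambda>p. ?b (fst p) * of_real (rho p) ^ Suc m)"
    by (intro Ck_mult Ck_fst Ck_power Ck_rho b)
  ultimately have "wave_op (approx q g (Suc m)) p = wave_op (approx q g m) p + wave_op (\<lambda>p. ?b (fst p) * of_real (rho p) ^ Suc m) p"
    unfolding eq by (rule box_add)
  moreover have "wave_op (approx q g m) p - q (fst p) * approx q g m p = - schr q (bcoef q g m) (fst p) * ?r ^ m"
    by (rule Suc.IH) (use Suc.prems in auto)
  then have "wave_op (approx q g m) p = q (fst p) * approx q g m p - schr q (bcoef q g m) (fst p) * ?r ^ m"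
    by (simp add: algebra_simps)
  moreover have tr: "4 * of_nat (Suc m) * (pd (fst p) ?b (fst p) + of_nat (m + 2) * ?b (fst p)) = schr q (bcoef q g m) (fst p)"
    unfolding bcoef.simps by (rule tstep_euler) (use Suc.prems(2) in auto)
  ultimately have "wave_op (approx q g (Suc m)) p = q (fst p) * approx q g m p - lapl ?b (fst p) * ?r ^ Suc m"
    unfolding box_coefficient_term[OF b] tr by (simp del: bcoef.simps)
  then show ?case
    unfolding fun_cong[OF eq, of p] schr_def[of q ?b]
    by (simp add: algebra_simps del: bcoef.simps)
qed

section \<open>Powers of rho, continued by zero outside the forward cone\<close>

definition cpow :: "nat \<Rightarrow> spacetime \<Rightarrow> complex" where
  "cpow m p = (if p \<in> closed_cone then of_real (rho p) ^ m else 0)"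

lemma csupp_cpow: "csupp (cpow m)"
  by (simp add: csupp_def cpow_def)

lemma mem_closed_cone: "p \<in> closed_cone \<longleftrightarrow> norm (fst p) \<le> snd p"
  and mem_open_cone: "p \<in> open_cone \<longleftrightarrow> norm (fst p) < snd p"
  by (cases p; simp add: closed_cone_def open_cone_def)+

lemma rho_factor: "rho p = (snd p - norm (fst p)) * (snd p + norm (fst p))"
  by (simp add: rho_def power2_norm_eq_inner[symmetric] power2_eq_square algebra_simps)

lemma open_open_cone: "open open_cone"
proof -
  have eq: "open_cone = {p. norm (fst p) < snd p}" using mem_open_cone by blast
  show ?thesis unfolding eq by (intro open_Collect_less continuous_intros)
qed

text \<open>In the factorization rho = (t - |x|) (t + |x|), continuation by zero means taking the
  positive part of the first factor.\<close>

lemma continuous_cpow: "m \<ge> 1 \<Longrightarrow> continuous_on UNIV (cpow m)"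
proof -
  assume m: "m \<ge> 1"
  have "cpow m p = of_real (max 0 (snd p - norm (fst p)) * (snd p + norm (fst p))) ^ m" for p
    using m by (simp add: cpow_def mem_closed_cone rho_factor max_def)
  then have "cpow m = (\<lambda>p. of_real (max 0 (snd p - norm (fst p)) * (snd p + norm (fst p))) ^ m)" ..
  then show ?thesis by (simp only:) (intro continuous_intros)
qed

text \<open>On the light cone, vertex included, the cut-off power is dominated by the full power,
  whose derivative vanishes there because the exponent is at least 2.\<close>

lemma has_derivative_cpow:
  "(cpow (Suc (Suc m)) has_derivative (\<lambda>v. of_real (drho p v) * (of_nat (Suc (Suc m)) * cpow (Suc m) p))) (at p)"
proof -
  let ?m = "Suc (Suc m)" and ?f = "\<lambda>p. complex_of_real (rho p) ^ Suc (Suc m)"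
  have f: "(?f has_derivative (\<lambda>v. of_real (drho p v) * (of_nat ?m * complex_of_real (rho p) ^ Suc m))) (at p)"
    using compose_rho_has_derivative[OF Ck_of_real_power, of ?m p] unfolding pd_of_real_power by simp
  consider "p \<in> open_cone" | "p \<notin> closed_cone" | "norm (fst p) = snd p"
    unfolding mem_open_cone mem_closed_cone by linarith
  then show ?thesis
  proof cases
    case 1
    then have "cpow (Suc m) p = of_real (rho p) ^ Suc m" by (simp add: cpow_def mem_open_cone mem_closed_cone)
    then show ?thesis
      using has_derivative_transform_within_open[OF f open_open_cone 1, of "cpow ?m"]
      by (auto simp: cpow_def mem_open_cone mem_closed_cone)
  next
    case 2
    have "((\<lambda>p. 0) has_derivative (\<lambda>v. 0)) (at p)" by simp
    then have "(cpow ?m has_derivative (\<lambda>v. 0)) (at p)"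
      by (rule has_derivative_transform_within_open[where s="- closed_cone"])
        (use 2 closed_closed_cone in \<open>auto simp: cpow_def\<close>)
    then show ?thesis using 2 by (simp add: cpow_def)
  next
    case 3
    then have r0: "rho p = 0" by (simp add: rho_factor)
    have "(\<lambda>h. norm (?f (p + h) - ?f p - 0) / norm h) \<midarrow>0\<rightarrow> 0"
      using f unfolding r0 has_derivative_at by simp
    then have "(\<lambda>h. norm (cpow ?m (p + h) - cpow ?m p - 0) / norm h) \<midarrow>0\<rightarrow> 0"
    proof (rule Lim_null_comparison[rotated], intro always_eventually allI)
      fix h
      have nb: "norm (cpow ?m (p + h)) \<le> norm (?f (p + h))" by (simp add: cpow_def)
      have c0: "cpow ?m p = 0" "?f p = 0" using r0 by (simp_all add: cpow_def)
      show "norm (norm (cpow ?m (p + h) - cpow ?m p - 0) / norm h) \<le> norm (?f (p + h) - ?f p - 0) / norm h"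
        unfolding c0 diff_0_right real_norm_def abs_divide abs_norm_cancel by (rule divide_right_mono[OF nb norm_ge_zero])
    qed
    moreover have "cpow (Suc m) p = 0" using r0 by (simp add: cpow_def)
    ultimately show ?thesis unfolding has_derivative_at by simp
  qed
qed

lemma Ck_cpow: "k < m \<Longrightarrow> Ck k UNIV (cpow m)"
proof (induction k arbitrary: m)
  case 0
  then show ?case using continuous_cpow[of m] by simp
next
  case (Suc k)
  then obtain j where m: "m = Suc (Suc j)" by (metis less_Suc_eq_0_disj old.nat.exhaust not_less_zero)
  show ?case unfolding m
    by (rule Ck_Suc_UNIV_I[OF has_derivative_cpow]) (use Suc m in \<open>intro Ck_mult Ck_drho Ck_const Suc.IH, simp\<close>)
qed

lemma pd_cpow: "pd b (cpow (Suc (Suc m))) = (\<lambda>p. of_real (drho p b) * (of_nat (Suc (Suc m)) * cpow (Suc m) p))"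
  by (rule ext, rule pd_eq[OF has_derivative_cpow])

lemma bnd_csupp:
  assumes "csupp f" "bnd k closed_cone \<beta> f" "\<And>p. 0 \<le> \<beta> p"
  shows "bnd k UNIV \<beta> f"
  by (rule bnd_extend_zero[OF assms(2), of "- closed_cone"])
    (use assms closed_closed_cone in \<open>auto simp: csupp_def\<close>)

text \<open>The derivatives of \<open>rho\<close> grow linearly in |x| and t; inside the cone |x| <=
  t, so exp t absorbs the growth.\<close>

lemma bnd_drho:
  assumes b: "b \<in> Basis"
  shows "bnd k closed_cone (wt 2 1) (\<lambda>p. complex_of_real (drho p b))"
proof -
  have ab: "\<bar>drho p b\<bar> \<le> 2 * snd p" if "p \<in> closed_cone" for p
  proof -
    from b consider e where "e \<in> Basis" "b = (e, 0)" | "b = (0, 1)" by (auto simp: Basis_prod_def)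
    then show ?thesis
    proof cases
      case 1
      then show ?thesis using Basis_le_norm[OF 1(1), of "fst p"] that by (simp add: drho_def mem_closed_cone)
    next
      case 2
      then show ?thesis using that norm_ge_zero[of "fst p"] by (simp add: drho_def mem_closed_cone del: norm_ge_zero)
    qed
  qed
  have sp: "0 \<le> snd p" if "p \<in> closed_cone" for p
    using that norm_ge_zero[of "fst p"] unfolding mem_closed_cone by linarith
  have n: "norm (complex_of_real (drho p b)) \<le> wt 2 1 p" if "p \<in> closed_cone" for p
  proof -
    have "\<bar>drho p b\<bar> \<le> 2 * snd p" by (rule ab[OF that])
    also have "\<dots> \<le> 2 * exp (snd p)" using exp_ge_add_one_self[of "snd p"] by linarith
    finally show ?thesis by simp
  qed
  show ?thesis
  proof (cases k)
    case (Suc j)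
    have "bnd j closed_cone (wt 2 1) (pd c (\<lambda>p. complex_of_real (drho p b)))" if c: "c \<in> Basis" for c
    proof -
      have "\<bar>drho c b\<bar> \<le> 2"
      proof -
        \<comment> \<open>Reversing the space component turns the Lorentz product into a Euclidean
          one, so that the Cauchy-Schwarz inequality applies.\<close>
        have eq: "drho c b = 2 * (c \<bullet> (- fst b, snd b))" by (simp add: drho_def inner_prod_def algebra_simps)
        have "norm (- fst b, snd b) = norm b" by (simp add: norm_prod_def)
        then have "\<bar>c \<bullet> (- fst b, snd b)\<bar> \<le> 1"
          using Cauchy_Schwarz_ineq2[of c "(- fst b, snd b)"] b c by simp
        then show ?thesis unfolding eq by simp
      qed
      then have "bnd j closed_cone (\<lambda>p. 2) (\<lambda>p. complex_of_real (drho c b))"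
        by (intro bnd_const) simp
      then have "bnd j closed_cone (wt 2 1) (\<lambda>p. complex_of_real (drho c b))"
        by (rule bnd_weaken) (use sp in auto)
      then show ?thesis by (simp add: pd_drho[abs_def])
    qed
    then show ?thesis unfolding Suc bnd_Suc using n by blast
  qed (use n in simp)
qed

text \<open>Inside the cone the growth is polynomial in t; an exponential weight absorbs it, so that
  the source fits the weighted iteration. Each derivative brings a factor \<open>drho\<close>, for
  which the weight is raised.\<close>

lemma bnd_cpow: "k < m \<Longrightarrow> \<exists>A\<ge>0. \<exists>L\<ge>0. bnd k UNIV (wt A L) (cpow m)"
proof (induction k arbitrary: m)
  case 0
  have "norm (cpow m p) \<le> wt 1 (2 * m) p" if "p \<in> closed_cone" for p
  proof -
    have np: "norm (fst p) \<le> snd p" and sp: "0 \<le> snd p"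
      using that norm_ge_zero[of "fst p"] unfolding mem_closed_cone by linarith+
    have "0 \<le> rho p" using np sp by (simp add: rho_factor)
    moreover have "rho p \<le> (snd p)\<^sup>2" by (simp add: rho_def)
    ultimately have "norm (cpow m p) \<le> ((snd p)\<^sup>2) ^ m"
      using that by (simp add: cpow_def norm_power power_mono)
    also have "\<dots> \<le> ((exp (snd p))\<^sup>2) ^ m"
    proof (intro power_mono)
      show "snd p \<le> exp (snd p)" using exp_ge_add_one_self[of "snd p"] by linarith
    qed (use sp in auto)
    also have "\<dots> = exp (real (2 * m) * snd p)"
      by (simp only: exp_of_nat_mult power_mult)
    finally show ?thesis by simp
  qed
  then have "bnd 0 UNIV (wt 1 (2 * m)) (cpow m)"
    by (intro bnd_csupp csupp_cpow) auto
  then show ?case by (intro exI[of _ 1] exI[of _ "real (2 * m)"] conjI) auto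
next
  case (Suc k)
  then obtain j where m: "m = Suc (Suc j)" by (metis less_Suc_eq_0_disj old.nat.exhaust not_less_zero)
  obtain A L where A: "A \<ge> 0" "L \<ge> 0" "bnd k UNIV (wt A L) (cpow (Suc j))"
    using Suc.IH[of "Suc j"] Suc.prems m by auto
  obtain A0 L0 where A0: "A0 \<ge> 0" "L0 \<ge> 0" "bnd k UNIV (wt A0 L0) (cpow m)"
    using Suc.IH[of m] Suc.prems by auto
  have sp: "0 \<le> snd p" if "p \<in> closed_cone" for p
    using that norm_ge_zero[of "fst p"] unfolding mem_closed_cone by linarith
  let ?A = "A0 + 2 ^ k * (2 * (real m * A))" and ?L = "L0 + (1 + L)"
  have mono: "wt B l p \<le> wt C l' p" if "p \<in> closed_cone" "0 \<le> B" "B \<le> C" "l \<le> l'" for B C l l' p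
    using that sp[OF that(1)] by (intro mult_mono) (auto intro: mult_right_mono)
  have "bnd k UNIV (wt ?A ?L) (pd b (cpow m))" if b: "b \<in> Basis" for b
  proof (rule bnd_csupp)
    have Cj: "Ck k UNIV (cpow (Suc j))" using Suc.prems m by (intro Ck_cpow) simp
    have "bnd k closed_cone (\<lambda>p. norm (of_nat m :: complex) * wt A L p) (\<lambda>p. of_nat m * cpow (Suc j) p)"
      by (intro bnd_cmult Cj bnd_weaken[OF A(3)]) auto
    then have "bnd k closed_cone (\<lambda>p. 2 ^ k * (wt 2 1 p * (norm (of_nat m :: complex) * wt A L p))) (pd b (cpow m))"
      unfolding m pd_cpow by (intro bnd_mult Ck_drho Ck_cmult Cj bnd_drho b)
    then show "bnd k closed_cone (wt ?A ?L) (pd b (cpow m))"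
    proof (rule bnd_weaken)
      fix p assume p: "p \<in> closed_cone"
      have "2 ^ k * (wt 2 1 p * (norm (of_nat m :: complex) * wt A L p)) = wt (2 ^ k * (2 * (real m * A))) (1 + L) p"
        by (simp add: exp_add algebra_simps)
      also have "\<dots> \<le> wt ?A ?L p" by (rule mono[OF p]) (use A A0 in auto)
      finally show "2 ^ k * (wt 2 1 p * (norm (of_nat m :: complex) * wt A L p)) \<le> wt ?A ?L p" .
    qed auto
    show "csupp (pd b (cpow m))" by (rule csupp_pd[OF csupp_cpow])
    show "0 \<le> wt ?A ?L p" for p using A A0 by simp
  qed
  moreover have "norm (cpow m p) \<le> wt ?A ?L p" for p
  proof (cases "p \<in> closed_cone")
    case True
    have "norm (cpow m p) \<le> wt A0 L0 p" by (rule bnd_norm[OF A0(3) UNIV_I])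
    also have "\<dots> \<le> wt ?A ?L p" by (rule mono[OF True]) (use A A0 in auto)
    finally show ?thesis .
  next
    case False
    then show ?thesis using A A0 by (simp add: cpow_def)
  qed
  ultimately have "bnd (Suc k) UNIV (wt ?A ?L) (cpow m)" unfolding bnd_Suc by blast
  then show ?case using A A0 by (intro exI[of _ ?A] exI[of _ ?L] conjI) auto
qed

section \<open>Weak solutions and cutoffs\<close>

lemma test_function_D:
  assumes "test_function U \<phi>"
  obtains K where "compact K" "K \<subseteq> U" "smooth \<phi>" "bsupp \<phi>" "\<And>p. p \<notin> K \<Longrightarrow> \<phi> p = 0" "\<And>p. p \<notin> K \<Longrightarrow> wave_op \<phi> p = 0"
proof -
  let ?K = "closure {p. \<phi> p \<noteq> 0}"
  have K: "compact ?K" "?K \<subseteq> U" and sm: "smooth \<phi>"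
    using assms by (auto simp: test_function_def smooth_def)
  have z: "\<phi> p = 0" if "p \<notin> ?K" for p
    using that closure_subset[of "{p. \<phi> p \<noteq> 0}"] by blast
  obtain R where R: "\<And>p. p \<in> ?K \<Longrightarrow> norm p \<le> R"
    using compact_imp_bounded[OF K(1)] unfolding bounded_iff by blast
  have bs: "bsupp \<phi>" unfolding bsupp_def
  proof (intro exI[of _ R] allI impI)
    fix p :: spacetime assume "norm p > R"
    then have "p \<notin> ?K" using R[of p] by linarith
    then show "\<phi> p = 0" by (rule z)
  qed
  have op: "open (- ?K)" by (rule open_Compl[OF closed_closure])
  have zb: "wave_op \<phi> p = 0" if "p \<notin> ?K" for p
  proof -
    have p: "p \<in> - ?K" unfolding Compl_iff by (rule that)
    have z': "\<phi> x = 0" if "x \<in> - ?K" for x by (rule z[OF ComplD[OF that]])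
    have "pd b (pd b \<phi>) p = 0" for b
      using pdl_vanish[where f=\<phi> and l="[b, b]", OF op z' p] unfolding pdl_simps .
    then show ?thesis by (simp add: wave_op_def pd_t_def laplace_x_def)
  qed
  show thesis by (rule that[OF K sm bs z zb])
qed

lemma weak_wave_solution_box:
  "weak_wave_solution U q u \<longleftrightarrow> (\<forall>\<phi>. test_function U \<phi> \<longrightarrow> (\<integral>p. u p * (wave_op \<phi> p - q (fst p) * \<phi> p) \<partial>lborel) = 0)"
  by (simp add: weak_wave_solution_def wave_op_def)

text \<open>Write v = ret (q v + G), move \<open>ret\<close> onto the test function as
  \<open>adv\<close>, and use that \<open>adv\<close> undoes the wave operator on test
  functions.\<close>

lemma volterra_weak:
  assumes q: "continuous_on UNIV q" and G: "continuous_on UNIV G" "csupp G" and v: "volterra q G v"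
    and \<phi>: "smooth \<phi>" "bsupp \<phi>"
  shows "(\<integral>p. v p * (wave_op \<phi> p - q (fst p) * \<phi> p) \<partial>lborel) = (\<integral>p. G p * \<phi> p \<partial>lborel)"
proof -
  have cv: "continuous_on UNIV v" "csupp v" and eq: "\<And>p. v p = ret (\<lambda>p. q (fst p) * v p + G p) p"
    using v unfolding volterra_def by blast+
  have cH: "continuous_on UNIV (\<lambda>p. q (fst p) * v p + G p)"
    by (intro continuous_on_add continuous_fst_mult q cv G)
  have vH: "vanishes_before 0 (\<lambda>p. q (fst p) * v p + G p)"
    by (intro csupp_vanishes csupp_add csupp_mult cv G)
  note c\<phi> = smooth_continuous[OF \<phi>(1)] and cb = smooth_continuous[OF smooth_box[OF \<phi>(1)]] and bb = bsupp_box[OF \<phi>(2)]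
  have "(\<integral>p. v p * wave_op \<phi> p \<partial>lborel) = (\<integral>p. ret (\<lambda>p. q (fst p) * v p + G p) p * wave_op \<phi> p \<partial>lborel)"
    by (rule Bochner_Integration.integral_cong[OF refl]) (rule arg_cong[where f="\<lambda>z. z * _"], rule eq)
  also have "\<dots> = (\<integral>p. (q (fst p) * v p + G p) * adv (wave_op \<phi>) p \<partial>lborel)"
    by (rule ret_adv_duality[OF cH vH cb bb])
  also have "\<dots> = (\<integral>p. v p * (q (fst p) * \<phi> p) + G p * \<phi> p \<partial>lborel)"
    unfolding adv_box[OF \<phi>] by (rule Bochner_Integration.integral_cong[OF refl]) (simp add: algebra_simps)
  also have "\<dots> = (\<integral>p. v p * (q (fst p) * \<phi> p) \<partial>lborel) + (\<integral>p. G p * \<phi> p \<partial>lborel)"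
    by (intro Bochner_Integration.integral_add bsupp_integrable continuous_on_mult[OF cv(1)] continuous_on_mult[OF G(1)]
      continuous_fst_mult q c\<phi> bsupp_mult2 \<phi>(2))
  finally have *: "(\<integral>p. v p * wave_op \<phi> p \<partial>lborel) = (\<integral>p. v p * (q (fst p) * \<phi> p) \<partial>lborel) + (\<integral>p. G p * \<phi> p \<partial>lborel)" .
  have "(\<integral>p. v p * (wave_op \<phi> p - q (fst p) * \<phi> p) \<partial>lborel) = (\<integral>p. v p * wave_op \<phi> p \<partial>lborel) - (\<integral>p. v p * (q (fst p) * \<phi> p) \<partial>lborel)"
    unfolding right_diff_distrib
    by (intro Bochner_Integration.integral_diff bsupp_integrable continuous_on_mult[OF cv(1)]
      continuous_fst_mult q c\<phi> cb bsupp_mult2 bb \<phi>(2))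
  then show ?thesis using * by simp
qed

lemma open_cone_subset: "open_cone \<subseteq> closed_cone"
  by (auto simp: mem_open_cone mem_closed_cone)

text \<open>The finite sum is C^2 and is integrated by parts classically, which leaves the residual
  with a minus sign; the remainder contributes the same source with a plus sign. The test functions
  live in the open cone, where \<open>cpow m\<close> is the full power of
  \<open>rho\<close>.\<close>

lemma approx_weak:
  assumes q: "continuous_on UNIV q"
    and C: "\<And>k. k \<le> m \<Longrightarrow> Ck 2 UNIV (bcoef q g k)" "\<And>k. k < m \<Longrightarrow> Ck (Suc 0) UNIV (schr q (bcoef q g k))"
    and F: "continuous_on UNIV (\<lambda>p. schr q (bcoef q g m) (fst p) * cpow m p)"
    and v: "volterra q (\<lambda>p. schr q (bcoef q g m) (fst p) * cpow m p) v"
    and u: "\<And>p. p \<in> open_cone \<Longrightarrow> u p = approx q g m p + v p"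
  shows "weak_wave_solution open_cone q u"
  unfolding weak_wave_solution_box
proof (intro allI impI)
  fix \<phi> assume "test_function open_cone \<phi>"
  then obtain K where K: "compact K" "K \<subseteq> open_cone" and \<phi>: "smooth \<phi>" "bsupp \<phi>"
    and z: "\<And>p. p \<notin> K \<Longrightarrow> \<phi> p = 0" "\<And>p. p \<notin> K \<Longrightarrow> wave_op \<phi> p = 0"
    by (rule test_function_D) (rule that; assumption)
  let ?X = "\<lambda>p. wave_op \<phi> p - q (fst p) * \<phi> p" and ?F = "\<lambda>p. schr q (bcoef q g m) (fst p) * cpow m p"
  note c\<phi> = smooth_continuous[OF \<phi>(1)] and cb = smooth_continuous[OF smooth_box[OF \<phi>(1)]] and bb = bsupp_box[OF \<phi>(2)]
  have Ca: "Ck 2 UNIV (approx q g m)" by (rule Ck_approx) (rule C(1))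
  have ca: "continuous_on UNIV (approx q g m)" by (rule Ck_continuous[OF Ca])
  have cv: "continuous_on UNIV v" using v unfolding volterra_def by blast
  have cX: "continuous_on UNIV ?X" by (intro continuous_on_diff cb continuous_fst_mult q c\<phi>)
  have bX: "bsupp ?X" by (intro bsupp_diff bb bsupp_mult2 \<phi>(2))
  have csF: "csupp ?F" by (intro csupp_mult csupp_cpow)
  have "(\<integral>p. u p * ?X p \<partial>lborel) = (\<integral>p. approx q g m p * ?X p + v p * ?X p \<partial>lborel)"
  proof (rule Bochner_Integration.integral_cong[OF refl])
    fix p show "u p * ?X p = approx q g m p * ?X p + v p * ?X p"
      using u[of p] K(2) z[of p] by (cases "p \<in> K") (auto simp: distrib_right)
  qed
  also have "\<dots> = (\<integral>p. approx q g m p * ?X p \<partial>lborel) + (\<integral>p. v p * ?X p \<partial>lborel)"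
    by (intro Bochner_Integration.integral_add bsupp_integrable continuous_on_mult ca cv cX bsupp_mult2 bX)
  also have "(\<integral>p. v p * ?X p \<partial>lborel) = (\<integral>p. ?F p * \<phi> p \<partial>lborel)"
    by (rule volterra_weak[OF q F csF v \<phi>])
  also have "(\<integral>p. approx q g m p * ?X p \<partial>lborel) = (\<integral>p. approx q g m p * wave_op \<phi> p \<partial>lborel) - (\<integral>p. approx q g m p * (q (fst p) * \<phi> p) \<partial>lborel)"
    unfolding right_diff_distrib
    by (intro Bochner_Integration.integral_diff bsupp_integrable continuous_on_mult[OF ca]
      continuous_fst_mult q c\<phi> cb bsupp_mult2 bb \<phi>(2))
  also have "(\<integral>p. approx q g m p * wave_op \<phi> p \<partial>lborel) = (\<integral>p. wave_op (approx q g m) p * \<phi> p \<partial>lborel)"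
    by (rule box_by_parts[OF Ca smooth_Ck[OF \<phi>(1)] \<phi>(2)])
  also have "(\<integral>p. wave_op (approx q g m) p * \<phi> p \<partial>lborel) = (\<integral>p. approx q g m p * (q (fst p) * \<phi> p) - ?F p * \<phi> p \<partial>lborel)"
  proof (rule Bochner_Integration.integral_cong[OF refl])
    fix p
    show "wave_op (approx q g m) p * \<phi> p = approx q g m p * (q (fst p) * \<phi> p) - ?F p * \<phi> p"
    proof (cases "p \<in> K")
      case True
      then have "p \<in> closed_cone" using K(2) open_cone_subset by blast
      then have cp: "cpow m p = of_real (rho p) ^ m" by (simp add: cpow_def)
      have bx: "wave_op (approx q g m) p = q (fst p) * approx q g m p - schr q (bcoef q g m) (fst p) * of_real (rho p) ^ m"
        using box_approx[OF C, of m p] by (simp add: algebra_simps)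
      show ?thesis unfolding cp bx by (simp add: algebra_simps)
    qed (simp add: z)
  qed
  also have "\<dots> = (\<integral>p. approx q g m p * (q (fst p) * \<phi> p) \<partial>lborel) - (\<integral>p. ?F p * \<phi> p \<partial>lborel)"
    by (intro Bochner_Integration.integral_diff bsupp_integrable continuous_on_mult[OF ca] continuous_on_mult[OF F]
      continuous_fst_mult q c\<phi> bsupp_mult2 \<phi>(2))
  finally show "(\<integral>p. u p * ?X p \<partial>lborel) = 0" by simp
qed

section \<open>Cutoff functions near the light cone\<close>

lemma box_cong_open:
  assumes "open S" "p \<in> S" "\<And>x. x \<in> S \<Longrightarrow> f x = g x"
  shows "wave_op f p = wave_op g p"
proof -
  have "pd b f x = pd b g x" if "x \<in> S" for b x
    by (rule pd_cong_open[OF assms(1) that assms(3)])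
  then have "pd b (pd b f) p = pd b (pd b g) p" for b
    by (rule pd_cong_open[OF assms(1,2)])
  then show ?thesis by (simp add: wave_op_def pd_t_def laplace_x_def)
qed

text \<open>A cutoff that vanishes near the light cone and in the past.\<close>

definition hcut :: "real \<Rightarrow> real \<Rightarrow> complex" where
  "hcut d z = step (inverse (d\<^sup>2) * z + (-1))"

text \<open>\<open>rho\<close> is positive in the backward cone too, which is removed by the factor
  in t. For t > 0 that factor is invisible, since rho > d^2 forces t >= d.\<close>

definition ccut :: "real \<Rightarrow> spacetime \<Rightarrow> complex" where
  "ccut d p = hcut d (rho p) * step (inverse d * snd p + 0)"

lemma Ck_hcut: "Ck k UNIV (hcut d)"
  unfolding hcut_def[abs_def] by (rule Ck_real_affine[OF Ck_step])

lemma Ck_ccut: "Ck k UNIV (ccut d)"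
  unfolding ccut_def[abs_def]
  by (intro Ck_mult Ck_compose_rho[OF Ck_hcut] Ck_compose_real[OF Ck_real_affine[OF Ck_step]] Ck_coord bounded_linear_snd)

lemma hcut_0: "d > 0 \<Longrightarrow> z \<le> d\<^sup>2 \<Longrightarrow> hcut d z = 0"
  by (simp add: hcut_def step_0 field_simps)

lemma ccut_eq:
  assumes d: "d > 0" and p: "snd p > 0"
  shows "ccut d p = hcut d (rho p)"
proof (cases "rho p \<le> d\<^sup>2")
  case False
  have "rho p \<le> (snd p)\<^sup>2" by (simp add: rho_def)
  then have "d\<^sup>2 \<le> (snd p)\<^sup>2" using False by linarith
  then have "d \<le> snd p" using p by (auto intro: power2_le_imp_le[of d "snd p"])
  then have "step (inverse d * snd p + 0) = 1" using d by (intro step_1) (simp add: field_simps)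
  then show ?thesis by (simp add: ccut_def)
qed (simp add: ccut_def hcut_0[OF d])

lemma ccut_nonzero:
  assumes "d > 0" "ccut d p \<noteq> 0"
  shows "rho p \<ge> d\<^sup>2" "snd p \<ge> 0"
proof -
  show "rho p \<ge> d\<^sup>2" using assms hcut_0[of d "rho p"] by (cases "rho p \<le> d\<^sup>2") (auto simp: ccut_def)
  show "snd p \<ge> 0"
  proof (rule ccontr)
    assume "\<not> snd p \<ge> 0"
    then have "step (inverse d * snd p + 0) = 0" using assms(1) by (intro step_0) (simp add: mult_nonneg_nonpos)
    then show False using assms(2) by (simp add: ccut_def)
  qed
qed

lemma pd_hcut: "pd 1 (hcut d) z = of_real (inverse (d\<^sup>2)) * pd 1 step (inverse (d\<^sup>2) * z + (-1))"
proof -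
  have "pd 1 (hcut d) z = pd (inverse (d\<^sup>2) * 1) step (inverse (d\<^sup>2) * z + (-1))"
    unfolding hcut_def[abs_def]
    by (rule pd_affine[OF Ck_differentiable[OF Ck_step] bounded_linear_mult_right])
  also have "\<dots> = inverse (d\<^sup>2) *\<^sub>R pd 1 step (inverse (d\<^sup>2) * z + (-1))"
    using linear_scale[OF has_derivative_linear[OF Ck_has_derivative[OF Ck_step]], of "inverse (d\<^sup>2)" 1] by simp
  finally show ?thesis by (simp add: scaleR_conv_of_real)
qed

lemma pd_pd_hcut: "pd 1 (pd 1 (hcut d)) z = of_real (inverse (d\<^sup>2)) * (of_real (inverse (d\<^sup>2)) * pd 1 (pd 1 step) (inverse (d\<^sup>2) * z + (-1)))"
proof -
  have C: "Ck (Suc 0) UNIV (pd 1 step)" by (rule Ck_pd[OF Ck_step]) simp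
  have "pd 1 (pd 1 (hcut d)) z = of_real (inverse (d\<^sup>2)) * pd 1 (\<lambda>z. pd 1 step (inverse (d\<^sup>2) * z + (-1))) z"
    unfolding pd_hcut[abs_def] by (rule pd_cmult[OF Ck_differentiable[OF Ck_real_affine[OF C]]])
  also have "pd 1 (\<lambda>z. pd 1 step (inverse (d\<^sup>2) * z + (-1))) z = pd (inverse (d\<^sup>2) * 1) (pd 1 step) (inverse (d\<^sup>2) * z + (-1))"
    by (rule pd_affine[OF Ck_differentiable[OF C] bounded_linear_mult_right])
  also have "\<dots> = inverse (d\<^sup>2) *\<^sub>R pd 1 (pd 1 step) (inverse (d\<^sup>2) * z + (-1))"
    using linear_scale[OF has_derivative_linear[OF Ck_has_derivative[OF C]], of "inverse (d\<^sup>2)" 1] by simp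
  finally show ?thesis by (simp add: scaleR_conv_of_real)
qed

lemma step_derivatives_vanish:
  assumes "z < 0 \<or> z > 1"
  shows "pd 1 step z = 0" "pd 1 (pd 1 step) z = 0"
proof -
  have "pd 1 step y = 0" if y: "y \<in> {..<0} \<union> {1<..}" for y
  proof -
    consider "y \<in> {..<0}" | "y \<in> {1<..}" using y by blast
    then show ?thesis
    proof cases
      case 1
      have "pd 1 step y = pd 1 (\<lambda>_. 0) y" by (rule pd_cong_open[OF open_lessThan 1]) (simp add: step_0)
      then show ?thesis by simp
    next
      case 2
      have "pd 1 step y = pd 1 (\<lambda>_. 1) y" by (rule pd_cong_open[OF open_greaterThan 2]) (simp add: step_1)
      then show ?thesis by simp
    qed
  qed
  moreover have "open ({..<0} \<union> {1<..} :: real set)" by (intro open_Un open_lessThan open_greaterThan)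
  moreover have "z \<in> {..<0} \<union> {1<..}" using assms by auto
  ultimately show "pd 1 step z = 0" "pd 1 (pd 1 step) z = 0" using pd_vanish[of "{..<0} \<union> {1<..}" "pd 1 step" z 1] by blast+
qed

text \<open>Since \<open>\<box> (h \<circ> \<rho>) = 4 \<rho> h'' + 8 h'\<close>, a cutoff at scale \<open>d\<^sup>2\<close> in \<open>\<rho>\<close> costs only \<open>1 / \<rho>\<close>.\<close>

lemma hcut_bounds:
  obtains C where "C \<ge> 0" "\<And>d z. d > 0 \<Longrightarrow> z > 0 \<Longrightarrow> norm (hcut d z) \<le> C"
    "\<And>d z. d > 0 \<Longrightarrow> z > 0 \<Longrightarrow> norm (pd 1 (hcut d) z) \<le> C / z"
    "\<And>d z. d > 0 \<Longrightarrow> z > 0 \<Longrightarrow> norm (4 * of_real z * pd 1 (pd 1 (hcut d)) z + 8 * pd 1 (hcut d) z) \<le> C / z"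
proof -
  obtain B where B: "B \<ge> 0" "bnd 2 {0..1::real} (\<lambda>_. B) step"
    using bnd_compact[OF Ck_step compact_Icc, of 2 0 1] by blast
  have one: "(1::real) \<in> Basis" by simp
  have B0: "norm (step y) \<le> B" if "y \<in> {0..1}" for y using bnd_norm[OF B(2) that] .
  have B1: "norm (pd 1 step y) \<le> B" for y
  proof (cases "y \<in> {0..1}")
    case True
    then show ?thesis using bnd_norm[OF bnd_pd[OF B(2)[unfolded numeral_2_eq_2] one]] by blast
  next
    case False
    then have "y < 0 \<or> y > 1" by auto
    then show ?thesis using step_derivatives_vanish(1) B(1) by simp
  qed
  have B2: "norm (pd 1 (pd 1 step) y) \<le> B" for y
  proof (cases "y \<in> {0..1}")
    case True
    then show ?thesis using bnd_norm[OF bnd_pd[OF bnd_pd[OF B(2)[unfolded numeral_2_eq_2] one] one]] by blast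
  next
    case False
    then have "y < 0 \<or> y > 1" by auto
    then show ?thesis using step_derivatives_vanish(2) B(1) by simp
  qed
  have Bs: "norm (step y) \<le> B + 1" for y
  proof (cases "y \<in> {0..1}")
    case True
    then show ?thesis using B0[of y] by simp
  next
    case False
    then have "y < 0 \<or> y > 1" by auto
    then show ?thesis using step_0[of y] step_1[of y] B(1) by auto
  qed
  \<comment> \<open>32 = 4 * 4 + 8 * 2, from the bounds 4 B / z and 2 B / z below; the 1 accounts
    for the value of \<open>step\<close> beyond 1.\<close>
  let ?C = "1 + 32 * B"
  have h1: "norm (pd 1 (hcut d) z) \<le> 2 * B / z" and h2: "norm (of_real z * pd 1 (pd 1 (hcut d)) z) \<le> 4 * B / z"
    if d: "d > 0" and z: "z > 0" for d z
  proof -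
    let ?i = "inverse (d\<^sup>2)"
    have i: "?i > 0" using d by simp
    show "norm (pd 1 (hcut d) z) \<le> 2 * B / z"
    proof (cases "?i * z + (-1) > 1")
      case True
      then show ?thesis using B(1) z by (simp add: pd_hcut step_derivatives_vanish)
    next
      case False
      \<comment> \<open>The derivatives of the cutoff live where z <= 2 d^2, so a factor 1 / d^2
        costs at most 2 / z.\<close>
      then have iz: "?i \<le> 2 / z" using z by (simp add: pos_le_divide_eq)
      have "norm (pd 1 (hcut d) z) = ?i * norm (pd 1 step (?i * z + (-1)))"
        unfolding pd_hcut norm_mult norm_of_real using i by (simp only: abs_of_pos)
      also have "\<dots> \<le> 2 / z * B" by (intro mult_mono iz B1) (use z in auto)
      finally show ?thesis by simp
    qed
    show "norm (of_real z * pd 1 (pd 1 (hcut d)) z) \<le> 4 * B / z"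
    proof (cases "?i * z + (-1) > 1")
      case True
      then show ?thesis using B(1) z by (simp add: pd_pd_hcut step_derivatives_vanish)
    next
      case False
      then have iz: "?i \<le> 2 / z" using z by (simp add: pos_le_divide_eq)
      have "norm (of_real z * pd 1 (pd 1 (hcut d)) z) = z * (?i * (?i * norm (pd 1 (pd 1 step) (?i * z + (-1)))))"
        unfolding pd_pd_hcut norm_mult norm_of_real using i z by (simp only: abs_of_pos)
      also have "\<dots> \<le> z * (2 / z * (2 / z * B))"
        by (intro mult_left_mono mult_mono iz B2 mult_nonneg_nonneg) (use z i B(1) in auto)
      also have "\<dots> = 4 * B / z" using z by (simp add: field_simps)
      finally show ?thesis .
    qed
  qed
  show thesis
  proof (rule that[of ?C])
    fix d z :: real assume d: "d > 0" and z: "z > 0"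
    show "norm (hcut d z) \<le> ?C" unfolding hcut_def using Bs[of "inverse (d\<^sup>2) * z + (-1)"] B(1) by linarith
    have "norm (pd 1 (hcut d) z) \<le> 2 * B / z" by (rule h1[OF d z])
    also have "\<dots> \<le> ?C / z" using B(1) z by (intro divide_right_mono) auto
    finally show "norm (pd 1 (hcut d) z) \<le> ?C / z" .
    have "norm (4 * of_real z * pd 1 (pd 1 (hcut d)) z + 8 * pd 1 (hcut d) z)
      \<le> 4 * norm (of_real z * pd 1 (pd 1 (hcut d)) z) + 8 * norm (pd 1 (hcut d) z)"
      by (rule norm_triangle_le) (simp add: norm_mult)
    also have "\<dots> \<le> 4 * (4 * B / z) + 8 * (2 * B / z)" using h1[OF d z] h2[OF d z] by linarith
    also have "\<dots> = (32 * B) / z" by (simp add: add_divide_distrib[symmetric])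
    also have "\<dots> \<le> ?C / z" using z by (intro divide_right_mono) auto
    finally show "norm (4 * of_real z * pd 1 (pd 1 (hcut d)) z + 8 * pd 1 (hcut d) z) \<le> ?C / z" .
  qed (use B(1) in simp)
qed

section \<open>Uniqueness\<close>

definition ctrunc :: "real \<Rightarrow> spacetime set" where
  "ctrunc T = {p. norm (fst p) \<le> snd p \<and> snd p \<le> T}"

lemma compact_ctrunc: "compact (ctrunc T)"
proof -
  have "closed (ctrunc T)"
    unfolding ctrunc_def by (intro closed_Collect_conj closed_Collect_le continuous_intros)
  moreover have "bounded (ctrunc T)"
  proof (rule boundedI)
    fix p assume p: "p \<in> ctrunc T"
    have "norm p \<le> norm (fst p) + norm (snd p)" using norm_Pair_le[of "fst p" "snd p"] by simp
    also have "\<dots> \<le> T + T"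
      using p norm_ge_zero[of "fst p"] unfolding ctrunc_def by (auto simp del: norm_ge_zero)
    finally show "norm p \<le> T + T" .
  qed
  ultimately show ?thesis by (simp add: compact_eq_bounded_closed)
qed

lemma ctrunc_nonneg: "p \<in> ctrunc T \<Longrightarrow> 0 \<le> snd p"
  using norm_ge_zero[of "fst p"] unfolding ctrunc_def by (auto simp del: norm_ge_zero)

text \<open>Majorant for the cut-off integrands: a constant times 1 / (kc |x|) + 1 on a cylinder. As
  t >= |x| in the cone, it controls 1 / t, and 1 / |x| is integrable on bounded subsets of
  R^3.\<close>

definition cdom :: "real \<Rightarrow> real \<Rightarrow> spacetime \<Rightarrow> real" where
  "cdom T C p = indicator {0..T} (snd p) * (C * (kernT T (fst p) + indicator (cball 0 T) (fst p)))"

lemma cdom_integrable: "integrable lborel (cdom T C)"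
proof -
  have fs: "(fst :: spacetime \<Rightarrow> _) \<in> borel_measurable borel" "(snd :: spacetime \<Rightarrow> _) \<in> borel_measurable borel"
    by (intro borel_measurable_continuous_onI continuous_intros)+
  have m: "cdom T C \<in> borel_measurable borel"
    unfolding cdom_def[abs_def]
    by (intro borel_measurable_times borel_measurable_const borel_measurable_add
        measurable_compose[OF fs(1) kernT_measurable]
        measurable_compose[OF fs(1), of "indicator (cball 0 T)"] measurable_compose[OF fs(2), of "indicator {0..T}"]
        borel_measurable_indicator) simp_all
  have ib: "integrable lborel (\<lambda>x::real^3. kernT T x + indicator (cball 0 T) x)"
    by (intro Bochner_Integration.integrable_add kernT_integrable integrable_real_indicator emeasure_lborel_cball_finite) simp
  have "integrable (lborel \<Otimes>\<^sub>M lborel) (cdom T C)"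
  proof (rule lborel_pair.Fubini_integrable)
    show "cdom T C \<in> borel_measurable (lborel \<Otimes>\<^sub>M lborel)" unfolding lborel_prod using m by simp
    have "(\<lambda>x. \<integral>t. norm (cdom T C (x, t)) \<partial>lborel) = (\<lambda>x. (\<integral>t. indicator {0..T} t \<partial>lborel) * (\<bar>C\<bar> * (kernT T x + indicator (cball 0 T) x)))"
      by (simp add: cdom_def abs_mult abs_of_nonneg[OF add_nonneg_nonneg[OF kernT_nonneg]])
    then show "integrable lborel (\<lambda>x. \<integral>t. norm (cdom T C (x, t)) \<partial>lborel)" using ib by simp
    have "integrable lborel (indicator {0..T} :: real \<Rightarrow> real)"
      by (intro integrable_real_indicator) (simp_all add: emeasure_lborel_Icc_eq)
    then show "AE x in lborel. integrable lborel (\<lambda>t. cdom T C (x, t))"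
      by (simp add: cdom_def)
  qed
  then show ?thesis unfolding lborel_prod .
qed

lemma AE_fst_nonzero: "AE p in (lborel :: spacetime measure). fst p \<noteq> 0"
proof -
  obtain e :: "real^3" where e: "e \<in> Basis" using nonempty_Basis by blast
  have "AE p in (lborel :: spacetime measure). p \<bullet> (e, 0) \<noteq> 0"
    by (rule AE_lborel_inner_neq) (simp add: e)
  then show ?thesis by eventually_elim (auto simp: inner_prod_def)
qed

lemma cdom_bound:
  assumes p: "p \<in> ctrunc T" "fst p \<noteq> 0" and C: "0 \<le> C" and z: "norm z \<le> C * (1 / kc / snd p + 1)"
  shows "norm z \<le> cdom T C p"
proof -
  have np: "norm (fst p) > 0" "norm (fst p) \<le> snd p" "snd p \<le> T" using p by (auto simp: ctrunc_def)
  have "0 < snd p * norm (fst p)" using np by (intro mult_pos_pos) linarith+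
  then have "1 / kc / snd p \<le> 1 / kc / norm (fst p)"
    using np(2) kc_pos by (intro divide_left_mono) simp_all
  then have "C * (1 / kc / snd p + 1) \<le> C * (1 / kc / norm (fst p) + 1)"
    by (intro mult_left_mono C) simp
  also have "\<dots> = cdom T C p"
    using np ctrunc_nonneg[OF p(1)] by (simp add: cdom_def kernT_def kern_def)
  finally show ?thesis using z by linarith
qed

text \<open>In the open cone |W| <= L (t - |x|) <= L rho / t, so errors of size 1 / rho become
  errors of size 1 / t, which are integrable over the truncated cone. \<Phi> is asked to vanish for
  late times only, as advanced potentials do; the support of \<open>W\<close> confines the
  rest.\<close>

lemma characteristic_extension_weak:
  assumes q: "continuous_on UNIV q" and W: "continuous_on UNIV W" "csupp W"
    and lip: "\<And>T. \<exists>L\<ge>0. \<forall>p\<in>ctrunc T. norm (W p) \<le> L * (snd p - norm (fst p))"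
    and weak: "weak_wave_solution open_cone q W"
    and \<Phi>: "smooth \<Phi>" and T: "\<And>p. snd p > T \<Longrightarrow> \<Phi> p = 0"
  shows "(\<integral>p. W p * (wave_op \<Phi> p - q (fst p) * \<Phi> p) \<partial>lborel) = 0"
proof -
  obtain L where L: "L \<ge> 0" "\<And>p. p \<in> ctrunc T \<Longrightarrow> norm (W p) \<le> L * (snd p - norm (fst p))"
    using lip[of T] by blast
  obtain C where C: "C \<ge> 0" "\<And>d z. d > 0 \<Longrightarrow> z > 0 \<Longrightarrow> norm (hcut d z) \<le> C"
    "\<And>d z. d > 0 \<Longrightarrow> z > 0 \<Longrightarrow> norm (pd 1 (hcut d) z) \<le> C / z"
    "\<And>d z. d > 0 \<Longrightarrow> z > 0 \<Longrightarrow> norm (4 * of_real z * pd 1 (pd 1 (hcut d)) z + 8 * pd 1 (hcut d) z) \<le> C / z"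
    by (rule hcut_bounds) (rule that; assumption)
  let ?X = "\<lambda>p. wave_op \<Phi> p - q (fst p) * \<Phi> p"
  let ?\<Phi>c = "\<lambda>d p. \<Phi> p * ccut d p"
  note c\<Phi> = smooth_continuous[OF \<Phi>]
  have cX: "continuous_on UNIV ?X"
    by (intro continuous_on_diff smooth_continuous[OF smooth_box[OF \<Phi>]] continuous_fst_mult q c\<Phi>)
  have radial: "pd p \<Phi> p = (\<Sum>e\<in>Basis. of_real (fst p \<bullet> e) * pd (e, 0) \<Phi> p) + of_real (snd p) * pd (0, 1) \<Phi> p" for p
    by (rule pd_radial_sum[OF smooth_Ck[OF \<Phi>, of "Suc 0"]])
  have cr: "continuous_on UNIV (\<lambda>p. pd p \<Phi> p)"
    unfolding radial by (intro continuous_intros smooth_continuous smooth_pd \<Phi> Basis_t Basis_x)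
  obtain B1 where B1: "B1 \<ge> 0" "\<And>p. p \<in> ctrunc T \<Longrightarrow> norm (?X p) \<le> B1"
    by (rule continuous_compact_bound[OF cX compact_ctrunc[of T]]) (rule that; assumption)
  obtain B2 where B2: "B2 \<ge> 0" "\<And>p. p \<in> ctrunc T \<Longrightarrow> norm (\<Phi> p) \<le> B2"
    by (rule continuous_compact_bound[OF c\<Phi> compact_ctrunc[of T]]) (rule that; assumption)
  obtain B3 where B3: "B3 \<ge> 0" "\<And>p. p \<in> ctrunc T \<Longrightarrow> norm (pd p \<Phi> p) \<le> B3"
    by (rule continuous_compact_bound[OF cr compact_ctrunc[of T]]) (rule that; assumption)
  have sm: "smooth (?\<Phi>c d)" for d
    unfolding smooth_def by (intro allI Ck_mult smooth_Ck \<Phi> Ck_ccut)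
  have test: "test_function open_cone (?\<Phi>c d)" if d: "d > 0" for d
  proof -
    \<comment> \<open>The region above a hyperboloid and below time T: it is closed, lies in the
      open cone, and is bounded because the time is.\<close>
    let ?S = "{p. d\<^sup>2 \<le> rho p \<and> 0 \<le> snd p \<and> snd p \<le> T}"
    have crho: "continuous_on UNIV rho"
      using has_derivative_continuous[OF rho_has_derivative] by (simp add: continuous_at_imp_continuous_on)
    have S: "closed ?S"
      by (intro closed_Collect_conj closed_Collect_le continuous_intros crho)
    have sub: "?S \<subseteq> open_cone"
    proof
      fix p assume p: "p \<in> ?S"
      have "d\<^sup>2 > 0" using d by simp
      moreover have "d\<^sup>2 \<le> rho p" using p by simp
      ultimately have "rho p > 0" by linarith
      then have "(norm (fst p))\<^sup>2 < (snd p)\<^sup>2" by (simp add: rho_def power2_norm_eq_inner)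
      then have "norm (fst p) < snd p" by (rule power2_less_imp_less) (use p in simp)
      then show "p \<in> open_cone" by (simp add: mem_open_cone)
    qed
    have "?S \<subseteq> ctrunc T"
    proof
      fix p assume p: "p \<in> ?S"
      then have "p \<in> open_cone" using sub by blast
      then show "p \<in> ctrunc T" using p unfolding ctrunc_def mem_open_cone by simp
    qed
    then have "bounded ?S" using compact_imp_bounded[OF compact_ctrunc] bounded_subset by blast
    then have cS: "compact ?S" using S by (simp add: compact_eq_bounded_closed)
    have "{p. ?\<Phi>c d p \<noteq> 0} \<subseteq> ?S"
    proof
      fix p assume "p \<in> {p. ?\<Phi>c d p \<noteq> 0}"
      then have nz: "\<Phi> p \<noteq> 0" "ccut d p \<noteq> 0" by auto
      then have "snd p \<le> T" using T[of p] by (cases "snd p \<le> T") simp_all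
      then show "p \<in> ?S" using ccut_nonzero[OF d nz(2)] by simp
    qed
    then have cl: "closure {p. ?\<Phi>c d p \<noteq> 0} \<subseteq> ?S" by (rule closure_minimal[OF _ S])
    have "compact (closure {p. ?\<Phi>c d p \<noteq> 0})"
      using compact_Int_closed[OF cS closed_closure, of "{p. ?\<Phi>c d p \<noteq> 0}"] cl by (simp add: Int_absorb1)
    then show ?thesis
      unfolding test_function_def using smooth_Ck[OF sm[of d]] cl sub by blast
  qed
  let ?Xc = "\<lambda>d p. wave_op (?\<Phi>c d) p - q (fst p) * ?\<Phi>c d p"
  have cXc: "continuous_on UNIV (?Xc d)" for d
    by (intro continuous_on_diff smooth_continuous[OF smooth_box[OF sm]] continuous_fst_mult q smooth_continuous[OF sm])
  have expand: "?Xc d p = ?X p * hcut d (rho p)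
      + \<Phi> p * (4 * of_real (rho p) * pd 1 (pd 1 (hcut d)) (rho p) + 8 * pd 1 (hcut d) (rho p)) + 4 * pd p \<Phi> p * pd 1 (hcut d) (rho p)"
    if d: "d > 0" and p: "snd p > 0" for d p
  proof -
    have op: "open {p::spacetime. 0 < snd p}" by (intro open_Collect_less continuous_intros)
    have "wave_op (?\<Phi>c d) p = wave_op (\<lambda>p. \<Phi> p * hcut d (rho p)) p"
      by (rule box_cong_open[OF op]) (use p in \<open>auto simp: ccut_eq[OF d]\<close>)
    then show ?thesis
      unfolding box_mult_rho[OF smooth_Ck[OF \<Phi>] Ck_hcut] ccut_eq[OF d p] by (simp add: algebra_simps)
  qed
  \<comment> \<open>The first part comes from the bounded factor of the cutoff and |W| <= L |T|, the
    second from the terms of size 1 / rho; there \<open>kc\<close> undoes the normalization of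
    \<open>kernT\<close> in the majorant.\<close>
  let ?C = "B1 * C * (L * \<bar>T\<bar>) + kc * (L * (B2 * C + 4 * (B3 * C)))"
  have C0: "?C \<ge> 0" using B1(1) B2(1) B3(1) C(1) L(1) kc_pos by simp
  have zeroW: "W p = 0" if "p \<notin> open_cone" for p
  proof (cases "p \<in> closed_cone")
    case True
    then have eq: "snd p = norm (fst p)" using that by (simp add: mem_open_cone mem_closed_cone)
    have "p \<in> ctrunc (snd p)" using eq by (simp add: ctrunc_def)
    then obtain L' where "norm (W p) \<le> L' * (snd p - norm (fst p))"
      using lip[of "snd p"] by blast
    then show ?thesis using eq by simp
  next
    case False
    then show ?thesis using W(2) unfolding csupp_def by blast
  qed
  have zeroT: "\<Phi> p = 0" "wave_op \<Phi> p = 0" "?Xc d p = 0" if "snd p > T" for p d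
  proof -
    have op: "open {p::spacetime. T < snd p}" by (intro open_Collect_less continuous_intros)
    show "\<Phi> p = 0" by (rule T[OF that])
    have "wave_op \<Phi> p = wave_op (\<lambda>p. 0) p" by (rule box_cong_open[OF op]) (use that T in auto)
    moreover have b0: "wave_op (\<lambda>p. 0) p = 0" for p
    proof -
      have "pd b (\<lambda>p::spacetime. 0) = (\<lambda>p. 0)" for b by (rule ext) simp
      then show ?thesis by (simp add: wave_op_def pd_t_def laplace_x_def)
    qed
    ultimately show "wave_op \<Phi> p = 0" by simp
    have "wave_op (?\<Phi>c d) p = wave_op (\<lambda>p. 0) p" by (rule box_cong_open[OF op]) (use that T in auto)
    then show "?Xc d p = 0" using b0 T[OF that] by simp
  qed
  have bound: "norm (W p * ?Xc d p) \<le> cdom T ?C p" if d: "d > 0" and f: "fst p \<noteq> 0" for d p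
  proof (cases "p \<in> open_cone \<and> snd p \<le> T")
    case False
    then have "W p = 0 \<or> ?Xc d p = 0" using zeroW[of p] zeroT(3)[of p d] by linarith
    then have z: "W p * ?Xc d p = 0" unfolding mult_eq_0_iff .
    have "0 \<le> cdom T ?C p"
      unfolding cdom_def by (intro mult_nonneg_nonneg add_nonneg_nonneg[of "kernT _ _"] C0 kernT_nonneg) simp_all
    then show ?thesis unfolding z norm_zero .
  next
    case True
    then have K: "p \<in> ctrunc T" and t: "snd p > 0" and lt: "norm (fst p) < snd p"
      using norm_ge_zero[of "fst p"] by (auto simp: ctrunc_def mem_open_cone simp del: norm_ge_zero)
    have r: "rho p > 0" using t lt norm_ge_zero[of "fst p"] unfolding rho_factor by (intro mult_pos_pos) linarith+
    have W1: "norm (W p) \<le> L * (rho p / snd p)"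
    proof -
      have "(snd p - norm (fst p)) * snd p \<le> rho p"
        unfolding rho_factor using lt by (intro mult_left_mono) auto
      then have "snd p - norm (fst p) \<le> rho p / snd p" using t by (simp add: pos_le_divide_eq)
      from mult_left_mono[OF this L(1)] L(2)[OF K] show ?thesis by linarith
    qed
    have W2: "norm (W p) \<le> L * \<bar>T\<bar>"
    proof -
      have "snd p - norm (fst p) \<le> \<bar>T\<bar>" using True norm_ge_zero[of "fst p"] by linarith
      from mult_left_mono[OF this L(1)] L(2)[OF K] show ?thesis by linarith
    qed
    let ?Y = "4 * of_real (rho p) * pd 1 (pd 1 (hcut d)) (rho p) + 8 * pd 1 (hcut d) (rho p)" and ?Z = "pd 1 (hcut d) (rho p)"
    have "norm (?Xc d p) \<le> norm (?X p) * norm (hcut d (rho p)) + (norm (\<Phi> p) * norm ?Y + 4 * (norm (pd p \<Phi> p) * norm ?Z))"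
    proof -
      have "norm (?X p * hcut d (rho p) + \<Phi> p * ?Y + 4 * pd p \<Phi> p * ?Z) \<le> norm (?X p * hcut d (rho p) + \<Phi> p * ?Y) + norm (4 * pd p \<Phi> p * ?Z)"
        by (rule norm_triangle_ineq)
      also have "norm (?X p * hcut d (rho p) + \<Phi> p * ?Y) \<le> norm (?X p * hcut d (rho p)) + norm (\<Phi> p * ?Y)"
        by (rule norm_triangle_ineq)
      finally show ?thesis unfolding expand[OF d t] by (simp add: norm_mult)
    qed
    also have "\<dots> \<le> B1 * C + (B2 * (C / rho p) + 4 * (B3 * (C / rho p)))"
      by (intro add_mono mult_mono mult_left_mono B1 B2 B3 K C d r) (use C(1) r in auto)
    finally have X1: "norm (?Xc d p) \<le> B1 * C + (B2 * C + 4 * (B3 * C)) / rho p"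
      by (simp add: add_divide_distrib)
    have "norm (W p * ?Xc d p) \<le> norm (W p) * (B1 * C + (B2 * C + 4 * (B3 * C)) / rho p)"
      unfolding norm_mult by (rule mult_left_mono[OF X1 norm_ge_zero])
    also have "\<dots> = (B1 * C) * norm (W p) + ((B2 * C + 4 * (B3 * C)) / rho p) * norm (W p)"
      by (simp add: algebra_simps)
    also have "\<dots> \<le> (B1 * C) * (L * \<bar>T\<bar>) + ((B2 * C + 4 * (B3 * C)) / rho p) * (L * (rho p / snd p))"
      by (intro add_mono mult_left_mono W1 W2) (use B1(1) B2(1) B3(1) C(1) r in auto)
    also have "((B2 * C + 4 * (B3 * C)) / rho p) * (L * (rho p / snd p)) = kc * (L * (B2 * C + 4 * (B3 * C))) * (1 / kc / snd p)"
    proof -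
      have "(K / r) * (l * (r / s)) = k * (l * K) * (1 / k / s)" if "r > 0" "k > 0" "s > 0" for K r l s k :: real
        using that by (simp add: field_simps)
      from this[OF r kc_pos t] show ?thesis .
    qed
    also have "B1 * C * (L * \<bar>T\<bar>) + kc * (L * (B2 * C + 4 * (B3 * C))) * (1 / kc / snd p) \<le> ?C * (1 / kc / snd p + 1)"
    proof -
      have "0 \<le> B1 * C * (L * \<bar>T\<bar>) * (1 / kc / snd p)" "0 \<le> kc * (L * (B2 * C + 4 * (B3 * C)))"
        using B1(1) B2(1) B3(1) C(1) L(1) kc_pos t by simp_all
      then show ?thesis by (simp only: distrib_right distrib_left mult_1_right)
    qed
    finally show ?thesis by (rule cdom_bound[OF K f C0])
  qed
  have "(\<lambda>j. \<integral>p. W p * ?Xc (eps j) p \<partial>lborel) \<longlonglongrightarrow> (\<integral>p. W p * ?X p \<partial>lborel)"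
  proof (rule integral_dominated_convergence)
    show "integrable lborel (cdom T ?C)" by (rule cdom_integrable)
    show "AE p in lborel. norm (W p * ?Xc (eps j) p) \<le> cdom T ?C p" for j
      using AE_fst_nonzero by eventually_elim (rule bound[OF eps_pos])
    show "(\<lambda>p. W p * ?X p) \<in> borel_measurable lborel"
      using borel_measurable_continuous_onI[OF continuous_on_mult[OF W(1) cX]] by (simp only: measurable_lborel1 measurable_lborel2)
    show "(\<lambda>p. W p * ?Xc (eps j) p) \<in> borel_measurable lborel" for j
      using borel_measurable_continuous_onI[OF continuous_on_mult[OF W(1) cXc[of "eps j"]]] by (simp only: measurable_lborel1 measurable_lborel2)
    show "AE p in lborel. (\<lambda>j. W p * ?Xc (eps j) p) \<longlonglongrightarrow> W p * ?X p"
    proof (rule AE_I2)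
      fix p :: spacetime
      show "(\<lambda>j. W p * ?Xc (eps j) p) \<longlonglongrightarrow> W p * ?X p"
      proof (cases "p \<in> open_cone")
        case True
        then have lt: "norm (fst p) < snd p" by (simp add: mem_open_cone)
        have t: "snd p > 0" using lt norm_ge_zero[of "fst p"] by linarith
        have r: "rho p > 0" using t lt norm_ge_zero[of "fst p"] unfolding rho_factor by (intro mult_pos_pos) linarith+
        \<comment> \<open>Once rho > 3 \<epsilon>^2, the point lies beyond the transition zone: the
          cutoff is 1 there and its first two derivatives vanish.\<close>
        have e0: "(\<lambda>j. (eps j)\<^sup>2) \<longlonglongrightarrow> 0\<^sup>2" by (intro tendsto_power eps_tendsto)
        have "\<forall>\<^sub>F j in sequentially. (eps j)\<^sup>2 < rho p / 3"
          by (rule order_tendstoD(2)[OF e0]) (use r in simp)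
        then have "\<forall>\<^sub>F j in sequentially. ?Xc (eps j) p = ?X p"
        proof eventually_elim
          fix j assume j: "(eps j)\<^sup>2 < rho p / 3"
          have e2: "(eps j)\<^sup>2 > 0" using eps_pos[of j] by (rule zero_less_power)
          have "inverse ((eps j)\<^sup>2) * rho p + (-1) > 1"
          proof -
            have "(eps j)\<^sup>2 * 2 < rho p" using j e2 by linarith
            then have "2 < rho p / (eps j)\<^sup>2" using e2 by (simp only: pos_less_divide_eq mult.commute)
            then show ?thesis by (simp only: divide_inverse mult.commute)
          qed
          note g = this
          have "hcut (eps j) (rho p) = 1" unfolding hcut_def by (rule step_1[OF less_imp_le[OF g]])
          moreover have "pd 1 (hcut (eps j)) (rho p) = 0"
            unfolding pd_hcut by (simp only: step_derivatives_vanish(1)[OF disjI2[OF g]] mult_zero_right)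
          moreover have "pd 1 (pd 1 (hcut (eps j))) (rho p) = 0"
            unfolding pd_pd_hcut by (simp only: step_derivatives_vanish(2)[OF disjI2[OF g]] mult_zero_right)
          ultimately show "?Xc (eps j) p = ?X p"
            unfolding expand[OF eps_pos t] by (simp only: mult_zero_right mult_1_right add_0_right)
        qed
        then have "\<forall>\<^sub>F j in sequentially. W p * ?X p = W p * ?Xc (eps j) p"
          by eventually_elim (simp only:)
        from Lim_transform_eventually[OF tendsto_const this] show ?thesis .
      next
        case False
        then have "W p = 0" by (rule zeroW)
        then show ?thesis by simp
      qed
    qed
  qed
  moreover have "(\<integral>p. W p * ?Xc (eps j) p \<partial>lborel) = 0" for j
    using weak test[OF eps_pos, of j] unfolding weak_wave_solution_box by blast
  ultimately have "(\<lambda>j::nat. 0) \<longlonglongrightarrow> (\<integral>p. W p * ?X p \<partial>lborel)" by (simp only:)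
  then show ?thesis by (simp add: LIMSEQ_const_iff)
qed

lemma characteristic_uniqueness:
  assumes q: "continuous_on UNIV q" "\<And>x. norm (q x) \<le> M" and W: "continuous_on UNIV W" "csupp W"
    and lip: "\<And>T. \<exists>L\<ge>0. \<forall>p\<in>ctrunc T. norm (W p) \<le> L * (snd p - norm (fst p))"
    and weak: "weak_wave_solution open_cone q W"
  shows "W p = 0"
proof (rule volterra_homogeneous_unique[OF q W])
  let ?H = "\<lambda>p. q (fst p) * W p"
  have cH: "continuous_on UNIV ?H" by (intro continuous_fst_mult q W)
  have vH: "vanishes_before 0 ?H" by (intro csupp_vanishes csupp_mult W)
  have cR: "continuous_on UNIV (ret ?H)" using Ck_ret[OF vH, of 0] cH by simp
  have eq: "W p0 - ret ?H p0 = 0" for p0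
  proof (rule fundamental_lemma[of "\<lambda>p. W p - ret ?H p"])
    show "continuous_on UNIV (\<lambda>p. W p - ret ?H p)" by (intro continuous_on_diff W cR)
    fix \<phi> :: "spacetime \<Rightarrow> complex" assume \<phi>: "smooth \<phi>" "bsupp \<phi>"
    obtain T where T: "\<And>p. snd p > T \<Longrightarrow> adv \<phi> p = 0" using adv_vanishes_after[OF \<phi>(2)] by blast
    note sa = smooth_adv[OF \<phi>]
    note c\<phi> = smooth_continuous[OF \<phi>(1)]
    have "(\<integral>p. W p * (wave_op (adv \<phi>) p - q (fst p) * adv \<phi> p) \<partial>lborel) = 0"
      by (rule characteristic_extension_weak[OF q(1) W lip weak sa T])
    then have 0: "(\<integral>p. W p * \<phi> p - ?H p * adv \<phi> p \<partial>lborel) = 0"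
      unfolding box_adv[OF \<phi>] by (simp add: algebra_simps)
    \<comment> \<open>\<open>W\<close> lives in the forward cone and \<open>adv \<phi>\<close>
      before time \<open>T\<close>; neither need have bounded support, but the product does.\<close>
    have bH: "bsupp (\<lambda>p. ?H p * adv \<phi> p)" unfolding bsupp_def
    proof (intro exI[of _ "T + T"] allI impI)
      fix p :: spacetime assume p: "norm p > T + T"
      have "p \<notin> ctrunc T"
      proof
        assume c: "p \<in> ctrunc T"
        have "norm p \<le> norm (fst p) + norm (snd p)" using norm_Pair_le[of "fst p" "snd p"] by simp
        then show False using p c ctrunc_nonneg[OF c] by (simp add: ctrunc_def)
      qed
      then have "snd p < norm (fst p) \<or> snd p > T" by (auto simp: ctrunc_def)
      then show "?H p * adv \<phi> p = 0" using csupp_D[OF W(2), of p] T[of p] by auto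
    qed
    have i1: "integrable lborel (\<lambda>p. W p * \<phi> p)" and i2: "integrable lborel (\<lambda>p. ?H p * adv \<phi> p)"
      and i3: "integrable lborel (\<lambda>p. ret ?H p * \<phi> p)"
      by (intro bsupp_integrable continuous_on_mult[OF W(1) c\<phi>] continuous_on_mult[OF cH smooth_continuous[OF sa]]
          continuous_on_mult[OF cR c\<phi>] bH bsupp_mult2 \<phi>(2))+
    have "(\<integral>p. (W p - ret ?H p) * \<phi> p \<partial>lborel) = (\<integral>p. W p * \<phi> p \<partial>lborel) - (\<integral>p. ret ?H p * \<phi> p \<partial>lborel)"
      unfolding left_diff_distrib by (rule Bochner_Integration.integral_diff[OF i1 i3])
    also have "\<dots> = (\<integral>p. W p * \<phi> p \<partial>lborel) - (\<integral>p. ?H p * adv \<phi> p \<partial>lborel)"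
      unfolding ret_adv_duality[OF cH vH c\<phi> \<phi>(2)] ..
    also have "\<dots> = 0" using 0 Bochner_Integration.integral_diff[OF i1 i2] by simp
    finally show "(\<integral>p. (W p - ret ?H p) * \<phi> p \<partial>lborel) = 0" .
  qed
  show "W p = ret ?H p" for p by (rule eq_iff_diff_eq_0[THEN iffD2, OF eq])
qed

text \<open>The segment from (x, |x|) up to (x, t) stays in the cone, and the time derivative,
  continuous up to the boundary, is bounded on the compact truncated cone.\<close>

lemma Ck1_cone_lipschitz:
  assumes f: "Ck 1 closed_cone f" and zero: "\<And>x. f (x, norm x) = 0"
  shows "\<exists>L\<ge>0. \<forall>p\<in>ctrunc T. norm (f p) \<le> L * (snd p - norm (fst p))"
proof -
  obtain D where D: "\<And>p. p \<in> closed_cone \<Longrightarrow> (f has_derivative D p) (at p within closed_cone)"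
    and cD: "\<And>b. b \<in> Basis \<Longrightarrow> continuous_on closed_cone (\<lambda>p. D p b)"
    using f by auto
  have sub: "ctrunc T \<subseteq> closed_cone" by (auto simp: ctrunc_def closed_cone_def)
  have "compact ((\<lambda>p. D p (0, 1)) ` ctrunc T)"
    by (intro compact_continuous_image continuous_on_subset[OF cD sub] compact_ctrunc) simp
  from compact_imp_bounded[OF this] obtain B where B: "\<forall>z\<in>(\<lambda>p. D p (0, 1)) ` ctrunc T. norm z \<le> B"
    unfolding bounded_iff by blast
  show ?thesis
  proof (intro exI[of _ "max B 0"] conjI ballI)
    fix p assume p: "p \<in> ctrunc T"
    let ?x = "fst p" and ?S = "{norm (fst p)..snd p}"
    have in_cone: "(?x, s) \<in> closed_cone" if "s \<in> ?S" for s using that by (simp add: mem_closed_cone)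
    have "((\<lambda>s. f (?x, s)) has_derivative (\<lambda>h. D (?x, s) (0, h))) (at s within ?S)" if s: "s \<in> ?S" for s
    proof -
      have 1: "((\<lambda>s. (?x, s)) has_derivative (\<lambda>h. (0, h))) (at s within ?S)" by (auto intro!: derivative_eq_intros)
      have "Pair ?x ` ?S \<subseteq> closed_cone" by (intro image_subsetI in_cone)
      then have 2: "(f has_derivative D (?x, s)) (at (?x, s) within Pair ?x ` ?S)"
        by (rule has_derivative_subset[OF D[OF in_cone[OF s]]])
      show ?thesis by (rule has_derivative_in_compose[where g=f and f="Pair ?x", OF 1 2])
    qed
    note d = this
    have "norm (f (?x, snd p) - f (?x, norm ?x)) \<le> max B 0 * norm (snd p - norm ?x)"
    proof (rule differentiable_bound[OF convex_real_interval(5) d])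
      fix s assume s: "s \<in> ?S"
      have lin: "linear (D (?x, s))" by (rule has_derivative_linear[OF D[OF in_cone[OF s]]])
      have "(?x, s) \<in> ctrunc T" using s p by (simp add: ctrunc_def)
      then have b: "norm (D (?x, s) (0, 1)) \<le> max B 0" using B by (auto simp: le_max_iff_disj)
      show "onorm (\<lambda>h. D (?x, s) (0, h)) \<le> max B 0"
      proof (rule onorm_bound)
        fix h :: real
        have "D (?x, s) (0, h) = D (?x, s) (h *\<^sub>R (0, 1))" by simp
        also have "\<dots> = h *\<^sub>R D (?x, s) (0, 1)" by (rule linear_scale[OF lin])
        finally show "norm (D (?x, s) (0, h)) \<le> max B 0 * norm h"
          using mult_right_mono[OF b, of "\<bar>h\<bar>"] by (simp add: mult.commute)
      qed simp
    qed (use p in \<open>auto simp: ctrunc_def\<close>)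
    then show "norm (f p) \<le> max B 0 * (snd p - norm (fst p))"
      using p zero by (simp add: ctrunc_def)
  qed simp
qed

lemma continuous_cone_extension:
  assumes f: "continuous_on closed_cone f" and zero: "\<And>x. f (x, norm x) = 0"
  shows "continuous_on UNIV (\<lambda>p. if p \<in> closed_cone then f p else (0::complex))"
proof -
  have cl: "closed {p::spacetime. snd p \<le> norm (fst p)}"
    by (intro closed_Collect_le continuous_intros)
  have "continuous_on (closed_cone \<union> {p. snd p \<le> norm (fst p)}) (\<lambda>p. if p \<in> closed_cone then f p else 0)"
  proof (rule continuous_on_cases[OF closed_closed_cone cl f continuous_on_const])
    show "\<forall>p. p \<in> closed_cone \<and> p \<notin> closed_cone \<or> p \<in> {p. snd p \<le> norm (fst p)} \<and> p \<in> closed_cone \<longrightarrow> f p = 0"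
    proof (intro allI impI)
      fix p :: spacetime assume "p \<in> closed_cone \<and> p \<notin> closed_cone \<or> p \<in> {p. snd p \<le> norm (fst p)} \<and> p \<in> closed_cone"
      then have "p = (fst p, norm (fst p))" by (auto simp: mem_closed_cone prod_eq_iff)
      then show "f p = 0" using zero[of "fst p"] by metis
    qed
  qed
  moreover have "closed_cone \<union> {p. snd p \<le> norm (fst p)} = UNIV" by (auto simp: mem_closed_cone)
  ultimately show ?thesis by simp
qed

lemma goursat_unique:
  assumes q: "continuous_on UNIV q" "\<And>x. norm (q x) \<le> M"
    and u: "goursat_solution q g u" and v: "goursat_solution q g v" and p: "p \<in> closed_cone"
  shows "v p = u p"
proof -
  let ?f = "\<lambda>p. v p - u p"
  let ?W = "\<lambda>p. if p \<in> closed_cone then ?f p else 0"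
  have Cu: "Ck 1 closed_cone u" "weak_wave_solution open_cone q u" "\<And>x. u (x, norm x) = g x"
    and Cv: "Ck 1 closed_cone v" "weak_wave_solution open_cone q v" "\<And>x. v (x, norm x) = g x"
    using u v unfolding goursat_solution_def by blast+
  have cu: "continuous_on closed_cone u" and cv: "continuous_on closed_cone v"
    using Ck_continuous[OF Cu(1)] Ck_continuous[OF Cv(1)] by auto
  have z: "?f (x, norm x) = 0" for x using Cu(3) Cv(3) by simp
  have Cf: "Ck 1 closed_cone ?f"
  proof -
    obtain D where D: "\<And>p. p \<in> closed_cone \<Longrightarrow> (u has_derivative D p) (at p within closed_cone)"
      "\<And>b. b \<in> Basis \<Longrightarrow> continuous_on closed_cone (\<lambda>p. D p b)" using Cu(1) by auto
    obtain E where E: "\<And>p. p \<in> closed_cone \<Longrightarrow> (v has_derivative E p) (at p within closed_cone)"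
      "\<And>b. b \<in> Basis \<Longrightarrow> continuous_on closed_cone (\<lambda>p. E p b)" using Cv(1) by auto
    show ?thesis unfolding One_nat_def Ck.simps
      by (intro exI[of _ "\<lambda>p h. E p h - D p h"] conjI ballI has_derivative_diff continuous_on_diff D E)
  qed
  have "?W p = 0"
  proof (rule characteristic_uniqueness[OF q])
    show "continuous_on UNIV ?W" by (rule continuous_cone_extension[OF continuous_on_diff[OF cv cu] z])
    show "csupp ?W" by (simp add: csupp_def)
    show "\<exists>L\<ge>0. \<forall>p\<in>ctrunc T. norm (?W p) \<le> L * (snd p - norm (fst p))" for T
    proof -
      obtain L where "L \<ge> 0" "\<forall>p\<in>ctrunc T. norm (?f p) \<le> L * (snd p - norm (fst p))"
        using Ck1_cone_lipschitz[OF Cf z] by blast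
      then show ?thesis by (intro exI[of _ L]) (auto simp: ctrunc_def mem_closed_cone)
    qed
    show "weak_wave_solution open_cone q ?W"
      unfolding weak_wave_solution_box
    proof (intro allI impI)
      fix \<phi> assume t: "test_function open_cone \<phi>"
      then obtain K where K: "compact K" "K \<subseteq> open_cone" and \<phi>: "smooth \<phi>" "bsupp \<phi>"
        and z: "\<And>p. p \<notin> K \<Longrightarrow> \<phi> p = 0" "\<And>p. p \<notin> K \<Longrightarrow> wave_op \<phi> p = 0"
        by (rule test_function_D) (rule that; assumption)
      let ?X = "\<lambda>p. wave_op \<phi> p - q (fst p) * \<phi> p"
      have zX: "?X p = 0" if "p \<notin> K" for p using z[OF that] by simp
      have Kc: "K \<subseteq> closed_cone" using K(2) open_cone_subset by blast
      have cX: "continuous_on UNIV ?X"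
        by (intro continuous_on_diff smooth_continuous[OF smooth_box[OF \<phi>(1)]] continuous_fst_mult q smooth_continuous[OF \<phi>(1)])
      \<comment> \<open>\<open>u\<close> and \<open>v\<close> are known to be continuous on the
        closed cone only, so the integrands are restricted to the compact set \<open>K\<close> that
        carries the test function.\<close>
      have int: "integrable lborel (\<lambda>p. w p * ?X p)" if w: "continuous_on closed_cone w" for w :: "spacetime \<Rightarrow> complex"
      proof -
        have "integrable lborel (\<lambda>p. indicator K p *\<^sub>R (w p * ?X p))"
          by (rule borel_integrable_compact[OF K(1)])
            (intro continuous_on_mult continuous_on_subset[OF w Kc] continuous_on_subset[OF cX], simp)
        moreover have "indicator K p *\<^sub>R (w p * ?X p) = w p * ?X p" for p
          using zX[of p] by (cases "p \<in> K") auto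
        ultimately show ?thesis by simp
      qed
      have "(\<integral>p. ?W p * ?X p \<partial>lborel) = (\<integral>p. v p * ?X p - u p * ?X p \<partial>lborel)"
      proof (rule Bochner_Integration.integral_cong[OF refl])
        fix p show "?W p * ?X p = v p * ?X p - u p * ?X p"
          using zX[of p] Kc by (cases "p \<in> K") (auto simp: left_diff_distrib)
      qed
      also have "\<dots> = (\<integral>p. v p * ?X p \<partial>lborel) - (\<integral>p. u p * ?X p \<partial>lborel)"
        by (rule Bochner_Integration.integral_diff[OF int[OF cv] int[OF cu]])
      also have "\<dots> = 0" using Cu(2) Cv(2) t unfolding weak_wave_solution_box by simp
      finally show "(\<integral>p. ?W p * ?X p \<partial>lborel) = 0" .
    qed
  qed
  then show ?thesis using p by simp
qed

section \<open>The Goursat problem\<close>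

text \<open>Equals z^k for z >= 0 and 0 for z <= -1. Inside the cone nothing changes, while on a
  slab 0 <= t <= T, where \<open>rho\<close> is unbounded below, all derivatives of the composition
  with \<open>rho\<close> become bounded.\<close>

definition hk :: "nat \<Rightarrow> real \<Rightarrow> complex" where
  "hk k z = of_real z ^ k * step (1 * z + 1)"

lemma Ck_hk: "Ck j UNIV (hk k)"
  unfolding hk_def[abs_def] by (intro Ck_mult Ck_of_real_power Ck_real_affine[OF Ck_step])

lemma hk_nonneg: "z \<ge> 0 \<Longrightarrow> hk k z = of_real z ^ k"
  by (simp add: hk_def step_1)

lemma hk_0: "z \<le> -1 \<Longrightarrow> hk k z = 0"
  by (simp add: hk_def step_0)

text \<open>Where rho >= -1 one has |x|^2 <= t^2 + 1 <= (t + 1)^2, so on the slab the function lives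
  in a ball, and compactness gives the bound.\<close>

lemma bnd_hk:
  "\<exists>B\<ge>0. bnd s (UNIV \<times> {0..T}) (\<lambda>_. B) (\<lambda>p. hk k (rho p))"
proof -
  obtain B where B: "B \<ge> 0" "bnd s (cball 0 (\<bar>T\<bar> + 1 + \<bar>T\<bar>)) (\<lambda>_. B) (\<lambda>p. hk k (rho p))"
    using bnd_compact[OF Ck_compose_rho[OF Ck_hk] compact_cball] by blast
  have crho: "continuous_on UNIV rho"
    using has_derivative_continuous[OF rho_has_derivative] by (simp add: continuous_at_imp_continuous_on)
  have op: "open {p. rho p < -1}" by (intro open_Collect_less crho continuous_intros)
  have "bnd s (UNIV \<times> {0..T}) (\<lambda>_. B) (\<lambda>p. hk k (rho p))"
  proof (rule bnd_extend_zero[OF B(2) op])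
    show "hk k (rho p) = 0" if "p \<in> {p. rho p < -1}" for p using that by (intro hk_0) simp
    show "UNIV \<times> {0..T} \<subseteq> cball 0 (\<bar>T\<bar> + 1 + \<bar>T\<bar>) \<union> {p. rho p < -1}"
    proof
      fix p :: spacetime assume p: "p \<in> UNIV \<times> {0..T}"
      have t: "0 \<le> snd p" "snd p \<le> T" using p by (auto simp: mem_Times_iff)
      show "p \<in> cball 0 (\<bar>T\<bar> + 1 + \<bar>T\<bar>) \<union> {p. rho p < -1}"
      proof (cases "rho p < -1")
        case False
        then have "(norm (fst p))\<^sup>2 \<le> (snd p)\<^sup>2 + 1" by (simp add: rho_def power2_norm_eq_inner)
        also have "\<dots> \<le> (snd p + 1)\<^sup>2" using t by (simp add: power2_eq_square algebra_simps)
        finally have "norm (fst p) \<le> snd p + 1" by (rule power2_le_imp_le) (use t in simp)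
        moreover have "norm p \<le> norm (fst p) + norm (snd p)" using norm_Pair_le[of "fst p" "snd p"] by simp
        ultimately show ?thesis using t by simp
      qed simp
    qed
  qed (rule B(1))
  with B(1) show ?thesis by blast
qed

text \<open>Chosen by the equation alone, so that the solution map does not involve the bounds
  \<open>M\<close> and \<open>N\<close>. By \<open>volterra_unique\<close> it coincides with the
  solution obtained by iteration, for whatever order and weight that was run.\<close>

definition vsol :: "(real^3 \<Rightarrow> complex) \<Rightarrow> (spacetime \<Rightarrow> complex) \<Rightarrow> spacetime \<Rightarrow> complex" where
  "vsol q G = (SOME v. volterra q G v)"

definition src :: "nat \<Rightarrow> (real^3 \<Rightarrow> complex) \<Rightarrow> (real^3 \<Rightarrow> complex) \<Rightarrow> spacetime \<Rightarrow> complex" where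
  "src m q g p = schr q (bcoef q g m) (fst p) * cpow m p"

definition ext_sum :: "nat \<Rightarrow> (nat \<Rightarrow> real^3 \<Rightarrow> complex) \<Rightarrow> spacetime \<Rightarrow> complex" where
  "ext_sum m b p = (\<Sum>k\<le>m. b k (fst p) * hk k (rho p))"

definition sol :: "nat \<Rightarrow> (real^3 \<Rightarrow> complex) \<Rightarrow> (real^3 \<Rightarrow> complex) \<Rightarrow> spacetime \<Rightarrow> complex" where
  "sol m q g p = ext_sum m (bcoef q g) p + vsol q (src m q g) p"

lemma vsol:
  assumes q: "Ck k UNIV q" "bnd k UNIV (\<lambda>_. M) q" and G: "Ck k UNIV G" "csupp G" "bnd k UNIV (wt \<Gamma> l) G"
    and l: "l \<ge> 1" "kap l * (2 ^ k * M) \<le> 1 / 2"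
  shows "volterra q G (vsol q G)" "Ck k UNIV (vsol q G)" "bnd k UNIV (wt (2 * kap l * \<Gamma>) l) (vsol q G)"
proof -
  obtain v where v: "volterra q G v" "Ck k UNIV v" "bnd k UNIV (wt (2 * kap l * \<Gamma>) l) v"
    using volterra_exists[OF assms] by blast
  show vs: "volterra q G (vsol q G)" unfolding vsol_def by (rule someI[of "volterra q G", OF v(1)])
  have "vsol q G = v"
    by (rule volterra_unique[OF Ck_continuous[OF q(1)] bnd_norm[OF q(2) UNIV_I] Ck_continuous[OF G(1)] G(2) vs v(1)])
  with v show "Ck k UNIV (vsol q G)" "bnd k UNIV (wt (2 * kap l * \<Gamma>) l) (vsol q G)" by simp_all
qed

lemma Ck_ext_sum: "(\<And>k. k \<le> m \<Longrightarrow> Ck j UNIV (b k)) \<Longrightarrow> Ck j UNIV (ext_sum m b)"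
  unfolding ext_sum_def[abs_def] by (intro Ck_sum Ck_mult Ck_fst Ck_compose_rho[OF Ck_hk]) auto

lemma bnd_ext_sum:
  assumes b: "\<And>k. k \<le> m \<Longrightarrow> Ck s UNIV (b k)" "\<And>k. k \<le> m \<Longrightarrow> bnd s UNIV (\<lambda>_. \<beta> k) (b k)"
    and H: "\<And>k. bnd s X (\<lambda>_. H k) (\<lambda>p. hk k (rho p))"
  shows "bnd s X (\<lambda>_. \<Sum>k\<le>m. 2 ^ s * (\<beta> k * H k)) (ext_sum m b)"
  unfolding ext_sum_def[abs_def]
proof (intro bnd_sum bnd_mult Ck_mult Ck_fst Ck_compose_rho[OF Ck_hk] H)
  fix k assume "k \<in> {..m}"
  then have k: "k \<le> m" by simp
  show "Ck s UNIV (b k)" "Ck s UNIV (b k)" by (rule b(1)[OF k])+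
  show "bnd s X (\<lambda>_. \<beta> k) (\<lambda>p. b k (fst p))"
    by (rule bnd_weaken[OF bnd_fst[OF b(1)[OF k] b(2)[OF k]]]) auto
qed simp

lemma ext_sum_diff: "ext_sum m b1 p - ext_sum m b2 p = ext_sum m (\<lambda>k x. b1 k x - b2 k x) p"
  by (simp add: ext_sum_def sum_subtractf left_diff_distrib)

text \<open>In the cone t >= 0, so raising the weight from \<open>L\<close> to \<open>l\<close> only
  weakens the bound; outside the cone the product vanishes with all derivatives.\<close>

lemma bnd_cone_source:
  assumes c: "s < m" "A \<ge> 0" "bnd s UNIV (wt A L) (cpow m)" and l: "L \<le> l"
    and F: "Ck s UNIV F" "bnd s UNIV (\<lambda>_. B) F"
  shows "bnd s UNIV (wt (2 ^ s * B * A) l) (\<lambda>p. F (fst p) * cpow m p)"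
proof (rule bnd_csupp)
  have B0: "B \<ge> 0" using order.trans[OF norm_ge_zero bnd_norm[OF F(2) UNIV_I]] .
  show "csupp (\<lambda>p. F (fst p) * cpow m p)" by (rule csupp_mult[OF csupp_cpow])
  show "0 \<le> wt (2 ^ s * B * A) l p" for p using c(2) B0 by simp
  have "bnd s closed_cone (\<lambda>p. 2 ^ s * (B * wt A L p)) (\<lambda>p. F (fst p) * cpow m p)"
    by (intro bnd_mult Ck_fst F Ck_cpow c(1) bnd_weaken[OF bnd_fst[OF F]] bnd_weaken[OF c(3)]) auto
  then show "bnd s closed_cone (wt (2 ^ s * B * A) l) (\<lambda>p. F (fst p) * cpow m p)"
  proof (rule bnd_weaken)
    fix p assume "p \<in> closed_cone"
    then have "0 \<le> snd p" using norm_ge_zero[of "fst p"] unfolding mem_closed_cone by linarith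
    then have "exp (L * snd p) \<le> exp (l * snd p)" using l by (simp add: mult_right_mono)
    from mult_left_mono[OF this, of "2 ^ s * B * A"] show "2 ^ s * (B * wt A L p) \<le> wt (2 ^ s * B * A) l p"
      using c(2) B0 by (simp add: mult_ac)
  qed auto
qed

lemma bnd_wt_slab:
  assumes "bnd k UNIV (wt B l) f" "B \<ge> 0" "l \<ge> 0"
  shows "bnd k (UNIV \<times> {0..T}) (\<lambda>_. B * exp (l * \<bar>T\<bar>)) f"
proof (rule bnd_weaken[OF assms(1)])
  fix p :: spacetime assume "p \<in> UNIV \<times> {0..T}"
  then have "snd p \<le> \<bar>T\<bar>" by (auto simp: mem_Times_iff)
  then show "wt B l p \<le> B * exp (l * \<bar>T\<bar>)" using assms(2,3) by (simp add: mult_left_mono)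
qed auto

text \<open>By continuity, approaching the light cone from outside.\<close>

lemma csupp_boundary:
  assumes "continuous_on UNIV v" "csupp v"
  shows "v (x, norm x) = 0"
proof -
  have "(\<lambda>j. (x, norm x - eps j)) \<longlonglongrightarrow> (x, norm x - 0)"
    by (intro tendsto_Pair tendsto_const tendsto_diff eps_tendsto)
  from continuous_on_tendsto_compose[OF assms(1) this]
  have "(\<lambda>j. v (x, norm x - eps j)) \<longlonglongrightarrow> v (x, norm x)" by simp
  moreover have "v (x, norm x - eps j) = 0" for j
    by (rule csupp_D[OF assms(2)]) (use eps_pos[of j] in simp)
  ultimately have "(\<lambda>j::nat. 0) \<longlonglongrightarrow> v (x, norm x)" by simp
  then show ?thesis by (simp add: LIMSEQ_const_iff)
qed

text \<open>Away from the vertex d_t + d_r is tangential to the light cone: with \<omega> = x / |x|,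
  the curve (x + r \<omega>, |x| + r) stays on the cone for r > - |x|, and u = g is differentiated
  along it at r = 0.\<close>

lemma goursat_transport:
  assumes u: "Ck (Suc 0) UNIV u" and g: "Ck (Suc 0) UNIV g" and eq: "\<And>x. u (x, norm x) = g x" and x: "x \<noteq> 0"
  shows "pd_t u (x, norm x) + pd_r u (x, norm x) = pd_r_space g x"
proof -
  define \<omega> where "\<omega> = x /\<^sub>R norm x"
  have we: "\<omega> \<bullet> e = (x \<bullet> e) / norm x" for e by (simp add: \<omega>_def divide_inverse)
  have c1: "((\<lambda>r. (x + r *\<^sub>R \<omega>, norm x + r)) has_derivative (\<lambda>h. (h *\<^sub>R \<omega>, h))) (at (0::real))"
    by (auto intro!: derivative_eq_intros)
  have c2: "((\<lambda>r. x + r *\<^sub>R \<omega>) has_derivative (\<lambda>h. h *\<^sub>R \<omega>)) (at (0::real))"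
    by (auto intro!: derivative_eq_intros)
  have d1: "((\<lambda>r. u (x + r *\<^sub>R \<omega>, norm x + r)) has_derivative (\<lambda>h. pd (h *\<^sub>R \<omega>, h) u (x, norm x))) (at (0::real))"
    using has_derivative_compose[OF c1 Ck_has_derivative[OF u]] by simp
  have d2: "((\<lambda>r. g (x + r *\<^sub>R \<omega>)) has_derivative (\<lambda>h. pd (h *\<^sub>R \<omega>) g x)) (at (0::real))"
    using has_derivative_compose[OF c2 Ck_has_derivative[OF g]] by simp
  have nx: "norm x > 0" using x by simp
  have on_cone: "u (x + r *\<^sub>R \<omega>, norm x + r) = g (x + r *\<^sub>R \<omega>)" if "r \<in> {- norm x<..}" for r
  proof -
    have "x + r *\<^sub>R \<omega> = ((norm x + r) / norm x) *\<^sub>R x"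
      using nx by (simp add: \<omega>_def algebra_simps add_divide_distrib divide_inverse)
    then have "norm (x + r *\<^sub>R \<omega>) = norm x + r" using that nx by simp
    then show ?thesis using eq[of "x + r *\<^sub>R \<omega>"] by simp
  qed
  have "((\<lambda>r. g (x + r *\<^sub>R \<omega>)) has_derivative (\<lambda>h. pd (h *\<^sub>R \<omega>, h) u (x, norm x))) (at (0::real))"
    by (rule has_derivative_transform_within_open[OF d1, of "{- norm x<..}"]) (use nx on_cone in auto)
  from fun_cong[OF has_derivative_unique[OF this d2], of 1]
  have "pd (\<omega>, 1) u (x, norm x) = pd \<omega> g x" by simp
  then show ?thesis
    unfolding pd_radial_sum[OF u, of "(\<omega>, 1)" "(x, norm x)"] pd_linear_sum[OF Ck_differentiable[OF g], of \<omega>]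
    by (simp add: pd_t_def pd_r_def pd_r_space_def we scaleR_conv_of_real add.commute)
qed

section \<open>Choice of the orders, the solution map and its estimates\<close>

locale goursat_orders =
  fixes n s m :: nat
  assumes n: "n \<ge> 5" and s: "s = (n - 2) div 3" and m: "m = Suc s"
begin

lemma orders: "2 * m \<le> n" "s \<le> n - 2 * m" "1 \<le> s" "s \<le> n" "s < m"
  using n s m by auto

text \<open>Every coefficient up to \<open>m\<close> keeps \<open>s + 2\<close> derivatives, so at
  least three. This makes (Delta + q) b_k of class C^1, as the transport equation requires.\<close>

lemma order_le: "k \<le> m \<Longrightarrow> 2 * k \<le> n + 2" "k \<le> m \<Longrightarrow> s + 2 \<le> n + 2 - 2 * k"
  using orders by auto

lemma order_m: "n + 2 - 2 * m = Suc (Suc (n - 2 * m))" "n - 2 * m \<le> n"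
  using orders by auto

text \<open>One \<open>l\<close> meets two demands: to dominate the growth of the source and to make
  the iteration a contraction. It is found from \<open>M\<close> and the orders, which makes the
  later constants uniform in \<open>q\<close> and \<open>g\<close>.\<close>

lemma weight_exists:
  fixes M :: real
  assumes M: "M \<ge> 0"
  obtains A L l where "A \<ge> 0" "bnd s UNIV (wt A L) (cpow m)" "L \<le> l" "l \<ge> 1" "kap l * (2 ^ s * M) \<le> 1 / 2"
proof -
  obtain A L where A: "A \<ge> 0" "L \<ge> 0" "bnd s UNIV (wt A L) (cpow m)" using bnd_cpow[OF orders(5)] by blast
  have "0 < 1 / (2 * (2 ^ s * M + 1))" using M by (simp add: add_nonneg_pos)
  from kap_small[OF this, of L] obtain l where l: "l \<ge> L" "l \<ge> 1" "kap l \<le> 1 / (2 * (2 ^ s * M + 1))" by blast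
  have half: "1 / (2 * (a + 1)) * a \<le> 1 / 2" if "a \<ge> 0" for a :: real
    using that by (simp add: field_simps)
  have "kap l * (2 ^ s * M) \<le> 1 / (2 * (2 ^ s * M + 1)) * (2 ^ s * M)" using M l(3) by (intro mult_right_mono) auto
  also have "\<dots> \<le> 1 / 2" by (rule half) (use M in simp)
  finally show thesis by (rule that[OF A(1,3) l(1,2)])
qed

context
  fixes q g :: "real^3 \<Rightarrow> complex" and M N :: real
  assumes q: "Ck n UNIV q" "bnd n UNIV (\<lambda>_. M) q" and g: "Ck (n + 2) UNIV g" "bnd (n + 2) UNIV (\<lambda>_. N) g"
begin

lemma Ck_b: "k \<le> m \<Longrightarrow> Ck (s + 2) UNIV (bcoef q g k)"
  by (rule Ck_mono[OF Ck_bcoef[OF q g]]) (use order_le in auto)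

lemma bnd_b: "k \<le> m \<Longrightarrow> bnd s UNIV (\<lambda>_. (3 + 2 ^ n * M) ^ k * N) (bcoef q g k)"
  by (rule bnd_weaken[OF bnd_bcoef[OF q g]]) (use order_le(1)[of k] order_le(2)[of k] in auto)

lemma q_low: "j \<le> n \<Longrightarrow> Ck j UNIV q" "j \<le> n \<Longrightarrow> bnd j UNIV (\<lambda>_. M) q"
  using Ck_mono[OF q(1)] bnd_weaken[OF q(2)] by auto

lemma Ck_schr_m: "Ck s UNIV (schr q (bcoef q g m))"
proof -
  have "Ck (n - 2 * m) UNIV (schr q (bcoef q g m))"
    using Ck_bcoef[OF q g order_le(1)[OF order.refl]] q_low(1)[OF order_m(2)] unfolding order_m(1) by (rule Ck_schr)
  then show ?thesis by (rule Ck_mono) (rule orders(2))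
qed

lemma bnd_schr_m: "bnd s UNIV (\<lambda>_. (3 + 2 ^ (n - 2 * m) * M) * ((3 + 2 ^ n * M) ^ m * N)) (schr q (bcoef q g m))"
proof -
  have "bnd (n - 2 * m) UNIV (\<lambda>_. (3 + 2 ^ (n - 2 * m) * M) * ((3 + 2 ^ n * M) ^ m * N)) (schr q (bcoef q g m))"
    by (rule bnd_schr[OF Ck_bcoef[OF q g order_le(1)[OF order.refl], unfolded order_m(1)]
        bnd_bcoef[OF q g order_le(1)[OF order.refl], unfolded order_m(1)] q_low[OF order_m(2)]])
  then show ?thesis by (rule bnd_weaken) (use orders(2) in auto)
qed

lemma src_props:
  assumes c: "A \<ge> 0" "bnd s UNIV (wt A L) (cpow m)" and l: "L \<le> l"
  shows "Ck s UNIV (src m q g)" "csupp (src m q g)"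
    "bnd s UNIV (wt (2 ^ s * ((3 + 2 ^ (n - 2 * m) * M) * ((3 + 2 ^ n * M) ^ m * N)) * A) l) (src m q g)"
  unfolding src_def[abs_def]
  by (intro Ck_mult Ck_fst Ck_schr_m Ck_cpow orders(5) csupp_mult csupp_cpow bnd_cone_source[OF orders(5) c l] bnd_schr_m)+

lemma M_nonneg: "M \<ge> 0" and N_nonneg: "N \<ge> 0"
  using order.trans[OF norm_ge_zero bnd_norm[OF q(2) UNIV_I]] order.trans[OF norm_ge_zero bnd_norm[OF g(2) UNIV_I]] .

lemma vsol_props:
  assumes c: "A \<ge> 0" "bnd s UNIV (wt A L) (cpow m)" and l: "L \<le> l" "l \<ge> 1" "kap l * (2 ^ s * M) \<le> 1 / 2"
  shows "volterra q (src m q g) (vsol q (src m q g))" "Ck s UNIV (vsol q (src m q g))"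
    "bnd s UNIV (wt (2 * kap l * (2 ^ s * ((3 + 2 ^ (n - 2 * m) * M) * ((3 + 2 ^ n * M) ^ m * N)) * A)) l) (vsol q (src m q g))"
  by (rule vsol[OF q_low[OF orders(4)] src_props[OF c l(1)] l(2,3)])+

lemma sol_props:
  "Ck s UNIV (sol m q g)" "volterra q (src m q g) (vsol q (src m q g))" "Ck s UNIV (vsol q (src m q g))"
proof -
  obtain A L l where A: "A \<ge> 0" "bnd s UNIV (wt A L) (cpow m)" and l: "L \<le> l" "l \<ge> 1" "kap l * (2 ^ s * M) \<le> 1 / 2"
    by (rule weight_exists[OF M_nonneg]) (rule that; assumption)
  note v = vsol_props[OF A l]
  show "volterra q (src m q g) (vsol q (src m q g))" "Ck s UNIV (vsol q (src m q g))" by (rule v)+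
  show "Ck s UNIV (sol m q g)"
    unfolding sol_def[abs_def] by (intro Ck_add v Ck_ext_sum Ck_mono[OF Ck_b]) auto
qed

lemma sol_boundary: "sol m q g (x, norm x) = g x"
proof -
  have r0: "rho (x, norm x) = 0" by (simp add: rho_def power2_norm_eq_inner)
  have "ext_sum m (bcoef q g) (x, norm x) = (\<Sum>k\<le>m. bcoef q g k x * 0 ^ k)"
    by (simp add: ext_sum_def r0 hk_nonneg)
  \<comment> \<open>By \<open>0 ^ 0 = 1\<close> the term \<open>k = 0\<close> survives on the light
    cone; all others vanish.\<close>
  also have "\<dots> = (\<Sum>k\<in>{0}. bcoef q g k x * 0 ^ k)"
    by (rule sum.mono_neutral_right) auto
  finally have "ext_sum m (bcoef q g) (x, norm x) = g x" by simp
  moreover have "vsol q (src m q g) (x, norm x) = 0"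
    by (rule csupp_boundary) (use sol_props(2) in \<open>auto simp: volterra_def\<close>)
  ultimately show ?thesis by (simp add: sol_def)
qed

lemma goursat_solution_sol: "goursat_solution q g (sol m q g)"
  unfolding goursat_solution_def
proof (intro conjI allI sol_boundary)
  show "Ck 1 closed_cone (sol m q g)"
    by (rule Ck_subset[OF Ck_mono[OF sol_props(1) orders(3)]]) simp
  show "weak_wave_solution open_cone q (sol m q g)"
  proof (rule approx_weak)
    show "continuous_on UNIV q" by (rule Ck_continuous[OF q(1)])
    show "Ck 2 UNIV (bcoef q g k)" if "k \<le> m" for k by (rule Ck_mono[OF Ck_b[OF that]]) simp
    show "Ck (Suc 0) UNIV (schr q (bcoef q g k))" if "k < m" for k
    proof (rule Ck_schr)
      show "Ck (Suc (Suc (Suc 0))) UNIV (bcoef q g k)"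
        by (rule Ck_mono[OF Ck_b]) (use that orders(3) in auto)
      show "Ck (Suc 0) UNIV q" by (rule q_low) (use n in simp)
    qed
    show "continuous_on UNIV (\<lambda>p. schr q (bcoef q g m) (fst p) * cpow m p)"
      by (intro Ck_continuous[of s] Ck_mult Ck_fst Ck_schr_m Ck_cpow orders(5))
    show "volterra q (\<lambda>p. schr q (bcoef q g m) (fst p) * cpow m p) (vsol q (src m q g))"
      using sol_props(2) unfolding src_def[abs_def] .
    show "sol m q g p = approx q g m p + vsol q (src m q g) p" if "p \<in> open_cone" for p
    proof -
      have lt: "norm (fst p) < snd p" using that by (simp add: mem_open_cone)
      have "0 \<le> rho p" unfolding rho_factor using lt norm_ge_zero[of "fst p"] by (intro mult_nonneg_nonneg) linarith+
      then show ?thesis by (simp add: sol_def ext_sum_def approx_def hk_nonneg)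
    qed
  qed
qed

lemma sol_transport: "x \<noteq> 0 \<Longrightarrow> pd_t (sol m q g) (x, norm x) + pd_r (sol m q g) (x, norm x) = pd_r_space g x"
proof (rule goursat_transport)
  show "Ck (Suc 0) UNIV (sol m q g)" by (rule Ck_mono[OF sol_props(1)]) (use orders(3) in simp)
  show "Ck (Suc 0) UNIV g" by (rule Ck_mono[OF g(1)]) simp
qed (rule sol_boundary)

lemma sol_unique: "goursat_solution q g v \<Longrightarrow> p \<in> closed_cone \<Longrightarrow> v p = sol m q g p"
  by (rule goursat_unique[OF Ck_continuous[OF q(1)] bnd_norm[OF q(2) UNIV_I] goursat_solution_sol])

end

lemma hk_bounds:
  obtains H where "\<And>k. H k \<ge> 0" "\<And>k. bnd s (UNIV \<times> {0..T}) (\<lambda>_. H k) (\<lambda>p. hk k (rho p))"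
proof -
  have "\<forall>k. \<exists>B. B \<ge> 0 \<and> bnd s (UNIV \<times> {0..T}) (\<lambda>_. B) (\<lambda>p. hk k (rho p))" using bnd_hk by blast
  from choice[OF this] show thesis using that by blast
qed

text \<open>The weight and all constants are fixed before \<open>N\<close>, \<open>q\<close> and
  \<open>g\<close>. Coefficients, source and remainder are bounded linearly in \<open>N\<close>,
  which factors out.\<close>

lemma sol_bound:
  assumes M: "M \<ge> 0"
  shows "\<exists>C\<ge>0. \<forall>N (q :: real^3 \<Rightarrow> complex) (g :: real^3 \<Rightarrow> complex). Ck n UNIV q \<longrightarrow> bnd n UNIV (\<lambda>_. M) q \<longrightarrow> Ck (n + 2) UNIV g \<longrightarrow> bnd (n + 2) UNIV (\<lambda>_. N) g \<longrightarrow>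
    bnd s (UNIV \<times> {0..T}) (\<lambda>_. C * N) (sol m q g)"
proof -
  obtain A L l where A: "A \<ge> 0" "bnd s UNIV (wt A L) (cpow m)" and l: "L \<le> l" "l \<ge> 1" "kap l * (2 ^ s * M) \<le> 1 / 2"
    by (rule weight_exists[OF M]) (rule that; assumption)
  obtain H where H: "\<And>k. H k \<ge> 0" "\<And>k. bnd s (UNIV \<times> {0..T}) (\<lambda>_. H k) (\<lambda>p. hk k (rho p))"
    by (rule hk_bounds) (rule that; assumption)
  let ?K = "3 + 2 ^ n * M"
  let ?C1 = "\<Sum>k\<le>m. 2 ^ s * (?K ^ k * H k)"
  let ?C2 = "2 * kap l * (2 ^ s * ((3 + 2 ^ (n - 2 * m) * M) * ?K ^ m) * A) * exp (l * \<bar>T\<bar>)"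
  have K0: "?K \<ge> 0" using M by simp
  have C0: "?C1 \<ge> 0" "?C2 \<ge> 0"
    using K0 H(1) A(1) M kap_nonneg[of l] by (auto intro!: sum_nonneg mult_nonneg_nonneg zero_le_power)
  show ?thesis
  proof (intro exI[of _ "?C1 + ?C2"] conjI allI impI)
    fix N :: real and q g :: "real^3 \<Rightarrow> complex"
    assume q: "Ck n UNIV q" "bnd n UNIV (\<lambda>_. M) q" and g: "Ck (n + 2) UNIV g" "bnd (n + 2) UNIV (\<lambda>_. N) g"
    have N0: "N \<ge> 0" by (rule N_nonneg[OF q g])
    note v = vsol_props[OF q g A l]
    have 1: "bnd s (UNIV \<times> {0..T}) (\<lambda>_. \<Sum>k\<le>m. 2 ^ s * ((?K ^ k * N) * H k)) (ext_sum m (bcoef q g))"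
      by (rule bnd_ext_sum[OF Ck_mono[OF Ck_b[OF q g]] bnd_b[OF q g] H(2)]) simp_all
    have 2: "bnd s (UNIV \<times> {0..T}) (\<lambda>_. 2 * kap l * (2 ^ s * ((3 + 2 ^ (n - 2 * m) * M) * (?K ^ m * N)) * A) * exp (l * \<bar>T\<bar>)) (vsol q (src m q g))"
      by (rule bnd_wt_slab[OF v(3)]) (use K0 A(1) M N0 l kap_nonneg[of l] in auto)
    have "bnd s (UNIV \<times> {0..T}) (\<lambda>_. (\<Sum>k\<le>m. 2 ^ s * ((?K ^ k * N) * H k)) + 2 * kap l * (2 ^ s * ((3 + 2 ^ (n - 2 * m) * M) * (?K ^ m * N)) * A) * exp (l * \<bar>T\<bar>)) (sol m q g)"
      unfolding sol_def[abs_def]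
      by (rule bnd_add[OF Ck_ext_sum[OF Ck_mono[OF Ck_b[OF q g]]] v(2) 1 2]) simp_all
    moreover have "(\<Sum>k\<le>m. 2 ^ s * ((?K ^ k * N) * H k)) = ?C1 * N"
      unfolding sum_distrib_right by (rule sum.cong) (simp_all add: mult_ac)
    moreover have "2 * kap l * (2 ^ s * ((3 + 2 ^ (n - 2 * m) * M) * (?K ^ m * N)) * A) * exp (l * \<bar>T\<bar>) = ?C2 * N"
      by (simp only: mult_ac)
    ultimately show "bnd s (UNIV \<times> {0..T}) (\<lambda>_. (?C1 + ?C2) * N) (sol m q g)"
      by (simp only: distrib_right)
  qed (use C0 in simp)
qed

text \<open>The coefficients differ by at most \<open>dcoef\<close> times \<delta>, and the
  remainders by a Volterra solution with potential \<open>q1\<close> and a source of size \<delta>.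
  \<open>N\<close> enters the constant because q1 - q2 is multiplied by coefficients and a remainder
  of size \<open>N\<close>.\<close>

lemma sol_diff_bound:
  assumes M: "M \<ge> 0" and N: "N \<ge> 0"
  shows "\<exists>C\<ge>0. \<forall>\<delta> (q1 :: real^3 \<Rightarrow> complex) (q2 :: real^3 \<Rightarrow> complex) (g1 :: real^3 \<Rightarrow> complex) (g2 :: real^3 \<Rightarrow> complex). Ck n UNIV q1 \<longrightarrow> bnd n UNIV (\<lambda>_. M) q1 \<longrightarrow> Ck (n + 2) UNIV g1 \<longrightarrow> bnd (n + 2) UNIV (\<lambda>_. N) g1 \<longrightarrow>
    Ck n UNIV q2 \<longrightarrow> bnd n UNIV (\<lambda>_. M) q2 \<longrightarrow> Ck (n + 2) UNIV g2 \<longrightarrow> bnd (n + 2) UNIV (\<lambda>_. N) g2 \<longrightarrow>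
    bnd n UNIV (\<lambda>_. \<delta>) (\<lambda>x. q1 x - q2 x) \<longrightarrow> bnd (n + 2) UNIV (\<lambda>_. \<delta>) (\<lambda>x. g1 x - g2 x) \<longrightarrow>
    bnd s (UNIV \<times> {0..T}) (\<lambda>_. C * \<delta>) (\<lambda>p. sol m q1 g1 p - sol m q2 g2 p)"
proof -
  obtain A L l where A: "A \<ge> 0" "bnd s UNIV (wt A L) (cpow m)" and l: "L \<le> l" "l \<ge> 1" "kap l * (2 ^ s * M) \<le> 1 / 2"
    by (rule weight_exists[OF M]) (rule that; assumption)
  obtain H where H: "\<And>k. H k \<ge> 0" "\<And>k. bnd s (UNIV \<times> {0..T}) (\<lambda>_. H k) (\<lambda>p. hk k (rho p))"
    by (rule hk_bounds) (rule that; assumption)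
  let ?K = "3 + 2 ^ n * M" and ?j = "n - 2 * m"
  \<comment> \<open>\<open>?V\<close> bounds the second remainder; per unit of \<delta>,
    \<open>?D\<close> bounds the difference of the source coefficients and \<open>?\<Gamma>\<close>
    the source of the difference equation.\<close>
  let ?V = "2 * kap l * (2 ^ s * ((3 + 2 ^ ?j * M) * (?K ^ m * N)) * A)"
  let ?D = "(3 + 2 ^ ?j * M) * dcoef n M N m + 2 ^ ?j * (?K ^ m * N)"
  let ?\<Gamma> = "2 ^ s * ?V + 2 ^ s * ?D * A"
  let ?C1 = "\<Sum>k\<le>m. 2 ^ s * (dcoef n M N k * H k)"
  let ?C2 = "2 * kap l * ?\<Gamma> * exp (l * \<bar>T\<bar>)"
  have K0: "?K \<ge> 0" using M by simp
  have V0: "?V \<ge> 0" using K0 A(1) M N kap_nonneg[of l] by (intro mult_nonneg_nonneg zero_le_power add_nonneg_nonneg) auto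
  have D0: "?D \<ge> 0" using K0 M N dcoef_nonneg[OF M N] by (intro mult_nonneg_nonneg zero_le_power add_nonneg_nonneg) auto
  have G0: "?\<Gamma> \<ge> 0" by (rule add_nonneg_nonneg[OF mult_nonneg_nonneg[OF _ V0] mult_nonneg_nonneg[OF mult_nonneg_nonneg[OF _ D0] A(1)]]) simp_all
  have C0: "?C1 \<ge> 0" "?C2 \<ge> 0"
    using H(1) dcoef_nonneg[OF M N] G0 kap_nonneg[of l] by (auto intro!: sum_nonneg mult_nonneg_nonneg)
  show ?thesis
  proof (intro exI[of _ "?C1 + ?C2"] conjI allI impI)
    fix \<delta> :: real and q1 q2 g1 g2 :: "real^3 \<Rightarrow> complex"
    assume q1: "Ck n UNIV q1" "bnd n UNIV (\<lambda>_. M) q1" and g1: "Ck (n + 2) UNIV g1" "bnd (n + 2) UNIV (\<lambda>_. N) g1"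
      and q2: "Ck n UNIV q2" "bnd n UNIV (\<lambda>_. M) q2" and g2: "Ck (n + 2) UNIV g2" "bnd (n + 2) UNIV (\<lambda>_. N) g2"
      and dq: "bnd n UNIV (\<lambda>_. \<delta>) (\<lambda>x. q1 x - q2 x)" and dg: "bnd (n + 2) UNIV (\<lambda>_. \<delta>) (\<lambda>x. g1 x - g2 x)"
    have \<delta>0: "\<delta> \<ge> 0" using order.trans[OF norm_ge_zero bnd_norm[OF dq UNIV_I]] .
    let ?v1 = "vsol q1 (src m q1 g1)" and ?v2 = "vsol q2 (src m q2 g2)"
    let ?F1 = "schr q1 (bcoef q1 g1 m)" and ?F2 = "schr q2 (bcoef q2 g2 m)"
    note v1 = vsol_props[OF q1 g1 A l] and v2 = vsol_props[OF q2 g2 A l]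
    note s1 = src_props[OF q1 g1 A l(1)] and s2 = src_props[OF q2 g2 A l(1)]
    note F1 = Ck_schr_m[OF q1 g1] and F2 = Ck_schr_m[OF q2 g2]
    have m2: "2 * m \<le> n + 2" using orders(1) by simp
    have dF: "bnd s UNIV (\<lambda>_. ?D * \<delta>) (\<lambda>x. ?F1 x - ?F2 x)"
    proof -
      have "bnd ?j UNIV (\<lambda>_. (3 + 2 ^ ?j * M) * (dcoef n M N m * \<delta>) + 2 ^ ?j * (\<delta> * (?K ^ m * N))) (\<lambda>x. ?F1 x - ?F2 x)"
        by (rule bnd_schr_diff[OF Ck_bcoef[OF q1 g1 m2, unfolded order_m(1)] Ck_bcoef[OF q2 g2 m2, unfolded order_m(1)]
            bnd_bcoef[OF q2 g2 m2, unfolded order_m(1)] bnd_bcoef_diff[OF q1 q2 g1 g2 dq dg m2, unfolded order_m(1)]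
            Ck_mono[OF q1(1) order_m(2)] bnd_weaken[OF q1(2) order_m(2) subset_UNIV order.refl]
            Ck_mono[OF q2(1) order_m(2)] bnd_weaken[OF dq order_m(2) subset_UNIV order.refl]])
      then show ?thesis
        by (rule bnd_weaken) (use orders(2) in \<open>auto simp: algebra_simps\<close>)
    qed
    let ?G = "\<lambda>p. (q1 (fst p) - q2 (fst p)) * ?v2 p + (src m q1 g1 p - src m q2 g2 p)"
    have CdF: "Ck s UNIV (\<lambda>x. ?F1 x - ?F2 x)" by (intro Ck_diff F1 F2)
    have Cdq: "Ck s UNIV (\<lambda>x. q1 x - q2 x)" by (intro Ck_diff Ck_mono[OF q1(1) orders(4)] Ck_mono[OF q2(1) orders(4)])
    have bdq: "bnd s UNIV (\<lambda>_. \<delta>) (\<lambda>x. q1 x - q2 x)" by (rule bnd_weaken[OF dq orders(4)]) auto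
    have eqs: "(\<lambda>p. src m q1 g1 p - src m q2 g2 p) = (\<lambda>p. (?F1 (fst p) - ?F2 (fst p)) * cpow m p)"
      by (simp add: src_def fun_eq_iff left_diff_distrib)
    have b2: "bnd s UNIV (wt (2 ^ s * (?D * \<delta>) * A) l) (\<lambda>p. src m q1 g1 p - src m q2 g2 p)"
      unfolding eqs by (rule bnd_cone_source[OF orders(5) A l(1) CdF dF])
    have b1: "bnd s UNIV (wt (2 ^ s * \<delta> * ?V) l) (\<lambda>p. (q1 (fst p) - q2 (fst p)) * ?v2 p)"
      by (rule bnd_potential_mult[OF Cdq bdq v2(2,3)])
    have C1: "Ck s UNIV (\<lambda>p. (q1 (fst p) - q2 (fst p)) * ?v2 p)"
      by (intro Ck_mult v2(2)) (rule Ck_fst[OF Cdq])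
    have C2: "Ck s UNIV (\<lambda>p. src m q1 g1 p - src m q2 g2 p)" by (intro Ck_diff s1 s2)
    have GC: "Ck s UNIV ?G" by (rule Ck_add[OF C1 C2])
    have csv2: "csupp ?v2" using v2(1) unfolding volterra_def by blast
    have Gc: "csupp ?G" by (intro csupp_add csupp_diff csupp_mult csv2 s1(2) s2(2))
    have Gb: "bnd s UNIV (wt (?\<Gamma> * \<delta>) l) ?G"
    proof (rule bnd_weaken[OF bnd_add[OF C1 C2 b1 b2] order.refl subset_UNIV])
      fix p :: spacetime
      show "wt (2 ^ s * \<delta> * ?V) l p + wt (2 ^ s * (?D * \<delta>) * A) l p \<le> wt (?\<Gamma> * \<delta>) l p"
        unfolding distrib_right[symmetric] by (rule mult_right_mono) (simp_all add: algebra_simps)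
    qed
    have vd: "volterra q1 ?G (\<lambda>p. ?v1 p - ?v2 p)"
      by (rule volterra_diff[OF Ck_continuous[OF q1(1)] Ck_continuous[OF q2(1)] Ck_continuous[OF s1(1)] Ck_continuous[OF s2(1)] s1(2) s2(2) v1(1) v2(1)])
    note q1s = Ck_mono[OF q1(1) orders(4)] bnd_weaken[OF q1(2) orders(4) subset_UNIV order.refl]
    \<comment> \<open>The difference of the remainders solves this equation, but a bound in terms of
      \<delta> is not yet known for it. The solution constructed for the same data has one, and
      uniqueness identifies the two.\<close>
    obtain w where w: "volterra q1 ?G w" "bnd s UNIV (wt (2 * kap l * (?\<Gamma> * \<delta>)) l) w"
      using volterra_exists[OF q1s GC Gc Gb l(2,3)] by blast
    have "(\<lambda>p. ?v1 p - ?v2 p) = w"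
      by (rule volterra_unique[OF Ck_continuous[OF q1(1)] bnd_norm[OF q1(2) UNIV_I] Ck_continuous[OF GC] Gc vd w(1)])
    then have bv: "bnd s UNIV (wt (2 * kap l * (?\<Gamma> * \<delta>)) l) (\<lambda>p. ?v1 p - ?v2 p)" using w(2) by simp
    have 2: "bnd s (UNIV \<times> {0..T}) (\<lambda>_. 2 * kap l * (?\<Gamma> * \<delta>) * exp (l * \<bar>T\<bar>)) (\<lambda>p. ?v1 p - ?v2 p)"
      by (rule bnd_wt_slab[OF bv]) (intro mult_nonneg_nonneg kap_nonneg G0 \<delta>0, use l in auto)
    let ?b = "\<lambda>k x. bcoef q1 g1 k x - bcoef q2 g2 k x"
    have Cb: "Ck s UNIV (?b k)" if "k \<le> m" for k
      by (intro Ck_diff Ck_mono[OF Ck_b[OF q1 g1 that]] Ck_mono[OF Ck_b[OF q2 g2 that]]) simp_all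
    have bb: "bnd s UNIV (\<lambda>_. dcoef n M N k * \<delta>) (?b k)" if "k \<le> m" for k
      by (rule bnd_weaken[OF bnd_bcoef_diff[OF q1 q2 g1 g2 dq dg order_le(1)[OF that]]])
        (use order_le(2)[OF that] in auto)
    have 1: "bnd s (UNIV \<times> {0..T}) (\<lambda>_. \<Sum>k\<le>m. 2 ^ s * ((dcoef n M N k * \<delta>) * H k)) (ext_sum m ?b)"
      by (rule bnd_ext_sum[OF Cb bb H(2)])
    have eq: "(\<lambda>p. sol m q1 g1 p - sol m q2 g2 p) = (\<lambda>p. ext_sum m ?b p + (?v1 p - ?v2 p))"
      by (simp add: sol_def fun_eq_iff ext_sum_diff[symmetric])
    have "bnd s (UNIV \<times> {0..T}) (\<lambda>_. (\<Sum>k\<le>m. 2 ^ s * ((dcoef n M N k * \<delta>) * H k)) + 2 * kap l * (?\<Gamma> * \<delta>) * exp (l * \<bar>T\<bar>)) (\<lambda>p. sol m q1 g1 p - sol m q2 g2 p)"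
      unfolding eq by (rule bnd_add[OF Ck_ext_sum[OF Cb] Ck_diff[OF v1(2) v2(2)] 1 2])
    moreover have "(\<Sum>k\<le>m. 2 ^ s * ((dcoef n M N k * \<delta>) * H k)) = ?C1 * \<delta>"
      unfolding sum_distrib_right by (rule sum.cong) (simp_all add: mult_ac)
    moreover have "2 * kap l * (?\<Gamma> * \<delta>) * exp (l * \<bar>T\<bar>) = ?C2 * \<delta>"
      by (simp only: mult_ac)
    ultimately show "bnd s (UNIV \<times> {0..T}) (\<lambda>_. (?C1 + ?C2) * \<delta>) (\<lambda>p. sol m q1 g1 p - sol m q2 g2 p)"
      by (simp only: distrib_right)
  qed (use C0 in simp)
qed

end

lemma admissible_bnd:
  assumes "admissible n M N q g"
  shows "0 \<le> M" "0 \<le> N" "Ck n UNIV q" "bnd n UNIV (\<lambda>_. M) q" "Ck (n + 2) UNIV g" "bnd (n + 2) UNIV (\<lambda>_. N) g"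
  using assms Ck_norm_bnd[of n q UNIV M] Ck_norm_bnd[of "n + 2" g UNIV N]
  unfolding admissible_def by blast+

theorem theorem1p3:
  fixes n s :: nat
  assumes "n \<ge> 5" and "s = (n - 2) div 3"
  shows "\<exists>S :: (real^3 \<Rightarrow> complex) \<Rightarrow> (real^3 \<Rightarrow> complex) \<Rightarrow> spacetime \<Rightarrow> complex.
    (\<forall>M N q g. admissible n M N q g \<longrightarrow>
       goursat_solution q g (S q g) \<and>
       (\<forall>v. goursat_solution q g v \<longrightarrow> (\<forall>p\<in>closed_cone. v p = S q g p)) \<and>
       Ck s UNIV (S q g) \<and>
       (\<forall>x. x \<noteq> 0 \<longrightarrow>
          pd_t (S q g) (x, norm x) + pd_r (S q g) (x, norm x) = pd_r_space g x)) \<and>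
    (\<forall>(T::real) M. \<exists>C::real. C \<ge> 0 \<and> (\<forall>N q g. admissible n M N q g \<longrightarrow>
       Ck_norm s (UNIV \<times> {0..T}) (S q g) \<le> ennreal C * ennreal N)) \<and>
    (\<forall>(T::real) M N. \<exists>C::real. C \<ge> 0 \<and> (\<forall>q1 g1 q2 g2.
       admissible n M N q1 g1 \<longrightarrow> admissible n M N q2 g2 \<longrightarrow>
       Ck_norm s (UNIV \<times> {0..T}) (\<lambda>p. S q1 g1 p - S q2 g2 p)
         \<le> ennreal C * (Ck_norm n UNIV (\<lambda>x. q1 x - q2 x) +
                         Ck_norm (n + 2) UNIV (\<lambda>x. g1 x - g2 x))))"
proof -
  interpret goursat_orders n s "Suc s" by standard (use assms in auto)
  \<comment> \<open>With m = s + 1 the cut-off power is of class C^s. The map depends on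
    \<open>s\<close> alone, and neither on \<open>M\<close> and \<open>N\<close> nor on
    \<open>T\<close>.\<close>
  let ?S = "sol (Suc s)"
  let ?c = "real (card (multi_indices s :: (spacetime \<Rightarrow> nat) set))"
  show ?thesis
  proof (intro exI[of _ ?S] conjI)
    show "\<forall>M N q g. admissible n M N q g \<longrightarrow>
       goursat_solution q g (?S q g) \<and>
       (\<forall>v. goursat_solution q g v \<longrightarrow> (\<forall>p\<in>closed_cone. v p = ?S q g p)) \<and>
       Ck s UNIV (?S q g) \<and>
       (\<forall>x. x \<noteq> 0 \<longrightarrow> pd_t (?S q g) (x, norm x) + pd_r (?S q g) (x, norm x) = pd_r_space g x)"
    proof (intro allI impI)
      fix M N q g assume "admissible n M N q g"
      note a = admissible_bnd(3-6)[OF this]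
      show "goursat_solution q g (?S q g) \<and>
        (\<forall>v. goursat_solution q g v \<longrightarrow> (\<forall>p\<in>closed_cone. v p = ?S q g p)) \<and>
        Ck s UNIV (?S q g) \<and>
        (\<forall>x. x \<noteq> 0 \<longrightarrow> pd_t (?S q g) (x, norm x) + pd_r (?S q g) (x, norm x) = pd_r_space g x)"
        using goursat_solution_sol[OF a] sol_unique[OF a] sol_props(1)[OF a] sol_transport[OF a] by blast
    qed
    show "\<forall>(T::real) M. \<exists>C::real. C \<ge> 0 \<and> (\<forall>N q g. admissible n M N q g \<longrightarrow>
       Ck_norm s (UNIV \<times> {0..T}) (?S q g) \<le> ennreal C * ennreal N)"
    proof (intro allI)
      fix T M :: real
      show "\<exists>C::real. C \<ge> 0 \<and> (\<forall>N q g. admissible n M N q g \<longrightarrow> Ck_norm s (UNIV \<times> {0..T}) (?S q g) \<le> ennreal C * ennreal N)"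
      proof (cases "M \<ge> 0")
        \<comment> \<open>For negative \<open>M\<close> there are no admissible data.\<close>
        case False
        then show ?thesis by (intro exI[of _ 0]) (auto dest: admissible_bnd(1))
      next
        case True
        obtain C where C: "C \<ge> 0" "\<And>N q g. Ck n UNIV q \<Longrightarrow> bnd n UNIV (\<lambda>_. M) q \<Longrightarrow> Ck (n + 2) UNIV g \<Longrightarrow> bnd (n + 2) UNIV (\<lambda>_. N) g \<Longrightarrow>
            bnd s (UNIV \<times> {0..T}) (\<lambda>_. C * N) (?S q g)"
          using sol_bound[OF True, of T] by blast
        show ?thesis
        proof (intro exI[of _ "?c * C"] conjI allI impI)
          fix N q g assume a: "admissible n M N q g"
          have N0: "N \<ge> 0" by (rule admissible_bnd(2)[OF a])
          have "Ck_norm s (UNIV \<times> {0..T}) (?S q g) \<le> ennreal (?c * (C * N))"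
            by (rule Ck_norm_le[OF C(2)[OF admissible_bnd(3-6)[OF a]]]) (use C(1) N0 in simp)
          also have "\<dots> = ennreal (?c * C) * ennreal N"
            using C(1) N0 by (subst ennreal_mult[symmetric]) (simp_all add: mult.assoc)
          finally show "Ck_norm s (UNIV \<times> {0..T}) (?S q g) \<le> ennreal (?c * C) * ennreal N" .
        qed (use C(1) in simp)
      qed
    qed
    show "\<forall>(T::real) M N. \<exists>C::real. C \<ge> 0 \<and> (\<forall>q1 g1 q2 g2.
       admissible n M N q1 g1 \<longrightarrow> admissible n M N q2 g2 \<longrightarrow>
       Ck_norm s (UNIV \<times> {0..T}) (\<lambda>p. ?S q1 g1 p - ?S q2 g2 p)
         \<le> ennreal C * (Ck_norm n UNIV (\<lambda>x. q1 x - q2 x) + Ck_norm (n + 2) UNIV (\<lambda>x. g1 x - g2 x)))"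
    proof (intro allI)
      fix T M N :: real
      show "\<exists>C::real. C \<ge> 0 \<and> (\<forall>q1 g1 q2 g2.
         admissible n M N q1 g1 \<longrightarrow> admissible n M N q2 g2 \<longrightarrow>
         Ck_norm s (UNIV \<times> {0..T}) (\<lambda>p. ?S q1 g1 p - ?S q2 g2 p)
           \<le> ennreal C * (Ck_norm n UNIV (\<lambda>x. q1 x - q2 x) + Ck_norm (n + 2) UNIV (\<lambda>x. g1 x - g2 x)))"
      proof (cases "M \<ge> 0 \<and> N \<ge> 0")
        case False
        then show ?thesis by (intro exI[of _ 0]) (auto dest: admissible_bnd(1,2))
      next
        case True
        then obtain C where C: "C \<ge> 0" "\<And>\<delta> q1 q2 g1 g2. Ck n UNIV q1 \<Longrightarrow> bnd n UNIV (\<lambda>_. M) q1 \<Longrightarrow> Ck (n + 2) UNIV g1 \<Longrightarrow> bnd (n + 2) UNIV (\<lambda>_. N) g1 \<Longrightarrow>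
            Ck n UNIV q2 \<Longrightarrow> bnd n UNIV (\<lambda>_. M) q2 \<Longrightarrow> Ck (n + 2) UNIV g2 \<Longrightarrow> bnd (n + 2) UNIV (\<lambda>_. N) g2 \<Longrightarrow>
            bnd n UNIV (\<lambda>_. \<delta>) (\<lambda>x. q1 x - q2 x) \<Longrightarrow> bnd (n + 2) UNIV (\<lambda>_. \<delta>) (\<lambda>x. g1 x - g2 x) \<Longrightarrow>
            bnd s (UNIV \<times> {0..T}) (\<lambda>_. C * \<delta>) (\<lambda>p. ?S q1 g1 p - ?S q2 g2 p)"
          using sol_diff_bound[of M N T] by blast
        show ?thesis
        \<comment> \<open>The added 1 keeps the factor positive, so that the right-hand side is
          infinite whenever the norms of the differences are; 0 times infinity would be 0.\<close>
        proof (intro exI[of _ "?c * C + 1"] conjI allI impI)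
          fix q1 g1 q2 g2 assume a1: "admissible n M N q1 g1" and a2: "admissible n M N q2 g2"
          let ?X = "Ck_norm n UNIV (\<lambda>x. q1 x - q2 x) + Ck_norm (n + 2) UNIV (\<lambda>x. g1 x - g2 x)"
          have cC: "?c * C + 1 > 0" using C(1) by (simp add: add_nonneg_pos)
          show "Ck_norm s (UNIV \<times> {0..T}) (\<lambda>p. ?S q1 g1 p - ?S q2 g2 p) \<le> ennreal (?c * C + 1) * ?X"
          proof (cases ?X rule: ennreal_cases)
            case top
            have "ennreal (?c * C + 1) * ?X = top"
              unfolding top by (rule ennreal_top_mult_left) (use cC in \<open>simp only: ennreal_eq_0_iff not_le\<close>)
            then show ?thesis by (simp only: top_greatest)
          next
            case (real \<delta>)
            \<comment> \<open>The sum of the two norms serves as the common bound \<delta> for both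
              differences.\<close>
            have le: "Ck_norm n UNIV (\<lambda>x. q1 x - q2 x) \<le> ennreal \<delta>" "Ck_norm (n + 2) UNIV (\<lambda>x. g1 x - g2 x) \<le> ennreal \<delta>"
              unfolding real(2)[symmetric] by (simp_all add: add_increasing add_increasing2)
            note b1 = admissible_bnd(3-6)[OF a1] and b2 = admissible_bnd(3-6)[OF a2]
            have "bnd s (UNIV \<times> {0..T}) (\<lambda>_. C * \<delta>) (\<lambda>p. ?S q1 g1 p - ?S q2 g2 p)"
              by (rule C(2)[OF b1 b2 Ck_norm_bnd[OF Ck_diff[OF b1(1) b2(1)] le(1) real(1)]
                  Ck_norm_bnd[OF Ck_diff[OF b1(3) b2(3)] le(2) real(1)]])
            from Ck_norm_le[OF this] have "Ck_norm s (UNIV \<times> {0..T}) (\<lambda>p. ?S q1 g1 p - ?S q2 g2 p) \<le> ennreal (?c * (C * \<delta>))"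
              using C(1) real(1) by simp
            also have "\<dots> \<le> ennreal ((?c * C + 1) * \<delta>)"
              using real(1) by (intro ennreal_leI) (simp add: algebra_simps)
            also have "\<dots> = ennreal (?c * C + 1) * ?X"
              unfolding real(2) using cC real(1) by (simp add: ennreal_mult)
            finally show ?thesis .
          qed
        qed (use C(1) in simp)
      qed
    qed
  qed
qed

end
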